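(* Let $X$ be a connected smooth manifold, let $Q$ be a finite quiver, let $M=\{M_a\}_{a\in Q_1}$ be a collection of smooth vector bundles on $X$ with fixed smooth connections $\nabla_1=\{\nabla_a\}_{a\in Q_1}$, and let $\mathcal{R}=(\mathcal{E},\phi)$ be an $M$-twisted smooth $Q$-bundle over $X$. Fix smooth connections $\nabla_i^0$ on $\mathcal{E}_i$ for $i\in Q_0$, and for $a\in Q_1$ put $$\beta_a:=(\mathrm{id}_{T_X^*}\otimes\phi_a)\circ(\nabla^0_{s(a)}\otimes\nabla_a)-\nabla^0_{t(a)}\circ\phi_a\ \in\ \mathrm{Hom}_{\mathcal{C}^\infty_X}(\mathcal{E}_{s(a)}\otimes M_a,\,T_X^*\otimes\mathcal{E}_{t(a)}).$$ Then $\mathcal{R}$ admits a smooth relative connection whose connections on the bundles $M_a$ are $\nabla_a$ for all $a\in Q_1$ if and only if the image of $\{\beta_a\}_{a\in Q_1}$ in $\mathrm{Ext}^1_{\mathcal{A}}(\mathcal{R},T_X^*\otimes\mathcal{R})$ vanishes.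
   Context: A quiver $Q=(Q_0,Q_1,s,t)$ is a directed graph with vertices $Q_0$, arrows $Q_1$, source and target maps $s,t$. $\mathcal{C}^\infty_X$ is the sheaf of smooth functions; vector bundles are identified with locally free sheaves of finite rank, and tensor products are over $\mathcal{C}^\infty_X$. An $M$-twisted $Q$-bundle $\mathcal{R}=(\mathcal{E},\phi)$ assigns a smooth vector bundle $\mathcal{E}_i$ to each $i\in Q_0$ and a morphism $\phi_a:\mathcal{E}_{s(a)}\otimes M_a\to\mathcal{E}_{t(a)}$ to each $a\in Q_1$. A morphism $(\mathcal{E},\phi)\to(\mathcal{E}',\phi')$ is a collection $f_i:\mathcal{E}_i\to\mathcal{E}_i'$ with $f_{t(a)}\circ\phi_a=\phi_a'\circ(f_{s(a)}\otimes\mathrm{id}_{M_a})$ for all $a$. Replacing vector bundles $\mathcal E_i$ by sheaves of $\mathcal{C}^\infty_X$-modules gives the category of $M$-twisted $Q$-sheaves. A smooth relative connection on $\mathcal{R}$ consists of smooth connections $\nabla_i:\mathcal{E}_i\to T_X^*\otimes\mathcal{E}_i$ ($i\in Q_0$) and $\nabla_a:M_a\to T_X^*\otimes M_a$ ($a\in Q_1$) such that $\nabla_{t(a)}\circ\phi_a=(\mathrm{id}_{T_X^*}\otimes\phi_a)\circ(\nabla_{s(a)}\otimes\nabla_a)$ for all $a\in Q_1$, where $\nabla_{s(a)}\otimes\nabla_a:=\nabla_{s(a)}\otimes\mathrm{id}_{M_a}+\mathrm{id}_{\mathcal{E}_{s(a)}}\otimes\nabla_a$ is the tensor product connection on $\mathcal{E}_{s(a)}\otimes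 M_a$. $\mathcal{A}$ denotes the $M$-twisted path algebra of $Q$: with $\mathcal{S}=\bigoplus_{i\in Q_0}\mathcal{C}^\infty_X e_i$ ($e_i$ orthogonal idempotents) and the $\mathcal{S}$-bimodule $\mathcal{M}=\bigoplus_{a\in Q_1}M_a$, it is the tensor algebra $\mathcal{A}=\bigoplus_{n\ge0}\mathcal{M}^{\otimes_{\mathcal{S}}n}$. The category of $\mathcal{A}$-modules is identified with the category of $M$-twisted $Q$-sheaves, and $\mathrm{Ext}^1_{\mathcal{A}}$ is taken in this category. $T_X^*\otimes\mathcal{R}$ denotes the $M$-twisted $Q$-bundle $(\{T_X^*\otimes\mathcal{E}_i\},\{\mathrm{id}_{T_X^*}\otimes\phi_a\})$. The image of $\{\beta_a\}\in\bigoplus_{a\in Q_1}\mathrm{Hom}_{\mathcal{C}^\infty_X}(\mathcal{E}_{s(a)}\otimes M_a,T_X^*\otimes\mathcal{E}_{t(a)})$ in $\mathrm{Ext}^1_{\mathcal{A}}(\mathcal{R},T_X^*\otimes\mathcal{R})$ is the class of the extension of $\mathcal{R}$ by $T_X^*\otimes\mathcal{R}$ with vertex bundles $(T_X^*\otimes\mathcal{E}_i)\oplus\mathcal{E}_i$ and structure maps $(\tau\otimes m,\,v\otimes m)\mapsto\big((\mathrm{id}\otimes\phi_a)(\tau\otimes m)+\beta_a(v\otimes m),\ \phi_a(v\otimes m)\big)$. (This is the map following $L_{\nabla_1}:\{\alpha_i\}\mapsto\{\alpha_{t(a)}\circ\phi_a-(\mathrm{id}\otimes\phi_a)\circ(\alpha_{s(a)}\otimes\mathrm{id})\}$,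 defined on $\bigoplus_{i}\mathrm{Hom}_{\mathcal{C}^\infty_X}(\mathcal{E}_i,T_X^*\otimes\mathcal{E}_i)$, in the standard long exact sequence for $\mathrm{Hom}$ and $\mathrm{Ext}^1$ of twisted quiver sheaves.) *)

theory Defs
  imports "HOL-Analysis.Analysis" "HOL-Algebra.Module" "HOL-Algebra.Free_Abelian_Groups" "Graph_Theory.Digraph"
begin

section \<open>Smooth manifolds\<close>

text \<open>
  The model space of dimension \<open>n\<close> (including \<open>n = 0\<close>) is \<^const>\<open>Euclidean_space\<close> \<open>n\<close>: the
  sequences that vanish from index \<open>n\<close> on.
\<close>

definition partial_deriv :: "nat \<Rightarrow> ((nat \<Rightarrow> real) \<Rightarrow> real) \<Rightarrow> (nat \<Rightarrow> real) \<Rightarrow> real" where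
  "partial_deriv i f p = deriv (\<lambda>t. f (p(i := t))) (p i)"

primrec Ck_on :: "nat \<Rightarrow> nat \<Rightarrow> (nat \<Rightarrow> real) set \<Rightarrow> ((nat \<Rightarrow> real) \<Rightarrow> real) \<Rightarrow> bool" where
  "Ck_on n 0 W f \<longleftrightarrow> continuous_map (subtopology (Euclidean_space n) W) euclideanreal f"
| "Ck_on n (Suc k) W f \<longleftrightarrow>
     continuous_map (subtopology (Euclidean_space n) W) euclideanreal f \<and>
     (\<forall>i<n. (\<forall>p\<in>W. (\<lambda>t. f (p(i := t))) differentiable (at (p i))) \<and>
            Ck_on n k W (partial_deriv i f))"

definition smooth_euclidean :: "nat \<Rightarrow> (nat \<Rightarrow> real) set \<Rightarrow> ((nat \<Rightarrow> real) \<Rightarrow> real) \<Rightarrow> bool" where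
  "smooth_euclidean n W f \<longleftrightarrow> (\<forall>k. Ck_on n k W f)"

record 'x smooth_structure =
  mdim :: nat
  charts :: "('x set \<times> ('x \<Rightarrow> nat \<Rightarrow> real)) set"

text \<open>
  The manifold is the whole type. The Hausdorff and second countability axioms are the sort
  constraint, and the atlas need not be maximal.
\<close>

definition smooth_manifold ::
    "'x::{t2_space, second_countable_topology} smooth_structure \<Rightarrow> bool" where
  "smooth_manifold X \<longleftrightarrow>
     (\<forall>(U, \<kappa>) \<in> charts X. open U \<and>
        (\<exists>W. openin (Euclidean_space (mdim X)) W \<and>
             homeomorphic_map (subtopology euclidean U)
               (subtopology (Euclidean_space (mdim X)) W) \<kappa>)) \<and>
     (\<Union>(U, \<kappa>) \<in> charts X. U) = UNIV \<and>
     (\<forall>(U, \<kappa>) \<in> charts X. \<forall>(V, \<theta>) \<in> charts X. \<forall>i < mdim X.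
        smooth_euclidean (mdim X) (\<theta> ` (U \<inter> V)) (\<lambda>p. \<kappa> (inv_into V \<theta> p) i))"

definition smooth_on :: "'x::topological_space smooth_structure \<Rightarrow> 'x set \<Rightarrow> ('x \<Rightarrow> real) \<Rightarrow> bool" where
  "smooth_on X U f \<longleftrightarrow>
     (\<forall>(W, \<kappa>) \<in> charts X. smooth_euclidean (mdim X) (\<kappa> ` (U \<inter> W)) (\<lambda>p. f (inv_into W \<kappa> p)))"

text \<open>
  The ring of smooth functions on an open set. So that functions on \<open>U\<close> can be compared by
  \<open>=\<close>, they are normalized to vanish outside \<open>U\<close> (no smoothness across the boundary is implied).
\<close>

definition cinf :: "'x::topological_space smooth_structure \<Rightarrow> 'x set \<Rightarrow> ('x \<Rightarrow> real) ring" where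
  "cinf X U = \<lparr>carrier = {f. smooth_on X U f \<and> (\<forall>x. x \<notin> U \<longrightarrow> f x = 0)},
     monoid.mult = (\<lambda>f g x. f x * g x), monoid.one = (\<lambda>x. if x \<in> U then 1 else 0),
     ring.zero = (\<lambda>x. 0), add = (\<lambda>f g x. f x + g x)\<rparr>"

definition fres :: "'x set \<Rightarrow> ('x \<Rightarrow> real) \<Rightarrow> 'x \<Rightarrow> real" where
  "fres V f = (\<lambda>x. if x \<in> V then f x else 0)"


section \<open>Sheaves of modules over the smooth functions\<close>

record ('x, 'f) osheaf =
  sec :: "'x set \<Rightarrow> ('x \<Rightarrow> real, 'f) module"
  res :: "'x set \<Rightarrow> 'x set \<Rightarrow> 'f \<Rightarrow> 'f"  \<comment> \<open>\<open>res F U V\<close> restricts from \<open>U\<close> to \<open>V \<subseteq> U\<close>\<close>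

definition presheaf_mod ::
    "'x::topological_space smooth_structure \<Rightarrow> ('x, 'f) osheaf \<Rightarrow> bool" where
  "presheaf_mod X F \<longleftrightarrow>
     (\<forall>U. open U \<longrightarrow> module (cinf X U) (sec F U)) \<and>
     (\<forall>U V. open U \<and> open V \<and> V \<subseteq> U \<longrightarrow>
        (\<forall>s \<in> carrier (sec F U). res F U V s \<in> carrier (sec F V)) \<and>
        (\<forall>s \<in> carrier (sec F U). \<forall>t \<in> carrier (sec F U).
           res F U V (s \<oplus>\<^bsub>sec F U\<^esub> t) = res F U V s \<oplus>\<^bsub>sec F V\<^esub> res F U V t) \<and>
        (\<forall>f \<in> carrier (cinf X U). \<forall>s \<in> carrier (sec F U).
           res F U V (f \<odot>\<^bsub>sec F U\<^esub> s) = fres V f \<odot>\<^bsub>sec F V\<^esub> res F U V s)) \<and>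
     (\<forall>U. open U \<longrightarrow> (\<forall>s \<in> carrier (sec F U). res F U U s = s)) \<and>
     (\<forall>U V W. open U \<and> open V \<and> open W \<and> W \<subseteq> V \<and> V \<subseteq> U \<longrightarrow>
        (\<forall>s \<in> carrier (sec F U). res F V W (res F U V s) = res F U W s))"

definition sheaf_mod ::
    "'x::topological_space smooth_structure \<Rightarrow> ('x, 'f) osheaf \<Rightarrow> bool" where
  "sheaf_mod X F \<longleftrightarrow> presheaf_mod X F \<and>
     (\<forall>\<C> s. (\<forall>V\<in>\<C>. open V \<and> s V \<in> carrier (sec F V)) \<and>
            (\<forall>V\<in>\<C>. \<forall>W\<in>\<C>. res F V (V \<inter> W) (s V) = res F W (V \<inter> W) (s W)) \<longrightarrow>
        (\<exists>!t. t \<in> carrier (sec F (\<Union>\<C>)) \<and> (\<forall>V\<in>\<C>. res F (\<Union>\<C>) V t = s V)))"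

definition sheaf_hom ::
    "'x::topological_space smooth_structure \<Rightarrow> ('x, 'f) osheaf \<Rightarrow> ('x, 'g) osheaf \<Rightarrow>
     ('x set \<Rightarrow> 'f \<Rightarrow> 'g) \<Rightarrow> bool" where
  "sheaf_hom X F G h \<longleftrightarrow>
     (\<forall>U. open U \<longrightarrow>
        (\<forall>s \<in> carrier (sec F U). h U s \<in> carrier (sec G U)) \<and>
        (\<forall>s \<in> carrier (sec F U). \<forall>t \<in> carrier (sec F U).
           h U (s \<oplus>\<^bsub>sec F U\<^esub> t) = h U s \<oplus>\<^bsub>sec G U\<^esub> h U t) \<and>
        (\<forall>f \<in> carrier (cinf X U). \<forall>s \<in> carrier (sec F U).
           h U (f \<odot>\<^bsub>sec F U\<^esub> s) = f \<odot>\<^bsub>sec G U\<^esub> h U s)) \<and>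
     (\<forall>U V. open U \<and> open V \<and> V \<subseteq> U \<longrightarrow>
        (\<forall>s \<in> carrier (sec F U). h V (res F U V s) = res G U V (h U s)))"

text \<open>Smooth vector bundles: locally free sheaves of finite rank, in terms of local frames \<open>e\<close>.\<close>

definition vector_bundle ::
    "'x::topological_space smooth_structure \<Rightarrow> ('x, 'f) osheaf \<Rightarrow> bool" where
  "vector_bundle X F \<longleftrightarrow> sheaf_mod X F \<and>
     (\<forall>x. \<exists>U (r::nat) e. open U \<and> x \<in> U \<and> (\<forall>k<r. e k \<in> carrier (sec F U)) \<and>
        (\<forall>V. open V \<and> V \<subseteq> U \<longrightarrow> (\<forall>s \<in> carrier (sec F V).
           \<exists>!c. c \<in> {..<r} \<rightarrow>\<^sub>E carrier (cinf X V) \<and>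
                s = (\<Oplus>\<^bsub>sec F V\<^esub>k\<in>{..<r}. c k \<odot>\<^bsub>sec F V\<^esub> res F U V (e k)))))"

definition dirsum :: "('x, 'f) osheaf \<Rightarrow> ('x, 'g) osheaf \<Rightarrow> ('x, 'f \<times> 'g) osheaf" where
  "dirsum F G = \<lparr>
     sec = (\<lambda>U. \<lparr>carrier = carrier (sec F U) \<times> carrier (sec G U),
        monoid.mult = undefined, monoid.one = undefined,
        ring.zero = (\<zero>\<^bsub>sec F U\<^esub>, \<zero>\<^bsub>sec G U\<^esub>),
        add = (\<lambda>(s, t) (s', t'). (s \<oplus>\<^bsub>sec F U\<^esub> s', t \<oplus>\<^bsub>sec G U\<^esub> t')),
        smult = (\<lambda>f (s, t). (f \<odot>\<^bsub>sec F U\<^esub> s, f \<odot>\<^bsub>sec G U\<^esub> t))\<rparr>),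
     res = (\<lambda>U V (s, t). (res F U V s, res G U V t))\<rparr>"

subsection \<open>Sheafification\<close>

definition germ ::
    "('x::topological_space, 'p) osheaf \<Rightarrow> 'x \<Rightarrow> 'x set \<Rightarrow> 'p \<Rightarrow> ('x set \<times> 'p) set" where
  "germ P x V t = {(W, u). open W \<and> x \<in> W \<and> u \<in> carrier (sec P W) \<and>
     (\<exists>Z. open Z \<and> x \<in> Z \<and> Z \<subseteq> V \<inter> W \<and> res P V Z t = res P W Z u)}"

definition to_sheafify ::
    "('x::topological_space, 'p) osheaf \<Rightarrow> 'x set \<Rightarrow> 'p \<Rightarrow> 'x \<Rightarrow> ('x set \<times> 'p) set" where
  "to_sheafify P U t = (\<lambda>x. if x \<in> U then germ P x U t else {})"

text \<open>
  A section over \<open>U\<close> maps each point of \<open>U\<close> to a germ there and is locally given by sections of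
  the presheaf; at points outside \<open>U\<close> its value is normalized to be empty.
\<close>

definition sheafify :: "('x::topological_space, 'p) osheaf \<Rightarrow> ('x, 'x \<Rightarrow> ('x set \<times> 'p) set) osheaf" where
  "sheafify P = \<lparr>
     sec = (\<lambda>U. \<lparr>carrier = {s. (\<forall>x\<in>U. \<exists>V t. open V \<and> x \<in> V \<and> V \<subseteq> U \<and> t \<in> carrier (sec P V) \<and>
                                   (\<forall>y\<in>V. s y = germ P y V t)) \<and>
                           (\<forall>x. x \<notin> U \<longrightarrow> s x = {})},
        monoid.mult = undefined, monoid.one = undefined,
        ring.zero = to_sheafify P U \<zero>\<^bsub>sec P U\<^esub>,
        add = (\<lambda>s s' x. \<Union>(V, t)\<in>s x. \<Union>(W, u)\<in>s' x.
           germ P x (V \<inter> W) (res P V (V \<inter> W) t \<oplus>\<^bsub>sec P (V \<inter> W)\<^esub> res P W (V \<inter> W) u)),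
        smult = (\<lambda>f s x. \<Union>(V, t)\<in>s x.
           germ P x (U \<inter> V) (fres (U \<inter> V) f \<odot>\<^bsub>sec P (U \<inter> V)\<^esub> res P V (U \<inter> V) t))\<rparr>),
     res = (\<lambda>U V s x. if x \<in> V then s x else {})\<rparr>"


section \<open>Tensor products\<close>

subsection \<open>Modules\<close>

text \<open>
  The tensor product is the free abelian group on pairs modulo the usual relations;
  \<open>m \<otimes> n\<close> is the coset of \<open>frag_of (m, n)\<close>.
\<close>

definition tensor_relations ::
    "('r, 'k) ring_scheme \<Rightarrow> ('r, 'm) module \<Rightarrow> ('r, 'n) module \<Rightarrow> (('m \<times> 'n) \<Rightarrow>\<^sub>0 int) set" where
  "tensor_relations R M N =
     {frag_of (m \<oplus>\<^bsub>M\<^esub> m', n) - frag_of (m, n) - frag_of (m', n) | m m' n.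
        m \<in> carrier M \<and> m' \<in> carrier M \<and> n \<in> carrier N} \<union>
     {frag_of (m, n \<oplus>\<^bsub>N\<^esub> n') - frag_of (m, n) - frag_of (m, n') | m n n'.
        m \<in> carrier M \<and> n \<in> carrier N \<and> n' \<in> carrier N} \<union>
     {frag_of (r \<odot>\<^bsub>M\<^esub> m, n) - frag_of (m, r \<odot>\<^bsub>N\<^esub> n) | r m n.
        r \<in> carrier R \<and> m \<in> carrier M \<and> n \<in> carrier N}"

definition tensor_subgroup ::
    "('r, 'k) ring_scheme \<Rightarrow> ('r, 'm) module \<Rightarrow> ('r, 'n) module \<Rightarrow> (('m \<times> 'n) \<Rightarrow>\<^sub>0 int) set" where
  "tensor_subgroup R M N =
     generate (free_Abelian_group (carrier M \<times> carrier N)) (tensor_relations R M N)"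

definition tensor_coset ::
    "('r, 'k) ring_scheme \<Rightarrow> ('r, 'm) module \<Rightarrow> ('r, 'n) module \<Rightarrow>
     (('m \<times> 'n) \<Rightarrow>\<^sub>0 int) \<Rightarrow> (('m \<times> 'n) \<Rightarrow>\<^sub>0 int) set" where
  "tensor_coset R M N \<xi> =
     tensor_subgroup R M N #>\<^bsub>free_Abelian_group (carrier M \<times> carrier N)\<^esub> \<xi>"

definition tensor_module ::
    "('r, 'k) ring_scheme \<Rightarrow> ('r, 'm) module \<Rightarrow> ('r, 'n) module \<Rightarrow>
     ('r, (('m \<times> 'n) \<Rightarrow>\<^sub>0 int) set) module" where
  "tensor_module R M N =
     (let Q = free_Abelian_group (carrier M \<times> carrier N) Mod tensor_subgroup R M N in
      \<lparr>carrier = carrier Q, monoid.mult = undefined, monoid.one = undefined,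
       ring.zero = one Q, add = monoid.mult Q,
       smult = (\<lambda>r C. \<Union>\<xi>\<in>C.
         tensor_coset R M N (frag_extend (\<lambda>(m, n). frag_of (r \<odot>\<^bsub>M\<^esub> m, n)) \<xi>))\<rparr>)"

subsection \<open>Sheaves\<close>

definition tensor_presheaf ::
    "'x::topological_space smooth_structure \<Rightarrow> ('x, 'f) osheaf \<Rightarrow> ('x, 'g) osheaf \<Rightarrow>
     ('x, (('f \<times> 'g) \<Rightarrow>\<^sub>0 int) set) osheaf" where
  "tensor_presheaf X F G = \<lparr>
     sec = (\<lambda>U. tensor_module (cinf X U) (sec F U) (sec G U)),
     res = (\<lambda>U V C. \<Union>\<xi>\<in>C. tensor_coset (cinf X V) (sec F V) (sec G V)
              (frag_extend (\<lambda>(s, t). frag_of (res F U V s, res G U V t)) \<xi>))\<rparr>"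

type_synonym ('x, 'f, 'g) tens = "'x \<Rightarrow> ('x set \<times> (('f \<times> 'g) \<Rightarrow>\<^sub>0 int) set) set"

definition tensor ::
    "'x::topological_space smooth_structure \<Rightarrow> ('x, 'f) osheaf \<Rightarrow> ('x, 'g) osheaf \<Rightarrow>
     ('x, ('x, 'f, 'g) tens) osheaf" where
  "tensor X F G = sheafify (tensor_presheaf X F G)"

definition pure ::
    "'x::topological_space smooth_structure \<Rightarrow> ('x, 'f) osheaf \<Rightarrow> ('x, 'g) osheaf \<Rightarrow>
     'x set \<Rightarrow> 'f \<Rightarrow> 'g \<Rightarrow> ('x, 'f, 'g) tens" where
  "pure X F G U s t = to_sheafify (tensor_presheaf X F G) U
     (tensor_coset (cinf X U) (sec F U) (sec G U) (frag_of (s, t)))"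

text \<open>
  \<open>tensor_lift X F G H b\<close> is the additive sheaf map \<open>F \<otimes> G \<rightarrow> H\<close> determined by
  \<open>s \<otimes> t \<mapsto> b V s t\<close> on sections over open sets \<open>V\<close>, for biadditive maps \<open>b V\<close> that are
  compatible with restriction and satisfy \<open>b V (f s) t = b V s (f t)\<close>. Sections of \<open>F \<otimes> G\<close>
  over \<open>U\<close> are finite sums of pure tensors only locally, so the value is the
  section of \<open>H\<close> that is given by the formula wherever such a sum exists. Only the values
  \<open>b V\<close> for \<open>V \<subseteq> U\<close> matter, and the image of \<open>b\<close> need not be \<open>\<C>\<^sup>\<infinity>\<close>-linear, as is needed for
  connections.
\<close>

definition tensor_lift ::
    "'x::topological_space smooth_structure \<Rightarrow> ('x, 'f) osheaf \<Rightarrow> ('x, 'g) osheaf \<Rightarrow>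
     ('x, 'h) osheaf \<Rightarrow> ('x set \<Rightarrow> 'f \<Rightarrow> 'g \<Rightarrow> 'h) \<Rightarrow> 'x set \<Rightarrow> ('x, 'f, 'g) tens \<Rightarrow> 'h" where
  "tensor_lift X F G H b U \<xi> =
     (THE h. h \<in> carrier (sec H U) \<and>
        (\<forall>V (r::nat) s t. open V \<and> V \<subseteq> U \<and>
           (\<forall>k<r. s k \<in> carrier (sec F V) \<and> t k \<in> carrier (sec G V)) \<and>
           res (tensor X F G) U V \<xi> = (\<Oplus>\<^bsub>sec (tensor X F G) V\<^esub>k\<in>{..<r}. pure X F G V (s k) (t k)) \<longrightarrow>
           res H U V h = (\<Oplus>\<^bsub>sec H V\<^esub>k\<in>{..<r}. b V (s k) (t k))))"

definition tensor_map ::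
    "'x::topological_space smooth_structure \<Rightarrow> ('x, 'f) osheaf \<Rightarrow> ('x, 'g) osheaf \<Rightarrow>
     ('x, 'f') osheaf \<Rightarrow> ('x, 'g') osheaf \<Rightarrow> ('x set \<Rightarrow> 'f \<Rightarrow> 'f') \<Rightarrow> ('x set \<Rightarrow> 'g \<Rightarrow> 'g') \<Rightarrow>
     'x set \<Rightarrow> ('x, 'f, 'g) tens \<Rightarrow> ('x, 'f', 'g') tens" where
  "tensor_map X F G F' G' u v =
     tensor_lift X F G (tensor X F' G') (\<lambda>V s t. pure X F' G' V (u V s) (v V t))"

abbreviation id_hom :: "'x set \<Rightarrow> 'f \<Rightarrow> 'f" where
  "id_hom \<equiv> (\<lambda>_ s. s)"

text \<open>The isomorphism \<open>(F \<otimes> G) \<otimes> H \<rightarrow> F \<otimes> (G \<otimes> H)\<close>, \<open>(s \<otimes> t) \<otimes> w \<mapsto> s \<otimes> (t \<otimes> w)\<close>.\<close>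

definition assoc ::
    "'x::topological_space smooth_structure \<Rightarrow> ('x, 'f) osheaf \<Rightarrow> ('x, 'g) osheaf \<Rightarrow> ('x, 'h) osheaf \<Rightarrow>
     'x set \<Rightarrow> ('x, ('x, 'f, 'g) tens, 'h) tens \<Rightarrow> ('x, 'f, ('x, 'g, 'h) tens) tens" where
  "assoc X F G H =
     tensor_lift X (tensor X F G) H (tensor X F (tensor X G H))
       (\<lambda>U \<xi> w. tensor_lift X F G (tensor X F (tensor X G H))
          (\<lambda>V s t. pure X F (tensor X G H) V s (pure X G H V t (res H U V w))) U \<xi>)"

text \<open>The isomorphism \<open>G \<otimes> (F \<otimes> H) \<rightarrow> F \<otimes> (G \<otimes> H)\<close>, \<open>t \<otimes> (s \<otimes> w) \<mapsto> s \<otimes> (t \<otimes> w)\<close>.\<close>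

definition exchange ::
    "'x::topological_space smooth_structure \<Rightarrow> ('x, 'f) osheaf \<Rightarrow> ('x, 'g) osheaf \<Rightarrow> ('x, 'h) osheaf \<Rightarrow>
     'x set \<Rightarrow> ('x, 'g, ('x, 'f, 'h) tens) tens \<Rightarrow> ('x, 'f, ('x, 'g, 'h) tens) tens" where
  "exchange X F G H =
     tensor_lift X G (tensor X F H) (tensor X F (tensor X G H))
       (\<lambda>U t \<xi>. tensor_lift X F H (tensor X F (tensor X G H))
          (\<lambda>V s w. pure X F (tensor X G H) V s (pure X G H V (res G U V t) w)) U \<xi>)"


section \<open>The cotangent bundle and connections\<close>

text \<open>
  Tangent vectors at \<open>x\<close> are derivations of the ring of germs of smooth functions at \<open>x\<close>; they are
  encoded as functionals that depend only on the germ and are normalized to be \<open>0\<close> on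
  functions not smooth near \<open>x\<close>.
\<close>

definition smooth_near :: "'x::topological_space smooth_structure \<Rightarrow> 'x \<Rightarrow> ('x \<Rightarrow> real) \<Rightarrow> bool" where
  "smooth_near X x f \<longleftrightarrow> (\<exists>U. open U \<and> x \<in> U \<and> smooth_on X U f)"

type_synonym 'x tangent = "('x \<Rightarrow> real) \<Rightarrow> real"

definition tangent_space :: "'x::topological_space smooth_structure \<Rightarrow> 'x \<Rightarrow> 'x tangent set" where
  "tangent_space X x = {v.
     (\<forall>f g. smooth_near X x f \<and> smooth_near X x g \<longrightarrow>
        v (\<lambda>y. f y + g y) = v f + v g \<and> v (\<lambda>y. f y * g y) = f x * v g + g x * v f) \<and>
     (\<forall>c f. smooth_near X x f \<longrightarrow> v (\<lambda>y. c * f y) = c * v f) \<and>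
     (\<forall>f g. smooth_near X x f \<and> smooth_near X x g \<and> (\<exists>U. open U \<and> x \<in> U \<and> (\<forall>y\<in>U. f y = g y)) \<longrightarrow>
        v f = v g) \<and>
     (\<forall>f. \<not> smooth_near X x f \<longrightarrow> v f = 0)}"

definition smooth_vector_field ::
    "'x::topological_space smooth_structure \<Rightarrow> 'x set \<Rightarrow> ('x \<Rightarrow> 'x tangent) \<Rightarrow> bool" where
  "smooth_vector_field X U D \<longleftrightarrow> (\<forall>x\<in>U. D x \<in> tangent_space X x) \<and>
     (\<forall>V f. open V \<and> V \<subseteq> U \<and> smooth_on X V f \<longrightarrow> smooth_on X V (\<lambda>x. D x f))"

text \<open>Linear functionals on the tangent space, normalized to be \<open>0\<close> off it.\<close>

definition cotangent_space ::
    "'x::topological_space smooth_structure \<Rightarrow> 'x \<Rightarrow> ('x tangent \<Rightarrow> real) set" where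
  "cotangent_space X x = {\<omega>.
     (\<forall>v \<in> tangent_space X x. \<forall>w \<in> tangent_space X x. \<omega> (\<lambda>f. v f + w f) = \<omega> v + \<omega> w) \<and>
     (\<forall>c. \<forall>v \<in> tangent_space X x. \<omega> (\<lambda>f. c * v f) = c * \<omega> v) \<and>
     (\<forall>v. v \<notin> tangent_space X x \<longrightarrow> \<omega> v = 0)}"

text \<open>
  Sections are the smooth \<open>1\<close>-forms: those whose pairing with every smooth vector field, on every
  smaller open set, is a smooth function.
\<close>

definition cotangent ::
    "'x::topological_space smooth_structure \<Rightarrow> ('x, 'x \<Rightarrow> 'x tangent \<Rightarrow> real) osheaf" where
  "cotangent X = \<lparr>
     sec = (\<lambda>U. \<lparr>carrier = {\<omega>. (\<forall>x\<in>U. \<omega> x \<in> cotangent_space X x) \<and>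
                            (\<forall>x. x \<notin> U \<longrightarrow> \<omega> x = (\<lambda>_. 0)) \<and>
                            (\<forall>V D. open V \<and> V \<subseteq> U \<and> smooth_vector_field X V D \<longrightarrow>
                               smooth_on X V (\<lambda>x. \<omega> x (D x)))},
        monoid.mult = undefined, monoid.one = undefined,
        ring.zero = (\<lambda>x v. 0), add = (\<lambda>\<omega> \<eta> x v. \<omega> x v + \<eta> x v), smult = (\<lambda>f \<omega> x v. f x * \<omega> x v)\<rparr>),
     res = (\<lambda>U V \<omega> x. if x \<in> V then \<omega> x else (\<lambda>_. 0))\<rparr>"

definition differential ::
    "'x::topological_space smooth_structure \<Rightarrow> 'x set \<Rightarrow> ('x \<Rightarrow> real) \<Rightarrow> 'x \<Rightarrow> 'x tangent \<Rightarrow> real" where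
  "differential X U f = (\<lambda>x v. if x \<in> U \<and> v \<in> tangent_space X x then v f else 0)"

type_synonym ('x, 'f) cot_tens = "('x, 'x \<Rightarrow> 'x tangent \<Rightarrow> real, 'f) tens"

text \<open>Real linearity follows from additivity and the Leibniz rule, as constants have zero differential.\<close>

definition connection ::
    "'x::topological_space smooth_structure \<Rightarrow> ('x, 'f) osheaf \<Rightarrow>
     ('x set \<Rightarrow> 'f \<Rightarrow> ('x, 'f) cot_tens) \<Rightarrow> bool" where
  "connection X E D \<longleftrightarrow>
     (\<forall>U. open U \<longrightarrow>
        (\<forall>s \<in> carrier (sec E U). D U s \<in> carrier (sec (tensor X (cotangent X) E) U)) \<and>
        (\<forall>s \<in> carrier (sec E U). \<forall>t \<in> carrier (sec E U).
           D U (s \<oplus>\<^bsub>sec E U\<^esub> t) = D U s \<oplus>\<^bsub>sec (tensor X (cotangent X) E) U\<^esub> D U t) \<and>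
        (\<forall>f \<in> carrier (cinf X U). \<forall>s \<in> carrier (sec E U).
           D U (f \<odot>\<^bsub>sec E U\<^esub> s) =
             pure X (cotangent X) E U (differential X U f) s
               \<oplus>\<^bsub>sec (tensor X (cotangent X) E) U\<^esub> f \<odot>\<^bsub>sec (tensor X (cotangent X) E) U\<^esub> D U s)) \<and>
     (\<forall>U V. open U \<and> open V \<and> V \<subseteq> U \<longrightarrow>
        (\<forall>s \<in> carrier (sec E U). D V (res E U V s) = res (tensor X (cotangent X) E) U V (D U s)))"

text \<open>
  The tensor product connection
  \<open>v \<otimes> m \<mapsto> \<nabla> v \<otimes> m + v \<otimes> \<nabla>' m\<close>, with both summands moved to \<open>T\<^sup>* \<otimes> (E \<otimes> M)\<close>. Neither summand
  alone is well defined on the tensor product over \<open>\<C>\<^sup>\<infinity>\<close>.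
\<close>

definition tensor_connection ::
    "'x::topological_space smooth_structure \<Rightarrow> ('x, 'f) osheaf \<Rightarrow> ('x, 'm) osheaf \<Rightarrow>
     ('x set \<Rightarrow> 'f \<Rightarrow> ('x, 'f) cot_tens) \<Rightarrow> ('x set \<Rightarrow> 'm \<Rightarrow> ('x, 'm) cot_tens) \<Rightarrow>
     'x set \<Rightarrow> ('x, 'f, 'm) tens \<Rightarrow> ('x, ('x, 'f, 'm) tens) cot_tens" where
  "tensor_connection X E M D D' =
     (let T = cotangent X; H = tensor X T (tensor X E M) in
      tensor_lift X E M H
        (\<lambda>U v m. assoc X T E M U (pure X (tensor X T E) M U (D U v) m)
                   \<oplus>\<^bsub>sec H U\<^esub> exchange X T E M U (pure X E (tensor X T M) U v (D' U m))))"


section \<open>Twisted quiver sheaves\<close>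

text \<open>A finite quiver is a \<^locale>\<open>fin_digraph\<close>; loops and multiple arrows are allowed.\<close>

record ('v, 'a, 'x, 'm, 'f) qsheaf =
  vsh :: "'v \<Rightarrow> ('x, 'f) osheaf"
  amap :: "'a \<Rightarrow> 'x set \<Rightarrow> ('x, 'f, 'm) tens \<Rightarrow> 'f"

definition twisted_sheaf ::
    "'x::topological_space smooth_structure \<Rightarrow> ('v, 'a) pre_digraph \<Rightarrow> ('a \<Rightarrow> ('x, 'm) osheaf) \<Rightarrow>
     ('v, 'a, 'x, 'm, 'f) qsheaf \<Rightarrow> bool" where
  "twisted_sheaf X Q M R \<longleftrightarrow>
     (\<forall>i \<in> verts Q. sheaf_mod X (vsh R i)) \<and>
     (\<forall>a \<in> arcs Q. sheaf_hom X (tensor X (vsh R (tail Q a)) (M a)) (vsh R (head Q a)) (amap R a))"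

definition twisted_bundle ::
    "'x::topological_space smooth_structure \<Rightarrow> ('v, 'a) pre_digraph \<Rightarrow> ('a \<Rightarrow> ('x, 'm) osheaf) \<Rightarrow>
     ('v, 'a, 'x, 'm, 'f) qsheaf \<Rightarrow> bool" where
  "twisted_bundle X Q M R \<longleftrightarrow> twisted_sheaf X Q M R \<and> (\<forall>i \<in> verts Q. vector_bundle X (vsh R i))"

definition twisted_hom ::
    "'x::topological_space smooth_structure \<Rightarrow> ('v, 'a) pre_digraph \<Rightarrow> ('a \<Rightarrow> ('x, 'm) osheaf) \<Rightarrow>
     ('v, 'a, 'x, 'm, 'f) qsheaf \<Rightarrow> ('v, 'a, 'x, 'm, 'g) qsheaf \<Rightarrow>
     ('v \<Rightarrow> 'x set \<Rightarrow> 'f \<Rightarrow> 'g) \<Rightarrow> bool" where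
  "twisted_hom X Q M R R' h \<longleftrightarrow>
     (\<forall>i \<in> verts Q. sheaf_hom X (vsh R i) (vsh R' i) (h i)) \<and>
     (\<forall>a \<in> arcs Q. \<forall>U. open U \<longrightarrow>
        (\<forall>\<xi> \<in> carrier (sec (tensor X (vsh R (tail Q a)) (M a)) U).
           h (head Q a) U (amap R a U \<xi>) =
           amap R' a U (tensor_map X (vsh R (tail Q a)) (M a) (vsh R' (tail Q a)) (M a)
                          (h (tail Q a)) id_hom U \<xi>)))"

text \<open>
  The map \<open>id \<otimes> \<phi>\<^sub>a : T\<^sup>* \<otimes> (E\<^sub>s \<otimes> M\<^sub>a) \<rightarrow> T\<^sup>* \<otimes> E\<^sub>t\<close>; as a structure map of \<open>T\<^sup>* \<otimes> R\<close> it is precomposed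
  with the associativity isomorphism.
\<close>

definition cot_amap ::
    "'x::topological_space smooth_structure \<Rightarrow> ('v, 'a) pre_digraph \<Rightarrow> ('a \<Rightarrow> ('x, 'm) osheaf) \<Rightarrow>
     ('v, 'a, 'x, 'm, 'f) qsheaf \<Rightarrow> 'a \<Rightarrow>
     'x set \<Rightarrow> ('x, ('x, 'f, 'm) tens) cot_tens \<Rightarrow> ('x, 'f) cot_tens" where
  "cot_amap X Q M R a =
     tensor_map X (cotangent X) (tensor X (vsh R (tail Q a)) (M a)) (cotangent X) (vsh R (head Q a))
       id_hom (amap R a)"

definition cot_twist ::
    "'x::topological_space smooth_structure \<Rightarrow> ('v, 'a) pre_digraph \<Rightarrow> ('a \<Rightarrow> ('x, 'm) osheaf) \<Rightarrow>
     ('v, 'a, 'x, 'm, 'f) qsheaf \<Rightarrow> ('v, 'a, 'x, 'm, ('x, 'f) cot_tens) qsheaf" where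
  "cot_twist X Q M R = \<lparr>
     vsh = (\<lambda>i. tensor X (cotangent X) (vsh R i)),
     amap = (\<lambda>a U \<xi>. cot_amap X Q M R a U (assoc X (cotangent X) (vsh R (tail Q a)) (M a) U \<xi>))\<rparr>"

definition relative_connection ::
    "'x::topological_space smooth_structure \<Rightarrow> ('v, 'a) pre_digraph \<Rightarrow> ('a \<Rightarrow> ('x, 'm) osheaf) \<Rightarrow>
     ('v, 'a, 'x, 'm, 'f) qsheaf \<Rightarrow> ('v \<Rightarrow> 'x set \<Rightarrow> 'f \<Rightarrow> ('x, 'f) cot_tens) \<Rightarrow>
     ('a \<Rightarrow> 'x set \<Rightarrow> 'm \<Rightarrow> ('x, 'm) cot_tens) \<Rightarrow> bool" where
  "relative_connection X Q M R D0 D1 \<longleftrightarrow>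
     (\<forall>i \<in> verts Q. connection X (vsh R i) (D0 i)) \<and>
     (\<forall>a \<in> arcs Q. connection X (M a) (D1 a)) \<and>
     (\<forall>a \<in> arcs Q. \<forall>U. open U \<longrightarrow>
        (\<forall>\<xi> \<in> carrier (sec (tensor X (vsh R (tail Q a)) (M a)) U).
           D0 (head Q a) U (amap R a U \<xi>) =
           cot_amap X Q M R a U
             (tensor_connection X (vsh R (tail Q a)) (M a) (D0 (tail Q a)) (D1 a) U \<xi>)))"

definition obstruction ::
    "'x::topological_space smooth_structure \<Rightarrow> ('v, 'a) pre_digraph \<Rightarrow> ('a \<Rightarrow> ('x, 'm) osheaf) \<Rightarrow>
     ('v, 'a, 'x, 'm, 'f) qsheaf \<Rightarrow> ('v \<Rightarrow> 'x set \<Rightarrow> 'f \<Rightarrow> ('x, 'f) cot_tens) \<Rightarrow>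
     ('a \<Rightarrow> 'x set \<Rightarrow> 'm \<Rightarrow> ('x, 'm) cot_tens) \<Rightarrow>
     'a \<Rightarrow> 'x set \<Rightarrow> ('x, 'f, 'm) tens \<Rightarrow> ('x, 'f) cot_tens" where
  "obstruction X Q M R D0 D1 a U \<xi> =
     cot_amap X Q M R a U
       (tensor_connection X (vsh R (tail Q a)) (M a) (D0 (tail Q a)) (D1 a) U \<xi>)
     \<ominus>\<^bsub>sec (tensor X (cotangent X) (vsh R (head Q a))) U\<^esub>
     D0 (head Q a) U (amap R a U \<xi>)"


section \<open>Extensions\<close>

type_synonym ('v, 'a, 'x, 'm, 's, 'r, 'e) qext =
  "('v, 'a, 'x, 'm, 'e) qsheaf \<times> ('v \<Rightarrow> 'x set \<Rightarrow> 's \<Rightarrow> 'e) \<times> ('v \<Rightarrow> 'x set \<Rightarrow> 'e \<Rightarrow> 'r)"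

text \<open>
  Short exact sequences \<open>0 \<rightarrow> S \<rightarrow> E \<rightarrow> R \<rightarrow> 0\<close> of twisted quiver sheaves. Exactness is that of sheaves
  at each vertex, so surjectivity is local; given injectivity of the first map, exactness in the
  middle can be tested on sections.
\<close>

definition extension ::
    "'x::topological_space smooth_structure \<Rightarrow> ('v, 'a) pre_digraph \<Rightarrow> ('a \<Rightarrow> ('x, 'm) osheaf) \<Rightarrow>
     ('v, 'a, 'x, 'm, 's) qsheaf \<Rightarrow> ('v, 'a, 'x, 'm, 'r) qsheaf \<Rightarrow>
     ('v, 'a, 'x, 'm, 's, 'r, 'e) qext \<Rightarrow> bool" where
  "extension X Q M S R = (\<lambda>(E, \<iota>, \<pi>).
     twisted_sheaf X Q M E \<and> twisted_hom X Q M S E \<iota> \<and> twisted_hom X Q M E R \<pi> \<and>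
     (\<forall>i \<in> verts Q. \<forall>U. open U \<longrightarrow>
        inj_on (\<iota> i U) (carrier (sec (vsh S i) U)) \<and>
        \<iota> i U ` carrier (sec (vsh S i) U) =
          {e \<in> carrier (sec (vsh E i) U). \<pi> i U e = \<zero>\<^bsub>sec (vsh R i) U\<^esub>} \<and>
        (\<forall>r \<in> carrier (sec (vsh R i) U). \<forall>x\<in>U. \<exists>V. open V \<and> x \<in> V \<and> V \<subseteq> U \<and>
           res (vsh R i) U V r \<in> \<pi> i V ` carrier (sec (vsh E i) V))))"

text \<open>Equivalence: an isomorphism of the middle terms that is the identity on \<open>S\<close> and on \<open>R\<close>.\<close>

definition ext_equiv ::
    "'x::topological_space smooth_structure \<Rightarrow> ('v, 'a) pre_digraph \<Rightarrow> ('a \<Rightarrow> ('x, 'm) osheaf) \<Rightarrow>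
     ('v, 'a, 'x, 'm, 's) qsheaf \<Rightarrow> ('v, 'a, 'x, 'm, 'r) qsheaf \<Rightarrow>
     ('v, 'a, 'x, 'm, 's, 'r, 'e) qext \<Rightarrow> ('v, 'a, 'x, 'm, 's, 'r, 'e) qext \<Rightarrow> bool" where
  "ext_equiv X Q M S R = (\<lambda>(E, \<iota>, \<pi>) (E', \<iota>', \<pi>').
     \<exists>h h'. twisted_hom X Q M E E' h \<and> twisted_hom X Q M E' E h' \<and>
       (\<forall>i \<in> verts Q. \<forall>U. open U \<longrightarrow>
          (\<forall>e \<in> carrier (sec (vsh E i) U). h' i U (h i U e) = e \<and> \<pi>' i U (h i U e) = \<pi> i U e) \<and>
          (\<forall>e \<in> carrier (sec (vsh E' i) U). h i U (h' i U e) = e) \<and>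
          (\<forall>s \<in> carrier (sec (vsh S i) U). h i U (\<iota> i U s) = \<iota>' i U s)))"

text \<open>
  Yoneda \<open>Ext\<^sup>1(R, S)\<close>: equivalence classes of extensions whose middle sheaves have sections of type
  \<open>'s \<times> 'r\<close>. This loses no class: a section group of a middle term is in bijection with
  a subset of \<open>'s \<times> 'r\<close>, by left exactness of sections.
\<close>

definition ext_rel ::
    "'x::topological_space smooth_structure \<Rightarrow> ('v, 'a) pre_digraph \<Rightarrow> ('a \<Rightarrow> ('x, 'm) osheaf) \<Rightarrow>
     ('v, 'a, 'x, 'm, 's) qsheaf \<Rightarrow> ('v, 'a, 'x, 'm, 'r) qsheaf \<Rightarrow>
     ('v, 'a, 'x, 'm, 's, 'r, 's \<times> 'r) qext rel" where
  "ext_rel X Q M S R =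
     {(e, e'). extension X Q M S R e \<and> extension X Q M S R e' \<and> ext_equiv X Q M S R e e'}"

definition Ext1 ::
    "'x::topological_space smooth_structure \<Rightarrow> ('v, 'a) pre_digraph \<Rightarrow> ('a \<Rightarrow> ('x, 'm) osheaf) \<Rightarrow>
     ('v, 'a, 'x, 'm, 'r) qsheaf \<Rightarrow> ('v, 'a, 'x, 'm, 's) qsheaf \<Rightarrow>
     ('v, 'a, 'x, 'm, 's, 'r, 's \<times> 'r) qext set set" where
  "Ext1 X Q M R S = {e. extension X Q M S R e} // ext_rel X Q M S R"

text \<open>
  The distributivity isomorphism identifies \<open>(S \<oplus> R) \<otimes> M\<close> with \<open>(S \<otimes> M) \<oplus> (R \<otimes> M)\<close>; its components
  are \<open>fst \<otimes> id\<close> and \<open>snd \<otimes> id\<close>.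
\<close>

definition sum_qsheaf ::
    "'x::topological_space smooth_structure \<Rightarrow> ('v, 'a) pre_digraph \<Rightarrow> ('a \<Rightarrow> ('x, 'm) osheaf) \<Rightarrow>
     ('v, 'a, 'x, 'm, 's) qsheaf \<Rightarrow> ('v, 'a, 'x, 'm, 'r) qsheaf \<Rightarrow>
     ('v, 'a, 'x, 'm, 's \<times> 'r) qsheaf" where
  "sum_qsheaf X Q M S R = \<lparr>
     vsh = (\<lambda>i. dirsum (vsh S i) (vsh R i)),
     amap = (\<lambda>a U \<xi>.
       let Ss = vsh S (tail Q a); Rs = vsh R (tail Q a);
           \<sigma> = tensor_map X (dirsum Ss Rs) (M a) Ss (M a) (\<lambda>_. fst) id_hom U \<xi>;
           \<rho> = tensor_map X (dirsum Ss Rs) (M a) Rs (M a) (\<lambda>_. snd) id_hom U \<xi>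
       in (amap S a U \<sigma>, amap R a U \<rho>))\<rparr>"

definition twisted_sum_qsheaf ::
    "'x::topological_space smooth_structure \<Rightarrow> ('v, 'a) pre_digraph \<Rightarrow> ('a \<Rightarrow> ('x, 'm) osheaf) \<Rightarrow>
     ('v, 'a, 'x, 'm, 's) qsheaf \<Rightarrow> ('v, 'a, 'x, 'm, 'r) qsheaf \<Rightarrow>
     ('a \<Rightarrow> 'x set \<Rightarrow> ('x, 'r, 'm) tens \<Rightarrow> 's) \<Rightarrow> ('v, 'a, 'x, 'm, 's \<times> 'r) qsheaf" where
  "twisted_sum_qsheaf X Q M S R \<beta> = \<lparr>
     vsh = (\<lambda>i. dirsum (vsh S i) (vsh R i)),
     amap = (\<lambda>a U \<xi>.
       let Ss = vsh S (tail Q a); Rs = vsh R (tail Q a);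
           \<sigma> = tensor_map X (dirsum Ss Rs) (M a) Ss (M a) (\<lambda>_. fst) id_hom U \<xi>;
           \<rho> = tensor_map X (dirsum Ss Rs) (M a) Rs (M a) (\<lambda>_. snd) id_hom U \<xi>
       in (amap S a U \<sigma> \<oplus>\<^bsub>sec (vsh S (head Q a)) U\<^esub> \<beta> a U \<rho>, amap R a U \<rho>))\<rparr>"

definition sum_incl :: "('v, 'a, 'x, 'm, 'r) qsheaf \<Rightarrow> 'v \<Rightarrow> 'x set \<Rightarrow> 's \<Rightarrow> 's \<times> 'r" where
  "sum_incl R i U s = (s, \<zero>\<^bsub>sec (vsh R i) U\<^esub>)"

definition sum_proj :: "'v \<Rightarrow> 'x set \<Rightarrow> 's \<times> 'r \<Rightarrow> 'r" where
  "sum_proj i U = snd"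

text \<open>The zero of \<open>Ext\<^sup>1(R, S)\<close> is the class of the split extension \<open>S \<oplus> R\<close>.\<close>

definition Ext1_zero ::
    "'x::topological_space smooth_structure \<Rightarrow> ('v, 'a) pre_digraph \<Rightarrow> ('a \<Rightarrow> ('x, 'm) osheaf) \<Rightarrow>
     ('v, 'a, 'x, 'm, 'r) qsheaf \<Rightarrow> ('v, 'a, 'x, 'm, 's) qsheaf \<Rightarrow>
     ('v, 'a, 'x, 'm, 's, 'r, 's \<times> 'r) qext set" where
  "Ext1_zero X Q M R S = ext_rel X Q M S R `` {(sum_qsheaf X Q M S R, sum_incl R, sum_proj)}"

definition Ext1_image ::
    "'x::topological_space smooth_structure \<Rightarrow> ('v, 'a) pre_digraph \<Rightarrow> ('a \<Rightarrow> ('x, 'm) osheaf) \<Rightarrow>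
     ('v, 'a, 'x, 'm, 'r) qsheaf \<Rightarrow> ('v, 'a, 'x, 'm, 's) qsheaf \<Rightarrow>
     ('a \<Rightarrow> 'x set \<Rightarrow> ('x, 'r, 'm) tens \<Rightarrow> 's) \<Rightarrow> ('v, 'a, 'x, 'm, 's, 'r, 's \<times> 'r) qext set" where
  "Ext1_image X Q M R S \<beta> =
     ext_rel X Q M S R `` {(twisted_sum_qsheaf X Q M S R \<beta>, sum_incl R, sum_proj)}"

end

(*
Two connections on the same bundle differ by a homomorphism, so with the connections on the M_a
fixed, every relative connection has the form nabla_i = nabla0_i - alpha_i with alpha_i : E_i -> T* (x) E_i.
Passing from nabla0 to nabla changes the tensor product connection on E_s(a) (x) M_a by alpha_s(a) (x) id;
hence nabla is compatible with phi iff beta_a + alpha_t(a) phi_a = (id (x) phi_a)(alpha_s(a) (x) id) for all a.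
On the other side, an equivalence from the extension of beta to the split one is a shear
(tau, v) |-> (tau + alpha_i v, v), and such a shear commutes with the structure maps iff the same equation
holds. The remaining point is that maps out of a sheaf tensor product, whose sections are only
locally sums of pure tensors, exist and are determined by balanced maps; the maps here are only
additive, because the tensor product connection satisfies the Leibniz rule instead of linearity.
*)
theory Submission
  imports Defs
begin

section \<open>Additive maps and tensor products of modules\<close>

text \<open>Maps out of a sheaf tensor product are definite descriptions
  (\<open>tensor_lift\<close>), so nothing can be computed before existence and uniqueness are
  known. Over each open set a balanced map factors through the module tensor product; sheafification
  may identify tensors that agree only locally, and the sheaf property of the target both removes
  this ambiguity and glues the values. After that, identities of maps are tested on pure tensors.
  Balancedness \<open>b (f s) t = b s (f t)\<close> involves no scalars on the target, so it makes
  sense for the tensor product connection, whose two summands fail it by df \<otimes> (v \<otimes>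
  m) with opposite signs. Such Leibniz terms also cancel in the obstruction and in the difference of
  two connections, so both are linear. Vanishing in Ext^1 is an equality of classes, so equivalence
  of extensions must be shown to be an equivalence relation. The shear form is forced: compatibility
  with inclusion and projection leaves only the component from the quotient to the subobject
  free.\<close>

definition additive_on :: "('a, 'm) ring_scheme \<Rightarrow> ('b, 'n) ring_scheme \<Rightarrow> ('a \<Rightarrow> 'b) \<Rightarrow> bool" where
  "additive_on A B h \<longleftrightarrow> (\<forall>x\<in>carrier A. h x \<in> carrier B) \<and>
     (\<forall>x\<in>carrier A. \<forall>y\<in>carrier A. h (x \<oplus>\<^bsub>A\<^esub> y) = h x \<oplus>\<^bsub>B\<^esub> h y)"

lemma additive_onI:
  assumes "\<And>x. x \<in> carrier A \<Longrightarrow> h x \<in> carrier B"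
    and "\<And>x y. x \<in> carrier A \<Longrightarrow> y \<in> carrier A \<Longrightarrow> h (x \<oplus>\<^bsub>A\<^esub> y) = h x \<oplus>\<^bsub>B\<^esub> h y"
  shows "additive_on A B h"
  using assms by (simp add: additive_on_def)

lemma additive_on_closed: "additive_on A B h \<Longrightarrow> x \<in> carrier A \<Longrightarrow> h x \<in> carrier B"
  and additive_on_add:
    "additive_on A B h \<Longrightarrow> x \<in> carrier A \<Longrightarrow> y \<in> carrier A \<Longrightarrow> h (x \<oplus>\<^bsub>A\<^esub> y) = h x \<oplus>\<^bsub>B\<^esub> h y"
  by (auto simp: additive_on_def)

lemma additive_on_zero:
  assumes "abelian_group A" "abelian_group B" "additive_on A B h"
  shows "h \<zero>\<^bsub>A\<^esub> = \<zero>\<^bsub>B\<^esub>"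
proof -
  interpret A: abelian_group A by fact
  interpret B: abelian_group B by fact
  have "h \<zero>\<^bsub>A\<^esub> \<in> carrier B" using assms by (simp add: additive_on_closed)
  moreover have "h \<zero>\<^bsub>A\<^esub> \<oplus>\<^bsub>B\<^esub> h \<zero>\<^bsub>A\<^esub> = h \<zero>\<^bsub>A\<^esub>"
    using additive_on_add[OF assms(3), of "\<zero>\<^bsub>A\<^esub>" "\<zero>\<^bsub>A\<^esub>"] by simp
  ultimately show ?thesis
    by (metis B.add.l_cancel_one')
qed

lemma additive_on_minus:
  assumes "abelian_group A" "abelian_group B" "additive_on A B h" "x \<in> carrier A"
  shows "h (\<ominus>\<^bsub>A\<^esub> x) = \<ominus>\<^bsub>B\<^esub> h x"
proof -
  interpret A: abelian_group A by fact
  interpret B: abelian_group B by fact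
  have "h (\<ominus>\<^bsub>A\<^esub> x) \<oplus>\<^bsub>B\<^esub> h x = \<zero>\<^bsub>B\<^esub>"
    using additive_on_add[OF assms(3), of "\<ominus>\<^bsub>A\<^esub> x" x] additive_on_zero[OF assms(1-3)] assms(4)
    by (simp add: A.l_neg)
  then show ?thesis
    using assms by (metis A.a_inv_closed B.minus_equality additive_on_closed)
qed

lemma additive_on_diff:
  assumes "abelian_group A" "abelian_group B" "additive_on A B h" "x \<in> carrier A" "y \<in> carrier A"
  shows "h (x \<ominus>\<^bsub>A\<^esub> y) = h x \<ominus>\<^bsub>B\<^esub> h y"
proof -
  interpret A: abelian_group A by fact
  interpret B: abelian_group B by fact
  show ?thesis
    using assms by (simp add: a_minus_def additive_on_add additive_on_minus)
qed

lemma (in abelian_monoid) finsum_lessThan_Suc: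
  assumes "\<And>k. k < Suc r \<Longrightarrow> f k \<in> carrier G"
  shows "(\<Oplus>k\<in>{..<Suc r}. f k) = f r \<oplus> (\<Oplus>k\<in>{..<r}. f k)"
  unfolding lessThan_Suc using assms by (subst finsum_insert) (auto simp: less_SucI)

text \<open>Joining two index ranges end to end keeps the form \<open>{..<n}\<close> in which
  \<open>tensor_lift\<close> asks for sums of pure tensors; closure of such sums under addition and
  additivity of lifts rest on it.\<close>

lemma (in abelian_monoid) finsum_lessThan_append:
  assumes "\<And>k. k < (r::nat) \<Longrightarrow> f k \<in> carrier G" "\<And>k. k < (r'::nat) \<Longrightarrow> g k \<in> carrier G"
  shows "(\<Oplus>k\<in>{..<r + r'}. if k < r then f k else g (k - r)) =
    (\<Oplus>k\<in>{..<r}. f k) \<oplus> (\<Oplus>k\<in>{..<r'}. g k)"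
  using assms(2)
proof (induction r')
  case 0
  have "(\<Oplus>k\<in>{..<r}. if k < r then f k else g (k - r)) = (\<Oplus>k\<in>{..<r}. f k)"
    by (rule finsum_cong') (use assms in auto)
  moreover have "(\<Oplus>k\<in>{..<r}. f k) \<in> carrier G"
    using assms by (auto intro!: finsum_closed)
  ultimately show ?case by simp
next
  case (Suc r')
  have c: "(\<Oplus>k\<in>{..<r}. f k) \<in> carrier G" "(\<Oplus>k\<in>{..<r'}. g k) \<in> carrier G" "g r' \<in> carrier G"
    using assms Suc by (auto intro!: finsum_closed)
  have "(\<Oplus>k\<in>{..<r + Suc r'}. if k < r then f k else g (k - r)) =
      g r' \<oplus> (\<Oplus>k\<in>{..<r + r'}. if k < r then f k else g (k - r))"
    unfolding add_Suc_right by (subst finsum_lessThan_Suc) (use assms Suc in auto)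
  also have "\<dots> = g r' \<oplus> ((\<Oplus>k\<in>{..<r}. f k) \<oplus> (\<Oplus>k\<in>{..<r'}. g k))"
    using Suc by simp
  also have "\<dots> = (\<Oplus>k\<in>{..<r}. f k) \<oplus> (\<Oplus>k\<in>{..<Suc r'}. g k)"
    by (subst finsum_lessThan_Suc) (use Suc c in \<open>auto simp: a_ac\<close>)
  finally show ?case .
qed

lemma additive_on_finsum:
  assumes "abelian_group A" "abelian_group B" "additive_on A B h"
    and "\<And>k. k < (r::nat) \<Longrightarrow> f k \<in> carrier A"
  shows "h (\<Oplus>\<^bsub>A\<^esub>k\<in>{..<r}. f k) = (\<Oplus>\<^bsub>B\<^esub>k\<in>{..<r}. h (f k))"
  using assms(4)
proof (induction r)
  case 0
  interpret A: abelian_group A by fact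
  interpret B: abelian_group B by fact
  show ?case using assms by (simp add: additive_on_zero)
next
  case (Suc r)
  interpret A: abelian_group A by fact
  interpret B: abelian_group B by fact
  have "(\<Oplus>\<^bsub>A\<^esub>k\<in>{..<r}. f k) \<in> carrier A"
    using Suc by (auto intro!: A.finsum_closed)
  then show ?case
    using Suc assms(3) by (simp add: A.finsum_lessThan_Suc B.finsum_lessThan_Suc additive_on_closed additive_on_add)
qed

section \<open>The tensor product of two modules over a ring\<close>

locale module_pair = M: module R M + N: module R N
  for R :: "('r, 'k) ring_scheme" (structure) and M :: "('r, 'm) module" and N :: "('r, 'n) module"
begin

abbreviation "Fr \<equiv> free_Abelian_group (carrier M \<times> carrier N)"
abbreviation "Ks \<equiv> tensor_subgroup R M N"
abbreviation "coset_of \<equiv> tensor_coset R M N"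
abbreviation "T \<equiv> tensor_module R M N"

lemma frag_of_closed: "m \<in> carrier M \<Longrightarrow> n \<in> carrier N \<Longrightarrow> frag_of (m, n) \<in> carrier Fr"
  by simp

lemma carrier_Fr_diff: "\<xi> \<in> carrier Fr \<Longrightarrow> \<eta> \<in> carrier Fr \<Longrightarrow> \<xi> - \<eta> \<in> carrier Fr"
  using keys_diff[of \<xi> \<eta>] by auto

lemma carrier_Fr_add: "\<xi> \<in> carrier Fr \<Longrightarrow> \<eta> \<in> carrier Fr \<Longrightarrow> \<xi> + \<eta> \<in> carrier Fr"
  using group.is_monoid[OF group_free_Abelian_group, THEN monoid.m_closed] by (metis mult_free_Abelian_group)

lemma tensor_relations_carrier: "tensor_relations R M N \<subseteq> carrier Fr"
  unfolding tensor_relations_def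
  by (safe; intro carrier_Fr_diff frag_of_closed) auto

sublocale Fr: comm_group Fr by (rule abelian_free_Abelian_group)

lemma subgroup_Ks: "subgroup Ks Fr"
  unfolding tensor_subgroup_def by (rule Fr.generate_is_subgroup[OF tensor_relations_carrier])

lemma normal_Ks: "Ks \<lhd> Fr"
  using subgroup_Ks Fr.normal_iff_subgroup by blast

lemma relation_Ks: "x \<in> tensor_relations R M N \<Longrightarrow> x \<in> Ks"
  unfolding tensor_subgroup_def by (rule generate.incl)

sublocale Ks: normal Ks Fr by (rule normal_Ks)

text \<open>The group operation of \<open>free_Abelian_group\<close> is the addition of finitely
  supported functions, so equality of cosets turns into a difference lying in the relation subgroup,
  the form in which well-definedness is checked.\<close>

lemma coset_of_eq_iff:
  assumes "\<xi> \<in> carrier Fr" "\<eta> \<in> carrier Fr"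
  shows "coset_of \<xi> = coset_of \<eta> \<longleftrightarrow> \<xi> - \<eta> \<in> Ks"
proof
  assume "coset_of \<xi> = coset_of \<eta>"
  then have "\<xi> \<in> Ks #>\<^bsub>Fr\<^esub> \<eta>"
    using Fr.rcos_self[OF assms(1) subgroup_Ks] by (simp add: tensor_coset_def)
  then obtain k where "k \<in> Ks" "\<xi> = k + \<eta>" by (auto simp: r_coset_def)
  then show "\<xi> - \<eta> \<in> Ks" by simp
next
  assume *: "\<xi> - \<eta> \<in> Ks"
  have "\<xi> = (\<xi> - \<eta>) \<otimes>\<^bsub>Fr\<^esub> \<eta>" by simp
  then have "\<xi> \<in> Ks #>\<^bsub>Fr\<^esub> \<eta>" using * by (force simp: r_coset_def)
  then show "coset_of \<xi> = coset_of \<eta>"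
    unfolding tensor_coset_def by (metis Fr.repr_independence assms(2) subgroup_Ks)
qed

lemma carrier_T: "carrier T = coset_of ` carrier Fr"
  by (auto simp: tensor_module_def Let_def FactGroup_def RCOSETS_def tensor_coset_def)

lemma coset_of_closed: "\<xi> \<in> carrier Fr \<Longrightarrow> coset_of \<xi> \<in> carrier T"
  by (simp add: carrier_T)

lemma zero_T: "\<zero>\<^bsub>T\<^esub> = coset_of 0"
  using Fr.coset_mult_one[OF subgroup.subset[OF subgroup_Ks]]
  by (simp add: tensor_module_def Let_def FactGroup_def tensor_coset_def)

lemma add_T: "\<xi> \<in> carrier Fr \<Longrightarrow> \<eta> \<in> carrier Fr \<Longrightarrow> coset_of \<xi> \<oplus>\<^bsub>T\<^esub> coset_of \<eta> = coset_of (\<xi> + \<eta>)"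
  using Ks.rcos_sum[of \<xi> \<eta>]
  by (simp add: tensor_module_def Let_def FactGroup_def tensor_coset_def)

lemma abelian_group_T: "abelian_group T"
proof -
  interpret Q: comm_group "Fr Mod Ks"
    by (rule Fr.abelian_FactGroup[OF subgroup_Ks])
  have "comm_group (add_monoid T)"
    by (rule comm_groupI)
      (use Q.m_assoc Q.m_comm Q.m_closed Q.one_closed Q.l_one Q.l_inv_ex in \<open>auto simp: tensor_module_def Let_def\<close>)
  then show ?thesis
    unfolding abelian_group_def abelian_monoid_def abelian_group_axioms_def comm_group_def by blast
qed

text \<open>The relation subgroup is generated by the relations, and preimages of subgroups are
  subgroups. With \<open>L\<close> trivial this makes a map vanish on the relation subgroup; with
  \<open>L\<close> the relation subgroup of another pair it makes a map descend between tensor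
  products.\<close>

lemma additive_Ks:
  assumes "\<And>\<xi> \<eta>. \<xi> \<in> carrier Fr \<Longrightarrow> \<eta> \<in> carrier Fr \<Longrightarrow> \<phi> (\<xi> + \<eta>) = \<phi> \<xi> \<otimes>\<^bsub>H\<^esub> \<phi> \<eta>"
    and "\<And>\<xi>. \<xi> \<in> carrier Fr \<Longrightarrow> \<phi> \<xi> \<in> carrier H" "group H" "subgroup L H"
    and "\<And>x. x \<in> tensor_relations R M N \<Longrightarrow> \<phi> x \<in> L" "x \<in> Ks"
  shows "\<phi> x \<in> L"
proof -
  interpret \<phi>: group_hom Fr H \<phi>
    using assms(1-3) by (simp add: group_hom_def group_hom_axioms_def hom_def Pi_iff)
  have "generate Fr (tensor_relations R M N) \<subseteq> {x \<in> carrier Fr. \<phi> x \<in> L}"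
  proof (rule Fr.generate_subgroup_incl)
    show "tensor_relations R M N \<subseteq> {x \<in> carrier Fr. \<phi> x \<in> L}"
      using assms(5) tensor_relations_carrier by blast
    interpret L: subgroup L H by fact
    show "subgroup {x \<in> carrier Fr. \<phi> x \<in> L} Fr"
      by unfold_locales (use \<phi>.hom_mult \<phi>.hom_one \<phi>.hom_inv Fr.m_closed Fr.inv_closed in \<open>auto simp del: carrier_free_Abelian_group_iff one_free_Abelian_group mult_free_Abelian_group inv_free_Abelian_group\<close>)
  qed
  then show ?thesis using assms(6) by (auto simp: tensor_subgroup_def)
qed

text \<open>The pairs form a basis of the free group, so \<open>b\<close> extends to it, and the
  last three conditions on \<open>b\<close> say that the extension kills the three kinds of
  relations. The target is only an abelian group, since the maps of interest include
  connections.\<close>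

lemma tensor_universal:
  assumes "abelian_group H"
    and "\<And>m n. m \<in> carrier M \<Longrightarrow> n \<in> carrier N \<Longrightarrow> b m n \<in> carrier H"
    and "\<And>m m' n. m \<in> carrier M \<Longrightarrow> m' \<in> carrier M \<Longrightarrow> n \<in> carrier N \<Longrightarrow> b (m \<oplus>\<^bsub>M\<^esub> m') n = b m n \<oplus>\<^bsub>H\<^esub> b m' n"
    and "\<And>m n n'. m \<in> carrier M \<Longrightarrow> n \<in> carrier N \<Longrightarrow> n' \<in> carrier N \<Longrightarrow> b m (n \<oplus>\<^bsub>N\<^esub> n') = b m n \<oplus>\<^bsub>H\<^esub> b m n'"
    and "\<And>r m n. r \<in> carrier R \<Longrightarrow> m \<in> carrier M \<Longrightarrow> n \<in> carrier N \<Longrightarrow> b (r \<odot>\<^bsub>M\<^esub> m) n = b m (r \<odot>\<^bsub>N\<^esub> n)"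
  obtains h where "additive_on T H h"
    "\<And>m n. m \<in> carrier M \<Longrightarrow> n \<in> carrier N \<Longrightarrow> h (coset_of (frag_of (m, n))) = b m n"
proof -
  interpret H: abelian_group H by fact
  have G: "group (add_monoid H)" by (rule comm_group.axioms(2)[OF H.a_comm_group])
  obtain \<phi> where \<phi>: "\<phi> \<in> hom Fr (add_monoid H)"
    and \<phi>b: "\<And>x. x \<in> carrier M \<times> carrier N \<Longrightarrow> \<phi> (frag_of x) = (\<lambda>(m, n). b m n) x"
    by (rule comm_group.free_Abelian_group_universal[OF H.a_comm_group, of "\<lambda>(m, n). b m n" "carrier M \<times> carrier N"]) (use assms(2) in auto)
  have cl: "\<phi> \<xi> \<in> carrier H" if "\<xi> \<in> carrier Fr" for \<xi>
    using \<phi> that by (auto simp: hom_def simp del: carrier_free_Abelian_group_iff)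
  have add: "\<phi> (\<xi> + \<eta>) = \<phi> \<xi> \<oplus>\<^bsub>H\<^esub> \<phi> \<eta>" if "\<xi> \<in> carrier Fr" "\<eta> \<in> carrier Fr" for \<xi> \<eta>
    using \<phi> that by (auto simp: hom_def simp del: carrier_free_Abelian_group_iff)
  have diff: "\<phi> (\<xi> - \<eta>) = \<phi> \<xi> \<ominus>\<^bsub>H\<^esub> \<phi> \<eta>" if "\<xi> \<in> carrier Fr" "\<eta> \<in> carrier Fr" for \<xi> \<eta>
    using add[OF carrier_Fr_diff[OF that] that(2)] cl[OF that(1)] cl[OF that(2)] cl[OF carrier_Fr_diff[OF that]]
    by (simp add: H.add.inv_solve_right a_minus_def)
  \<comment> \<open>The additivity relations reduce to this pattern after expansion and
    sorting.\<close>
  have cancel: "x \<oplus>\<^bsub>H\<^esub> (y \<oplus>\<^bsub>H\<^esub> (\<ominus>\<^bsub>H\<^esub> x \<oplus>\<^bsub>H\<^esub> \<ominus>\<^bsub>H\<^esub> y)) = \<zero>\<^bsub>H\<^esub>"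
    if "x \<in> carrier H" "y \<in> carrier H" for x y
    using H.r_neg[of "x \<oplus>\<^bsub>H\<^esub> y"] that by (simp add: H.minus_add H.a_assoc)
  have rel: "\<phi> x = \<zero>\<^bsub>H\<^esub>" if "x \<in> tensor_relations R M N" for x
    using that unfolding tensor_relations_def
    by (auto simp: diff \<phi>b assms carrier_Fr_diff frag_of_closed a_minus_def H.minus_add H.a_ac H.r_neg cancel
        simp del: carrier_free_Abelian_group_iff)
  have Ks: "\<phi> x = \<zero>\<^bsub>H\<^esub>" if "x \<in> Ks" for x
    using additive_Ks[of \<phi> "add_monoid H" "{\<zero>\<^bsub>H\<^esub>}" x] that rel cl add G group.triv_subgroup[OF G] by auto
  \<comment> \<open>A coset is evaluated at an arbitrary representative; two representatives differ
    by an element of \<open>Ks\<close>, on which \<open>\<phi>\<close> vanishes.\<close>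
  define h where "h C = \<phi> (SOME \<xi>. \<xi> \<in> carrier Fr \<and> coset_of \<xi> = C)" for C
  have h: "h (coset_of \<xi>) = \<phi> \<xi>" if "\<xi> \<in> carrier Fr" for \<xi>
  proof -
    define \<eta> where "\<eta> = (SOME \<eta>. \<eta> \<in> carrier Fr \<and> coset_of \<eta> = coset_of \<xi>)"
    have \<eta>: "\<eta> \<in> carrier Fr" "coset_of \<eta> = coset_of \<xi>"
      using someI[of "\<lambda>\<eta>. \<eta> \<in> carrier Fr \<and> coset_of \<eta> = coset_of \<xi>" \<xi>] that by (auto simp: \<eta>_def)
    then have "\<phi> \<eta> \<ominus>\<^bsub>H\<^esub> \<phi> \<xi> = \<zero>\<^bsub>H\<^esub>"
      using Ks diff that coset_of_eq_iff by (metis)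
    then show ?thesis
      using \<eta> that H.minus_equality[of "\<phi> \<eta>" "\<ominus>\<^bsub>H\<^esub> \<phi> \<xi>"] cl[of \<eta>] cl[of \<xi>]
      by (simp add: h_def \<eta>_def[symmetric] a_minus_def del: carrier_free_Abelian_group_iff)
  qed
  show thesis
  proof (rule that)
    show "additive_on T H h"
      by (rule additive_onI) (auto simp: carrier_T h add_T cl add carrier_Fr_add simp del: carrier_free_Abelian_group_iff)
    show "h (coset_of (frag_of (m, n))) = b m n" if "m \<in> carrier M" "n \<in> carrier N" for m n
      using that h[OF frag_of_closed[OF that]] \<phi>b[of "(m, n)"] by simp
  qed
qed

lemma coset_pure_add_left:
  assumes "m \<in> carrier M" "m' \<in> carrier M" "n \<in> carrier N"
  shows "coset_of (frag_of (m \<oplus>\<^bsub>M\<^esub> m', n)) = coset_of (frag_of (m, n)) \<oplus>\<^bsub>T\<^esub> coset_of (frag_of (m', n))"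
proof -
  have "frag_of (m \<oplus>\<^bsub>M\<^esub> m', n) - frag_of (m, n) - frag_of (m', n) \<in> Ks"
    by (rule relation_Ks) (use assms in \<open>unfold tensor_relations_def; blast\<close>)
  then show ?thesis
    using assms by (subst add_T) (simp_all add: coset_of_eq_iff carrier_Fr_add diff_diff_eq
        del: carrier_free_Abelian_group_iff add: frag_of_closed)
qed

lemma coset_pure_add_right:
  assumes "m \<in> carrier M" "n \<in> carrier N" "n' \<in> carrier N"
  shows "coset_of (frag_of (m, n \<oplus>\<^bsub>N\<^esub> n')) = coset_of (frag_of (m, n)) \<oplus>\<^bsub>T\<^esub> coset_of (frag_of (m, n'))"
proof -
  have "frag_of (m, n \<oplus>\<^bsub>N\<^esub> n') - frag_of (m, n) - frag_of (m, n') \<in> Ks"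
    by (rule relation_Ks) (use assms in \<open>unfold tensor_relations_def; blast\<close>)
  then show ?thesis
    using assms by (subst add_T) (simp_all add: coset_of_eq_iff carrier_Fr_add diff_diff_eq
        del: carrier_free_Abelian_group_iff add: frag_of_closed)
qed

lemma coset_pure_balanced:
  assumes "r \<in> carrier R" "m \<in> carrier M" "n \<in> carrier N"
  shows "coset_of (frag_of (r \<odot>\<^bsub>M\<^esub> m, n)) = coset_of (frag_of (m, r \<odot>\<^bsub>N\<^esub> n))"
proof -
  have "frag_of (r \<odot>\<^bsub>M\<^esub> m, n) - frag_of (m, r \<odot>\<^bsub>N\<^esub> n) \<in> Ks"
    by (rule relation_Ks) (use assms in \<open>unfold tensor_relations_def; blast\<close>)
  then show ?thesis
    using assms by (simp add: coset_of_eq_iff del: carrier_free_Abelian_group_iff add: frag_of_closed)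
qed

text \<open>Elements of the free group have integer coefficients, but a sign can be moved into the
  first factor. Sums of pure tensors without coefficients are therefore closed under negation and
  exhaust the quotient.\<close>

lemma pure_sum:
  assumes "x \<in> carrier T"
  shows "\<exists>(r::nat) s t. (\<forall>k<r. s k \<in> carrier M \<and> t k \<in> carrier N) \<and>
    x = (\<Oplus>\<^bsub>T\<^esub>k\<in>{..<r}. coset_of (frag_of (s k, t k)))"
proof -
  interpret T: abelian_group T by (rule abelian_group_T)
  define P where "P x \<longleftrightarrow> (\<exists>(r::nat) s t. (\<forall>k<r. s k \<in> carrier M \<and> t k \<in> carrier N) \<and>
    x = (\<Oplus>\<^bsub>T\<^esub>k\<in>{..<r}. coset_of (frag_of (s k, t k))))" for x
  have cl: "coset_of (frag_of (m, n)) \<in> carrier T" if "m \<in> carrier M" "n \<in> carrier N" for m n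
    using that by (intro coset_of_closed frag_of_closed)
  have neg: "coset_of (frag_of (\<ominus>\<^bsub>M\<^esub> m, n)) = \<ominus>\<^bsub>T\<^esub> coset_of (frag_of (m, n))" if "m \<in> carrier M" "n \<in> carrier N" for m n
    by (rule additive_on_minus[OF M.abelian_group_axioms abelian_group_T, of "\<lambda>m. coset_of (frag_of (m, n))" m])
      (use that in \<open>auto intro!: additive_onI simp: coset_pure_add_left cl\<close>)
  have P0: "P \<zero>\<^bsub>T\<^esub>"
    unfolding P_def by (rule exI[of _ 0]) simp
  have Pcl: "x \<in> carrier T" if "P x" for x
    using that unfolding P_def by (auto intro!: T.finsum_closed cl)
  have Padd: "P (x \<oplus>\<^bsub>T\<^esub> y)" if xy: "P x" "P y" for x y
  proof -
    obtain r s t where 1: "\<And>k. k < r \<Longrightarrow> s k \<in> carrier M \<and> t k \<in> carrier N"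
      "x = (\<Oplus>\<^bsub>T\<^esub>k\<in>{..<r::nat}. coset_of (frag_of (s k, t k)))" using xy unfolding P_def by blast
    obtain r' s' t' where 2: "\<And>k. k < r' \<Longrightarrow> s' k \<in> carrier M \<and> t' k \<in> carrier N"
      "y = (\<Oplus>\<^bsub>T\<^esub>k\<in>{..<r'::nat}. coset_of (frag_of (s' k, t' k)))" using xy unfolding P_def by blast
    have "x \<oplus>\<^bsub>T\<^esub> y = (\<Oplus>\<^bsub>T\<^esub>k\<in>{..<r+r'}. if k < r then coset_of (frag_of (s k, t k)) else coset_of (frag_of (s' (k - r), t' (k - r))))"
      unfolding 1(2) 2(2) by (rule T.finsum_lessThan_append[symmetric]) (use 1 2 cl in auto)
    also have "\<dots> = (\<Oplus>\<^bsub>T\<^esub>k\<in>{..<r+r'}. coset_of (frag_of (if k < r then s k else s' (k - r), if k < r then t k else t' (k - r))))"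
      by (rule T.finsum_cong') (use 1 2 cl in auto)
    finally show ?thesis
      unfolding P_def using 1 2
      by (intro exI[of _ "r + r'"] exI[of _ "\<lambda>k. if k < r then s k else s' (k - r)"] exI[of _ "\<lambda>k. if k < r then t k else t' (k - r)"]) auto
  qed
  have Pneg: "P (\<ominus>\<^bsub>T\<^esub> x)" if x: "P x" for x
  proof -
    obtain r s t where 1: "\<And>k. k < r \<Longrightarrow> s k \<in> carrier M \<and> t k \<in> carrier N"
      "x = (\<Oplus>\<^bsub>T\<^esub>k\<in>{..<r::nat}. coset_of (frag_of (s k, t k)))" using x unfolding P_def by blast
    have "\<ominus>\<^bsub>T\<^esub> x = (\<Oplus>\<^bsub>T\<^esub>k\<in>{..<r}. \<ominus>\<^bsub>T\<^esub> coset_of (frag_of (s k, t k)))"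
      unfolding 1(2) by (rule additive_on_finsum[OF abelian_group_T abelian_group_T])
        (use 1 cl T.minus_add T.a_comm in \<open>auto intro!: additive_onI\<close>)
    also have "\<dots> = (\<Oplus>\<^bsub>T\<^esub>k\<in>{..<r}. coset_of (frag_of (\<ominus>\<^bsub>M\<^esub> s k, t k)))"
      by (rule T.finsum_cong') (use 1 neg cl in auto)
    finally show ?thesis
      unfolding P_def using 1 by (intro exI[of _ r] exI[of _ "\<lambda>k. \<ominus>\<^bsub>M\<^esub> s k"] exI[of _ t]) auto
  qed
  have "P (coset_of \<xi>)" if "\<xi> \<in> carrier Fr" for \<xi>
  \<comment> \<open>The induction step is a difference of two elements, so closure under negation is
    needed besides addition; membership in the carrier is carried along because \<open>add_T\<close>
    requires it.\<close>
  proof (rule free_Abelian_group_induct[where P = "\<lambda>\<xi>. \<xi> \<in> carrier Fr \<and> P (coset_of \<xi>)", THEN conjunct2])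
    show "Poly_Mapping.keys \<xi> \<subseteq> carrier M \<times> carrier N" using that by simp
    show "0 \<in> carrier Fr \<and> P (coset_of 0)" using P0 zero_T by simp
    fix x y :: "('m \<times> 'n) \<Rightarrow>\<^sub>0 int"
    assume k: "Poly_Mapping.keys x \<subseteq> carrier M \<times> carrier N" "Poly_Mapping.keys y \<subseteq> carrier M \<times> carrier N"
      and xy: "x \<in> carrier Fr \<and> P (coset_of x)" "y \<in> carrier Fr \<and> P (coset_of y)"
    have d: "x - y \<in> carrier Fr" using xy carrier_Fr_diff by blast
    have "coset_of (x - y) \<oplus>\<^bsub>T\<^esub> coset_of y = coset_of x" using xy d by (simp add: add_T)
    then have "coset_of (x - y) = coset_of x \<oplus>\<^bsub>T\<^esub> \<ominus>\<^bsub>T\<^esub> coset_of y"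
      using xy d coset_of_closed T.add.inv_solve_right by (metis)
    then show "x - y \<in> carrier Fr \<and> P (coset_of (x - y))" using d Padd Pneg xy by auto
  next
    fix a assume "a \<in> carrier M \<times> carrier N"
    then obtain m n where a: "a = (m, n)" "m \<in> carrier M" "n \<in> carrier N" by auto
    then have "P (coset_of (frag_of a))"
      unfolding P_def by (intro exI[of _ 1] exI[of _ "\<lambda>_. m"] exI[of _ "\<lambda>_. n"])
        (use cl in \<open>auto simp: lessThan_Suc\<close>)
    then show "frag_of a \<in> carrier Fr \<and> P (coset_of (frag_of a))" using a by simp
  qed
  then show ?thesis
    using assms unfolding P_def carrier_T by blast
qed

text \<open>By \<open>pure_sum\<close> the pure tensors generate the tensor product already as an
  abelian group, so additive maps are determined by their values there.\<close>

lemma additive_eqI: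
  assumes "abelian_group H" "additive_on T H f" "additive_on T H g" "x \<in> carrier T"
    and "\<And>m n. m \<in> carrier M \<Longrightarrow> n \<in> carrier N \<Longrightarrow> f (coset_of (frag_of (m, n))) = g (coset_of (frag_of (m, n)))"
  shows "f x = g x"
proof -
  interpret H: abelian_group H by fact
  obtain r s t where st: "\<And>k. k < (r::nat) \<Longrightarrow> s k \<in> carrier M \<and> t k \<in> carrier N"
    and x: "x = (\<Oplus>\<^bsub>T\<^esub>k\<in>{..<r}. coset_of (frag_of (s k, t k)))"
    using pure_sum[OF assms(4)] by blast
  have cl: "coset_of (frag_of (s k, t k)) \<in> carrier T" if "k < r" for k
    using st[OF that] by (intro coset_of_closed frag_of_closed) auto
  have "f x = (\<Oplus>\<^bsub>H\<^esub>k\<in>{..<r}. f (coset_of (frag_of (s k, t k))))"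
    unfolding x by (rule additive_on_finsum[OF abelian_group_T assms(1,2)]) (rule cl)
  also have "\<dots> = (\<Oplus>\<^bsub>H\<^esub>k\<in>{..<r}. g (coset_of (frag_of (s k, t k))))"
    by (rule H.finsum_cong') (use st assms(3,5) cl in \<open>auto simp: additive_on_closed\<close>)
  also have "\<dots> = g x"
    unfolding x by (rule additive_on_finsum[OF abelian_group_T assms(1,3), symmetric]) (rule cl)
  finally show ?thesis .
qed

text \<open>The same union over a coset occurs in the scalar multiplication of
  \<open>tensor_module\<close> and in the restriction of \<open>tensor_presheaf\<close>; treating it
  once covers both. The union is a choice-free way to write a value that does not depend on the
  representative.\<close>

definition induced :: "('r, 'l) ring_scheme \<Rightarrow> ('r, 'm2) module \<Rightarrow> ('r, 'n2) module \<Rightarrow>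
    ('m \<Rightarrow> 'm2) \<Rightarrow> ('n \<Rightarrow> 'n2) \<Rightarrow> (('m \<times> 'n) \<Rightarrow>\<^sub>0 int) set \<Rightarrow> (('m2 \<times> 'n2) \<Rightarrow>\<^sub>0 int) set" where
  "induced R' M' N' u v C =
    (\<Union>\<xi>\<in>C. tensor_coset R' M' N' (frag_extend (\<lambda>(m, n). frag_of (u m, v n)) \<xi>))"

text \<open>\<open>u\<close> and \<open>v\<close> are semilinear over a common
  \<open>\<sigma>\<close>, which is the identity for multiplication by a scalar and
  \<open>fres V\<close> for restriction. Each relation goes to a relation of the same kind, so all
  members of a coset have the same image coset.\<close>

lemma
  fixes R' :: "('r, 'l) ring_scheme" and M' :: "('r, 'm2) module" and N' :: "('r, 'n2) module"
  assumes "module_pair R' M' N'" and u: "additive_on M M' u" and v: "additive_on N N' v"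
    and \<sigma>: "\<And>r. r \<in> carrier R \<Longrightarrow> \<sigma> r \<in> carrier R'"
    and us: "\<And>r m. r \<in> carrier R \<Longrightarrow> m \<in> carrier M \<Longrightarrow> u (r \<odot>\<^bsub>M\<^esub> m) = \<sigma> r \<odot>\<^bsub>M'\<^esub> u m"
    and vs: "\<And>r n. r \<in> carrier R \<Longrightarrow> n \<in> carrier N \<Longrightarrow> v (r \<odot>\<^bsub>N\<^esub> n) = \<sigma> r \<odot>\<^bsub>N'\<^esub> v n"
  shows induced_additive: "additive_on T (tensor_module R' M' N') (induced R' M' N' u v)"
    and induced_pure: "m \<in> carrier M \<Longrightarrow> n \<in> carrier N \<Longrightarrow>
      induced R' M' N' u v (coset_of (frag_of (m, n))) = tensor_coset R' M' N' (frag_of (u m, v n))"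
proof -
  interpret P: module_pair R' M' N' by fact
  define F where "F = frag_extend (\<lambda>(m, n). frag_of (u m, v n))"
  have F: "F \<xi> \<in> carrier P.Fr" if "\<xi> \<in> carrier Fr" for \<xi>
    using keys_frag_extend[of "\<lambda>(m, n). frag_of (u m, v n)" \<xi>] that
    by (fastforce simp: F_def additive_on_closed[OF u] additive_on_closed[OF v])
  have Fadd: "F (\<xi> + \<eta>) = F \<xi> + F \<eta>" for \<xi> \<eta> by (simp add: F_def frag_extend_add)
  have rel: "F x \<in> tensor_relations R' M' N'" if x: "x \<in> tensor_relations R M N" for x
  proof -
    consider (left) m m' n where "x = frag_of (m \<oplus>\<^bsub>M\<^esub> m', n) - frag_of (m, n) - frag_of (m', n)"
        "m \<in> carrier M" "m' \<in> carrier M" "n \<in> carrier N"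
      | (right) m n n' where "x = frag_of (m, n \<oplus>\<^bsub>N\<^esub> n') - frag_of (m, n) - frag_of (m, n')"
        "m \<in> carrier M" "n \<in> carrier N" "n' \<in> carrier N"
      | (scale) r m n where "x = frag_of (r \<odot>\<^bsub>M\<^esub> m, n) - frag_of (m, r \<odot>\<^bsub>N\<^esub> n)"
        "r \<in> carrier R" "m \<in> carrier M" "n \<in> carrier N"
      using x unfolding tensor_relations_def by blast
    then show ?thesis
    proof cases
      case left
      then have "F x = frag_of (u m \<oplus>\<^bsub>M'\<^esub> u m', v n) - frag_of (u m, v n) - frag_of (u m', v n)"
        "u m \<in> carrier M'" "u m' \<in> carrier M'" "v n \<in> carrier N'"
        using u v by (simp_all add: F_def frag_extend_diff additive_on_add additive_on_closed)
      then show ?thesis unfolding tensor_relations_def by blast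
    next
      case right
      then have "F x = frag_of (u m, v n \<oplus>\<^bsub>N'\<^esub> v n') - frag_of (u m, v n) - frag_of (u m, v n')"
        "u m \<in> carrier M'" "v n \<in> carrier N'" "v n' \<in> carrier N'"
        using u v by (simp_all add: F_def frag_extend_diff additive_on_add additive_on_closed)
      then show ?thesis unfolding tensor_relations_def by blast
    next
      case scale
      then have "F x = frag_of (\<sigma> r \<odot>\<^bsub>M'\<^esub> u m, v n) - frag_of (u m, \<sigma> r \<odot>\<^bsub>N'\<^esub> v n)"
        "\<sigma> r \<in> carrier R'" "u m \<in> carrier M'" "v n \<in> carrier N'"
        using u v \<sigma> us vs by (simp_all add: F_def frag_extend_diff additive_on_closed)
      then show ?thesis unfolding tensor_relations_def by blast
    qed
  qed
  have Ks: "F x \<in> P.Ks" if "x \<in> Ks" for x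
    by (rule additive_Ks[of F P.Fr]) (use F Fadd rel P.relation_Ks P.subgroup_Ks that in auto)
  have ind: "induced R' M' N' u v (coset_of \<xi>) = P.coset_of (F \<xi>)" if \<xi>: "\<xi> \<in> carrier Fr" for \<xi>
  proof -
    have "P.coset_of (F \<eta>) = P.coset_of (F \<xi>)" if \<eta>: "\<eta> \<in> coset_of \<xi>" for \<eta>
    proof -
      obtain k where k: "k \<in> Ks" "\<eta> = k + \<xi>"
        using \<eta> by (auto simp: tensor_coset_def r_coset_def)
      then have "\<eta> \<in> carrier Fr"
        using carrier_Fr_add \<xi> subgroup.mem_carrier[OF subgroup_Ks] by blast
      moreover have "F \<eta> - F \<xi> = F k" using k by (simp add: Fadd)
      ultimately show ?thesis
        using P.coset_of_eq_iff[OF F F[OF \<xi>]] Ks[OF k(1)] by simp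
    qed
    moreover have "\<xi> \<in> coset_of \<xi>"
      unfolding tensor_coset_def by (rule Fr.rcos_self[OF \<xi> subgroup_Ks])
    ultimately show ?thesis unfolding induced_def F_def[symmetric] by blast
  qed
  show "additive_on T (tensor_module R' M' N') (induced R' M' N' u v)"
    by (rule additive_onI) (auto simp: carrier_T ind F P.coset_of_closed add_T P.add_T Fadd carrier_Fr_add
        simp del: carrier_free_Abelian_group_iff)
  show "induced R' M' N' u v (coset_of (frag_of (m, n))) = P.coset_of (frag_of (u m, v n))"
    if "m \<in> carrier M" "n \<in> carrier N"
    using ind[OF frag_of_closed[OF that]] by (simp add: F_def)
qed

lemma smult_T: "r \<odot>\<^bsub>T\<^esub> C = induced R M N (\<lambda>m. r \<odot>\<^bsub>M\<^esub> m) (\<lambda>n. n) C"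
  by (simp add: tensor_module_def Let_def induced_def)

lemma additive_smult_T:
  assumes "r \<in> carrier R"
  shows "additive_on T T (\<lambda>C. r \<odot>\<^bsub>T\<^esub> C)"
  unfolding smult_T
  by (rule induced_additive[where \<sigma> = "\<lambda>r. r"])
    (use assms in \<open>auto intro!: additive_onI module_pair_axioms simp: M.smult_r_distr M.smult_assoc1[symmetric] M.R.m_comm\<close>)

lemma smult_T_pure:
  assumes "r \<in> carrier R" "m \<in> carrier M" "n \<in> carrier N"
  shows "r \<odot>\<^bsub>T\<^esub> coset_of (frag_of (m, n)) = coset_of (frag_of (r \<odot>\<^bsub>M\<^esub> m, n))"
  unfolding smult_T
  by (rule induced_pure[where \<sigma> = "\<lambda>r. r"])
    (use assms in \<open>auto intro!: additive_onI module_pair_axioms simp: M.smult_r_distr M.smult_assoc1[symmetric] M.R.m_comm\<close>)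

lemma pure_closed: "m \<in> carrier M \<Longrightarrow> n \<in> carrier N \<Longrightarrow> coset_of (frag_of (m, n)) \<in> carrier T"
  by (intro coset_of_closed frag_of_closed)

text \<open>Distributivity over sums of scalars, associativity and the unit law are equalities of
  additive maps in the tensor, so they are checked on pure tensors, where a scalar acts on the first
  factor.\<close>

lemma module_T: "module R T"
proof (rule moduleI)
  interpret T: abelian_group T by (rule abelian_group_T)
  note cl = additive_on_closed[OF additive_smult_T]
  show "cring R" by (rule M.R.is_cring)
  show "abelian_group T" by (rule abelian_group_T)
  show "a \<odot>\<^bsub>T\<^esub> x \<in> carrier T" if "a \<in> carrier R" "x \<in> carrier T" for a x
    using cl that .
  show "(a \<oplus> b) \<odot>\<^bsub>T\<^esub> x = a \<odot>\<^bsub>T\<^esub> x \<oplus>\<^bsub>T\<^esub> b \<odot>\<^bsub>T\<^esub> x"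
    if ab: "a \<in> carrier R" "b \<in> carrier R" and x: "x \<in> carrier T" for a b x
    by (rule additive_eqI[OF abelian_group_T additive_smult_T _ x])
      (use ab in \<open>auto intro!: additive_onI simp: smult_T_pure M.smult_l_distr coset_pure_add_left
        additive_on_add[OF additive_smult_T] T.a_ac cl\<close>)
  show "a \<odot>\<^bsub>T\<^esub> (x \<oplus>\<^bsub>T\<^esub> y) = a \<odot>\<^bsub>T\<^esub> x \<oplus>\<^bsub>T\<^esub> a \<odot>\<^bsub>T\<^esub> y"
    if "a \<in> carrier R" "x \<in> carrier T" "y \<in> carrier T" for a x y
    using additive_on_add[OF additive_smult_T] that .
  show "(a \<otimes> b) \<odot>\<^bsub>T\<^esub> x = a \<odot>\<^bsub>T\<^esub> (b \<odot>\<^bsub>T\<^esub> x)"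
    if ab: "a \<in> carrier R" "b \<in> carrier R" and x: "x \<in> carrier T" for a b x
    by (rule additive_eqI[OF abelian_group_T additive_smult_T _ x])
      (use ab in \<open>auto intro!: additive_onI simp: smult_T_pure M.smult_assoc1
        additive_on_add[OF additive_smult_T] cl\<close>)
  show "\<one> \<odot>\<^bsub>T\<^esub> x = x" if x: "x \<in> carrier T" for x
    by (rule additive_eqI[OF abelian_group_T additive_smult_T _ x])
      (auto intro!: additive_onI simp: smult_T_pure)
qed

end

section \<open>Presheaves and sheaves over the smooth functions\<close>

text \<open>The sheaf theory uses smoothness only through these two facts: the functions on an open
  set form a commutative ring, and restriction stays inside these rings. Manifolds are made an
  instance later.\<close>

locale smooth_functions =
  fixes X :: "'x::topological_space smooth_structure"
  assumes cring_cinf: "open U \<Longrightarrow> cring (cinf X U)"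
    and fres_closed: "open U \<Longrightarrow> open V \<Longrightarrow> V \<subseteq> U \<Longrightarrow> f \<in> carrier (cinf X U) \<Longrightarrow> fres V f \<in> carrier (cinf X V)"

lemma fres_fres: "W \<subseteq> V \<Longrightarrow> fres W (fres V f) = fres W f"
  by (auto simp: fres_def fun_eq_iff)

lemma fres_cinf_id: "f \<in> carrier (cinf X U) \<Longrightarrow> fres U f = f"
  by (auto simp: fres_def cinf_def)

lemma fres_add: "fres V (f \<oplus>\<^bsub>cinf X U\<^esub> g) = fres V f \<oplus>\<^bsub>cinf X V\<^esub> fres V g"
  and fres_mult: "fres V (f \<otimes>\<^bsub>cinf X U\<^esub> g) = fres V f \<otimes>\<^bsub>cinf X V\<^esub> fres V g"
  and fres_one: "V \<subseteq> U \<Longrightarrow> fres V \<one>\<^bsub>cinf X U\<^esub> = \<one>\<^bsub>cinf X V\<^esub>"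
  by (auto simp: fres_def cinf_def fun_eq_iff)

lemma (in smooth_functions) fres_additive:
  "open U \<Longrightarrow> open V \<Longrightarrow> V \<subseteq> U \<Longrightarrow> additive_on (cinf X U) (cinf X V) (fres V)"
  by (intro additive_onI fres_closed fres_add)

lemma
  assumes "presheaf_mod X F" "open U"
  shows presheaf_module: "module (cinf X U) (sec F U)"
    and presheaf_abelian_group: "abelian_group (sec F U)"
proof -
  show "module (cinf X U) (sec F U)" using assms by (simp add: presheaf_mod_def)
  then show "abelian_group (sec F U)" by (rule module.axioms)
qed

lemma
  assumes "presheaf_mod X F" "open U" "open V" "V \<subseteq> U" "s \<in> carrier (sec F U)"
  shows res_closed: "res F U V s \<in> carrier (sec F V)"
    and res_add: "t \<in> carrier (sec F U) \<Longrightarrow> res F U V (s \<oplus>\<^bsub>sec F U\<^esub> t) = res F U V s \<oplus>\<^bsub>sec F V\<^esub> res F U V t"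
    and res_smult: "f \<in> carrier (cinf X U) \<Longrightarrow> res F U V (f \<odot>\<^bsub>sec F U\<^esub> s) = fres V f \<odot>\<^bsub>sec F V\<^esub> res F U V s"
    and res_res: "open W \<Longrightarrow> W \<subseteq> V \<Longrightarrow> res F V W (res F U V s) = res F U W s"
  using assms by (simp_all add: presheaf_mod_def)

lemma res_id: "presheaf_mod X F \<Longrightarrow> open U \<Longrightarrow> s \<in> carrier (sec F U) \<Longrightarrow> res F U U s = s"
  by (simp add: presheaf_mod_def)

lemma res_additive:
  "presheaf_mod X F \<Longrightarrow> open U \<Longrightarrow> open V \<Longrightarrow> V \<subseteq> U \<Longrightarrow> additive_on (sec F U) (sec F V) (res F U V)"
  by (intro additive_onI res_closed res_add)

lemma sheaf_presheaf: "sheaf_mod X F \<Longrightarrow> presheaf_mod X F"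
  by (simp add: sheaf_mod_def)

text \<open>Uniqueness of gluing for the cover by all open sets on which the two sections agree:
  both glue the restrictions of \<open>s\<close>.\<close>

lemma sheaf_eqI:
  assumes "sheaf_mod X F" "open U" "s \<in> carrier (sec F U)" "t \<in> carrier (sec F U)"
    and "\<And>x. x \<in> U \<Longrightarrow> \<exists>V. open V \<and> x \<in> V \<and> V \<subseteq> U \<and> res F U V s = res F U V t"
  shows "s = t"
proof -
  define C where "C = {V. open V \<and> V \<subseteq> U \<and> res F U V s = res F U V t}"
  have U: "\<Union>C = U" using assms(5) unfolding C_def by blast
  note p = sheaf_presheaf[OF assms(1)]
  have "\<exists>!t'. t' \<in> carrier (sec F (\<Union>C)) \<and> (\<forall>V\<in>C. res F (\<Union>C) V t' = res F U V s)"
    using assms(1) unfolding sheaf_mod_def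
    by (elim conjE allE[of _ C] allE[of _ "\<lambda>V. res F U V s"] mp)
      (use assms(2,3,4) p in \<open>auto simp: C_def res_closed res_res open_Int le_infI1\<close>)
  then show ?thesis unfolding U using assms(3,4) by (auto simp: C_def)
qed

lemma sheaf_glue:
  assumes "sheaf_mod X F" "\<And>V. V \<in> \<C> \<Longrightarrow> open V" "\<And>V. V \<in> \<C> \<Longrightarrow> s V \<in> carrier (sec F V)"
    and "\<And>V W. V \<in> \<C> \<Longrightarrow> W \<in> \<C> \<Longrightarrow> res F V (V \<inter> W) (s V) = res F W (V \<inter> W) (s W)"
  obtains t where "t \<in> carrier (sec F (\<Union>\<C>))" "\<And>V. V \<in> \<C> \<Longrightarrow> res F (\<Union>\<C>) V t = s V"
proof -
  have "\<exists>!t. t \<in> carrier (sec F (\<Union>\<C>)) \<and> (\<forall>V\<in>\<C>. res F (\<Union>\<C>) V t = s V)"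
    using assms(1) unfolding sheaf_mod_def
    by (elim conjE allE[of _ \<C>] allE[of _ s] mp) (use assms(2-4) in auto)
  then show thesis using that by blast
qed

lemma sheaf_homI:
  assumes "\<And>U. open U \<Longrightarrow> additive_on (sec F U) (sec G U) (h U)"
    and "\<And>U f s. open U \<Longrightarrow> f \<in> carrier (cinf X U) \<Longrightarrow> s \<in> carrier (sec F U) \<Longrightarrow>
      h U (f \<odot>\<^bsub>sec F U\<^esub> s) = f \<odot>\<^bsub>sec G U\<^esub> h U s"
    and "\<And>U V s. open U \<Longrightarrow> open V \<Longrightarrow> V \<subseteq> U \<Longrightarrow> s \<in> carrier (sec F U) \<Longrightarrow>
      h V (res F U V s) = res G U V (h U s)"
  shows "sheaf_hom X F G h"
  using assms by (simp add: sheaf_hom_def additive_on_def)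

lemma
  assumes "sheaf_hom X F G h" "open U"
  shows sheaf_hom_additive: "additive_on (sec F U) (sec G U) (h U)"
    and sheaf_hom_closed: "s \<in> carrier (sec F U) \<Longrightarrow> h U s \<in> carrier (sec G U)"
    and sheaf_hom_add: "s \<in> carrier (sec F U) \<Longrightarrow> t \<in> carrier (sec F U) \<Longrightarrow>
      h U (s \<oplus>\<^bsub>sec F U\<^esub> t) = h U s \<oplus>\<^bsub>sec G U\<^esub> h U t"
    and sheaf_hom_smult: "f \<in> carrier (cinf X U) \<Longrightarrow> s \<in> carrier (sec F U) \<Longrightarrow>
      h U (f \<odot>\<^bsub>sec F U\<^esub> s) = f \<odot>\<^bsub>sec G U\<^esub> h U s"
    and sheaf_hom_res: "open V \<Longrightarrow> V \<subseteq> U \<Longrightarrow> s \<in> carrier (sec F U) \<Longrightarrow>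
      h V (res F U V s) = res G U V (h U s)"
  using assms by (auto simp: sheaf_hom_def additive_on_def)

subsection \<open>Sheafification\<close>

text \<open>A germ is the set of all local sections that agree with a given one near the point, and
  agreement near a point is transitive because the two neighbourhoods can be intersected.\<close>

lemma germ_eq_iff:
  assumes P: "presheaf_mod X P" and VW: "open V" "open W" "x \<in> V" "x \<in> W"
    and tu: "t \<in> carrier (sec P V)" "u \<in> carrier (sec P W)"
  shows "germ P x V t = germ P x W u \<longleftrightarrow> (\<exists>Z. open Z \<and> x \<in> Z \<and> Z \<subseteq> V \<inter> W \<and> res P V Z t = res P W Z u)"
proof
  assume "germ P x V t = germ P x W u"
  moreover have "(W, u) \<in> germ P x W u"
    using VW tu by (auto simp: germ_def)
  ultimately have "(W, u) \<in> germ P x V t" by simp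
  then show "\<exists>Z. open Z \<and> x \<in> Z \<and> Z \<subseteq> V \<inter> W \<and> res P V Z t = res P W Z u"
    by (auto simp: germ_def)
next
  have *: "germ P x V t \<subseteq> germ P x W u"
    if Z: "open Z" "x \<in> Z" "Z \<subseteq> V \<inter> W" "res P V Z t = res P W Z u"
      and VW: "open V" "open W" "x \<in> V" "x \<in> W" and tu: "t \<in> carrier (sec P V)" "u \<in> carrier (sec P W)"
    for V W Z t u
  proof clarify
    fix W' u' assume "(W', u') \<in> germ P x V t"
    then obtain Z' where Z': "open W'" "x \<in> W'" "u' \<in> carrier (sec P W')" "open Z'" "x \<in> Z'" "Z' \<subseteq> V \<inter> W'"
      "res P V Z' t = res P W' Z' u'" by (auto simp: germ_def)
    have "res P W (Z \<inter> Z') u = res P Z (Z \<inter> Z') (res P W Z u)"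
      using Z Z' VW tu by (subst res_res[OF P]) auto
    also have "\<dots> = res P V (Z \<inter> Z') t"
      unfolding Z(4)[symmetric] using Z Z' VW tu by (subst res_res[OF P]) auto
    also have "\<dots> = res P Z' (Z \<inter> Z') (res P V Z' t)"
      using Z Z' VW tu by (subst res_res[OF P]) auto
    also have "\<dots> = res P W' (Z \<inter> Z') u'"
      unfolding Z'(7) using Z Z' VW tu by (subst res_res[OF P]) auto
    finally show "(W', u') \<in> germ P x W u"
      using Z Z' unfolding germ_def by (auto intro!: exI[of _ "Z \<inter> Z'"])
  qed
  assume "\<exists>Z. open Z \<and> x \<in> Z \<and> Z \<subseteq> V \<inter> W \<and> res P V Z t = res P W Z u"
  then obtain Z where Z: "open Z" "x \<in> Z" "Z \<subseteq> V \<inter> W" "res P V Z t = res P W Z u" by blast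
  show "germ P x V t = germ P x W u"
    using *[OF Z VW tu] *[of Z W V u t] Z VW tu by (simp add: Int_commute)
qed

lemma germ_res:
  assumes P: "presheaf_mod X P" and "open V" "open W" "x \<in> W" "W \<subseteq> V" "t \<in> carrier (sec P V)"
  shows "germ P x W (res P V W t) = germ P x V t"
  using assms by (subst germ_eq_iff[OF P]) (auto simp: res_closed res_id intro!: exI[of _ W])

lemma mem_germ: "open V \<Longrightarrow> x \<in> V \<Longrightarrow> t \<in> carrier (sec P V) \<Longrightarrow> (V, t) \<in> germ P x V t"
  by (auto simp: germ_def)

text \<open>The link between germ-valued functions and the presheaf. Identities in the
  sheafification are proved on open sets over which every section involved has such a
  \<open>t\<close>.\<close>

definition represents ::
    "('x::topological_space, 'p) osheaf \<Rightarrow> ('x \<Rightarrow> ('x set \<times> 'p) set) \<Rightarrow> 'x set \<Rightarrow> 'p \<Rightarrow> bool" where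
  "represents P s V t \<longleftrightarrow> open V \<and> t \<in> carrier (sec P V) \<and> (\<forall>y\<in>V. s y = germ P y V t)"

lemma sheafify_carrier_iff:
  "s \<in> carrier (sec (sheafify P) U) \<longleftrightarrow>
    (\<forall>x\<in>U. \<exists>V t. x \<in> V \<and> V \<subseteq> U \<and> represents P s V t) \<and> (\<forall>x. x \<notin> U \<longrightarrow> s x = {})"
  by (simp add: sheafify_def represents_def conj_ac)

lemma sheafify_res: "res (sheafify P) U V s = (\<lambda>x. if x \<in> V then s x else {})"
  by (simp add: sheafify_def)

lemma represents_res:
  assumes "presheaf_mod X P" "represents P s V t" "open W" "W \<subseteq> V"
  shows "represents P s W (res P V W t)"
  using assms by (auto simp: represents_def res_closed germ_res subset_iff)

lemma represents_sheafify_res: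
  "represents P s W t \<Longrightarrow> W \<subseteq> V \<Longrightarrow> represents P (res (sheafify P) U V s) W t"
  by (auto simp: represents_def sheafify_res subset_iff)

lemma represents_to_sheafify:
  assumes "presheaf_mod X P" "open U" "t \<in> carrier (sec P U)"
  shows "represents P (to_sheafify P U t) U t"
  using assms by (auto simp: represents_def to_sheafify_def)

text \<open>The operations of \<open>sheafify\<close> are unions over all representatives of germs;
  such a union collapses once its members coincide and the index set is nonempty.\<close>

lemma UN_pair_const:
  assumes "\<And>a b. (a, b) \<in> A \<Longrightarrow> f a b = c" "(a, b) \<in> A"
  shows "(\<Union>(a, b)\<in>A. f a b) = c"
  using assms by (auto split: prod.splits)

lemma UN_pair2_const:
  assumes "\<And>a b a' b'. (a, b) \<in> A \<Longrightarrow> (a', b') \<in> A' \<Longrightarrow> f a b a' b' = c" "(a, b) \<in> A" "(a', b') \<in> A'"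
  shows "(\<Union>(a, b)\<in>A. \<Union>(a', b')\<in>A'. f a b a' b') = c"
  by (rule UN_pair_const[OF UN_pair_const[OF assms(1)] assms(2)]) (use assms(3) in auto)

context smooth_functions
begin

context
  fixes P :: "('x, 'p) osheaf"
  assumes P: "presheaf_mod X P"
begin

text \<open>Arbitrary representatives of the two germs agree with \<open>t\<close> and
  \<open>t'\<close> on neighbourhoods of the point, so their sum agrees with that of
  \<open>t\<close> and \<open>t'\<close> on the intersection. All members of the defining union are
  thus the same germ.\<close>

lemma represents_add:
  assumes s: "represents P s V t" and s': "represents P s' V t'"
  shows "represents P (s \<oplus>\<^bsub>sec (sheafify P) U\<^esub> s') V (t \<oplus>\<^bsub>sec P V\<^esub> t')"
proof -
  have V: "open V" "t \<in> carrier (sec P V)" "t' \<in> carrier (sec P V)"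
    using s s' by (auto simp: represents_def)
  interpret M: abelian_group "sec P V" by (rule presheaf_abelian_group[OF P V(1)])
  have "(\<Union>(V, t)\<in>s x. \<Union>(W, u)\<in>s' x.
           germ P x (V \<inter> W) (res P V (V \<inter> W) t \<oplus>\<^bsub>sec P (V \<inter> W)\<^esub> res P W (V \<inter> W) u)) =
      germ P x V (t \<oplus>\<^bsub>sec P V\<^esub> t')" (is "?L = _") if x: "x \<in> V" for x
  proof -
    have sx: "s x = germ P x V t" "s' x = germ P x V t'"
      using s s' x by (auto simp: represents_def)
    have "germ P x (A \<inter> B) (res P A (A \<inter> B) a \<oplus>\<^bsub>sec P (A \<inter> B)\<^esub> res P B (A \<inter> B) b) = germ P x V (t \<oplus>\<^bsub>sec P V\<^esub> t')"
      if m: "(A, a) \<in> s x" "(B, b) \<in> s' x" for A B a b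
    proof -
      obtain Z Z' where Z: "open A" "x \<in> A" "a \<in> carrier (sec P A)" "open Z" "x \<in> Z" "Z \<subseteq> V \<inter> A" "res P V Z t = res P A Z a"
        and Z': "open B" "x \<in> B" "b \<in> carrier (sec P B)" "open Z'" "x \<in> Z'" "Z' \<subseteq> V \<inter> B" "res P V Z' t' = res P B Z' b"
        using m unfolding sx germ_def by auto
      define Y where "Y = Z \<inter> Z'"
      have Y: "open Y" "x \<in> Y" "Y \<subseteq> Z" "Y \<subseteq> Z'" "Y \<subseteq> A" "Y \<subseteq> B" "Y \<subseteq> V" using Z Z' by (auto simp: Y_def)
      have a: "res P V Y t = res P A Y a"
        using res_res[OF P _ _ _ _ Y(1,3), of V t] res_res[OF P _ _ _ _ Y(1,3), of A a] Z V by simp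
      have b: "res P V Y t' = res P B Y b"
        using res_res[OF P _ _ _ _ Y(1,4), of V t'] res_res[OF P _ _ _ _ Y(1,4), of B b] Z' V by simp
      interpret N: abelian_group "sec P (A \<inter> B)" by (rule presheaf_abelian_group[OF P]) (use Z Z' in auto)
      have AB: "open (A \<inter> B)" using Z Z' by auto
      have "res P (A \<inter> B) Y (res P A (A \<inter> B) a \<oplus>\<^bsub>sec P (A \<inter> B)\<^esub> res P B (A \<inter> B) b) = res P A Y a \<oplus>\<^bsub>sec P Y\<^esub> res P B Y b"
        using Z Z' Y AB by (simp add: res_add[OF P] res_closed[OF P] res_res[OF P])
      moreover have "res P V Y (t \<oplus>\<^bsub>sec P V\<^esub> t') = res P V Y t \<oplus>\<^bsub>sec P Y\<^esub> res P V Y t'"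
        using V Y by (simp add: res_add[OF P])
      ultimately show ?thesis
        using Z Z' V Y a b AB x
        by (subst germ_eq_iff[OF P]) (auto simp: res_closed[OF P] intro!: exI[of _ Y])
    qed
    moreover have "(V, t) \<in> s x" "(V, t') \<in> s' x"
      using sx x V by (auto simp: mem_germ)
    ultimately show ?thesis by (intro UN_pair2_const)
  qed
  then show ?thesis using V by (simp add: represents_def sheafify_def)
qed

lemma represents_smult:
  assumes s: "represents P s V t" and U: "open U" "V \<subseteq> U" and f: "f \<in> carrier (cinf X U)"
  shows "represents P (f \<odot>\<^bsub>sec (sheafify P) U\<^esub> s) V (fres V f \<odot>\<^bsub>sec P V\<^esub> t)"
proof -
  have V: "open V" "t \<in> carrier (sec P V)"
    using s by (auto simp: represents_def)
  interpret M: module "cinf X V" "sec P V" by (rule presheaf_module[OF P V(1)])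
  have fV: "fres V f \<in> carrier (cinf X V)" by (rule fres_closed) (use U V f in auto)
  have "(\<Union>(W, u)\<in>s x. germ P x (U \<inter> W) (fres (U \<inter> W) f \<odot>\<^bsub>sec P (U \<inter> W)\<^esub> res P W (U \<inter> W) u)) =
      germ P x V (fres V f \<odot>\<^bsub>sec P V\<^esub> t)" (is "?L = _") if x: "x \<in> V" for x
  proof -
    have sx: "s x = germ P x V t"
      using s x by (auto simp: represents_def)
    have "germ P x (U \<inter> A) (fres (U \<inter> A) f \<odot>\<^bsub>sec P (U \<inter> A)\<^esub> res P A (U \<inter> A) a) = germ P x V (fres V f \<odot>\<^bsub>sec P V\<^esub> t)"
      if m: "(A, a) \<in> s x" for A a
    proof -
      obtain Z where Z: "open A" "x \<in> A" "a \<in> carrier (sec P A)" "open Z" "x \<in> Z" "Z \<subseteq> V \<inter> A" "res P V Z t = res P A Z a"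
        using m unfolding sx germ_def by auto
      interpret N: module "cinf X (U \<inter> A)" "sec P (U \<inter> A)" by (rule presheaf_module[OF P]) (use Z U in auto)
      have UA: "open (U \<inter> A)" using Z U by auto
      have fA: "fres (U \<inter> A) f \<in> carrier (cinf X (U \<inter> A))" by (rule fres_closed) (use U UA f in auto)
      have "res P (U \<inter> A) Z (fres (U \<inter> A) f \<odot>\<^bsub>sec P (U \<inter> A)\<^esub> res P A (U \<inter> A) a) = fres Z f \<odot>\<^bsub>sec P Z\<^esub> res P A Z a"
        using Z UA fA U by (subst res_smult[OF P]) (auto simp: res_closed[OF P] res_res[OF P] fres_fres subset_iff)
      moreover have "res P V Z (fres V f \<odot>\<^bsub>sec P V\<^esub> t) = fres Z f \<odot>\<^bsub>sec P Z\<^esub> res P V Z t"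
        using V Z fV by (subst res_smult[OF P]) (auto simp: fres_fres)
      ultimately show ?thesis
        using Z V UA x U fA fV
        by (subst germ_eq_iff[OF P]) (auto simp: res_closed[OF P] intro!: exI[of _ Z])
    qed
    moreover have "(V, t) \<in> s x"
      using sx x V by (auto simp: mem_germ)
    ultimately show ?thesis by (intro UN_pair_const)
  qed
  then show ?thesis using V fV by (simp add: represents_def sheafify_def)
qed

text \<open>Sections of a sheafification are functions on points, so equality is pointwise: a common
  representative fixes the germ at a point of \<open>U\<close>, and off \<open>U\<close> both values
  are empty.\<close>

lemma represents_unique:
  assumes "s \<in> carrier (sec (sheafify P) U)" "s' \<in> carrier (sec (sheafify P) U)"
    and "\<And>x. x \<in> U \<Longrightarrow> \<exists>V t. x \<in> V \<and> represents P s V t \<and> represents P s' V t"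
  shows "s = s'"
proof
  fix x show "s x = s' x"
    using assms by (cases "x \<in> U") (fastforce simp: sheafify_carrier_iff represents_def)+
qed

lemma sheafify_zero: "\<zero>\<^bsub>sec (sheafify P) U\<^esub> = to_sheafify P U \<zero>\<^bsub>sec P U\<^esub>"
  by (simp add: sheafify_def)

lemma to_sheafify_closed: "open U \<Longrightarrow> t \<in> carrier (sec P U) \<Longrightarrow> to_sheafify P U t \<in> carrier (sec (sheafify P) U)"
  using represents_to_sheafify[OF P] by (auto simp: sheafify_carrier_iff to_sheafify_def)

lemma represents_two:
  assumes "open U" "s \<in> carrier (sec (sheafify P) U)" "s' \<in> carrier (sec (sheafify P) U)" "x \<in> U"
  obtains V t t' where "x \<in> V" "V \<subseteq> U" "represents P s V t" "represents P s' V t'"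
proof -
  obtain V t where V: "x \<in> V" "V \<subseteq> U" "represents P s V t"
    using assms by (meson sheafify_carrier_iff)
  obtain V' t' where V': "x \<in> V'" "V' \<subseteq> U" "represents P s' V' t'"
    using assms by (meson sheafify_carrier_iff)
  have o: "open (V \<inter> V')" using V V' by (auto simp: represents_def)
  show thesis
    using that[of "V \<inter> V'"] represents_res[OF P V(3) o] represents_res[OF P V'(3) o] V V' by auto
qed

lemma sheafify_add_closed:
  assumes "open U" "s \<in> carrier (sec (sheafify P) U)" "s' \<in> carrier (sec (sheafify P) U)"
  shows "s \<oplus>\<^bsub>sec (sheafify P) U\<^esub> s' \<in> carrier (sec (sheafify P) U)"
  unfolding sheafify_carrier_iff
proof (intro conjI ballI allI impI)
  fix x assume "x \<in> U"
  then show "\<exists>V t. x \<in> V \<and> V \<subseteq> U \<and> represents P (s \<oplus>\<^bsub>sec (sheafify P) U\<^esub> s') V t"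
    using represents_two[OF assms] represents_add by metis
next
  fix x assume "x \<notin> U"
  then have "s x = {}" using assms by (auto simp: sheafify_carrier_iff)
  then show "(s \<oplus>\<^bsub>sec (sheafify P) U\<^esub> s') x = {}" by (simp add: sheafify_def)
qed

lemma sheafify_smult_closed:
  assumes "open U" "f \<in> carrier (cinf X U)" "s \<in> carrier (sec (sheafify P) U)"
  shows "f \<odot>\<^bsub>sec (sheafify P) U\<^esub> s \<in> carrier (sec (sheafify P) U)"
  unfolding sheafify_carrier_iff
proof (intro conjI ballI allI impI)
  fix x assume "x \<in> U"
  then show "\<exists>V t. x \<in> V \<and> V \<subseteq> U \<and> represents P (f \<odot>\<^bsub>sec (sheafify P) U\<^esub> s) V t"
    using represents_two[OF assms(1,3,3)] represents_smult assms by metis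
next
  fix x assume "x \<notin> U"
  then have "s x = {}" using assms by (auto simp: sheafify_carrier_iff)
  then show "(f \<odot>\<^bsub>sec (sheafify P) U\<^esub> s) x = {}" by (simp add: sheafify_def)
qed

text \<open>Every law holds for representatives in the modules \<open>sec P V\<close> and is carried
  over by \<open>represents_unique\<close>, after shrinking to a neighbourhood on which all
  arguments are represented.\<close>

lemma sheafify_module:
  assumes U: "open U"
  shows "module (cinf X U) (sec (sheafify P) U)"
proof -
  let ?S = "sec (sheafify P) U"
  note ac = sheafify_add_closed[OF U] and sc = sheafify_smult_closed[OF U]
  interpret R: cring "cinf X U" by (rule cring_cinf[OF U])
  interpret MU: module "cinf X U" "sec P U" by (rule presheaf_module[OF P U])
  have z: "\<zero>\<^bsub>?S\<^esub> \<in> carrier ?S"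
    unfolding sheafify_zero by (rule to_sheafify_closed[OF U]) simp
  have rz: "represents P \<zero>\<^bsub>?S\<^esub> V \<zero>\<^bsub>sec P V\<^esub>" if "open V" "V \<subseteq> U" for V
    using represents_res[OF P represents_to_sheafify[OF P U MU.zero_closed] that]
      additive_on_zero[OF presheaf_abelian_group[OF P] presheaf_abelian_group[OF P] res_additive[OF P]] U that
    by (simp add: sheafify_zero)
  have carr: "open V \<and> t \<in> carrier (sec P V)" if "represents P s V t" for s V t
    using that by (auto simp: represents_def)
  \<comment> \<open>The additive inverse is produced as the multiple by -1, so that its closure and
    its representatives come from those of scalar multiples.\<close>
  have neg: "(\<ominus>\<^bsub>cinf X U\<^esub> \<one>\<^bsub>cinf X U\<^esub>) \<odot>\<^bsub>?S\<^esub> s \<oplus>\<^bsub>?S\<^esub> s = \<zero>\<^bsub>?S\<^esub>" if s: "s \<in> carrier ?S" for s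
  proof (rule represents_unique[of _ U])
    fix x assume x: "x \<in> U"
    obtain V t where V: "x \<in> V" "V \<subseteq> U" "represents P s V t"
      using represents_two[OF U s s x] by metis
    then have o: "open V" "t \<in> carrier (sec P V)" using carr by auto
    interpret M: module "cinf X V" "sec P V" by (rule presheaf_module[OF P o(1)])
    have "fres V (\<ominus>\<^bsub>cinf X U\<^esub> \<one>\<^bsub>cinf X U\<^esub>) = \<ominus>\<^bsub>cinf X V\<^esub> \<one>\<^bsub>cinf X V\<^esub>"
      using additive_on_minus[OF R.abelian_group_axioms M.R.abelian_group_axioms fres_additive[OF U o(1) V(2)], of "\<one>\<^bsub>cinf X U\<^esub>"] V
      by (simp add: fres_one)
    moreover have "(\<ominus>\<^bsub>cinf X V\<^esub> \<one>\<^bsub>cinf X V\<^esub>) \<odot>\<^bsub>sec P V\<^esub> t \<oplus>\<^bsub>sec P V\<^esub> t = \<zero>\<^bsub>sec P V\<^esub>"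
      using o M.smult_l_minus[of "\<one>\<^bsub>cinf X V\<^esub>" t] by (simp add: M.M.l_neg)
    ultimately have "represents P ((\<ominus>\<^bsub>cinf X U\<^esub> \<one>\<^bsub>cinf X U\<^esub>) \<odot>\<^bsub>?S\<^esub> s \<oplus>\<^bsub>?S\<^esub> s) V \<zero>\<^bsub>sec P V\<^esub>"
      using represents_add[OF represents_smult[OF V(3) U V(2), of "\<ominus>\<^bsub>cinf X U\<^esub> \<one>\<^bsub>cinf X U\<^esub>"] V(3)] by simp
    then show "\<exists>V t. x \<in> V \<and> represents P ((\<ominus>\<^bsub>cinf X U\<^esub> \<one>\<^bsub>cinf X U\<^esub>) \<odot>\<^bsub>?S\<^esub> s \<oplus>\<^bsub>?S\<^esub> s) V t \<and> represents P \<zero>\<^bsub>?S\<^esub> V t"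
      using V rz[OF o(1) V(2)] by blast
  qed (use s z ac sc in auto)
  have ab: "abelian_group ?S"
  proof (rule abelian_groupI)
    fix a b c assume abc: "a \<in> carrier ?S" "b \<in> carrier ?S" "c \<in> carrier ?S"
    show "a \<oplus>\<^bsub>?S\<^esub> b \<oplus>\<^bsub>?S\<^esub> c = a \<oplus>\<^bsub>?S\<^esub> (b \<oplus>\<^bsub>?S\<^esub> c)"
    proof (rule represents_unique[of _ U])
      fix x assume x: "x \<in> U"
      obtain V t u where V: "x \<in> V" "V \<subseteq> U" "represents P a V t" "represents P b V u"
        using represents_two[OF U abc(1,2) x] .
      obtain W w where W: "x \<in> W" "W \<subseteq> U" "represents P c W w"
        using represents_two[OF U abc(3,3) x] by metis
      have o: "open V" "open W" "open (V \<inter> W)" using V W carr by auto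
      note r = represents_res[OF P V(3) o(3) Int_lower1] represents_res[OF P V(4) o(3) Int_lower1]
        represents_res[OF P W(3) o(3) Int_lower2]
      interpret M: abelian_group "sec P (V \<inter> W)" by (rule presheaf_abelian_group[OF P o(3)])
      show "\<exists>V t. x \<in> V \<and> represents P (a \<oplus>\<^bsub>?S\<^esub> b \<oplus>\<^bsub>?S\<^esub> c) V t \<and> represents P (a \<oplus>\<^bsub>?S\<^esub> (b \<oplus>\<^bsub>?S\<^esub> c)) V t"
        using represents_add[OF represents_add[OF r(1,2)] r(3)] represents_add[OF r(1) represents_add[OF r(2,3)]] V(1) W(1)
          carr[OF r(1)] carr[OF r(2)] carr[OF r(3)] by (metis IntI M.a_assoc)
    qed (use abc ac in auto)
  next
    fix a b assume abc: "a \<in> carrier ?S" "b \<in> carrier ?S"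
    show "a \<oplus>\<^bsub>?S\<^esub> b = b \<oplus>\<^bsub>?S\<^esub> a"
    proof (rule represents_unique[of _ U])
      fix x assume x: "x \<in> U"
      obtain V t u where V: "x \<in> V" "V \<subseteq> U" "represents P a V t" "represents P b V u"
        using represents_two[OF U abc(1,2) x] .
      interpret M: abelian_group "sec P V" by (rule presheaf_abelian_group[OF P]) (use carr V in blast)
      show "\<exists>V t. x \<in> V \<and> represents P (a \<oplus>\<^bsub>?S\<^esub> b) V t \<and> represents P (b \<oplus>\<^bsub>?S\<^esub> a) V t"
        using represents_add[OF V(3,4)] represents_add[OF V(4,3)] V carr by (metis M.a_comm)
    qed (use abc ac in auto)
  next
    fix a assume a: "a \<in> carrier ?S"
    show "\<zero>\<^bsub>?S\<^esub> \<oplus>\<^bsub>?S\<^esub> a = a"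
    proof (rule represents_unique[of _ U])
      fix x assume x: "x \<in> U"
      obtain V t where V: "x \<in> V" "V \<subseteq> U" "represents P a V t"
        using represents_two[OF U a a x] by metis
      have o: "open V" using V carr by auto
      interpret M: abelian_group "sec P V" by (rule presheaf_abelian_group[OF P o])
      show "\<exists>V t. x \<in> V \<and> represents P (\<zero>\<^bsub>?S\<^esub> \<oplus>\<^bsub>?S\<^esub> a) V t \<and> represents P a V t"
        using represents_add[OF rz[OF o V(2)] V(3)] V carr by (metis M.l_zero)
    qed (use a ac z in auto)
    show "\<exists>y\<in>carrier ?S. y \<oplus>\<^bsub>?S\<^esub> a = \<zero>\<^bsub>?S\<^esub>"
      using neg[OF a] sc[OF _ a] by blast
  qed (use ac z in auto)
  show ?thesis
  proof (rule moduleI[OF R.is_cring ab])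
    fix f g s assume fg: "f \<in> carrier (cinf X U)" "g \<in> carrier (cinf X U)" and s: "s \<in> carrier ?S"
    show "(f \<oplus>\<^bsub>cinf X U\<^esub> g) \<odot>\<^bsub>?S\<^esub> s = f \<odot>\<^bsub>?S\<^esub> s \<oplus>\<^bsub>?S\<^esub> g \<odot>\<^bsub>?S\<^esub> s"
    proof (rule represents_unique[of _ U])
      fix x assume x: "x \<in> U"
      obtain V t where V: "x \<in> V" "V \<subseteq> U" "represents P s V t"
        using represents_two[OF U s s x] by metis
      have o: "open V" using V carr by auto
      interpret M: module "cinf X V" "sec P V" by (rule presheaf_module[OF P o])
      show "\<exists>V t. x \<in> V \<and> represents P ((f \<oplus>\<^bsub>cinf X U\<^esub> g) \<odot>\<^bsub>?S\<^esub> s) V t \<and> represents P (f \<odot>\<^bsub>?S\<^esub> s \<oplus>\<^bsub>?S\<^esub> g \<odot>\<^bsub>?S\<^esub> s) V t"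
        using represents_smult[OF V(3) U V(2) R.a_closed[OF fg]]
          represents_add[OF represents_smult[OF V(3) U V(2) fg(1)] represents_smult[OF V(3) U V(2) fg(2)]] V(1)
          fres_closed[OF U o V(2) fg(1)] fres_closed[OF U o V(2) fg(2)] carr[OF V(3)]
        by (metis fres_add M.smult_l_distr)
    qed (use fg s ac sc in auto)
    show "(f \<otimes>\<^bsub>cinf X U\<^esub> g) \<odot>\<^bsub>?S\<^esub> s = f \<odot>\<^bsub>?S\<^esub> (g \<odot>\<^bsub>?S\<^esub> s)"
    proof (rule represents_unique[of _ U])
      fix x assume x: "x \<in> U"
      obtain V t where V: "x \<in> V" "V \<subseteq> U" "represents P s V t"
        using represents_two[OF U s s x] by metis
      have o: "open V" using V carr by auto
      interpret M: module "cinf X V" "sec P V" by (rule presheaf_module[OF P o])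
      show "\<exists>V t. x \<in> V \<and> represents P ((f \<otimes>\<^bsub>cinf X U\<^esub> g) \<odot>\<^bsub>?S\<^esub> s) V t \<and> represents P (f \<odot>\<^bsub>?S\<^esub> (g \<odot>\<^bsub>?S\<^esub> s)) V t"
        using represents_smult[OF V(3) U V(2) R.m_closed[OF fg]]
          represents_smult[OF represents_smult[OF V(3) U V(2) fg(2)] U V(2) fg(1)] V(1)
          fres_closed[OF U o V(2) fg(1)] fres_closed[OF U o V(2) fg(2)] carr[OF V(3)]
        by (metis fres_mult M.smult_assoc1)
    qed (use fg s ac sc in auto)
  next
    fix f a b assume f: "f \<in> carrier (cinf X U)" and abc: "a \<in> carrier ?S" "b \<in> carrier ?S"
    show "f \<odot>\<^bsub>?S\<^esub> (a \<oplus>\<^bsub>?S\<^esub> b) = f \<odot>\<^bsub>?S\<^esub> a \<oplus>\<^bsub>?S\<^esub> f \<odot>\<^bsub>?S\<^esub> b"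
    proof (rule represents_unique[of _ U])
      fix x assume x: "x \<in> U"
      obtain V t u where V: "x \<in> V" "V \<subseteq> U" "represents P a V t" "represents P b V u"
        using represents_two[OF U abc(1,2) x] .
      have o: "open V" using V carr by auto
      interpret M: module "cinf X V" "sec P V" by (rule presheaf_module[OF P o])
      show "\<exists>V t. x \<in> V \<and> represents P (f \<odot>\<^bsub>?S\<^esub> (a \<oplus>\<^bsub>?S\<^esub> b)) V t \<and> represents P (f \<odot>\<^bsub>?S\<^esub> a \<oplus>\<^bsub>?S\<^esub> f \<odot>\<^bsub>?S\<^esub> b) V t"
        using represents_smult[OF represents_add[OF V(3,4)] U V(2) f]
          represents_add[OF represents_smult[OF V(3) U V(2) f] represents_smult[OF V(4) U V(2) f]] V(1)
          fres_closed[OF U o V(2) f] carr[OF V(3)] carr[OF V(4)]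
        by (metis M.smult_r_distr)
    qed (use f abc ac sc in auto)
  next
    fix s assume s: "s \<in> carrier ?S"
    show "\<one>\<^bsub>cinf X U\<^esub> \<odot>\<^bsub>?S\<^esub> s = s"
    proof (rule represents_unique[of _ U])
      fix x assume x: "x \<in> U"
      obtain V t where V: "x \<in> V" "V \<subseteq> U" "represents P s V t"
        using represents_two[OF U s s x] by metis
      have o: "open V" using V carr by auto
      interpret M: module "cinf X V" "sec P V" by (rule presheaf_module[OF P o])
      show "\<exists>V t. x \<in> V \<and> represents P (\<one>\<^bsub>cinf X U\<^esub> \<odot>\<^bsub>?S\<^esub> s) V t \<and> represents P s V t"
        using represents_smult[OF V(3) U V(2) R.one_closed] V carr[OF V(3)] fres_one[OF V(2)] M.smult_one by metis
    qed (use s sc in auto)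
  qed (use sc in auto)
qed

lemma sheafify_res_closed:
  assumes "open V" "V \<subseteq> U" "s \<in> carrier (sec (sheafify P) U)"
  shows "res (sheafify P) U V s \<in> carrier (sec (sheafify P) V)"
  unfolding sheafify_carrier_iff
proof (intro conjI ballI allI impI)
  fix x assume x: "x \<in> V"
  then obtain W t where W: "x \<in> W" "represents P s W t"
    using assms by (meson sheafify_carrier_iff subsetD)
  have "open (V \<inter> W)" using W assms by (auto simp: represents_def)
  then show "\<exists>W t. x \<in> W \<and> W \<subseteq> V \<and> represents P (res (sheafify P) U V s) W t"
    using represents_sheafify_res[OF represents_res[OF P W(2) _ Int_lower2] Int_lower1] W x by blast
qed (simp add: sheafify_res)

lemma presheaf_sheafify: "presheaf_mod X (sheafify P)"
  unfolding presheaf_mod_def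
proof (intro conjI allI impI ballI; (elim conjE)?)
  fix U V :: "'x set" assume UV: "open U" "open V" "V \<subseteq> U"
  fix s assume s: "s \<in> carrier (sec (sheafify P) U)"
  let ?r = "res (sheafify P) U V"
  have both: "\<exists>W t. x \<in> W \<and> W \<subseteq> V \<and> represents P s W t" if "x \<in> V" for x
  proof -
    obtain W t where W: "x \<in> W" "W \<subseteq> V" "represents P (?r s) W t"
      using represents_two[OF UV(2) sheafify_res_closed[OF UV(2,3) s] sheafify_res_closed[OF UV(2,3) s] \<open>x \<in> V\<close>] by metis
    then have "represents P s W t" by (auto simp: represents_def sheafify_res subset_iff)
    then show ?thesis using W by blast
  qed
  show "?r (s \<oplus>\<^bsub>sec (sheafify P) U\<^esub> t) = ?r s \<oplus>\<^bsub>sec (sheafify P) V\<^esub> ?r t"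
    if t: "t \<in> carrier (sec (sheafify P) U)" for t
    by (rule ext) (simp add: sheafify_def)
  show "?r (f \<odot>\<^bsub>sec (sheafify P) U\<^esub> s) = fres V f \<odot>\<^bsub>sec (sheafify P) V\<^esub> ?r s"
    if f: "f \<in> carrier (cinf X U)" for f
  proof (rule represents_unique[of _ V])
    show "?r (f \<odot>\<^bsub>sec (sheafify P) U\<^esub> s) \<in> carrier (sec (sheafify P) V)"
      by (intro sheafify_res_closed sheafify_smult_closed UV s f)
    show "fres V f \<odot>\<^bsub>sec (sheafify P) V\<^esub> ?r s \<in> carrier (sec (sheafify P) V)"
      by (intro sheafify_res_closed sheafify_smult_closed fres_closed[OF UV] UV s f)
    fix x assume "x \<in> V"
    obtain W t where W: "x \<in> W" "W \<subseteq> V" "represents P s W t" using both[OF \<open>x \<in> V\<close>] by blast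
    have "represents P (?r (f \<odot>\<^bsub>sec (sheafify P) U\<^esub> s)) W (fres W f \<odot>\<^bsub>sec P W\<^esub> t)"
      using represents_sheafify_res[OF represents_smult[OF W(3) UV(1) order_trans[OF W(2) UV(3)] f] W(2)] .
    moreover have "represents P (fres V f \<odot>\<^bsub>sec (sheafify P) V\<^esub> ?r s) W (fres W f \<odot>\<^bsub>sec P W\<^esub> t)"
      using represents_smult[OF represents_sheafify_res[OF W(3,2)] UV(2) W(2) fres_closed[OF UV f]]
      unfolding fres_fres[OF W(2)] .
    ultimately show "\<exists>W t. x \<in> W \<and> represents P (?r (f \<odot>\<^bsub>sec (sheafify P) U\<^esub> s)) W t \<and>
        represents P (fres V f \<odot>\<^bsub>sec (sheafify P) V\<^esub> ?r s) W t"
      using W(1) by blast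
  qed
next
  fix U :: "'x set" and s assume "s \<in> carrier (sec (sheafify P) U)"
  then show "res (sheafify P) U U s = s"
    unfolding sheafify_carrier_iff sheafify_res by (intro ext) simp
next
  fix U V W :: "'x set" and s assume "W \<subseteq> V"
  then show "res (sheafify P) V W (res (sheafify P) U V s) = res (sheafify P) U W s"
    unfolding sheafify_res by (intro ext) auto
qed (rule sheafify_module sheafify_res_closed; assumption)+

text \<open>A compatible family of germ-valued functions is glued pointwise, the value at
  \<open>x\<close> being taken from any member defined there; local representability is inherited
  from that member.\<close>

lemma sheaf_sheafify: "sheaf_mod X (sheafify P)"
  unfolding sheaf_mod_def
proof (intro conjI allI impI presheaf_sheafify; elim conjE)
  fix \<C> s
  assume C: "\<forall>V\<in>\<C>. open V \<and> s V \<in> carrier (sec (sheafify P) V)"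
    and g: "\<forall>V\<in>\<C>. \<forall>W\<in>\<C>. res (sheafify P) V (V \<inter> W) (s V) = res (sheafify P) W (V \<inter> W) (s W)"
  have g: "s V x = s W x" if "V \<in> \<C>" "W \<in> \<C>" "x \<in> V" "x \<in> W" for V W x
    using g[rule_format, OF that(1,2), THEN fun_cong, of x] that by (simp add: sheafify_res)
  define t where "t x = (if x \<in> \<Union>\<C> then s (SOME V. V \<in> \<C> \<and> x \<in> V) x else {})" for x
  have t: "t x = s V x" if "V \<in> \<C>" "x \<in> V" for x V
  proof -
    have "(SOME V. V \<in> \<C> \<and> x \<in> V) \<in> \<C> \<and> x \<in> (SOME V. V \<in> \<C> \<and> x \<in> V)"
      by (rule someI[of _ V]) (use that in auto)
    then have "s (SOME V. V \<in> \<C> \<and> x \<in> V) x = s V x" using that by (intro g) auto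
    then show ?thesis unfolding t_def using that by (simp only: if_P[OF UnionI])
  qed
  show "\<exists>!t. t \<in> carrier (sec (sheafify P) (\<Union>\<C>)) \<and> (\<forall>V\<in>\<C>. res (sheafify P) (\<Union>\<C>) V t = s V)"
  proof (intro ex1I conjI ballI)
    show "t \<in> carrier (sec (sheafify P) (\<Union>\<C>))"
      unfolding sheafify_carrier_iff
    proof (intro conjI ballI allI impI)
      fix x assume "x \<in> \<Union>\<C>"
      then obtain V where V: "V \<in> \<C>" "x \<in> V" by blast
      then obtain W u where W: "x \<in> W" "W \<subseteq> V" "represents P (s V) W u"
        using C by (meson sheafify_carrier_iff)
      then have "represents P t W u" by (simp add: represents_def t[OF V(1)] subset_iff)
      then show "\<exists>W u. x \<in> W \<and> W \<subseteq> \<Union>\<C> \<and> represents P t W u" using W V by blast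
    qed (simp add: t_def)
    show "res (sheafify P) (\<Union>\<C>) V t = s V" if "V \<in> \<C>" for V
    proof
      fix x show "res (sheafify P) (\<Union>\<C>) V t x = s V x"
        using C[rule_format, OF that] by (cases "x \<in> V") (simp_all add: sheafify_res t[OF that] sheafify_carrier_iff)
    qed
    fix t' assume t': "t' \<in> carrier (sec (sheafify P) (\<Union>\<C>)) \<and> (\<forall>V\<in>\<C>. res (sheafify P) (\<Union>\<C>) V t' = s V)"
    show "t' = t"
    proof
      fix x show "t' x = t x"
      proof (cases "x \<in> \<Union>\<C>")
        case True
        then obtain V where V: "V \<in> \<C>" "x \<in> V" by blast
        then have "res (sheafify P) (\<Union>\<C>) V t' x = s V x" using t' by simp
        then show ?thesis using V(2) by (simp add: sheafify_res t[OF V])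
      next
        case False
        then show ?thesis using t' by (simp add: sheafify_carrier_iff t_def)
      qed
    qed
  qed
qed

lemma to_sheafify_hom: "sheaf_hom X P (sheafify P) (to_sheafify P)"
proof (rule sheaf_homI)
  fix U :: "'x set" assume U: "open U"
  interpret M: module "cinf X U" "sec P U" by (rule presheaf_module[OF P U])
  show "additive_on (sec P U) (sec (sheafify P) U) (to_sheafify P U)"
  proof (rule additive_onI)
    fix s t assume st: "s \<in> carrier (sec P U)" "t \<in> carrier (sec P U)"
    show "to_sheafify P U (s \<oplus>\<^bsub>sec P U\<^esub> t) = to_sheafify P U s \<oplus>\<^bsub>sec (sheafify P) U\<^esub> to_sheafify P U t"
      by (rule represents_unique[of _ U])
        (use represents_to_sheafify[OF P U M.a_closed[OF st]]
            represents_add[OF represents_to_sheafify[OF P U st(1)] represents_to_sheafify[OF P U st(2)]]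
            to_sheafify_closed[OF U] sheafify_add_closed[OF U] st in blast)+
  qed (rule to_sheafify_closed[OF U])
  fix f s assume f: "f \<in> carrier (cinf X U)" and s: "s \<in> carrier (sec P U)"
  show "to_sheafify P U (f \<odot>\<^bsub>sec P U\<^esub> s) = f \<odot>\<^bsub>sec (sheafify P) U\<^esub> to_sheafify P U s"
  proof (rule represents_unique[of _ U])
    have "represents P (f \<odot>\<^bsub>sec (sheafify P) U\<^esub> to_sheafify P U s) U (f \<odot>\<^bsub>sec P U\<^esub> s)"
      using represents_smult[OF represents_to_sheafify[OF P U s] U order_refl f] fres_cinf_id[OF f] by simp
    then show "\<exists>V t. x \<in> V \<and> represents P (to_sheafify P U (f \<odot>\<^bsub>sec P U\<^esub> s)) V t \<and>
        represents P (f \<odot>\<^bsub>sec (sheafify P) U\<^esub> to_sheafify P U s) V t" if "x \<in> U" for x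
      using represents_to_sheafify[OF P U M.smult_closed[OF f s]] that by blast
  qed (use f s to_sheafify_closed[OF U] sheafify_smult_closed[OF U] in auto)
next
  fix U V s assume "open U" "open V" "V \<subseteq> U" "s \<in> carrier (sec P U)"
  then show "to_sheafify P V (res P U V s) = res (sheafify P) U V (to_sheafify P U s)"
    by (auto simp: fun_eq_iff to_sheafify_def sheafify_res germ_res[OF P] subset_iff)
qed

lemma sheafify_locally:
  assumes "s \<in> carrier (sec (sheafify P) U)" "x \<in> U"
  obtains V t where "open V" "x \<in> V" "V \<subseteq> U" "t \<in> carrier (sec P V)" "res (sheafify P) U V s = to_sheafify P V t"
proof -
  obtain V t where "x \<in> V" "V \<subseteq> U" "represents P s V t"
    using assms by (meson sheafify_carrier_iff)
  then show thesis
    by (intro that[of V t]) (auto simp: represents_def sheafify_res to_sheafify_def fun_eq_iff)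
qed

text \<open>The presheaf need not be separated, so equal images in the sheafification give agreement
  only near each point.\<close>

lemma to_sheafify_eqD:
  assumes "open U" "s \<in> carrier (sec P U)" "t \<in> carrier (sec P U)" "to_sheafify P U s = to_sheafify P U t" "x \<in> U"
  obtains V where "open V" "x \<in> V" "V \<subseteq> U" "res P U V s = res P U V t"
  using assms(4)[THEN fun_cong, of x] germ_eq_iff[OF P assms(1,1,5,5,2,3)] assms(5)
  by (auto simp: to_sheafify_def)

end

end

section \<open>Tensor products of sheaves\<close>

context smooth_functions
begin

lemma module_pair_sec:
  "presheaf_mod X F \<Longrightarrow> presheaf_mod X G \<Longrightarrow> open U \<Longrightarrow> module_pair (cinf X U) (sec F U) (sec G U)"
  by (simp add: module_pair_def presheaf_module)

lemma sec_tensor_presheaf: "sec (tensor_presheaf X F G) U = tensor_module (cinf X U) (sec F U) (sec G U)"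
  by (simp add: tensor_presheaf_def)

context
  fixes F :: "('x, 'f) osheaf" and G :: "('x, 'g) osheaf"
  assumes F: "presheaf_mod X F" and G: "presheaf_mod X G"
begin

abbreviation "TP \<equiv> tensor_presheaf X F G"

abbreviation "TT \<equiv> tensor X F G"

abbreviation ptensor where "ptensor U s t \<equiv> tensor_coset (cinf X U) (sec F U) (sec G U) (frag_of (s, t))"

lemma tensor_presheaf_res:
  assumes "open U" "open V" "V \<subseteq> U"
  shows "additive_on (sec TP U) (sec TP V) (res TP U V)"
    and "s \<in> carrier (sec F U) \<Longrightarrow> t \<in> carrier (sec G U) \<Longrightarrow> res TP U V (ptensor U s t) = ptensor V (res F U V s) (res G U V t)"
proof -
  interpret M: module_pair "cinf X U" "sec F U" "sec G U" by (rule module_pair_sec[OF F G assms(1)])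
  \<comment> \<open>Restriction is the map induced by restricting both factors, which are semilinear
    over \<open>fres V\<close>.\<close>
  have r: "res TP U V = M.induced (cinf X V) (sec F V) (sec G V) (res F U V) (res G U V)"
    by (simp add: tensor_presheaf_def fun_eq_iff M.induced_def)
  note * = module_pair_sec[OF F G assms(2)] res_additive[OF F assms] res_additive[OF G assms]
    fres_closed[OF assms]
  show "additive_on (sec TP U) (sec TP V) (res TP U V)"
    unfolding r sec_tensor_presheaf
    by (rule M.induced_additive[where \<sigma> = "fres V"]) (use * res_smult[OF F assms] res_smult[OF G assms] in auto)
  show "res TP U V (ptensor U s t) = ptensor V (res F U V s) (res G U V t)"
    if "s \<in> carrier (sec F U)" "t \<in> carrier (sec G U)"
    unfolding r
    by (rule M.induced_pure[where \<sigma> = "fres V"]) (use * res_smult[OF F assms] res_smult[OF G assms] that in auto)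
qed

text \<open>Identity, composition and compatibility with scalars are equalities of additive maps on
  a module tensor product, hence checked on pure tensors, where restriction acts on both
  factors.\<close>

lemma presheaf_tensor_presheaf: "presheaf_mod X TP"
  unfolding presheaf_mod_def
proof (intro conjI allI impI ballI; (elim conjE)?)
  fix U :: "'x set" assume U: "open U"
  interpret M: module_pair "cinf X U" "sec F U" "sec G U" by (rule module_pair_sec[OF F G U])
  show "module (cinf X U) (sec TP U)" unfolding sec_tensor_presheaf by (rule M.module_T)
  fix s assume s: "s \<in> carrier (sec TP U)"
  show "res TP U U s = s"
  proof (rule M.additive_eqI[where H = "sec TP U" and f = "res TP U U" and g = "\<lambda>x. x"])
    show "additive_on M.T (sec TP U) (res TP U U)"
      using tensor_presheaf_res(1)[OF U U order_refl] by (simp add: sec_tensor_presheaf)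
    show "res TP U U (M.coset_of (frag_of (m, n))) = M.coset_of (frag_of (m, n))"
      if "m \<in> carrier (sec F U)" "n \<in> carrier (sec G U)" for m n
      using tensor_presheaf_res(2)[OF U U order_refl that] that by (simp add: res_id[OF F U] res_id[OF G U])
  qed (use s M.abelian_group_T in \<open>auto simp: sec_tensor_presheaf intro: additive_onI\<close>)
next
  fix U V :: "'x set" assume UV: "open U" "open V" "V \<subseteq> U"
  interpret M: module_pair "cinf X U" "sec F U" "sec G U" by (rule module_pair_sec[OF F G UV(1)])
  interpret N: module_pair "cinf X V" "sec F V" "sec G V" by (rule module_pair_sec[OF F G UV(2)])
  note ra = tensor_presheaf_res(1)[OF UV] and rp = tensor_presheaf_res(2)[OF UV]
  fix s assume s: "s \<in> carrier (sec TP U)"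
  show "res TP U V s \<in> carrier (sec TP V)" by (rule additive_on_closed[OF ra s])
  show "res TP U V (s \<oplus>\<^bsub>sec TP U\<^esub> t) = res TP U V s \<oplus>\<^bsub>sec TP V\<^esub> res TP U V t" if "t \<in> carrier (sec TP U)" for t
    by (rule additive_on_add[OF ra s that])
  fix f assume f: "f \<in> carrier (cinf X U)"
  have fV: "fres V f \<in> carrier (cinf X V)" by (rule fres_closed[OF UV f])
  show "res TP U V (f \<odot>\<^bsub>sec TP U\<^esub> s) = fres V f \<odot>\<^bsub>sec TP V\<^esub> res TP U V s"
    unfolding sec_tensor_presheaf
  proof (rule M.additive_eqI[where H = N.T and f = "\<lambda>s. res TP U V (f \<odot>\<^bsub>M.T\<^esub> s)" and g = "\<lambda>s. fres V f \<odot>\<^bsub>N.T\<^esub> res TP U V s"])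
    show "abelian_group N.T" by (rule N.abelian_group_T)
    show "s \<in> carrier M.T" using s by (simp add: sec_tensor_presheaf)
    have ra: "additive_on M.T N.T (res TP U V)" using ra by (simp add: sec_tensor_presheaf)
    show "additive_on M.T N.T (\<lambda>s. res TP U V (f \<odot>\<^bsub>M.T\<^esub> s))"
      by (rule additive_onI)
        (simp_all add: additive_on_closed[OF ra] additive_on_closed[OF M.additive_smult_T[OF f]]
          additive_on_add[OF ra] additive_on_add[OF M.additive_smult_T[OF f]])
    show "additive_on M.T N.T (\<lambda>s. fres V f \<odot>\<^bsub>N.T\<^esub> res TP U V s)"
      by (rule additive_onI)
        (simp_all add: additive_on_closed[OF ra] additive_on_closed[OF N.additive_smult_T[OF fV]]
          additive_on_add[OF ra] additive_on_add[OF N.additive_smult_T[OF fV]])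
    fix m n assume mn: "m \<in> carrier (sec F U)" "n \<in> carrier (sec G U)"
    show "res TP U V (f \<odot>\<^bsub>M.T\<^esub> M.coset_of (frag_of (m, n))) = fres V f \<odot>\<^bsub>N.T\<^esub> res TP U V (M.coset_of (frag_of (m, n)))"
      using mn f fV by (simp add: M.smult_T_pure rp N.smult_T_pure res_smult[OF F UV] res_closed[OF F UV] res_closed[OF G UV])
  qed
next
  fix U V W :: "'x set" assume UVW: "open U" "open V" "open W" "W \<subseteq> V" "V \<subseteq> U"
  fix s assume s: "s \<in> carrier (sec TP U)"
  interpret M: module_pair "cinf X U" "sec F U" "sec G U" by (rule module_pair_sec[OF F G UVW(1)])
  interpret N: module_pair "cinf X W" "sec F W" "sec G W" by (rule module_pair_sec[OF F G UVW(3)])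
  have WU: "W \<subseteq> U" using UVW by auto
  note r1 = tensor_presheaf_res[OF UVW(1,2,5)] and r2 = tensor_presheaf_res[OF UVW(2,3,4)]
    and r3 = tensor_presheaf_res[OF UVW(1,3) WU]
  show "res TP V W (res TP U V s) = res TP U W s"
  proof (rule M.additive_eqI[where H = N.T and f = "\<lambda>s. res TP V W (res TP U V s)" and g = "res TP U W"])
    show "additive_on M.T N.T (\<lambda>s. res TP V W (res TP U V s))"
      unfolding sec_tensor_presheaf[symmetric]
      by (rule additive_onI)
        (simp_all add: additive_on_closed[OF r1(1)] additive_on_closed[OF r2(1)] additive_on_add[OF r1(1)] additive_on_add[OF r2(1)])
    show "additive_on M.T N.T (res TP U W)" using r3(1) by (simp add: sec_tensor_presheaf)
    fix m n assume mn: "m \<in> carrier (sec F U)" "n \<in> carrier (sec G U)"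
    show "res TP V W (res TP U V (M.coset_of (frag_of (m, n)))) = res TP U W (M.coset_of (frag_of (m, n)))"
      using mn UVW
      by (simp add: r1(2) r2(2) r3(2) res_closed[OF F UVW(1,2,5)] res_closed[OF G UVW(1,2,5)]
          res_res[OF F UVW(1,2,5)] res_res[OF G UVW(1,2,5)])
  qed (use s N.abelian_group_T in \<open>simp_all add: sec_tensor_presheaf\<close>)
qed

lemma sheaf_tensor: "sheaf_mod X TT"
  unfolding tensor_def by (rule sheaf_sheafify[OF presheaf_tensor_presheaf])

lemma presheaf_tensor: "presheaf_mod X TT"
  by (rule sheaf_presheaf[OF sheaf_tensor])

lemma hom_TP: "sheaf_hom X TP TT (to_sheafify TP)"
  unfolding tensor_def by (rule to_sheafify_hom[OF presheaf_tensor_presheaf])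

lemma ptensor_closed: "open U \<Longrightarrow> s \<in> carrier (sec F U) \<Longrightarrow> t \<in> carrier (sec G U) \<Longrightarrow> ptensor U s t \<in> carrier (sec TP U)"
  unfolding sec_tensor_presheaf by (rule module_pair.pure_closed[OF module_pair_sec[OF F G]])

lemma pure_closed: "open U \<Longrightarrow> s \<in> carrier (sec F U) \<Longrightarrow> t \<in> carrier (sec G U) \<Longrightarrow> pure X F G U s t \<in> carrier (sec TT U)"
  unfolding pure_def by (rule sheaf_hom_closed[OF hom_TP _ ptensor_closed])

lemma pure_res:
  assumes "open U" "open V" "V \<subseteq> U" "s \<in> carrier (sec F U)" "t \<in> carrier (sec G U)"
  shows "res TT U V (pure X F G U s t) = pure X F G V (res F U V s) (res G U V t)"
  unfolding pure_def
  using sheaf_hom_res[OF hom_TP assms(1-3) ptensor_closed[OF assms(1,4,5)]] tensor_presheaf_res(2)[OF assms] by simp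

lemma pure_add_left:
  assumes "open U" "s \<in> carrier (sec F U)" "s' \<in> carrier (sec F U)" "t \<in> carrier (sec G U)"
  shows "pure X F G U (s \<oplus>\<^bsub>sec F U\<^esub> s') t = pure X F G U s t \<oplus>\<^bsub>sec TT U\<^esub> pure X F G U s' t"
  using module_pair.coset_pure_add_left[OF module_pair_sec[OF F G assms(1)] assms(2-4)]
    sheaf_hom_add[OF hom_TP assms(1) ptensor_closed[OF assms(1,2,4)] ptensor_closed[OF assms(1,3,4)]]
  by (simp add: pure_def sec_tensor_presheaf)

lemma pure_add_right:
  assumes "open U" "s \<in> carrier (sec F U)" "t \<in> carrier (sec G U)" "t' \<in> carrier (sec G U)"
  shows "pure X F G U s (t \<oplus>\<^bsub>sec G U\<^esub> t') = pure X F G U s t \<oplus>\<^bsub>sec TT U\<^esub> pure X F G U s t'"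
  using module_pair.coset_pure_add_right[OF module_pair_sec[OF F G assms(1)] assms(2-4)]
    sheaf_hom_add[OF hom_TP assms(1) ptensor_closed[OF assms(1,2,3)] ptensor_closed[OF assms(1,2,4)]]
  by (simp add: pure_def sec_tensor_presheaf)

lemma pure_smult_left:
  assumes "open U" "f \<in> carrier (cinf X U)" "s \<in> carrier (sec F U)" "t \<in> carrier (sec G U)"
  shows "pure X F G U (f \<odot>\<^bsub>sec F U\<^esub> s) t = f \<odot>\<^bsub>sec TT U\<^esub> pure X F G U s t"
  using module_pair.smult_T_pure[OF module_pair_sec[OF F G assms(1)] assms(2-4)]
    sheaf_hom_smult[OF hom_TP assms(1,2) ptensor_closed[OF assms(1,3,4)]]
  by (simp add: pure_def sec_tensor_presheaf)

lemma pure_balanced: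
  assumes "open U" "f \<in> carrier (cinf X U)" "s \<in> carrier (sec F U)" "t \<in> carrier (sec G U)"
  shows "pure X F G U (f \<odot>\<^bsub>sec F U\<^esub> s) t = pure X F G U s (f \<odot>\<^bsub>sec G U\<^esub> t)"
  using module_pair.coset_pure_balanced[OF module_pair_sec[OF F G assms(1)] assms(2-4)]
  by (simp add: pure_def)

lemma pure_smult_right:
  assumes "open U" "f \<in> carrier (cinf X U)" "s \<in> carrier (sec F U)" "t \<in> carrier (sec G U)"
  shows "pure X F G U s (f \<odot>\<^bsub>sec G U\<^esub> t) = f \<odot>\<^bsub>sec TT U\<^esub> pure X F G U s t"
  using pure_balanced[OF assms] pure_smult_left[OF assms] by simp

text \<open>Translates a sum in the module tensor product into the sum of sections
  \<open>pure\<close> by which \<open>tensor_lift\<close> recognizes a local expression.\<close>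

lemma to_sheafify_sum_pure:
  assumes "open U" "\<And>k. k < (r::nat) \<Longrightarrow> s k \<in> carrier (sec F U) \<and> t k \<in> carrier (sec G U)"
  shows "to_sheafify TP U (\<Oplus>\<^bsub>sec TP U\<^esub>k\<in>{..<r}. ptensor U (s k) (t k)) = (\<Oplus>\<^bsub>sec TT U\<^esub>k\<in>{..<r}. pure X F G U (s k) (t k))"
  unfolding pure_def
  by (rule additive_on_finsum[OF presheaf_abelian_group[OF presheaf_tensor_presheaf assms(1)]
        presheaf_abelian_group[OF presheaf_tensor assms(1)] sheaf_hom_additive[OF hom_TP assms(1)]])
    (use assms ptensor_closed in auto)

lemma TP_sum_pure:
  assumes "open U" "c \<in> carrier (sec TP U)"
  obtains r s t where "\<forall>k<r::nat. s k \<in> carrier (sec F U) \<and> t k \<in> carrier (sec G U)"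
    "c = (\<Oplus>\<^bsub>sec TP U\<^esub>k\<in>{..<r}. ptensor U (s k) (t k))"
proof -
  from module_pair.pure_sum[OF module_pair_sec[OF F G assms(1)] assms(2)[unfolded sec_tensor_presheaf]]
  obtain r s t where "\<forall>k<r. s k \<in> carrier (sec F U) \<and> t k \<in> carrier (sec G U)"
    "c = (\<Oplus>\<^bsub>sec TP U\<^esub>k\<in>{..<r::nat}. ptensor U (s k) (t k))"
    unfolding sec_tensor_presheaf by (elim exE conjE)
  then show thesis by (rule that)
qed

lemma tensor_locally:
  assumes "\<xi> \<in> carrier (sec TT U)" "x \<in> U"
  obtains V c where "open V" "x \<in> V" "V \<subseteq> U" "c \<in> carrier (sec TP V)" "res TT U V \<xi> = to_sheafify TP V c"
  by (rule sheafify_locally[OF presheaf_tensor_presheaf assms(1)[unfolded tensor_def] assms(2)])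
    (rule that[unfolded tensor_def])

end

end

subsection \<open>The universal property\<close>

text \<open>Maps are only required to be additive, since connections are not linear. They are defined on the
  open subsets of a given \<open>U0\<close>, since the inner maps of \<^const>\<open>assoc\<close> and \<^const>\<open>exchange\<close> depend on a
  section over \<open>U0\<close>.\<close>

definition sheaf_map_below ::
    "'x::topological_space set \<Rightarrow> ('x, 'f) osheaf \<Rightarrow> ('x, 'h) osheaf \<Rightarrow> ('x set \<Rightarrow> 'f \<Rightarrow> 'h) \<Rightarrow> bool" where
  "sheaf_map_below U0 F H h \<longleftrightarrow>
     (\<forall>U. open U \<and> U \<subseteq> U0 \<longrightarrow> additive_on (sec F U) (sec H U) (h U)) \<and>
     (\<forall>U V s. open U \<and> open V \<and> V \<subseteq> U \<and> U \<subseteq> U0 \<and> s \<in> carrier (sec F U) \<longrightarrow>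
        h V (res F U V s) = res H U V (h U s))"

text \<open>A scalar only moves between the arguments and never to the value. Maps linear in both
  arguments satisfy this, and so does the formula behind the tensor product connection, which is not
  linear.\<close>

definition balanced_below ::
    "'x::topological_space smooth_structure \<Rightarrow> 'x set \<Rightarrow> ('x, 'f) osheaf \<Rightarrow> ('x, 'g) osheaf \<Rightarrow>
     ('x, 'h) osheaf \<Rightarrow> ('x set \<Rightarrow> 'f \<Rightarrow> 'g \<Rightarrow> 'h) \<Rightarrow> bool" where
  "balanced_below X U0 F G H b \<longleftrightarrow>
     (\<forall>U t. open U \<and> U \<subseteq> U0 \<and> t \<in> carrier (sec G U) \<longrightarrow>
        additive_on (sec F U) (sec H U) (\<lambda>s. b U s t)) \<and>
     (\<forall>U s. open U \<and> U \<subseteq> U0 \<and> s \<in> carrier (sec F U) \<longrightarrow>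
        additive_on (sec G U) (sec H U) (b U s)) \<and>
     (\<forall>U f s t. open U \<and> U \<subseteq> U0 \<and> f \<in> carrier (cinf X U) \<and> s \<in> carrier (sec F U) \<and>
        t \<in> carrier (sec G U) \<longrightarrow> b U (f \<odot>\<^bsub>sec F U\<^esub> s) t = b U s (f \<odot>\<^bsub>sec G U\<^esub> t)) \<and>
     (\<forall>U V s t. open U \<and> open V \<and> V \<subseteq> U \<and> U \<subseteq> U0 \<and> s \<in> carrier (sec F U) \<and>
        t \<in> carrier (sec G U) \<longrightarrow> b V (res F U V s) (res G U V t) = res H U V (b U s t))"

lemma balanced_belowI:
  assumes "\<And>U t. open U \<Longrightarrow> U \<subseteq> U0 \<Longrightarrow> t \<in> carrier (sec G U) \<Longrightarrow> additive_on (sec F U) (sec H U) (\<lambda>s. b U s t)"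
    and "\<And>U s. open U \<Longrightarrow> U \<subseteq> U0 \<Longrightarrow> s \<in> carrier (sec F U) \<Longrightarrow> additive_on (sec G U) (sec H U) (b U s)"
    and "\<And>U f s t. open U \<Longrightarrow> U \<subseteq> U0 \<Longrightarrow> f \<in> carrier (cinf X U) \<Longrightarrow> s \<in> carrier (sec F U) \<Longrightarrow>
      t \<in> carrier (sec G U) \<Longrightarrow> b U (f \<odot>\<^bsub>sec F U\<^esub> s) t = b U s (f \<odot>\<^bsub>sec G U\<^esub> t)"
    and "\<And>U V s t. open U \<Longrightarrow> open V \<Longrightarrow> V \<subseteq> U \<Longrightarrow> U \<subseteq> U0 \<Longrightarrow> s \<in> carrier (sec F U) \<Longrightarrow>
      t \<in> carrier (sec G U) \<Longrightarrow> b V (res F U V s) (res G U V t) = res H U V (b U s t)"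
  shows "balanced_below X U0 F G H b"
  unfolding balanced_below_def by (intro conjI allI impI; elim conjE) (rule assms; assumption)+

lemma sheaf_map_belowI:
  assumes "\<And>U. open U \<Longrightarrow> U \<subseteq> U0 \<Longrightarrow> additive_on (sec F U) (sec H U) (h U)"
    and "\<And>U V s. open U \<Longrightarrow> open V \<Longrightarrow> V \<subseteq> U \<Longrightarrow> U \<subseteq> U0 \<Longrightarrow> s \<in> carrier (sec F U) \<Longrightarrow>
      h V (res F U V s) = res H U V (h U s)"
  shows "sheaf_map_below U0 F H h"
  unfolding sheaf_map_below_def by (intro conjI allI impI; (elim conjE)?) (rule assms; assumption)+

lemma
  assumes "sheaf_map_below U0 F H h" "open U" "U \<subseteq> U0"
  shows sheaf_map_additive: "additive_on (sec F U) (sec H U) (h U)"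
    and sheaf_map_res: "open V \<Longrightarrow> V \<subseteq> U \<Longrightarrow> s \<in> carrier (sec F U) \<Longrightarrow> h V (res F U V s) = res H U V (h U s)"
  using assms by (simp_all add: sheaf_map_below_def)

context smooth_functions
begin

context
  fixes F :: "('x, 'f) osheaf" and G :: "('x, 'g) osheaf" and H :: "('x, 'h) osheaf"
  assumes F: "presheaf_mod X F" and G: "presheaf_mod X G" and H: "sheaf_mod X H"
begin

text \<open>Near each point a section is a finite sum of pure tensors, on which the two additive
  maps agree; since \<open>H\<close> is a sheaf, local agreement suffices. Pure tensors over smaller
  open sets have to be compared because such an expression lives only there.\<close>

lemma tensor_hom_eqI:
  assumes "sheaf_map_below U0 (tensor X F G) H h" "sheaf_map_below U0 (tensor X F G) H h'"
    and U: "open U" "U \<subseteq> U0" and \<xi>: "\<xi> \<in> carrier (sec (tensor X F G) U)"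
    and pure: "\<And>V s t. open V \<Longrightarrow> V \<subseteq> U \<Longrightarrow> s \<in> carrier (sec F V) \<Longrightarrow> t \<in> carrier (sec G V) \<Longrightarrow>
      h V (pure X F G V s t) = h' V (pure X F G V s t)"
  shows "h U \<xi> = h' U \<xi>"
proof (rule sheaf_eqI[OF H U(1)])
  note h = sheaf_map_additive[OF assms(1)] sheaf_map_res[OF assms(1) U]
  note h' = sheaf_map_additive[OF assms(2)] sheaf_map_res[OF assms(2) U]
  show "h U \<xi> \<in> carrier (sec H U)" "h' U \<xi> \<in> carrier (sec H U)"
    using additive_on_closed[OF h(1)[OF U] \<xi>] additive_on_closed[OF h'(1)[OF U] \<xi>] by auto
  fix x assume "x \<in> U"
  then obtain V c where V: "open V" "x \<in> V" "V \<subseteq> U" "c \<in> carrier (sec (TP F G) V)"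
    "res (tensor X F G) U V \<xi> = to_sheafify (TP F G) V c"
    by (rule tensor_locally[OF F G \<xi>])
  interpret Z: abelian_group "sec H V" by (rule presheaf_abelian_group[OF sheaf_presheaf[OF H] V(1)])
  obtain r s t where st: "\<forall>k<r::nat. s k \<in> carrier (sec F V) \<and> t k \<in> carrier (sec G V)"
    "c = (\<Oplus>\<^bsub>sec (TP F G) V\<^esub>k\<in>{..<r}. ptensor F G V (s k) (t k))"
    by (rule TP_sum_pure[OF F G V(1,4)])
      note st = st(1)[rule_format] st(2)
  have V0: "V \<subseteq> U0" using V U by auto
  have pc: "pure X F G V (s k) (t k) \<in> carrier (sec (tensor X F G) V)" if "k < r" for k
    using st(1)[OF that] by (simp add: pure_closed[OF F G V(1)])
  have sum: "res (tensor X F G) U V \<xi> = (\<Oplus>\<^bsub>sec (tensor X F G) V\<^esub>k\<in>{..<r}. pure X F G V (s k) (t k))"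
    unfolding V(5) st(2) by (rule to_sheafify_sum_pure[OF F G V(1) st(1)])
  have "res H U V (h U \<xi>) = (\<Oplus>\<^bsub>sec H V\<^esub>k\<in>{..<r}. h V (pure X F G V (s k) (t k)))"
    unfolding h(2)[OF V(1,3) \<xi>, symmetric] sum
    by (rule additive_on_finsum[OF presheaf_abelian_group[OF presheaf_tensor[OF F G] V(1)] Z.abelian_group_axioms h(1)[OF V(1) V0]])
      (rule pc)
  also have "\<dots> = (\<Oplus>\<^bsub>sec H V\<^esub>k\<in>{..<r}. h' V (pure X F G V (s k) (t k)))"
    by (rule Z.finsum_cong')
      (use st(1) pure[OF V(1,3)] additive_on_closed[OF h'(1)[OF V(1) V0] pc] in auto)
  also have "\<dots> = res H U V (h' U \<xi>)"
    unfolding h'(2)[OF V(1,3) \<xi>, symmetric] sum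
    by (rule additive_on_finsum[OF presheaf_abelian_group[OF presheaf_tensor[OF F G] V(1)] Z.abelian_group_axioms h'(1)[OF V(1) V0], symmetric])
      (rule pc)
  finally show "\<exists>V. open V \<and> x \<in> V \<and> V \<subseteq> U \<and> res H U V (h U \<xi>) = res H U V (h' U \<xi>)"
    using V by blast
qed

context
  fixes U0 :: "'x set" and b :: "'x set \<Rightarrow> 'f \<Rightarrow> 'g \<Rightarrow> 'h"
  assumes b: "balanced_below X U0 F G H b"
begin

lemma
  assumes "open U" "U \<subseteq> U0"
  shows balanced_left: "t \<in> carrier (sec G U) \<Longrightarrow> additive_on (sec F U) (sec H U) (\<lambda>s. b U s t)"
    and balanced_right: "s \<in> carrier (sec F U) \<Longrightarrow> additive_on (sec G U) (sec H U) (b U s)"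
    and balanced_smult: "f \<in> carrier (cinf X U) \<Longrightarrow> s \<in> carrier (sec F U) \<Longrightarrow> t \<in> carrier (sec G U) \<Longrightarrow>
      b U (f \<odot>\<^bsub>sec F U\<^esub> s) t = b U s (f \<odot>\<^bsub>sec G U\<^esub> t)"
    and balanced_res: "open V \<Longrightarrow> V \<subseteq> U \<Longrightarrow> s \<in> carrier (sec F U) \<Longrightarrow> t \<in> carrier (sec G U) \<Longrightarrow>
      b V (res F U V s) (res G U V t) = res H U V (b U s t)"
  using assms b by (simp_all add: balanced_below_def)

lemma balanced_closed: "open U \<Longrightarrow> U \<subseteq> U0 \<Longrightarrow> s \<in> carrier (sec F U) \<Longrightarrow> t \<in> carrier (sec G U) \<Longrightarrow> b U s t \<in> carrier (sec H U)"
  using additive_on_closed[OF balanced_right] .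

text \<open>The factorizations are chosen for each open set separately. Their compatibility with
  restriction is not part of the choice; it follows later because pure tensors determine
  them.\<close>

lemma presheaf_lift:
  obtains T where "\<And>V. open V \<Longrightarrow> V \<subseteq> U0 \<Longrightarrow> additive_on (sec (TP F G) V) (sec H V) (T V)"
    "\<And>V s t. open V \<Longrightarrow> V \<subseteq> U0 \<Longrightarrow> s \<in> carrier (sec F V) \<Longrightarrow> t \<in> carrier (sec G V) \<Longrightarrow>
      T V (ptensor F G V s t) = b V s t"
proof -
  have "\<exists>T. additive_on (sec (TP F G) V) (sec H V) T \<and>
      (\<forall>s\<in>carrier (sec F V). \<forall>t\<in>carrier (sec G V). T (ptensor F G V s t) = b V s t)"
    if V: "open V" "V \<subseteq> U0" for V
  proof -
    interpret M: module_pair "cinf X V" "sec F V" "sec G V" by (rule module_pair_sec[OF F G V(1)])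
    obtain h where "additive_on M.T (sec H V) h"
      "\<And>m n. m \<in> carrier (sec F V) \<Longrightarrow> n \<in> carrier (sec G V) \<Longrightarrow> h (M.coset_of (frag_of (m, n))) = b V m n"
      by (rule M.tensor_universal[of "sec H V" "b V"])
        (simp_all add: presheaf_abelian_group[OF sheaf_presheaf[OF H] V(1)] balanced_closed[OF V] balanced_smult[OF V]
          additive_on_add[OF balanced_left[OF V]] additive_on_add[OF balanced_right[OF V]])
    then show ?thesis unfolding sec_tensor_presheaf by blast
  qed
  then have "\<forall>V. \<exists>T. open V \<and> V \<subseteq> U0 \<longrightarrow> additive_on (sec (TP F G) V) (sec H V) T \<and>
      (\<forall>s\<in>carrier (sec F V). \<forall>t\<in>carrier (sec G V). T (ptensor F G V s t) = b V s t)"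
    by metis
  from choice[OF this] obtain T where "\<forall>V. open V \<and> V \<subseteq> U0 \<longrightarrow> additive_on (sec (TP F G) V) (sec H V) (T V) \<and>
      (\<forall>s\<in>carrier (sec F V). \<forall>t\<in>carrier (sec G V). T V (ptensor F G V s t) = b V s t)" ..
  then show thesis by (intro that[of T]) auto
qed

text \<open>The described section exists because the values of the module-level maps
  \<open>T V\<close> on local representatives of \<open>\<xi>\<close> glue, and it is unique because
  \<open>\<xi>\<close> has an expression by pure tensors near every point.\<close>

lemma
  assumes U: "open U" "U \<subseteq> U0" and \<xi>: "\<xi> \<in> carrier (sec (tensor X F G) U)"
  shows tensor_lift_closed: "tensor_lift X F G H b U \<xi> \<in> carrier (sec H U)"
    and tensor_lift_sum: "open V \<Longrightarrow> V \<subseteq> U \<Longrightarrow> (\<And>k. k < (r::nat) \<Longrightarrow> s k \<in> carrier (sec F V) \<and> t k \<in> carrier (sec G V)) \<Longrightarrow>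
      res (tensor X F G) U V \<xi> = (\<Oplus>\<^bsub>sec (tensor X F G) V\<^esub>k\<in>{..<r}. pure X F G V (s k) (t k)) \<Longrightarrow>
      res H U V (tensor_lift X F G H b U \<xi>) = (\<Oplus>\<^bsub>sec H V\<^esub>k\<in>{..<r}. b V (s k) (t k))"
proof -
  let ?P = "TP F G" and ?T = "tensor X F G"
  note pH = sheaf_presheaf[OF H] and pP = presheaf_tensor_presheaf[OF F G] and pT = presheaf_tensor[OF F G]
  obtain T where T: "\<And>V. open V \<Longrightarrow> V \<subseteq> U0 \<Longrightarrow> additive_on (sec ?P V) (sec H V) (T V)"
    and Tb: "\<And>V s t. open V \<Longrightarrow> V \<subseteq> U0 \<Longrightarrow> s \<in> carrier (sec F V) \<Longrightarrow> t \<in> carrier (sec G V) \<Longrightarrow>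
      T V (ptensor F G V s t) = b V s t"
    using presheaf_lift by blast
  have Tcl: "T V c \<in> carrier (sec H V)" if "open V" "V \<subseteq> U0" "c \<in> carrier (sec ?P V)" for V c
    using additive_on_closed[OF T[OF that(1,2)] that(3)] .
  \<comment> \<open>Both sides are additive on the module tensor product over \<open>V\<close>, and
    on pure tensors the equation is the compatibility of \<open>b\<close> with restriction.\<close>
  have Tres: "T W (res ?P V W c) = res H V W (T V c)"
    if VW: "open V" "open W" "W \<subseteq> V" "V \<subseteq> U0" and c: "c \<in> carrier (sec ?P V)" for V W c
  proof -
    interpret M: module_pair "cinf X V" "sec F V" "sec G V" by (rule module_pair_sec[OF F G VW(1)])
    have W0: "W \<subseteq> U0" using VW by auto
    note rP = tensor_presheaf_res(1)[OF F G VW(1-3)] and rH = res_additive[OF pH VW(1-3)]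
    show ?thesis
    proof (rule M.additive_eqI[of "sec H W" "\<lambda>c. T W (res ?P V W c)" "\<lambda>c. res H V W (T V c)"])
      show "additive_on M.T (sec H W) (\<lambda>c. T W (res ?P V W c))"
        unfolding sec_tensor_presheaf[symmetric]
        by (rule additive_onI) (simp_all add: additive_on_closed[OF rP] additive_on_add[OF rP]
            additive_on_closed[OF T[OF VW(2) W0]] additive_on_add[OF T[OF VW(2) W0]])
      show "additive_on M.T (sec H W) (\<lambda>c. res H V W (T V c))"
        unfolding sec_tensor_presheaf[symmetric]
        by (rule additive_onI) (simp_all add: additive_on_closed[OF rH] additive_on_add[OF rH]
            additive_on_closed[OF T[OF VW(1,4)]] additive_on_add[OF T[OF VW(1,4)]])
      fix s t assume st: "s \<in> carrier (sec F V)" "t \<in> carrier (sec G V)"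
      show "T W (res ?P V W (M.coset_of (frag_of (s, t)))) = res H V W (T V (M.coset_of (frag_of (s, t))))"
        using st by (simp add: tensor_presheaf_res(2)[OF F G VW(1-3)] Tb[OF VW(2) W0] Tb[OF VW(1,4)]
            res_closed[OF F VW(1-3)] res_closed[OF G VW(1-3)] balanced_res[OF VW(1,4,2,3)])
    qed (use c presheaf_abelian_group[OF pH VW(2)] in \<open>simp_all add: sec_tensor_presheaf\<close>)
  qed
  \<comment> \<open>Distinct tensors may become equal after sheafification, but they then agree
    locally, and separatedness of \<open>H\<close> makes their values equal.\<close>
  have wd: "T V c = T V c'"
    if V: "open V" "V \<subseteq> U0" and c: "c \<in> carrier (sec ?P V)" "c' \<in> carrier (sec ?P V)"
      and eq: "to_sheafify ?P V c = to_sheafify ?P V c'" for V c c'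
  proof (rule sheaf_eqI[OF H V(1) Tcl[OF V c(1)] Tcl[OF V c(2)]])
    fix x assume "x \<in> V"
    then obtain W where W: "open W" "x \<in> W" "W \<subseteq> V" "res ?P V W c = res ?P V W c'"
      by (rule to_sheafify_eqD[OF pP V(1) c eq])
    then show "\<exists>W. open W \<and> x \<in> W \<and> W \<subseteq> V \<and> res H V W (T V c) = res H V W (T V c')"
      using Tres[OF V(1) W(1,3) V(2) c(1)] Tres[OF V(1) W(1,3) V(2) c(2)] by (metis (no_types))
  qed
  \<comment> \<open>\<open>R V c\<close> says that \<open>c\<close> is a presheaf-level
    representative of \<open>\<xi>\<close> over \<open>V\<close>.\<close>
  define R where "R V c \<longleftrightarrow> open V \<and> V \<subseteq> U \<and> c \<in> carrier (sec ?P V) \<and> res ?T U V \<xi> = to_sheafify ?P V c" for V c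
  have Rsum: "R V (\<Oplus>\<^bsub>sec ?P V\<^esub>k\<in>{..<r}. ptensor F G V (s k) (t k)) \<and>
      T V (\<Oplus>\<^bsub>sec ?P V\<^esub>k\<in>{..<r}. ptensor F G V (s k) (t k)) = (\<Oplus>\<^bsub>sec H V\<^esub>k\<in>{..<r}. b V (s k) (t k))"
    if V: "open V" "V \<subseteq> U" and st: "\<And>k. k < (r::nat) \<Longrightarrow> s k \<in> carrier (sec F V) \<and> t k \<in> carrier (sec G V)"
      and e: "res ?T U V \<xi> = (\<Oplus>\<^bsub>sec ?T V\<^esub>k\<in>{..<r}. pure X F G V (s k) (t k))" for V r s t
  proof
    interpret A: abelian_group "sec ?P V" by (rule presheaf_abelian_group[OF pP V(1)])
    interpret B: abelian_group "sec H V" by (rule presheaf_abelian_group[OF pH V(1)])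
    have V0: "V \<subseteq> U0" using V U by auto
    have cl: "ptensor F G V (s k) (t k) \<in> carrier (sec ?P V)" if "k < r" for k
      using st[OF that] ptensor_closed[OF F G V(1)] by blast
    show "R V (\<Oplus>\<^bsub>sec ?P V\<^esub>k\<in>{..<r}. ptensor F G V (s k) (t k))"
      unfolding R_def e
      by (intro conjI V A.finsum_closed to_sheafify_sum_pure[OF F G V(1) st, symmetric]) (use cl in auto)
    have "T V (\<Oplus>\<^bsub>sec ?P V\<^esub>k\<in>{..<r}. ptensor F G V (s k) (t k)) =
      (\<Oplus>\<^bsub>sec H V\<^esub>k\<in>{..<r}. T V (ptensor F G V (s k) (t k)))"
      by (rule additive_on_finsum[OF A.abelian_group_axioms B.abelian_group_axioms T[OF V(1) V0]]) (rule cl)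
    also have "\<dots> = (\<Oplus>\<^bsub>sec H V\<^esub>k\<in>{..<r}. b V (s k) (t k))"
      by (rule B.finsum_cong') (use st Tb[OF V(1) V0] balanced_closed[OF V(1) V0] in auto)
    finally show "T V (\<Oplus>\<^bsub>sec ?P V\<^esub>k\<in>{..<r}. ptensor F G V (s k) (t k)) =
      (\<Oplus>\<^bsub>sec H V\<^esub>k\<in>{..<r}. b V (s k) (t k))" .
  qed
  \<comment> \<open>The open sets over which \<open>\<xi>\<close> has a representative; they cover
    \<open>U\<close>, and \<open>c V\<close> picks one representative on each.\<close>
  define C where "C = {V. \<exists>c. R V c}"
  define c where "c V = (SOME c. R V c)" for V
  have c: "R V (c V)" if "V \<in> C" for V using that unfolding C_def c_def by (simp add: someI_ex)
  have UC: "\<Union>C = U"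
  proof
    show "U \<subseteq> \<Union>C"
    proof
      fix x assume "x \<in> U"
      then obtain V c where "open V" "x \<in> V" "V \<subseteq> U" "c \<in> carrier (sec ?P V)" "res ?T U V \<xi> = to_sheafify ?P V c"
        by (rule tensor_locally[OF F G \<xi>])
      then show "x \<in> \<Union>C" by (auto simp: C_def R_def)
    qed
  qed (auto simp: C_def R_def)
  \<comment> \<open>On the overlap both representatives induce the restriction of
    \<open>\<xi>\<close>, so \<open>wd\<close> applies to their restrictions.\<close>
  have compat: "res H V (V \<inter> W) (T V d) = res H W (V \<inter> W) (T W d')" if R: "R V d" "R W d'" for V W d d'
  proof -
    have V: "open V" "V \<subseteq> U" "V \<subseteq> U0" "d \<in> carrier (sec ?P V)" "res ?T U V \<xi> = to_sheafify ?P V d"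
      and W: "open W" "W \<subseteq> U" "W \<subseteq> U0" "d' \<in> carrier (sec ?P W)" "res ?T U W \<xi> = to_sheafify ?P W d'"
      using R U by (auto simp: R_def)
    have VW: "open (V \<inter> W)" "V \<inter> W \<subseteq> U0" using V W by auto
    have "to_sheafify ?P (V \<inter> W) (res ?P V (V \<inter> W) d) = res ?T U (V \<inter> W) \<xi>"
      unfolding sheaf_hom_res[OF hom_TP[OF F G] V(1) VW(1) Int_lower1 V(4)] V(5)[symmetric]
      by (rule res_res[OF pT U(1) V(1,2) \<xi> VW(1) Int_lower1])
    also have "\<dots> = to_sheafify ?P (V \<inter> W) (res ?P W (V \<inter> W) d')"
      unfolding sheaf_hom_res[OF hom_TP[OF F G] W(1) VW(1) Int_lower2 W(4)] W(5)[symmetric]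
      by (rule res_res[OF pT U(1) W(1,2) \<xi> VW(1) Int_lower2, symmetric])
    finally show ?thesis
      using wd[OF VW res_closed[OF pP V(1) VW(1) Int_lower1 V(4)] res_closed[OF pP W(1) VW(1) Int_lower2 W(4)]]
      by (simp add: Tres[OF V(1) VW(1) Int_lower1 V(3,4)] Tres[OF W(1) VW(1) Int_lower2 W(3,4)])
  qed
  have Cop: "open V" "V \<subseteq> U" "V \<subseteq> U0" "T V (c V) \<in> carrier (sec H V)" if "V \<in> C" for V
    using c[OF that] U Tcl[of V "c V"] by (auto simp: R_def)
  obtain h where h: "h \<in> carrier (sec H U)" "\<And>V. V \<in> C \<Longrightarrow> res H U V h = T V (c V)"
    by (rule sheaf_glue[OF H, of C "\<lambda>V. T V (c V)"]) (use Cop compat[OF c c] in \<open>simp_all add: UC\<close>)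
  \<comment> \<open>The predicate of the definite description in \<open>tensor_lift\<close>.\<close>
  let ?Q = "\<lambda>h. h \<in> carrier (sec H U) \<and>
        (\<forall>V (r::nat) s t. open V \<and> V \<subseteq> U \<and>
           (\<forall>k<r. s k \<in> carrier (sec F V) \<and> t k \<in> carrier (sec G V)) \<and>
           res ?T U V \<xi> = (\<Oplus>\<^bsub>sec ?T V\<^esub>k\<in>{..<r}. pure X F G V (s k) (t k)) \<longrightarrow>
           res H U V h = (\<Oplus>\<^bsub>sec H V\<^esub>k\<in>{..<r}. b V (s k) (t k)))"
  have hQ: "?Q h"
  proof (intro conjI h(1) allI impI; elim conjE)
    fix V and r :: nat and s t
    assume V: "open V" "V \<subseteq> U" and st: "\<forall>k<r. s k \<in> carrier (sec F V) \<and> t k \<in> carrier (sec G V)"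
      and e: "res ?T U V \<xi> = (\<Oplus>\<^bsub>sec ?T V\<^esub>k\<in>{..<r}. pure X F G V (s k) (t k))"
    obtain d where d: "R V d" "T V d = (\<Oplus>\<^bsub>sec H V\<^esub>k\<in>{..<r}. b V (s k) (t k))"
      using Rsum[OF V _ e] st by blast
    then have VC: "V \<in> C" by (auto simp: C_def)
    have dd: "d \<in> carrier (sec ?P V)" "to_sheafify ?P V (c V) = to_sheafify ?P V d" "c V \<in> carrier (sec ?P V)"
      using d(1) c[OF VC] by (auto simp: R_def)
    show "res H U V h = (\<Oplus>\<^bsub>sec H V\<^esub>k\<in>{..<r}. b V (s k) (t k))"
      unfolding h(2)[OF VC] d(2)[symmetric] by (rule wd[OF Cop(1,3)[OF VC] dd(3,1,2)])
  qed
  have "h' = h" if h': "?Q h'" for h'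
  proof (rule sheaf_eqI[OF H U(1)])
    fix x assume "x \<in> U"
    then obtain V c where V: "open V" "x \<in> V" "V \<subseteq> U" "c \<in> carrier (sec ?P V)" "res ?T U V \<xi> = to_sheafify ?P V c"
      by (rule tensor_locally[OF F G \<xi>])
    obtain r s t where st: "\<forall>k<r::nat. s k \<in> carrier (sec F V) \<and> t k \<in> carrier (sec G V)"
      "c = (\<Oplus>\<^bsub>sec ?P V\<^esub>k\<in>{..<r}. ptensor F G V (s k) (t k))"
      by (rule TP_sum_pure[OF F G V(1,4)])
      note st = st(1)[rule_format] st(2)
    have e: "res ?T U V \<xi> = (\<Oplus>\<^bsub>sec ?T V\<^esub>k\<in>{..<r}. pure X F G V (s k) (t k))"
      unfolding V(5) st(2) by (rule to_sheafify_sum_pure[OF F G V(1) st(1)])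
    have "res H U V h' = res H U V h"
      using h'[THEN conjunct2, rule_format, of V r s t] hQ[THEN conjunct2, rule_format, of V r s t] V st(1) e by simp
    then show "\<exists>V. open V \<and> x \<in> V \<and> V \<subseteq> U \<and> res H U V h' = res H U V h" using V by blast
  qed (use h' h in auto)
  then have "tensor_lift X F G H b U \<xi> = h"
    unfolding tensor_lift_def using hQ by (intro the_equality)
  then have Q: "?Q (tensor_lift X F G H b U \<xi>)" using hQ by simp
  then show "tensor_lift X F G H b U \<xi> \<in> carrier (sec H U)" ..
  show "res H U V (tensor_lift X F G H b U \<xi>) = (\<Oplus>\<^bsub>sec H V\<^esub>k\<in>{..<r}. b V (s k) (t k))"
    if "open V" "V \<subseteq> U" "\<And>k. k < (r::nat) \<Longrightarrow> s k \<in> carrier (sec F V) \<and> t k \<in> carrier (sec G V)"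
      "res (tensor X F G) U V \<xi> = (\<Oplus>\<^bsub>sec (tensor X F G) V\<^esub>k\<in>{..<r}. pure X F G V (s k) (t k))"
    using Q[THEN conjunct2, rule_format, of V r s t] that by simp
qed

text \<open>The one-term sum over \<open>V = U\<close> in the defining property.\<close>

lemma tensor_lift_pure:
  assumes U: "open U" "U \<subseteq> U0" and st: "s \<in> carrier (sec F U)" "t \<in> carrier (sec G U)"
  shows "tensor_lift X F G H b U (pure X F G U s t) = b U s t"
proof -
  interpret T: abelian_group "sec (tensor X F G) U" by (rule presheaf_abelian_group[OF presheaf_tensor[OF F G] U(1)])
  interpret B: abelian_group "sec H U" by (rule presheaf_abelian_group[OF sheaf_presheaf[OF H] U(1)])
  note pc = pure_closed[OF F G U(1) st]
  have "res H U U (tensor_lift X F G H b U (pure X F G U s t)) = (\<Oplus>\<^bsub>sec H U\<^esub>k\<in>{..<1::nat}. b U s t)"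
    by (rule tensor_lift_sum[OF U pc U(1) order_refl])
      (use st pc in \<open>simp_all add: lessThan_Suc res_id[OF presheaf_tensor[OF F G] U(1)]\<close>)
  then show ?thesis
    using tensor_lift_closed[OF U pc] balanced_closed[OF U st]
    by (simp add: lessThan_Suc res_id[OF sheaf_presheaf[OF H] U(1)])
qed

text \<open>The definition quantifies over all expressions on all smaller open sets, so one
  expression over \<open>W\<close> tests the lift of a section and of its restriction alike, which
  gives naturality. For additivity, expressions of two sections over a common neighbourhood are
  concatenated.\<close>

lemma sheaf_map_tensor_lift: "sheaf_map_below U0 (tensor X F G) H (tensor_lift X F G H b)"
proof (rule sheaf_map_belowI)
  let ?T = "tensor X F G" and ?L = "tensor_lift X F G H b"
  note pH = sheaf_presheaf[OF H] and pT = presheaf_tensor[OF F G]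
  have local_sum: "\<exists>V (r::nat) s t. open V \<and> x \<in> V \<and> V \<subseteq> U \<and> (\<forall>k<r. s k \<in> carrier (sec F V) \<and> t k \<in> carrier (sec G V)) \<and>
      res ?T U V \<xi> = (\<Oplus>\<^bsub>sec ?T V\<^esub>k\<in>{..<r}. pure X F G V (s k) (t k))"
    if \<xi>: "\<xi> \<in> carrier (sec ?T U)" and x: "x \<in> U" for \<xi> x U
  proof -
    obtain V c where V: "open V" "x \<in> V" "V \<subseteq> U" "c \<in> carrier (sec (TP F G) V)"
      "res ?T U V \<xi> = to_sheafify (TP F G) V c"
      by (rule tensor_locally[OF F G \<xi> x])
    obtain r s t where st: "\<forall>k<r::nat. s k \<in> carrier (sec F V) \<and> t k \<in> carrier (sec G V)"
      "c = (\<Oplus>\<^bsub>sec (TP F G) V\<^esub>k\<in>{..<r}. ptensor F G V (s k) (t k))"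
      by (rule TP_sum_pure[OF F G V(1,4)])
      note st = st(1)[rule_format] st(2)
    have "res ?T U V \<xi> = (\<Oplus>\<^bsub>sec ?T V\<^esub>k\<in>{..<r}. pure X F G V (s k) (t k))"
      unfolding V(5) st(2) by (rule to_sheafify_sum_pure[OF F G V(1) st(1)])
    then show ?thesis using V st(1) by blast
  qed
  fix U V \<xi> assume UV: "open U" "open V" "V \<subseteq> U" "U \<subseteq> U0" and \<xi>: "\<xi> \<in> carrier (sec ?T U)"
  have V0: "V \<subseteq> U0" using UV by auto
  have \<xi>V: "res ?T U V \<xi> \<in> carrier (sec ?T V)" by (rule res_closed[OF pT UV(1-3) \<xi>])
  note Lc = tensor_lift_closed[OF UV(1,4) \<xi>]
  show "?L V (res ?T U V \<xi>) = res H U V (?L U \<xi>)"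
  proof (rule sheaf_eqI[OF H UV(2) tensor_lift_closed[OF UV(2) V0 \<xi>V] res_closed[OF pH UV(1-3) Lc]])
    fix x assume "x \<in> V"
    from local_sum[OF \<xi>V this] obtain W r s t where W: "open W" "x \<in> W" "W \<subseteq> V"
      and st: "\<And>k. k < (r::nat) \<Longrightarrow> s k \<in> carrier (sec F W) \<and> t k \<in> carrier (sec G W)"
      and e: "res ?T V W (res ?T U V \<xi>) = (\<Oplus>\<^bsub>sec ?T W\<^esub>k\<in>{..<r}. pure X F G W (s k) (t k))"
      by blast
    have WU: "W \<subseteq> U" using W UV by auto
    have e': "res ?T U W \<xi> = (\<Oplus>\<^bsub>sec ?T W\<^esub>k\<in>{..<r}. pure X F G W (s k) (t k))"
      using e res_res[OF pT UV(1-3) \<xi> W(1,3)] by simp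
    have "res H V W (?L V (res ?T U V \<xi>)) = (\<Oplus>\<^bsub>sec H W\<^esub>k\<in>{..<r}. b W (s k) (t k))"
      by (rule tensor_lift_sum[OF UV(2) V0 \<xi>V W(1,3) st e])
    moreover have "res H U W (?L U \<xi>) = (\<Oplus>\<^bsub>sec H W\<^esub>k\<in>{..<r}. b W (s k) (t k))"
      by (rule tensor_lift_sum[OF UV(1,4) \<xi> W(1) WU st e'])
    ultimately have "res H V W (?L V (res ?T U V \<xi>)) = res H V W (res H U V (?L U \<xi>))"
      using res_res[OF pH UV(1-3) Lc W(1,3)] by simp
    then show "\<exists>W. open W \<and> x \<in> W \<and> W \<subseteq> V \<and> res H V W (?L V (res ?T U V \<xi>)) = res H V W (res H U V (?L U \<xi>))"
      using W by blast
  qed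
next
  let ?T = "tensor X F G" and ?L = "tensor_lift X F G H b"
  note pH = sheaf_presheaf[OF H] and pT = presheaf_tensor[OF F G]
  fix U assume U: "open U" "U \<subseteq> U0"
  show "additive_on (sec ?T U) (sec H U) (?L U)"
  proof (rule additive_onI)
    show "?L U \<xi> \<in> carrier (sec H U)" if "\<xi> \<in> carrier (sec ?T U)" for \<xi>
      using tensor_lift_closed[OF U that] .
    fix \<xi> \<eta> assume \<xi>: "\<xi> \<in> carrier (sec ?T U)" and \<eta>: "\<eta> \<in> carrier (sec ?T U)"
    interpret TU: abelian_group "sec ?T U" by (rule presheaf_abelian_group[OF pT U(1)])
    interpret HU: abelian_group "sec H U" by (rule presheaf_abelian_group[OF pH U(1)])
    note Lc = tensor_lift_closed[OF U]
    show "?L U (\<xi> \<oplus>\<^bsub>sec ?T U\<^esub> \<eta>) = ?L U \<xi> \<oplus>\<^bsub>sec H U\<^esub> ?L U \<eta>"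
    proof (rule sheaf_eqI[OF H U(1) Lc[OF TU.a_closed[OF \<xi> \<eta>]] HU.a_closed[OF Lc[OF \<xi>] Lc[OF \<eta>]]])
      fix x assume x: "x \<in> U"
      obtain V c where V: "open V" "x \<in> V" "V \<subseteq> U" "c \<in> carrier (sec (TP F G) V)"
        "res ?T U V \<xi> = to_sheafify (TP F G) V c"
        by (rule tensor_locally[OF F G \<xi> x])
      obtain V' c' where V': "open V'" "x \<in> V'" "V' \<subseteq> U" "c' \<in> carrier (sec (TP F G) V')"
        "res ?T U V' \<eta> = to_sheafify (TP F G) V' c'"
        by (rule tensor_locally[OF F G \<eta> x])
      define W where "W = V \<inter> V'"
      have W: "open W" "x \<in> W" "W \<subseteq> V" "W \<subseteq> V'" "W \<subseteq> U" using V V' by (auto simp: W_def)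
      note pP = presheaf_tensor_presheaf[OF F G]
      interpret TW: abelian_group "sec ?T W" by (rule presheaf_abelian_group[OF pT W(1)])
      interpret HW: abelian_group "sec H W" by (rule presheaf_abelian_group[OF pH W(1)])
      have W0: "W \<subseteq> U0" using W U by auto
      obtain r s t where st: "\<forall>k<r::nat. s k \<in> carrier (sec F W) \<and> t k \<in> carrier (sec G W)"
        "res (TP F G) V W c = (\<Oplus>\<^bsub>sec (TP F G) W\<^esub>k\<in>{..<r}. ptensor F G W (s k) (t k))"
        by (rule TP_sum_pure[OF F G W(1) res_closed[OF pP V(1) W(1,3) V(4)]])
      note st = st(1)[rule_format] st(2)
      obtain r' s' t' where st': "\<forall>k<r'::nat. s' k \<in> carrier (sec F W) \<and> t' k \<in> carrier (sec G W)"
        "res (TP F G) V' W c' = (\<Oplus>\<^bsub>sec (TP F G) W\<^esub>k\<in>{..<r'}. ptensor F G W (s' k) (t' k))"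
        by (rule TP_sum_pure[OF F G W(1) res_closed[OF pP V'(1) W(1,4) V'(4)]])
      note st' = st'(1)[rule_format] st'(2)
      have e: "res ?T U W \<xi> = (\<Oplus>\<^bsub>sec ?T W\<^esub>k\<in>{..<r}. pure X F G W (s k) (t k))"
        unfolding res_res[OF pT U(1) V(1,3) \<xi> W(1,3), symmetric] V(5)
          sheaf_hom_res[OF hom_TP[OF F G] V(1) W(1,3) V(4), symmetric] st(2)
        by (rule to_sheafify_sum_pure[OF F G W(1) st(1)])
      have e': "res ?T U W \<eta> = (\<Oplus>\<^bsub>sec ?T W\<^esub>k\<in>{..<r'}. pure X F G W (s' k) (t' k))"
        unfolding res_res[OF pT U(1) V'(1,3) \<eta> W(1,4), symmetric] V'(5)
          sheaf_hom_res[OF hom_TP[OF F G] V'(1) W(1,4) V'(4), symmetric] st'(2)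
        by (rule to_sheafify_sum_pure[OF F G W(1) st'(1)])
      \<comment> \<open>Indices below \<open>r\<close> run through the expression of
        \<open>\<xi>\<close>, the remaining ones, shifted by \<open>r\<close>, through that of
        \<open>\<eta>\<close>.\<close>
      let ?s = "\<lambda>k. if k < r then s k else s' (k - r)" and ?t = "\<lambda>k. if k < r then t k else t' (k - r)"
      have stt: "?s k \<in> carrier (sec F W) \<and> ?t k \<in> carrier (sec G W)" if "k < r + r'" for k
        using st(1)[of k] st'(1)[of "k - r"] that by auto
      have "res ?T U W (\<xi> \<oplus>\<^bsub>sec ?T U\<^esub> \<eta>) =
          (\<Oplus>\<^bsub>sec ?T W\<^esub>k\<in>{..<r + r'}. if k < r then pure X F G W (s k) (t k) else pure X F G W (s' (k - r)) (t' (k - r)))"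
        unfolding res_add[OF pT U(1) W(1,5) \<xi> \<eta>] e e'
        by (rule TW.finsum_lessThan_append[symmetric]) (use st(1) st'(1) pure_closed[OF F G W(1)] in auto)
      also have "\<dots> = (\<Oplus>\<^bsub>sec ?T W\<^esub>k\<in>{..<r + r'}. pure X F G W (?s k) (?t k))"
        by (rule TW.finsum_cong') (use stt pure_closed[OF F G W(1)] in auto)
      finally have "res H U W (?L U (\<xi> \<oplus>\<^bsub>sec ?T U\<^esub> \<eta>)) = (\<Oplus>\<^bsub>sec H W\<^esub>k\<in>{..<r + r'}. b W (?s k) (?t k))"
        by (intro tensor_lift_sum[OF U TU.a_closed[OF \<xi> \<eta>] W(1,5)] stt)
      also have "\<dots> = (\<Oplus>\<^bsub>sec H W\<^esub>k\<in>{..<r + r'}. if k < r then b W (s k) (t k) else b W (s' (k - r)) (t' (k - r)))"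
        by (rule HW.finsum_cong') (use st(1) st'(1) balanced_closed[OF W(1) W0] in auto)
      also have "\<dots> = (\<Oplus>\<^bsub>sec H W\<^esub>k\<in>{..<r}. b W (s k) (t k)) \<oplus>\<^bsub>sec H W\<^esub> (\<Oplus>\<^bsub>sec H W\<^esub>k\<in>{..<r'}. b W (s' k) (t' k))"
        by (rule HW.finsum_lessThan_append) (use st(1) st'(1) balanced_closed[OF W(1) W0] in auto)
      also have "\<dots> = res H U W (?L U \<xi> \<oplus>\<^bsub>sec H U\<^esub> ?L U \<eta>)"
      proof -
        have "res H U W (?L U \<xi>) = (\<Oplus>\<^bsub>sec H W\<^esub>k\<in>{..<r}. b W (s k) (t k))"
          by (rule tensor_lift_sum[OF U \<xi> W(1,5) st(1) e])
        moreover have "res H U W (?L U \<eta>) = (\<Oplus>\<^bsub>sec H W\<^esub>k\<in>{..<r'}. b W (s' k) (t' k))"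
          by (rule tensor_lift_sum[OF U \<eta> W(1,5) st'(1) e'])
        ultimately show ?thesis using res_add[OF pH U(1) W(1,5) Lc[OF \<xi>] Lc[OF \<eta>]] by simp
      qed
      finally show "\<exists>W. open W \<and> x \<in> W \<and> W \<subseteq> U \<and> res H U W (?L U (\<xi> \<oplus>\<^bsub>sec ?T U\<^esub> \<eta>)) = res H U W (?L U \<xi> \<oplus>\<^bsub>sec H U\<^esub> ?L U \<eta>)"
        using W by blast
    qed
  qed
qed

end

end

end

subsection \<open>Multilinear maps\<close>

text \<open>Scalars are carried to the value, unlike in \<open>balanced_below\<close>, so lifts of
  such maps are morphisms of sheaves of modules and not merely additive.\<close>

definition sheaf_bilinear ::
    "'x::topological_space smooth_structure \<Rightarrow> ('x, 'f) osheaf \<Rightarrow> ('x, 'g) osheaf \<Rightarrow>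
     ('x, 'h) osheaf \<Rightarrow> ('x set \<Rightarrow> 'f \<Rightarrow> 'g \<Rightarrow> 'h) \<Rightarrow> bool" where
  "sheaf_bilinear X F G H b \<longleftrightarrow>
     (\<forall>U t. open U \<and> t \<in> carrier (sec G U) \<longrightarrow>
        additive_on (sec F U) (sec H U) (\<lambda>s. b U s t)) \<and>
     (\<forall>U s. open U \<and> s \<in> carrier (sec F U) \<longrightarrow>
        additive_on (sec G U) (sec H U) (b U s)) \<and>
     (\<forall>U f s t. open U \<and> f \<in> carrier (cinf X U) \<and> s \<in> carrier (sec F U) \<and> t \<in> carrier (sec G U) \<longrightarrow>
        b U (f \<odot>\<^bsub>sec F U\<^esub> s) t = f \<odot>\<^bsub>sec H U\<^esub> b U s t \<and>
        b U s (f \<odot>\<^bsub>sec G U\<^esub> t) = f \<odot>\<^bsub>sec H U\<^esub> b U s t) \<and>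
     (\<forall>U V s t. open U \<and> open V \<and> V \<subseteq> U \<and> s \<in> carrier (sec F U) \<and> t \<in> carrier (sec G U) \<longrightarrow>
        b V (res F U V s) (res G U V t) = res H U V (b U s t))"

lemma sheaf_bilinearI:
  assumes "\<And>U t. open U \<Longrightarrow> t \<in> carrier (sec G U) \<Longrightarrow> additive_on (sec F U) (sec H U) (\<lambda>s. b U s t)"
    and "\<And>U s. open U \<Longrightarrow> s \<in> carrier (sec F U) \<Longrightarrow> additive_on (sec G U) (sec H U) (b U s)"
    and "\<And>U f s t. open U \<Longrightarrow> f \<in> carrier (cinf X U) \<Longrightarrow> s \<in> carrier (sec F U) \<Longrightarrow> t \<in> carrier (sec G U) \<Longrightarrow>
      b U (f \<odot>\<^bsub>sec F U\<^esub> s) t = f \<odot>\<^bsub>sec H U\<^esub> b U s t"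
    and "\<And>U f s t. open U \<Longrightarrow> f \<in> carrier (cinf X U) \<Longrightarrow> s \<in> carrier (sec F U) \<Longrightarrow> t \<in> carrier (sec G U) \<Longrightarrow>
      b U s (f \<odot>\<^bsub>sec G U\<^esub> t) = f \<odot>\<^bsub>sec H U\<^esub> b U s t"
    and "\<And>U V s t. open U \<Longrightarrow> open V \<Longrightarrow> V \<subseteq> U \<Longrightarrow> s \<in> carrier (sec F U) \<Longrightarrow>
      t \<in> carrier (sec G U) \<Longrightarrow> b V (res F U V s) (res G U V t) = res H U V (b U s t)"
  shows "sheaf_bilinear X F G H b"
  unfolding sheaf_bilinear_def by (intro conjI allI impI; elim conjE) (rule assms; assumption)+

lemma
  assumes "sheaf_bilinear X F G H b" "open U"
  shows bilinear_left: "t \<in> carrier (sec G U) \<Longrightarrow> additive_on (sec F U) (sec H U) (\<lambda>s. b U s t)"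
    and bilinear_right: "s \<in> carrier (sec F U) \<Longrightarrow> additive_on (sec G U) (sec H U) (b U s)"
    and bilinear_smult_left: "f \<in> carrier (cinf X U) \<Longrightarrow> s \<in> carrier (sec F U) \<Longrightarrow> t \<in> carrier (sec G U) \<Longrightarrow>
      b U (f \<odot>\<^bsub>sec F U\<^esub> s) t = f \<odot>\<^bsub>sec H U\<^esub> b U s t"
    and bilinear_smult_right: "f \<in> carrier (cinf X U) \<Longrightarrow> s \<in> carrier (sec F U) \<Longrightarrow> t \<in> carrier (sec G U) \<Longrightarrow>
      b U s (f \<odot>\<^bsub>sec G U\<^esub> t) = f \<odot>\<^bsub>sec H U\<^esub> b U s t"
    and bilinear_res: "open V \<Longrightarrow> V \<subseteq> U \<Longrightarrow> s \<in> carrier (sec F U) \<Longrightarrow> t \<in> carrier (sec G U) \<Longrightarrow>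
      b V (res F U V s) (res G U V t) = res H U V (b U s t)"
  using assms by (simp_all add: sheaf_bilinear_def)

lemma bilinear_closed:
  assumes "sheaf_bilinear X F G H b" "open U" "s \<in> carrier (sec F U)" "t \<in> carrier (sec G U)"
  shows "b U s t \<in> carrier (sec H U)"
  using additive_on_closed[OF bilinear_right[OF assms(1-3)] assms(4)] .

lemma bilinear_balanced: "sheaf_bilinear X F G H b \<Longrightarrow> balanced_below X U0 F G H b"
  by (rule balanced_belowI) (simp_all add: bilinear_left bilinear_right bilinear_smult_left bilinear_smult_right bilinear_res)

lemma bilinear_swap: "sheaf_bilinear X F G H b \<Longrightarrow> sheaf_bilinear X G F H (\<lambda>U t s. b U s t)"
  by (rule sheaf_bilinearI) (simp_all add: bilinear_left bilinear_right bilinear_smult_left bilinear_smult_right bilinear_res)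

lemma sheaf_hom_map_below: "sheaf_hom X F H h \<Longrightarrow> sheaf_map_below U0 F H h"
  by (rule sheaf_map_belowI) (simp_all add: sheaf_hom_additive sheaf_hom_res)

text \<open>Associativity and exchange are nested lifts of one map in three arguments; this
  condition allows both lifts to be taken.\<close>

definition sheaf_trilinear ::
    "'x::topological_space smooth_structure \<Rightarrow> ('x, 'f) osheaf \<Rightarrow> ('x, 'g) osheaf \<Rightarrow> ('x, 'p) osheaf \<Rightarrow>
     ('x, 'h) osheaf \<Rightarrow> ('x set \<Rightarrow> 'f \<Rightarrow> 'g \<Rightarrow> 'p \<Rightarrow> 'h) \<Rightarrow> bool" where
  "sheaf_trilinear X F G P H b \<longleftrightarrow>
     (\<forall>U s t. open U \<and> s \<in> carrier (sec F U) \<and> t \<in> carrier (sec G U) \<longrightarrow>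
        additive_on (sec P U) (sec H U) (b U s t)) \<and>
     (\<forall>U s p. open U \<and> s \<in> carrier (sec F U) \<and> p \<in> carrier (sec P U) \<longrightarrow>
        additive_on (sec G U) (sec H U) (\<lambda>t. b U s t p)) \<and>
     (\<forall>U t p. open U \<and> t \<in> carrier (sec G U) \<and> p \<in> carrier (sec P U) \<longrightarrow>
        additive_on (sec F U) (sec H U) (\<lambda>s. b U s t p)) \<and>
     (\<forall>U f s t p. open U \<and> f \<in> carrier (cinf X U) \<and> s \<in> carrier (sec F U) \<and> t \<in> carrier (sec G U) \<and>
        p \<in> carrier (sec P U) \<longrightarrow>
        b U (f \<odot>\<^bsub>sec F U\<^esub> s) t p = f \<odot>\<^bsub>sec H U\<^esub> b U s t p \<and>
        b U s (f \<odot>\<^bsub>sec G U\<^esub> t) p = f \<odot>\<^bsub>sec H U\<^esub> b U s t p \<and>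
        b U s t (f \<odot>\<^bsub>sec P U\<^esub> p) = f \<odot>\<^bsub>sec H U\<^esub> b U s t p) \<and>
     (\<forall>U V s t p. open U \<and> open V \<and> V \<subseteq> U \<and> s \<in> carrier (sec F U) \<and> t \<in> carrier (sec G U) \<and>
        p \<in> carrier (sec P U) \<longrightarrow>
        b V (res F U V s) (res G U V t) (res P U V p) = res H U V (b U s t p))"

lemma
  assumes "sheaf_trilinear X F G P H b" "open U"
  shows trilinear_3: "s \<in> carrier (sec F U) \<Longrightarrow> t \<in> carrier (sec G U) \<Longrightarrow> additive_on (sec P U) (sec H U) (b U s t)"
    and trilinear_2: "s \<in> carrier (sec F U) \<Longrightarrow> p \<in> carrier (sec P U) \<Longrightarrow> additive_on (sec G U) (sec H U) (\<lambda>t. b U s t p)"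
    and trilinear_1: "t \<in> carrier (sec G U) \<Longrightarrow> p \<in> carrier (sec P U) \<Longrightarrow> additive_on (sec F U) (sec H U) (\<lambda>s. b U s t p)"
    and trilinear_smult_1: "f \<in> carrier (cinf X U) \<Longrightarrow> s \<in> carrier (sec F U) \<Longrightarrow> t \<in> carrier (sec G U) \<Longrightarrow>
        p \<in> carrier (sec P U) \<Longrightarrow> b U (f \<odot>\<^bsub>sec F U\<^esub> s) t p = f \<odot>\<^bsub>sec H U\<^esub> b U s t p"
    and trilinear_smult_2: "f \<in> carrier (cinf X U) \<Longrightarrow> s \<in> carrier (sec F U) \<Longrightarrow> t \<in> carrier (sec G U) \<Longrightarrow>
        p \<in> carrier (sec P U) \<Longrightarrow> b U s (f \<odot>\<^bsub>sec G U\<^esub> t) p = f \<odot>\<^bsub>sec H U\<^esub> b U s t p"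
    and trilinear_smult_3: "f \<in> carrier (cinf X U) \<Longrightarrow> s \<in> carrier (sec F U) \<Longrightarrow> t \<in> carrier (sec G U) \<Longrightarrow>
        p \<in> carrier (sec P U) \<Longrightarrow> b U s t (f \<odot>\<^bsub>sec P U\<^esub> p) = f \<odot>\<^bsub>sec H U\<^esub> b U s t p"
    and trilinear_res: "open V \<Longrightarrow> V \<subseteq> U \<Longrightarrow> s \<in> carrier (sec F U) \<Longrightarrow> t \<in> carrier (sec G U) \<Longrightarrow>
        p \<in> carrier (sec P U) \<Longrightarrow> b V (res F U V s) (res G U V t) (res P U V p) = res H U V (b U s t p)"
  using assms by (simp_all add: sheaf_trilinear_def)

lemma sheaf_map_below_subset: "sheaf_map_below U0 F H h \<Longrightarrow> U \<subseteq> U0 \<Longrightarrow> sheaf_map_below U F H h"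
  by (rule sheaf_map_belowI) (simp_all add: sheaf_map_additive[of U0] sheaf_map_res[of U0] order_trans)

context smooth_functions
begin

lemma bilinear_pure:
  assumes "presheaf_mod X F" "presheaf_mod X G"
  shows "sheaf_bilinear X F G (tensor X F G) (pure X F G)"
  by (rule sheaf_bilinearI)
    (simp_all add: additive_on_def pure_closed[OF assms] pure_add_left[OF assms] pure_add_right[OF assms]
      pure_smult_left[OF assms] pure_smult_right[OF assms] pure_res[OF assms])

lemma sheaf_map_below_add:
  assumes "sheaf_mod X H" "sheaf_map_below U0 F H h" "sheaf_map_below U0 F H h'"
  shows "sheaf_map_below U0 F H (\<lambda>U s. h U s \<oplus>\<^bsub>sec H U\<^esub> h' U s)"
proof (rule sheaf_map_belowI)
  note pH = sheaf_presheaf[OF assms(1)]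
  fix U assume U: "open U" "U \<subseteq> U0"
  note h = sheaf_map_additive[OF assms(2) U] and h' = sheaf_map_additive[OF assms(3) U]
  interpret H: abelian_group "sec H U" by (rule presheaf_abelian_group[OF pH U(1)])
  show "additive_on (sec F U) (sec H U) (\<lambda>s. h U s \<oplus>\<^bsub>sec H U\<^esub> h' U s)"
    by (rule additive_onI) (simp_all add: additive_on_closed[OF h] additive_on_closed[OF h']
        additive_on_add[OF h] additive_on_add[OF h'] H.a_ac)
  fix V s assume V: "open V" "V \<subseteq> U" and s: "s \<in> carrier (sec F U)"
  show "h V (res F U V s) \<oplus>\<^bsub>sec H V\<^esub> h' V (res F U V s) = res H U V (h U s \<oplus>\<^bsub>sec H U\<^esub> h' U s)"
    using res_add[OF pH U(1) V additive_on_closed[OF h s] additive_on_closed[OF h' s]]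
    by (simp add: sheaf_map_res[OF assms(2) U V s] sheaf_map_res[OF assms(3) U V s])
qed

text \<open>For fixed \<open>f\<close> on \<open>U0\<close>, scaling before or after
  \<open>h\<close> gives additive maps on the open subsets of \<open>U0\<close>. Linearity and
  Leibniz rules thereby become equalities of maps to which \<open>tensor_hom_eqI\<close>
  applies.\<close>

lemma sheaf_map_below_smult:
  assumes "presheaf_mod X F" "sheaf_mod X H" "sheaf_map_below U0 F H h" "open U0" "f \<in> carrier (cinf X U0)"
  shows "sheaf_map_below U0 F H (\<lambda>U s. fres U f \<odot>\<^bsub>sec H U\<^esub> h U s)"
    and "sheaf_map_below U0 F H (\<lambda>U s. h U (fres U f \<odot>\<^bsub>sec F U\<^esub> s))"
proof -
  note pH = sheaf_presheaf[OF assms(2)]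
  have *: "additive_on (sec F U) (sec H U) (\<lambda>s. fres U f \<odot>\<^bsub>sec H U\<^esub> h U s) \<and>
      additive_on (sec F U) (sec H U) (\<lambda>s. h U (fres U f \<odot>\<^bsub>sec F U\<^esub> s))"
    if U: "open U" "U \<subseteq> U0" for U
  proof -
    note h = sheaf_map_additive[OF assms(3) U] and f = fres_closed[OF assms(4) U assms(5)]
    interpret F: module "cinf X U" "sec F U" by (rule presheaf_module[OF assms(1) U(1)])
    interpret H: module "cinf X U" "sec H U" by (rule presheaf_module[OF pH U(1)])
    show ?thesis
      by (intro conjI additive_onI)
        (simp_all add: additive_on_closed[OF h] additive_on_add[OF h] f F.smult_r_distr H.smult_r_distr)
  qed
  have r: "fres V f \<odot>\<^bsub>sec H V\<^esub> h V (res F U V s) = res H U V (fres U f \<odot>\<^bsub>sec H U\<^esub> h U s)"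
    "h V (fres V f \<odot>\<^bsub>sec F V\<^esub> res F U V s) = res H U V (h U (fres U f \<odot>\<^bsub>sec F U\<^esub> s))"
    if U: "open U" "open V" "V \<subseteq> U" "U \<subseteq> U0" and s: "s \<in> carrier (sec F U)" for U V s
  proof -
    note h = sheaf_map_additive[OF assms(3) U(1,4)] and f = fres_closed[OF assms(4) U(1,4) assms(5)]
    interpret F: module "cinf X U" "sec F U" by (rule presheaf_module[OF assms(1) U(1)])
    show "fres V f \<odot>\<^bsub>sec H V\<^esub> h V (res F U V s) = res H U V (fres U f \<odot>\<^bsub>sec H U\<^esub> h U s)"
      using res_smult[OF pH U(1-3) additive_on_closed[OF h s] f] sheaf_map_res[OF assms(3) U(1,4,2,3) s]
      by (simp add: fres_fres[OF U(3)])
    show "h V (fres V f \<odot>\<^bsub>sec F V\<^esub> res F U V s) = res H U V (h U (fres U f \<odot>\<^bsub>sec F U\<^esub> s))"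
      using res_smult[OF assms(1) U(1-3) s f] sheaf_map_res[OF assms(3) U(1,4,2,3) F.smult_closed[OF f s]]
      by (simp add: fres_fres[OF U(3)])
  qed
  show "sheaf_map_below U0 F H (\<lambda>U s. fres U f \<odot>\<^bsub>sec H U\<^esub> h U s)"
    by (rule sheaf_map_belowI) (use * r(1) in blast)+
  show "sheaf_map_below U0 F H (\<lambda>U s. h U (fres U f \<odot>\<^bsub>sec F U\<^esub> s))"
    by (rule sheaf_map_belowI) (use * r(2) in blast)+
qed

text \<open>For fixed \<open>f\<close> both sides are additive maps in \<open>\<xi>\<close>, so the
  equation reduces to pure tensors, where it is the linearity of \<open>b\<close> in its first
  argument.\<close>

lemma tensor_lift_linear:
  assumes F: "presheaf_mod X F" and G: "presheaf_mod X G" and H: "sheaf_mod X H"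
    and b: "balanced_below X U0 F G H b" and U: "open U" "U \<subseteq> U0"
    and lin: "\<And>V g s t. open V \<Longrightarrow> V \<subseteq> U \<Longrightarrow> g \<in> carrier (cinf X V) \<Longrightarrow> s \<in> carrier (sec F V) \<Longrightarrow>
      t \<in> carrier (sec G V) \<Longrightarrow> b V (g \<odot>\<^bsub>sec F V\<^esub> s) t = g \<odot>\<^bsub>sec H V\<^esub> b V s t"
    and f: "f \<in> carrier (cinf X U)" and \<xi>: "\<xi> \<in> carrier (sec (tensor X F G) U)"
  shows "tensor_lift X F G H b U (f \<odot>\<^bsub>sec (tensor X F G) U\<^esub> \<xi>) = f \<odot>\<^bsub>sec H U\<^esub> tensor_lift X F G H b U \<xi>"
proof -
  let ?L = "tensor_lift X F G H b" and ?T = "tensor X F G"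
  note L = sheaf_map_below_subset[OF sheaf_map_tensor_lift[OF F G H b] U(2)]
  note maps = sheaf_map_below_smult[OF presheaf_tensor[OF F G] H L U(1) f]
  have "(\<lambda>V \<eta>. ?L V (fres V f \<odot>\<^bsub>sec ?T V\<^esub> \<eta>)) U \<xi> = (\<lambda>V \<eta>. fres V f \<odot>\<^bsub>sec H V\<^esub> ?L V \<eta>) U \<xi>"
  proof (rule tensor_hom_eqI[OF F G H maps(2,1) U(1) order_refl \<xi>])
    fix V s t assume V: "open V" "V \<subseteq> U" and st: "s \<in> carrier (sec F V)" "t \<in> carrier (sec G V)"
    have V0: "V \<subseteq> U0" using V U by auto
    note fV = fres_closed[OF U(1) V f]
    interpret M: module "cinf X V" "sec F V" by (rule presheaf_module[OF F V(1)])
    show "?L V (fres V f \<odot>\<^bsub>sec ?T V\<^esub> pure X F G V s t) = fres V f \<odot>\<^bsub>sec H V\<^esub> ?L V (pure X F G V s t)"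
      unfolding pure_smult_left[OF F G V(1) fV st, symmetric]
      using tensor_lift_pure[OF F G H b V(1) V0] st fV lin[OF V fV st] by simp
  qed
  then show ?thesis by (simp add: fres_cinf_id[OF f])
qed

lemma tensor_lift_hom:
  assumes F: "presheaf_mod X F" and G: "presheaf_mod X G" and H: "sheaf_mod X H" and b: "sheaf_bilinear X F G H b"
  shows "sheaf_hom X (tensor X F G) H (tensor_lift X F G H b)"
proof (rule sheaf_homI)
  note m = sheaf_map_tensor_lift[OF F G H bilinear_balanced[OF b, of UNIV]]
  show "additive_on (sec (tensor X F G) U) (sec H U) (tensor_lift X F G H b U)" if "open U" for U
    by (rule sheaf_map_additive[OF m that]) simp
  show "tensor_lift X F G H b U (f \<odot>\<^bsub>sec (tensor X F G) U\<^esub> s) = f \<odot>\<^bsub>sec H U\<^esub> tensor_lift X F G H b U s"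
    if "open U" "f \<in> carrier (cinf X U)" "s \<in> carrier (sec (tensor X F G) U)" for U f s
    by (rule tensor_lift_linear[OF F G H bilinear_balanced[OF b, of U] that(1) order_refl _ that(2,3)])
      (rule bilinear_smult_left[OF b])
  show "tensor_lift X F G H b V (res (tensor X F G) U V s) = res H U V (tensor_lift X F G H b U s)"
    if "open U" "open V" "V \<subseteq> U" "s \<in> carrier (sec (tensor X F G) U)" for U V s
    by (rule sheaf_map_res[OF m that(1) _ that(2-4)]) simp
qed

lemma tensor_lift_bilinear_pure:
  assumes F: "presheaf_mod X F" and G: "presheaf_mod X G" and H: "sheaf_mod X H" and b: "sheaf_bilinear X F G H b"
    and "open U" "s \<in> carrier (sec F U)" "t \<in> carrier (sec G U)"
  shows "tensor_lift X F G H b U (pure X F G U s t) = b U s t"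
  by (rule tensor_lift_pure[OF F G H bilinear_balanced[OF b, of UNIV] assms(5) _ assms(6,7)]) simp

lemma tensor_sheaf_hom_eqI:
  assumes "presheaf_mod X F" "presheaf_mod X G" "sheaf_mod X H"
    and "sheaf_hom X (tensor X F G) H h" "sheaf_hom X (tensor X F G) H h'"
    and "open U" "\<xi> \<in> carrier (sec (tensor X F G) U)"
    and "\<And>V s t. open V \<Longrightarrow> s \<in> carrier (sec F V) \<Longrightarrow> t \<in> carrier (sec G V) \<Longrightarrow>
      h V (pure X F G V s t) = h' V (pure X F G V s t)"
  shows "h U \<xi> = h' U \<xi>"
  by (rule tensor_hom_eqI[OF assms(1-3) sheaf_hom_map_below[OF assms(4), of U] sheaf_hom_map_below[OF assms(5)] assms(6) order_refl assms(7)])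
    (rule assms(8))

section \<open>Lifting maps in three arguments\<close>

context
  fixes F :: "('x, 'f) osheaf" and G :: "('x, 'g) osheaf" and P :: "('x, 'p) osheaf" and H :: "('x, 'h) osheaf"
    and b :: "'x set \<Rightarrow> 'f \<Rightarrow> 'g \<Rightarrow> 'p \<Rightarrow> 'h"
  assumes F: "presheaf_mod X F" and G: "presheaf_mod X G" and P: "presheaf_mod X P" and H: "sheaf_mod X H"
    and b: "sheaf_trilinear X F G P H b"
begin

text \<open>The third argument is frozen at a section over \<open>U\<close> and restricted as
  needed, so the resulting map makes sense only on open subsets of \<open>U\<close>.\<close>

abbreviation "bb U p \<equiv> (\<lambda>V s t. b V s t (res P U V p))"

lemma trilinear_balanced:
  assumes U: "open U" and p: "p \<in> carrier (sec P U)"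
  shows "balanced_below X U F G H (bb U p)"
proof (rule balanced_belowI)
  note rp = res_closed[OF P U _ _ p]
  show "additive_on (sec F V) (sec H V) (\<lambda>s. b V s t (res P U V p))"
    if "open V" "V \<subseteq> U" "t \<in> carrier (sec G V)" for V t
    by (rule trilinear_1[OF b that(1,3) rp[OF that(1,2)]])
  show "additive_on (sec G V) (sec H V) (\<lambda>t. b V s t (res P U V p))"
    if "open V" "V \<subseteq> U" "s \<in> carrier (sec F V)" for V s
    by (rule trilinear_2[OF b that(1,3) rp[OF that(1,2)]])
  show "b V (f \<odot>\<^bsub>sec F V\<^esub> s) t (res P U V p) = b V s (f \<odot>\<^bsub>sec G V\<^esub> t) (res P U V p)"
    if "open V" "V \<subseteq> U" "f \<in> carrier (cinf X V)" "s \<in> carrier (sec F V)" "t \<in> carrier (sec G V)" for V f s t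
    using trilinear_smult_1[OF b that(1,3-5) rp[OF that(1,2)]] trilinear_smult_2[OF b that(1,3-5) rp[OF that(1,2)]] by simp
  show "b V (res F W V s) (res G W V t) (res P U V p) = res H W V (b W s t (res P U W p))"
    if "open W" "open V" "V \<subseteq> W" "W \<subseteq> U" "s \<in> carrier (sec F W)" "t \<in> carrier (sec G W)" for V W s t
    using trilinear_res[OF b that(1-3,5,6) rp[OF that(1,4)]] res_res[OF P U that(1,4) p that(2,3)] by simp
qed

lemma trilinear_lift_pure:
  assumes "open U" "p \<in> carrier (sec P U)" "open V" "V \<subseteq> U" "s \<in> carrier (sec F V)" "t \<in> carrier (sec G V)"
  shows "tensor_lift X F G H (bb U p) V (pure X F G V s t) = b V s t (res P U V p)"
  by (rule tensor_lift_pure[OF F G H trilinear_balanced[OF assms(1,2)] assms(3-6)])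

text \<open>Changing \<open>p\<close> changes the map that is lifted, so additivity and scaling in
  \<open>p\<close>, and naturality, compare lifts of different balanced maps; each comparison is
  made on pure tensors by \<open>trilinear_lift_pure\<close>.\<close>

lemma trilinear_lift: "sheaf_bilinear X (tensor X F G) P H (\<lambda>U \<xi> p. tensor_lift X F G H (bb U p) U \<xi>)"
proof (rule sheaf_bilinearI)
  fix U :: "'x set" assume U: "open U"
  interpret PU: module "cinf X U" "sec P U" by (rule presheaf_module[OF P U])
  note L = sheaf_map_tensor_lift[OF F G H trilinear_balanced[OF U]]
  show "additive_on (sec (tensor X F G) U) (sec H U) (\<lambda>\<xi>. tensor_lift X F G H (bb U p) U \<xi>)"
    if "p \<in> carrier (sec P U)" for p
    using sheaf_map_additive[OF L[OF that] U order_refl] .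
  show "additive_on (sec P U) (sec H U) (\<lambda>p. tensor_lift X F G H (bb U p) U \<xi>)"
    if \<xi>: "\<xi> \<in> carrier (sec (tensor X F G) U)" for \<xi>
  proof (rule additive_onI)
    show "tensor_lift X F G H (bb U p) U \<xi> \<in> carrier (sec H U)" if "p \<in> carrier (sec P U)" for p
      by (rule additive_on_closed[OF sheaf_map_additive[OF L[OF that] U order_refl] \<xi>])
    fix p q assume p: "p \<in> carrier (sec P U)" and q: "q \<in> carrier (sec P U)"
    show "tensor_lift X F G H (bb U (p \<oplus>\<^bsub>sec P U\<^esub> q)) U \<xi> =
        tensor_lift X F G H (bb U p) U \<xi> \<oplus>\<^bsub>sec H U\<^esub> tensor_lift X F G H (bb U q) U \<xi>"
    proof (rule tensor_hom_eqI[OF F G H L[OF PU.a_closed[OF p q]] sheaf_map_below_add[OF H L[OF p] L[OF q]] U order_refl \<xi>])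
      fix V s t assume V: "open V" "V \<subseteq> U" and st: "s \<in> carrier (sec F V)" "t \<in> carrier (sec G V)"
      show "tensor_lift X F G H (bb U (p \<oplus>\<^bsub>sec P U\<^esub> q)) V (pure X F G V s t) =
        tensor_lift X F G H (bb U p) V (pure X F G V s t) \<oplus>\<^bsub>sec H V\<^esub> tensor_lift X F G H (bb U q) V (pure X F G V s t)"
        unfolding trilinear_lift_pure[OF U PU.a_closed[OF p q] V st] trilinear_lift_pure[OF U p V st]
          trilinear_lift_pure[OF U q V st] res_add[OF P U V p q]
        by (rule additive_on_add[OF trilinear_3[OF b V(1) st] res_closed[OF P U V p] res_closed[OF P U V q]])
    qed
  qed
  fix f \<xi> p assume f: "f \<in> carrier (cinf X U)" and \<xi>: "\<xi> \<in> carrier (sec (tensor X F G) U)" and p: "p \<in> carrier (sec P U)"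
  show "tensor_lift X F G H (bb U p) U (f \<odot>\<^bsub>sec (tensor X F G) U\<^esub> \<xi>) = f \<odot>\<^bsub>sec H U\<^esub> tensor_lift X F G H (bb U p) U \<xi>"
    by (rule tensor_lift_linear[OF F G H trilinear_balanced[OF U p] U order_refl _ f \<xi>])
      (rule trilinear_smult_1[OF b]; (assumption | rule res_closed[OF P U _ _ p]))
  have "tensor_lift X F G H (bb U (f \<odot>\<^bsub>sec P U\<^esub> p)) U \<xi> = fres U f \<odot>\<^bsub>sec H U\<^esub> tensor_lift X F G H (bb U p) U \<xi>"
  proof (rule tensor_hom_eqI[OF F G H L[OF PU.smult_closed[OF f p]] sheaf_map_below_smult(1)[OF presheaf_tensor[OF F G] H L[OF p] U f] U order_refl \<xi>])
    fix V s t assume V: "open V" "V \<subseteq> U" and st: "s \<in> carrier (sec F V)" "t \<in> carrier (sec G V)"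
    show "tensor_lift X F G H (bb U (f \<odot>\<^bsub>sec P U\<^esub> p)) V (pure X F G V s t) =
        fres V f \<odot>\<^bsub>sec H V\<^esub> tensor_lift X F G H (bb U p) V (pure X F G V s t)"
      unfolding trilinear_lift_pure[OF U PU.smult_closed[OF f p] V st] trilinear_lift_pure[OF U p V st]
        res_smult[OF P U V p f]
      by (rule trilinear_smult_3[OF b V(1) fres_closed[OF U V f] st res_closed[OF P U V p]])
  qed
  then show "tensor_lift X F G H (bb U (f \<odot>\<^bsub>sec P U\<^esub> p)) U \<xi> = f \<odot>\<^bsub>sec H U\<^esub> tensor_lift X F G H (bb U p) U \<xi>"
    by (simp add: fres_cinf_id[OF f])
next
  fix U V \<xi> p assume UV: "open U" "open V" "V \<subseteq> U" and \<xi>: "\<xi> \<in> carrier (sec (tensor X F G) U)" and p: "p \<in> carrier (sec P U)"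
  note L = sheaf_map_tensor_lift[OF F G H trilinear_balanced[OF UV(1) p]]
  note rp = res_closed[OF P UV p]
  have "tensor_lift X F G H (bb V (res P U V p)) V (res (tensor X F G) U V \<xi>) = tensor_lift X F G H (bb U p) V (res (tensor X F G) U V \<xi>)"
  proof (rule tensor_hom_eqI[OF F G H sheaf_map_tensor_lift[OF F G H trilinear_balanced[OF UV(2) rp]] sheaf_map_below_subset[OF L UV(3)] UV(2) order_refl
        res_closed[OF presheaf_tensor[OF F G] UV \<xi>]])
    fix W s t assume W: "open W" "W \<subseteq> V" and st: "s \<in> carrier (sec F W)" "t \<in> carrier (sec G W)"
    show "tensor_lift X F G H (bb V (res P U V p)) W (pure X F G W s t) = tensor_lift X F G H (bb U p) W (pure X F G W s t)"
      using trilinear_lift_pure[OF UV(2) rp W st] trilinear_lift_pure[OF UV(1) p W(1) order_trans[OF W(2) UV(3)] st]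
        res_res[OF P UV p W] by simp
  qed
  also have "\<dots> = res H U V (tensor_lift X F G H (bb U p) U \<xi>)"
    by (rule sheaf_map_res[OF L UV(1) order_refl UV(2,3) \<xi>])
  finally show "tensor_lift X F G H (bb V (res P U V p)) V (res (tensor X F G) U V \<xi>) = res H U V (tensor_lift X F G H (bb U p) U \<xi>)" .
qed

end

subsection \<open>Functoriality, associativity and exchange\<close>

lemma bilinear_comp_hom:
  assumes F: "presheaf_mod X F" and G: "presheaf_mod X G" and b: "sheaf_bilinear X F' G' H b"
    and u: "sheaf_hom X F F' u" and v: "sheaf_hom X G G' v"
  shows "sheaf_bilinear X F G H (\<lambda>V s t. b V (u V s) (v V t))"
proof (rule sheaf_bilinearI)
  fix U :: "'x set" assume U: "open U"
  note uc = sheaf_hom_closed[OF u U] and vc = sheaf_hom_closed[OF v U]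
  show "additive_on (sec F U) (sec H U) (\<lambda>s. b U (u U s) (v U t))" if "t \<in> carrier (sec G U)" for t
    using bilinear_left[OF b U vc[OF that]] by (simp add: additive_on_def uc sheaf_hom_add[OF u U])
  show "additive_on (sec G U) (sec H U) (\<lambda>t. b U (u U s) (v U t))" if "s \<in> carrier (sec F U)" for s
    using bilinear_right[OF b U uc[OF that]] by (simp add: additive_on_def vc sheaf_hom_add[OF v U])
  fix f s t assume "f \<in> carrier (cinf X U)" "s \<in> carrier (sec F U)" "t \<in> carrier (sec G U)"
  then show "b U (u U (f \<odot>\<^bsub>sec F U\<^esub> s)) (v U t) = f \<odot>\<^bsub>sec H U\<^esub> b U (u U s) (v U t)"
    "b U (u U s) (v U (f \<odot>\<^bsub>sec G U\<^esub> t)) = f \<odot>\<^bsub>sec H U\<^esub> b U (u U s) (v U t)"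
    by (simp_all add: sheaf_hom_smult[OF u U] sheaf_hom_smult[OF v U] uc vc bilinear_smult_left[OF b U] bilinear_smult_right[OF b U])
next
  fix U V s t assume UV: "open U" "open V" "V \<subseteq> U" and "s \<in> carrier (sec F U)" "t \<in> carrier (sec G U)"
  then show "b V (u V (res F U V s)) (v V (res G U V t)) = res H U V (b U (u U s) (v U t))"
    by (simp add: sheaf_hom_res[OF u] sheaf_hom_res[OF v] sheaf_hom_closed[OF u] sheaf_hom_closed[OF v] bilinear_res[OF b])
qed

lemma
  assumes F: "presheaf_mod X F" and G: "presheaf_mod X G" and F': "presheaf_mod X F'" and G': "presheaf_mod X G'"
    and u: "sheaf_hom X F F' u" and v: "sheaf_hom X G G' v"
  shows tensor_map_hom: "sheaf_hom X (tensor X F G) (tensor X F' G') (tensor_map X F G F' G' u v)"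
    and tensor_map_pure: "open U \<Longrightarrow> s \<in> carrier (sec F U) \<Longrightarrow> t \<in> carrier (sec G U) \<Longrightarrow>
      tensor_map X F G F' G' u v U (pure X F G U s t) = pure X F' G' U (u U s) (v U t)"
proof -
  note b = bilinear_comp_hom[OF F G bilinear_pure[OF F' G'] u v]
  show "sheaf_hom X (tensor X F G) (tensor X F' G') (tensor_map X F G F' G' u v)"
    unfolding tensor_map_def by (rule tensor_lift_hom[OF F G sheaf_tensor[OF F' G'] b])
  show "tensor_map X F G F' G' u v U (pure X F G U s t) = pure X F' G' U (u U s) (v U t)"
    if "open U" "s \<in> carrier (sec F U)" "t \<in> carrier (sec G U)"
    unfolding tensor_map_def by (rule tensor_lift_bilinear_pure[OF F G sheaf_tensor[OF F' G'] b that])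
qed

lemma sheaf_hom_id: "sheaf_hom X F F id_hom"
  by (simp add: sheaf_hom_def)

lemma sheaf_hom_comp: "sheaf_hom X F G h \<Longrightarrow> sheaf_hom X G H k \<Longrightarrow> sheaf_hom X F H (\<lambda>U s. k U (h U s))"
  by (rule sheaf_homI)
    (simp_all add: additive_on_def sheaf_hom_closed sheaf_hom_add sheaf_hom_smult sheaf_hom_res)

text \<open>The same expression in two argument orders: the argument frozen during the inner lift
  must come last, which is the section of \<open>H\<close> for \<open>assoc\<close> and that of
  \<open>G\<close> for \<open>exchange\<close>.\<close>

lemma trilinear_pure_pure:
  assumes F: "presheaf_mod X F" and G: "presheaf_mod X G" and H: "presheaf_mod X H"
  shows "sheaf_trilinear X F G H (tensor X F (tensor X G H)) (\<lambda>V s t w. pure X F (tensor X G H) V s (pure X G H V t w))"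
    and "sheaf_trilinear X F H G (tensor X F (tensor X G H)) (\<lambda>V s w t. pure X F (tensor X G H) V s (pure X G H V t w))"
proof -
  note GH = presheaf_tensor[OF G H]
  note p = pure_closed[OF F GH] pure_add_left[OF F GH] pure_add_right[OF F GH] pure_smult_left[OF F GH] pure_smult_right[OF F GH] pure_res[OF F GH]
  note q = pure_closed[OF G H] pure_add_left[OF G H] pure_add_right[OF G H] pure_smult_left[OF G H] pure_smult_right[OF G H] pure_res[OF G H]
  show "sheaf_trilinear X F G H (tensor X F (tensor X G H)) (\<lambda>V s t w. pure X F (tensor X G H) V s (pure X G H V t w))"
    by (simp add: sheaf_trilinear_def additive_on_def p q)
  show "sheaf_trilinear X F H G (tensor X F (tensor X G H)) (\<lambda>V s w t. pure X F (tensor X G H) V s (pure X G H V t w))"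
    by (simp add: sheaf_trilinear_def additive_on_def p q)
qed

lemma
  assumes F: "presheaf_mod X F" and G: "presheaf_mod X G" and H: "presheaf_mod X H"
  shows assoc_hom: "sheaf_hom X (tensor X (tensor X F G) H) (tensor X F (tensor X G H)) (assoc X F G H)"
    and assoc_pure: "open U \<Longrightarrow> s \<in> carrier (sec F U) \<Longrightarrow> t \<in> carrier (sec G U) \<Longrightarrow> w \<in> carrier (sec H U) \<Longrightarrow>
      assoc X F G H U (pure X (tensor X F G) H U (pure X F G U s t) w) = pure X F (tensor X G H) U s (pure X G H U t w)"
    and exchange_hom: "sheaf_hom X (tensor X G (tensor X F H)) (tensor X F (tensor X G H)) (exchange X F G H)"
    and exchange_pure: "open U \<Longrightarrow> s \<in> carrier (sec F U) \<Longrightarrow> t \<in> carrier (sec G U) \<Longrightarrow> w \<in> carrier (sec H U) \<Longrightarrow>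
      exchange X F G H U (pure X G (tensor X F H) U t (pure X F H U s w)) = pure X F (tensor X G H) U s (pure X G H U t w)"
proof -
  note FG = presheaf_tensor[OF F G] and FH = presheaf_tensor[OF F H] and GH = presheaf_tensor[OF G H]
  note K = sheaf_tensor[OF F GH]
  note t = trilinear_pure_pure[OF F G H]
  note b1 = trilinear_lift[OF F G H K t(1)] and b2 = bilinear_swap[OF trilinear_lift[OF F H G K t(2)]]
  show "sheaf_hom X (tensor X (tensor X F G) H) (tensor X F (tensor X G H)) (assoc X F G H)"
    unfolding assoc_def by (rule tensor_lift_hom[OF FG H K b1])
  show "sheaf_hom X (tensor X G (tensor X F H)) (tensor X F (tensor X G H)) (exchange X F G H)"
    unfolding exchange_def by (rule tensor_lift_hom[OF G FH K b2])
  assume U: "open U" and s: "s \<in> carrier (sec F U)" and t': "t \<in> carrier (sec G U)" and w: "w \<in> carrier (sec H U)"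
  show "assoc X F G H U (pure X (tensor X F G) H U (pure X F G U s t) w) = pure X F (tensor X G H) U s (pure X G H U t w)"
    unfolding assoc_def tensor_lift_bilinear_pure[OF FG H K b1 U pure_closed[OF F G U s t'] w]
      trilinear_lift_pure[OF F G H K t(1) U w U order_refl s t'] res_id[OF H U w] ..
  show "exchange X F G H U (pure X G (tensor X F H) U t (pure X F H U s w)) = pure X F (tensor X G H) U s (pure X G H U t w)"
    unfolding exchange_def tensor_lift_bilinear_pure[OF G FH K b2 U t' pure_closed[OF F H U s w]]
      trilinear_lift_pure[OF F H G K t(2) U t' U order_refl s w] res_id[OF G U t'] ..
qed

lemma tensor_map_comp:
  assumes "presheaf_mod X F" "presheaf_mod X G" "presheaf_mod X F'" "presheaf_mod X G'" "presheaf_mod X F''" "presheaf_mod X G''"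
    and "sheaf_hom X F F' u" "sheaf_hom X G G' v" "sheaf_hom X F' F'' u'" "sheaf_hom X G' G'' v'"
    and "open U" "\<xi> \<in> carrier (sec (tensor X F G) U)"
  shows "tensor_map X F' G' F'' G'' u' v' U (tensor_map X F G F' G' u v U \<xi>) =
    tensor_map X F G F'' G'' (\<lambda>U s. u' U (u U s)) (\<lambda>U t. v' U (v U t)) U \<xi>"
  by (rule tensor_sheaf_hom_eqI[OF assms(1,2) sheaf_tensor[OF assms(5,6)]
        sheaf_hom_comp[OF tensor_map_hom[OF assms(1-4,7,8)] tensor_map_hom[OF assms(3-6,9,10)]]
        tensor_map_hom[OF assms(1,2,5,6) sheaf_hom_comp[OF assms(7,9)] sheaf_hom_comp[OF assms(8,10)]] assms(11,12)])
    (simp add: tensor_map_pure[OF assms(1-4,7,8)] tensor_map_pure[OF assms(3-6,9,10)]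
      tensor_map_pure[OF assms(1,2,5,6) sheaf_hom_comp[OF assms(7,9)] sheaf_hom_comp[OF assms(8,10)]]
      sheaf_hom_closed[OF assms(7)] sheaf_hom_closed[OF assms(8)])

lemma tensor_map_id:
  assumes "presheaf_mod X F" "presheaf_mod X G" "open U" "\<xi> \<in> carrier (sec (tensor X F G) U)"
  shows "tensor_map X F G F G id_hom id_hom U \<xi> = \<xi>"
  by (rule tensor_sheaf_hom_eqI[OF assms(1,2) sheaf_tensor[OF assms(1,2)]
        tensor_map_hom[OF assms(1,2,1,2) sheaf_hom_id sheaf_hom_id] sheaf_hom_id assms(3,4)])
    (simp add: tensor_map_pure[OF assms(1,2,1,2) sheaf_hom_id sheaf_hom_id])

lemma tensor_map_cong:
  assumes "presheaf_mod X F" "presheaf_mod X G" "presheaf_mod X F'" "presheaf_mod X G'"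
    and "sheaf_hom X F F' u" "sheaf_hom X G G' v" "sheaf_hom X F F' u'" "sheaf_hom X G G' v'"
    and "open U" "\<xi> \<in> carrier (sec (tensor X F G) U)"
    and "\<And>V s. open V \<Longrightarrow> s \<in> carrier (sec F V) \<Longrightarrow> u V s = u' V s"
    and "\<And>V t. open V \<Longrightarrow> t \<in> carrier (sec G V) \<Longrightarrow> v V t = v' V t"
  shows "tensor_map X F G F' G' u v U \<xi> = tensor_map X F G F' G' u' v' U \<xi>"
  by (rule tensor_sheaf_hom_eqI[OF assms(1,2) sheaf_tensor[OF assms(3,4)]
        tensor_map_hom[OF assms(1-6)] tensor_map_hom[OF assms(1-4,7,8)] assms(9,10)])
    (simp add: tensor_map_pure[OF assms(1-6)] tensor_map_pure[OF assms(1-4,7,8)] assms(11,12))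

end

section \<open>Smooth functions and one-forms on a manifold\<close>

text \<open>Changing a coordinate below \<open>n\<close> keeps all entries from \<open>n\<close> on
  zero, so the coordinate line maps continuously into the model space. Hence partial derivatives at
  points of an open \<open>W\<close> depend only on values on \<open>W\<close>.\<close>

lemma openin_Euclidean_line:
  assumes W: "openin (Euclidean_space n) W" and p: "p \<in> W" and i: "i < n"
  shows "eventually (\<lambda>t. p(i := t) \<in> W) (nhds (p i))"
proof -
  have pn: "\<forall>j\<ge>n. p j = 0" using openin_subset[OF W] p by (auto simp: topspace_Euclidean_space)
  have "continuous_map euclideanreal (Euclidean_space n) (\<lambda>t. p(i := t))"
    unfolding Euclidean_space_def continuous_map_in_subtopology continuous_map_componentwise_UNIV
    using pn i by (auto simp: fun_upd_def image_subset_iff)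
  then have "openin euclideanreal {t \<in> topspace euclideanreal. p(i := t) \<in> W}"
    using W openin_continuous_map_preimage by blast
  then have "open {t. p(i := t) \<in> W}" by simp
  then show ?thesis using p by (auto simp: eventually_nhds)
qed

text \<open>Near each point of \<open>W\<close> the functions agree along coordinate lines and so
  have the same derivatives there; the induction passes to their partial derivatives, which are
  again equal on \<open>W\<close>.\<close>

lemma Ck_on_cong:
  assumes W: "openin (Euclidean_space n) W"
  shows "Ck_on n k W f \<Longrightarrow> (\<And>p. p \<in> W \<Longrightarrow> f p = g p) \<Longrightarrow> Ck_on n k W g"
proof (induction k arbitrary: f g)
  case 0
  then show ?case by (auto intro: continuous_map_eq)
next
  case (Suc k)
  have ev: "eventually (\<lambda>t. f (p(i := t)) = g (p(i := t))) (nhds (p i))" if "p \<in> W" "i < n" for p i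
    using openin_Euclidean_line[OF W that] by eventually_elim (rule Suc.prems(2))
  show ?case
    unfolding Ck_on.simps
  proof (intro conjI allI impI ballI)
    show "continuous_map (subtopology (Euclidean_space n) W) euclideanreal g"
      using Suc.prems by (auto intro: continuous_map_eq)
    fix i assume i: "i < n"
    show "(\<lambda>t. g (p(i := t))) differentiable (at (p i))" if p: "p \<in> W" for p
    proof -
      obtain D where "((\<lambda>t. f (p(i := t))) has_real_derivative D) (at (p i))"
        using Suc.prems(1) i p by (auto simp: real_differentiable_def)
      then have "((\<lambda>t. g (p(i := t))) has_real_derivative D) (at (p i))"
        by (subst (asm) DERIV_cong_ev[OF refl ev[OF p i] refl])
      then show ?thesis by (auto simp: real_differentiable_def)
    qed
    show "Ck_on n k W (partial_deriv i g)"
    proof (rule Suc.IH)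
      show "Ck_on n k W (partial_deriv i f)" using Suc.prems(1) i by simp
      show "partial_deriv i f p = partial_deriv i g p" if "p \<in> W" for p
        unfolding partial_deriv_def by (rule deriv_cong_ev[OF ev[OF that i] refl])
    qed
  qed
qed

lemma Ck_on_mono: "Ck_on n k W f \<Longrightarrow> W' \<subseteq> W \<Longrightarrow> Ck_on n k W' f"
  by (induction k arbitrary: f) (auto intro: continuous_map_from_subtopology_mono)

lemma Ck_on_const: "Ck_on n k W (\<lambda>p. c)"
  by (induction k arbitrary: c) (simp_all add: partial_deriv_def[abs_def])

lemma Ck_on_SucD: "Ck_on n (Suc k) W f \<Longrightarrow> Ck_on n k W f"
  by (induction k arbitrary: f) auto

lemma DERIV_deriv_real:
  "(h :: real \<Rightarrow> real) differentiable (at a) \<Longrightarrow> (h has_real_derivative deriv h a) (at a)"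
  by (metis DERIV_imp_deriv real_differentiableE)

lemma Ck_on_add:
  assumes W: "openin (Euclidean_space n) W"
  shows "Ck_on n k W f \<Longrightarrow> Ck_on n k W g \<Longrightarrow> Ck_on n k W (\<lambda>p. f p + g p)"
proof (induction k arbitrary: f g)
  case 0
  then show ?case by (simp add: continuous_map_add)
next
  case (Suc k)
  show ?case
    unfolding Ck_on.simps
  proof (intro conjI allI impI ballI)
    show "continuous_map (subtopology (Euclidean_space n) W) euclideanreal (\<lambda>p. f p + g p)"
      using Suc.prems by (simp add: continuous_map_add)
    fix i assume i: "i < n"
    show "(\<lambda>t. f (p(i := t)) + g (p(i := t))) differentiable (at (p i))" if p: "p \<in> W" for p
      using Suc.prems i p by simp
    show "Ck_on n k W (partial_deriv i (\<lambda>p. f p + g p))"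
    proof (rule Ck_on_cong[OF W])
      show "Ck_on n k W (\<lambda>p. partial_deriv i f p + partial_deriv i g p)"
        using Suc i by simp
      show "partial_deriv i f p + partial_deriv i g p = partial_deriv i (\<lambda>p. f p + g p) p" if p: "p \<in> W" for p
        unfolding partial_deriv_def using Suc.prems i p
        by (intro DERIV_imp_deriv[symmetric] DERIV_add DERIV_deriv_real) auto
    qed
  qed
qed

text \<open>By the product rule the partial derivatives are sums of products, in which the
  undifferentiated factors are used with one order of smoothness less.\<close>

lemma Ck_on_mult:
  assumes W: "openin (Euclidean_space n) W"
  shows "Ck_on n k W f \<Longrightarrow> Ck_on n k W g \<Longrightarrow> Ck_on n k W (\<lambda>p. f p * g p)"
proof (induction k arbitrary: f g)
  case 0
  then show ?case by (simp add: continuous_map_real_mult)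
next
  case (Suc k)
  show ?case
    unfolding Ck_on.simps
  proof (intro conjI allI impI ballI)
    show "continuous_map (subtopology (Euclidean_space n) W) euclideanreal (\<lambda>p. f p * g p)"
      using Suc.prems by (simp add: continuous_map_real_mult)
    fix i assume i: "i < n"
    show "(\<lambda>t. f (p(i := t)) * g (p(i := t))) differentiable (at (p i))" if p: "p \<in> W" for p
      using Suc.prems i p by simp
    show "Ck_on n k W (partial_deriv i (\<lambda>p. f p * g p))"
    proof (rule Ck_on_cong[OF W])
      show "Ck_on n k W (\<lambda>p. partial_deriv i f p * g p + partial_deriv i g p * f p)"
        using Suc.prems i Ck_on_SucD[OF Suc.prems(1)] Ck_on_SucD[OF Suc.prems(2)]
        by (intro Ck_on_add[OF W] Suc.IH) auto
      show "partial_deriv i f p * g p + partial_deriv i g p * f p = partial_deriv i (\<lambda>p. f p * g p) p" if p: "p \<in> W" for p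
      proof -
        have "((\<lambda>t. f (p(i := t)) * g (p(i := t))) has_real_derivative
            partial_deriv i f p * g (p(i := p i)) + partial_deriv i g p * f (p(i := p i))) (at (p i))"
          unfolding partial_deriv_def using Suc.prems i p by (intro DERIV_mult DERIV_deriv_real) auto
        then show ?thesis unfolding partial_deriv_def[of i "\<lambda>p. f p * g p"] by (simp add: DERIV_imp_deriv)
      qed
    qed
  qed
qed

text \<open>\<open>smooth_on\<close> tests a function on these images; their openness in the model
  space makes \<open>Ck_on_cong\<close> and the sum and product rules applicable.\<close>

lemma chart_image_openin:
  assumes "smooth_manifold X" "(W, \<kappa>) \<in> charts X" "open U"
  shows "openin (Euclidean_space (mdim X)) (\<kappa> ` (U \<inter> W))" "inj_on \<kappa> W"
proof -
  obtain W' where W: "open W" "openin (Euclidean_space (mdim X)) W'"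
    "homeomorphic_map (subtopology euclidean W) (subtopology (Euclidean_space (mdim X)) W') \<kappa>"
    using assms(1,2) unfolding smooth_manifold_def by fast
  have "open_map (subtopology euclidean W) (subtopology (Euclidean_space (mdim X)) W') \<kappa>"
    using W(3) homeomorphic_imp_open_map by blast
  moreover have "openin (subtopology euclidean W) (U \<inter> W)"
    using assms(3) by (metis openin_open_Int Int_commute)
  ultimately have "openin (subtopology (Euclidean_space (mdim X)) W') (\<kappa> ` (U \<inter> W))"
    by (simp add: open_map_def)
  then show "openin (Euclidean_space (mdim X)) (\<kappa> ` (U \<inter> W))"
    using W(2) openin_trans_full by blast
  show "inj_on \<kappa> W"
    using homeomorphic_imp_injective_map[OF W(3)] by simp
qed

locale manifold =
  fixes X :: "'x::{t2_space, second_countable_topology} smooth_structure"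
  assumes X: "smooth_manifold X"
begin

text \<open>Elements of the rings \<open>cinf X U\<close> are normalized to zero off
  \<open>U\<close>, whereas smoothness is proved for unnormalized functions with the same values on
  \<open>U\<close>.\<close>

lemma smooth_on_cong:
  assumes "open U" "smooth_on X U f" "\<And>x. x \<in> U \<Longrightarrow> f x = g x"
  shows "smooth_on X U g"
  unfolding smooth_on_def smooth_euclidean_def
proof (intro ballI, clarify)
  fix W \<kappa> k assume c: "(W, \<kappa>) \<in> charts X"
  note i = chart_image_openin[OF X c assms(1)]
  have "Ck_on (mdim X) k (\<kappa> ` (U \<inter> W)) (\<lambda>p. f (inv_into W \<kappa> p))"
    using assms(2) c unfolding smooth_on_def smooth_euclidean_def by fast
  then show "Ck_on (mdim X) k (\<kappa> ` (U \<inter> W)) (\<lambda>p. g (inv_into W \<kappa> p))"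
    by (rule Ck_on_cong[OF i(1)]) (use i(2) assms(3) in auto)
qed

lemma smooth_on_mono: "smooth_on X U f \<Longrightarrow> V \<subseteq> U \<Longrightarrow> smooth_on X V f"
  unfolding smooth_on_def smooth_euclidean_def by (fast intro: Ck_on_mono)

lemma smooth_on_const: "smooth_on X U (\<lambda>x. c)"
  unfolding smooth_on_def smooth_euclidean_def by (simp add: Ck_on_const)

lemma smooth_on_add: "open U \<Longrightarrow> smooth_on X U f \<Longrightarrow> smooth_on X U g \<Longrightarrow> smooth_on X U (\<lambda>x. f x + g x)"
  unfolding smooth_on_def smooth_euclidean_def by (fast intro: Ck_on_add chart_image_openin[OF X])

lemma smooth_on_mult: "open U \<Longrightarrow> smooth_on X U f \<Longrightarrow> smooth_on X U g \<Longrightarrow> smooth_on X U (\<lambda>x. f x * g x)"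
  unfolding smooth_on_def smooth_euclidean_def by (fast intro: Ck_on_mult chart_image_openin[OF X])

lemma cring_cinf_manifold:
  assumes U: "open U"
  shows "cring (cinf X U)"
proof -
  have one: "smooth_on X U (\<lambda>x. if x \<in> U then 1 else 0)"
    by (rule smooth_on_cong[OF U smooth_on_const[of U 1]]) simp
  have neg: "\<exists>y\<in>carrier (cinf X U). y \<oplus>\<^bsub>cinf X U\<^esub> f = \<zero>\<^bsub>cinf X U\<^esub>" if "f \<in> carrier (cinf X U)" for f
    using that smooth_on_mult[OF U smooth_on_const[of U "-1"], of f]
    by (intro bexI[of _ "\<lambda>x. - f x"]) (auto simp: cinf_def)
  show ?thesis
    by (intro cringI abelian_groupI comm_monoidI neg)
      (auto simp: cinf_def algebra_simps fun_eq_iff intro: one smooth_on_const smooth_on_add[OF U] smooth_on_mult[OF U])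
qed

lemma fres_closed_manifold:
  assumes "open V" "V \<subseteq> U" "f \<in> carrier (cinf X U)"
  shows "fres V f \<in> carrier (cinf X V)"
proof -
  have "smooth_on X V (fres V f)"
    by (rule smooth_on_cong[OF assms(1), of f]) (use assms in \<open>auto simp: cinf_def fres_def intro: smooth_on_mono\<close>)
  then show ?thesis by (simp add: cinf_def fres_def)
qed

sublocale smooth_functions X
  by (intro smooth_functions.intro cring_cinf_manifold fres_closed_manifold)

section \<open>One-forms and differentials\<close>

lemma tangent_space_add: "v \<in> tangent_space X x \<Longrightarrow> w \<in> tangent_space X x \<Longrightarrow> (\<lambda>f. v f + w f) \<in> tangent_space X x"
  unfolding tangent_space_def mem_Collect_eq by (simp add: algebra_simps) metis

lemma tangent_space_scale: "v \<in> tangent_space X x \<Longrightarrow> (\<lambda>f. c * v f) \<in> tangent_space X x"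
  unfolding tangent_space_def mem_Collect_eq by (simp add: algebra_simps)

lemma cotangent_carrier:
  "\<omega> \<in> carrier (sec (cotangent X) U) \<longleftrightarrow> (\<forall>x\<in>U. \<omega> x \<in> cotangent_space X x) \<and>
     (\<forall>x. x \<notin> U \<longrightarrow> \<omega> x = (\<lambda>_. 0)) \<and>
     (\<forall>V D. open V \<and> V \<subseteq> U \<and> smooth_vector_field X V D \<longrightarrow> smooth_on X V (\<lambda>x. \<omega> x (D x)))"
  by (simp add: cotangent_def)

lemma cotangent_ops:
  "\<zero>\<^bsub>sec (cotangent X) U\<^esub> = (\<lambda>x v. 0)"
  "\<omega> \<oplus>\<^bsub>sec (cotangent X) U\<^esub> \<eta> = (\<lambda>x v. \<omega> x v + \<eta> x v)"
  "f \<odot>\<^bsub>sec (cotangent X) U\<^esub> \<omega> = (\<lambda>x v. f x * \<omega> x v)"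
  "res (cotangent X) U V \<omega> = (\<lambda>x. if x \<in> V then \<omega> x else (\<lambda>_. 0))"
  by (simp_all add: cotangent_def)

lemma cotangent_add_closed:
  assumes "\<omega> \<in> carrier (sec (cotangent X) U)" "\<eta> \<in> carrier (sec (cotangent X) U)"
  shows "\<omega> \<oplus>\<^bsub>sec (cotangent X) U\<^esub> \<eta> \<in> carrier (sec (cotangent X) U)"
  using assms unfolding cotangent_carrier cotangent_ops
  by (auto simp: cotangent_space_def algebra_simps intro!: smooth_on_add)

lemma cotangent_smult_closed:
  assumes "smooth_on X U f" "\<omega> \<in> carrier (sec (cotangent X) U)"
  shows "f \<odot>\<^bsub>sec (cotangent X) U\<^esub> \<omega> \<in> carrier (sec (cotangent X) U)"
  using assms unfolding cotangent_carrier cotangent_ops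
  by (auto simp: cotangent_space_def algebra_simps intro!: smooth_on_mult intro: smooth_on_mono)

lemma cotangent_res_closed:
  assumes "open V" "V \<subseteq> U" "\<omega> \<in> carrier (sec (cotangent X) U)"
  shows "res (cotangent X) U V \<omega> \<in> carrier (sec (cotangent X) V)"
  unfolding cotangent_carrier
proof (intro conjI allI impI ballI; (elim conjE)?)
  show "res (cotangent X) U V \<omega> x \<in> cotangent_space X x" if "x \<in> V" for x
    using assms that by (auto simp: cotangent_carrier cotangent_ops)
  show "res (cotangent X) U V \<omega> x = (\<lambda>_. 0)" if "x \<notin> V" for x
    using that by (simp add: cotangent_ops)
  fix W D assume W: "open W" "W \<subseteq> V" "smooth_vector_field X W D"
  have "smooth_on X W (\<lambda>x. \<omega> x (D x))"
    using assms W unfolding cotangent_carrier by (meson order_trans)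
  then show "smooth_on X W (\<lambda>x. res (cotangent X) U V \<omega> x (D x))"
    by (rule smooth_on_cong[OF W(1)]) (use W in \<open>auto simp: cotangent_ops\<close>)
qed

lemma presheaf_cotangent: "presheaf_mod X (cotangent X)"
  unfolding presheaf_mod_def
proof (intro conjI allI impI ballI; (elim conjE)?)
  fix U :: "'x set" assume U: "open U"
  show "module (cinf X U) (sec (cotangent X) U)"
  proof (intro moduleI cring_cinf_manifold[OF U] abelian_groupI)
    show "\<zero>\<^bsub>sec (cotangent X) U\<^esub> \<in> carrier (sec (cotangent X) U)"
      by (auto simp: cotangent_carrier cotangent_ops cotangent_space_def smooth_on_const)
    show "\<exists>\<eta>\<in>carrier (sec (cotangent X) U). \<eta> \<oplus>\<^bsub>sec (cotangent X) U\<^esub> \<omega> = \<zero>\<^bsub>sec (cotangent X) U\<^esub>"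
      if "\<omega> \<in> carrier (sec (cotangent X) U)" for \<omega>
      using cotangent_smult_closed[OF smooth_on_const[of U "-1"] that]
      \<comment> \<open>The constant -1 is in general not normalized off \<open>U\<close> and then
        no element of the ring, but \<open>cotangent_smult_closed\<close> asks only for smoothness
        on \<open>U\<close>.\<close>
      by (intro bexI[of _ "(\<lambda>x. -1) \<odot>\<^bsub>sec (cotangent X) U\<^esub> \<omega>"]) (simp_all add: cotangent_ops)
    show "\<one>\<^bsub>cinf X U\<^esub> \<odot>\<^bsub>sec (cotangent X) U\<^esub> \<omega> = \<omega>" if "\<omega> \<in> carrier (sec (cotangent X) U)" for \<omega>
      using that by (auto simp: cotangent_carrier cotangent_ops cinf_def fun_eq_iff)
    show "f \<odot>\<^bsub>sec (cotangent X) U\<^esub> \<omega> \<in> carrier (sec (cotangent X) U)"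
      if "f \<in> carrier (cinf X U)" "\<omega> \<in> carrier (sec (cotangent X) U)" for f \<omega>
      using that by (intro cotangent_smult_closed) (auto simp: cinf_def)
  qed (simp_all add: cotangent_add_closed, simp_all add: cotangent_ops cinf_def fun_eq_iff algebra_simps)
next
  fix U :: "'x set" and \<omega> assume "\<omega> \<in> carrier (sec (cotangent X) U)"
  then show "res (cotangent X) U U \<omega> = \<omega>" by (auto simp: cotangent_carrier cotangent_ops fun_eq_iff)
next
  fix U V W :: "'x set" and \<omega> assume "W \<subseteq> V"
  then show "res (cotangent X) V W (res (cotangent X) U V \<omega>) = res (cotangent X) U W \<omega>"
    by (auto simp: cotangent_ops fun_eq_iff)
qed (auto simp: cotangent_res_closed, auto simp: cotangent_ops fres_def fun_eq_iff)

text \<open>Pairing the differential with a vector field gives the derivative of \<open>f\<close>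
  along it, which is smooth by the definition of a smooth vector field.\<close>

lemma differential_closed:
  assumes U: "open U" and f: "f \<in> carrier (cinf X U)"
  shows "differential X U f \<in> carrier (sec (cotangent X) U)"
  unfolding cotangent_carrier
proof (intro conjI allI impI ballI; (elim conjE)?)
  show "differential X U f x \<in> cotangent_space X x" if "x \<in> U" for x
    using that by (auto simp: differential_def cotangent_space_def tangent_space_add tangent_space_scale)
  fix W D assume W: "open W" "W \<subseteq> U" "smooth_vector_field X W D"
  have "smooth_on X W f" using f W smooth_on_mono by (auto simp: cinf_def)
  then have "smooth_on X W (\<lambda>x. D x f)" using W by (simp add: smooth_vector_field_def)
  then show "smooth_on X W (\<lambda>x. differential X U f x (D x))"
    by (rule smooth_on_cong[OF W(1)]) (use W in \<open>auto simp: differential_def smooth_vector_field_def\<close>)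
qed (auto simp: differential_def)

text \<open>\<open>f\<close> and \<open>fres V f\<close> have the same germ at points of
  \<open>V\<close>, and tangent vectors depend only on germs.\<close>

lemma differential_res:
  assumes "open U" "open V" "V \<subseteq> U" "f \<in> carrier (cinf X U)"
  shows "differential X V (fres V f) = res (cotangent X) U V (differential X U f)"
proof (intro ext)
  fix x v
  have "v (fres V f) = v f" if "x \<in> V" "v \<in> tangent_space X x"
  proof -
    have "smooth_near X x f" "smooth_near X x (fres V f)"
      using assms that fres_closed_manifold[OF assms(2-4)] by (auto simp: smooth_near_def cinf_def)
    moreover have "\<forall>y\<in>V. fres V f y = f y" by (simp add: fres_def)
    ultimately show ?thesis
      using that assms(2) unfolding tangent_space_def mem_Collect_eq by blast
  qed
  then show "differential X V (fres V f) x v = res (cotangent X) U V (differential X U f) x v"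
    using assms(3) by (auto simp: differential_def cotangent_ops)
qed

end

section \<open>Connections\<close>

context manifold
begin

abbreviation "T \<equiv> cotangent X"

lemma
  assumes "connection X E D" "open U" "s \<in> carrier (sec E U)"
  shows connection_closed: "D U s \<in> carrier (sec (tensor X T E) U)"
    and connection_add: "t \<in> carrier (sec E U) \<Longrightarrow> D U (s \<oplus>\<^bsub>sec E U\<^esub> t) = D U s \<oplus>\<^bsub>sec (tensor X T E) U\<^esub> D U t"
    and connection_leibniz: "f \<in> carrier (cinf X U) \<Longrightarrow> D U (f \<odot>\<^bsub>sec E U\<^esub> s) =
      pure X T E U (differential X U f) s \<oplus>\<^bsub>sec (tensor X T E) U\<^esub> f \<odot>\<^bsub>sec (tensor X T E) U\<^esub> D U s"
    and connection_res: "open V \<Longrightarrow> V \<subseteq> U \<Longrightarrow> D V (res E U V s) = res (tensor X T E) U V (D U s)"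
  using assms by (simp_all add: connection_def)

lemma connection_sheaf_map: "connection X E D \<Longrightarrow> sheaf_map_below U0 E (tensor X T E) D"
  by (rule sheaf_map_belowI) (simp_all add: additive_on_def connection_closed connection_add connection_res)

text \<open>For fixed \<open>f\<close> the Leibniz term df \<otimes> s is an additive map in
  \<open>s\<close>, so both sides of a Leibniz rule can be compared on pure tensors.\<close>

lemma sheaf_map_pure_differential:
  assumes E: "presheaf_mod X E" and U: "open U" and f: "f \<in> carrier (cinf X U)"
  shows "sheaf_map_below U E (tensor X T E) (\<lambda>V s. pure X T E V (differential X V (fres V f)) s)"
proof (rule sheaf_map_belowI)
  note p = bilinear_pure[OF presheaf_cotangent E]
  fix V assume V: "open V" "V \<subseteq> U"
  note fV = fres_closed[OF U V f]
  note d = differential_closed[OF V(1) fV]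
  show "additive_on (sec E V) (sec (tensor X T E) V) (pure X T E V (differential X V (fres V f)))"
    by (rule bilinear_right[OF p V(1) d])
  fix W s assume W: "open W" "W \<subseteq> V" and s: "s \<in> carrier (sec E V)"
  show "pure X T E W (differential X W (fres W f)) (res E V W s) = res (tensor X T E) V W (pure X T E V (differential X V (fres V f)) s)"
    using bilinear_res[OF p V(1) W d s] differential_res[OF V(1) W fV] fres_fres[OF W(2), of f] by simp
qed

section \<open>The tensor product connection\<close>

context
  fixes E :: "('x, 'f) osheaf" and M :: "('x, 'm) osheaf" and D D'
  assumes E: "presheaf_mod X E" and M: "presheaf_mod X M" and D: "connection X E D" and D': "connection X M D'"
begin

abbreviation "EM \<equiv> tensor X E M"
abbreviation "TEM \<equiv> tensor X T (tensor X E M)"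
abbreviation "conn_left U v m \<equiv> assoc X T E M U (pure X (tensor X T E) M U (D U v) m)"
abbreviation "conn_right U v m \<equiv> exchange X T E M U (pure X E (tensor X T M) U v (D' U m))"

lemmas TE_sheaves = presheaf_tensor[OF presheaf_cotangent E] presheaf_tensor[OF presheaf_cotangent M]
  presheaf_tensor[OF E M] presheaf_tensor[OF presheaf_cotangent presheaf_tensor[OF E M]]

text \<open>A factor \<open>f\<close> in \<open>v\<close> yields a Leibniz term only in the left
  summand, a factor in \<open>m\<close> only in the right one. After \<open>assoc\<close> and
  \<open>exchange\<close> both terms are df \<otimes> (v \<otimes> m) in the same tensor
  product.\<close>

lemma tensor_connection_summands:
  assumes U: "open U" and v: "v \<in> carrier (sec E U)" and m: "m \<in> carrier (sec M U)"
  shows "conn_left U v m \<in> carrier (sec TEM U)" "conn_right U v m \<in> carrier (sec TEM U)"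
    and "v' \<in> carrier (sec E U) \<Longrightarrow> conn_left U (v \<oplus>\<^bsub>sec E U\<^esub> v') m = conn_left U v m \<oplus>\<^bsub>sec TEM U\<^esub> conn_left U v' m"
    and "v' \<in> carrier (sec E U) \<Longrightarrow> conn_right U (v \<oplus>\<^bsub>sec E U\<^esub> v') m = conn_right U v m \<oplus>\<^bsub>sec TEM U\<^esub> conn_right U v' m"
    and "m' \<in> carrier (sec M U) \<Longrightarrow> conn_left U v (m \<oplus>\<^bsub>sec M U\<^esub> m') = conn_left U v m \<oplus>\<^bsub>sec TEM U\<^esub> conn_left U v m'"
    and "m' \<in> carrier (sec M U) \<Longrightarrow> conn_right U v (m \<oplus>\<^bsub>sec M U\<^esub> m') = conn_right U v m \<oplus>\<^bsub>sec TEM U\<^esub> conn_right U v m'"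
    and "f \<in> carrier (cinf X U) \<Longrightarrow> conn_left U (f \<odot>\<^bsub>sec E U\<^esub> v) m =
      pure X T EM U (differential X U f) (pure X E M U v m) \<oplus>\<^bsub>sec TEM U\<^esub> f \<odot>\<^bsub>sec TEM U\<^esub> conn_left U v m"
    and "f \<in> carrier (cinf X U) \<Longrightarrow> conn_left U v (f \<odot>\<^bsub>sec M U\<^esub> m) = f \<odot>\<^bsub>sec TEM U\<^esub> conn_left U v m"
    and "f \<in> carrier (cinf X U) \<Longrightarrow> conn_right U (f \<odot>\<^bsub>sec E U\<^esub> v) m = f \<odot>\<^bsub>sec TEM U\<^esub> conn_right U v m"
    and "f \<in> carrier (cinf X U) \<Longrightarrow> conn_right U v (f \<odot>\<^bsub>sec M U\<^esub> m) =
      pure X T EM U (differential X U f) (pure X E M U v m) \<oplus>\<^bsub>sec TEM U\<^esub> f \<odot>\<^bsub>sec TEM U\<^esub> conn_right U v m"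
    and "open V \<Longrightarrow> V \<subseteq> U \<Longrightarrow> conn_left V (res E U V v) (res M U V m) = res TEM U V (conn_left U v m)"
    and "open V \<Longrightarrow> V \<subseteq> U \<Longrightarrow> conn_right V (res E U V v) (res M U V m) = res TEM U V (conn_right U v m)"
proof -
  note TE = TE_sheaves(1) and TM = TE_sheaves(2)
  note a = assoc_hom[OF presheaf_cotangent E M] and e = exchange_hom[OF presheaf_cotangent E M]
  note p1 = bilinear_pure[OF TE M] and p2 = bilinear_pure[OF E TM]
  note q1 = bilinear_pure[OF presheaf_cotangent E] and q2 = bilinear_pure[OF presheaf_cotangent M]
  note Dv = connection_closed[OF D U v] and Dm = connection_closed[OF D' U m]
  note c1 = bilinear_closed[OF p1 U] and c2 = bilinear_closed[OF p2 U]
  note ac = sheaf_hom_closed[OF a U] and ec = sheaf_hom_closed[OF e U]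
  interpret TE: module "cinf X U" "sec (tensor X T E) U" by (rule presheaf_module[OF TE U])
  interpret TM: module "cinf X U" "sec (tensor X T M) U" by (rule presheaf_module[OF TM U])
  interpret Em: module "cinf X U" "sec E U" by (rule presheaf_module[OF E U])
  interpret Mm: module "cinf X U" "sec M U" by (rule presheaf_module[OF M U])
  show "conn_left U v m \<in> carrier (sec TEM U)" "conn_right U v m \<in> carrier (sec TEM U)"
    by (intro ac c1 Dv m, intro ec c2 Dm v)
  show "conn_left U (v \<oplus>\<^bsub>sec E U\<^esub> v') m = conn_left U v m \<oplus>\<^bsub>sec TEM U\<^esub> conn_left U v' m" if v': "v' \<in> carrier (sec E U)"
    unfolding connection_add[OF D U v v'] additive_on_add[OF bilinear_left[OF p1 U m] Dv connection_closed[OF D U v']]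
    by (rule sheaf_hom_add[OF a U c1[OF Dv m] c1[OF connection_closed[OF D U v'] m]])
  show "conn_right U (v \<oplus>\<^bsub>sec E U\<^esub> v') m = conn_right U v m \<oplus>\<^bsub>sec TEM U\<^esub> conn_right U v' m" if v': "v' \<in> carrier (sec E U)"
    unfolding additive_on_add[OF bilinear_left[OF p2 U Dm] v v']
    by (rule sheaf_hom_add[OF e U c2[OF v Dm] c2[OF v' Dm]])
  show "conn_left U v (m \<oplus>\<^bsub>sec M U\<^esub> m') = conn_left U v m \<oplus>\<^bsub>sec TEM U\<^esub> conn_left U v m'" if m': "m' \<in> carrier (sec M U)"
    unfolding additive_on_add[OF bilinear_right[OF p1 U Dv] m m']
    by (rule sheaf_hom_add[OF a U c1[OF Dv m] c1[OF Dv m']])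
  show "conn_right U v (m \<oplus>\<^bsub>sec M U\<^esub> m') = conn_right U v m \<oplus>\<^bsub>sec TEM U\<^esub> conn_right U v m'" if m': "m' \<in> carrier (sec M U)"
    unfolding connection_add[OF D' U m m'] additive_on_add[OF bilinear_right[OF p2 U v] Dm connection_closed[OF D' U m']]
    by (rule sheaf_hom_add[OF e U c2[OF v Dm] c2[OF v connection_closed[OF D' U m']]])
  show "conn_left V (res E U V v) (res M U V m) = res TEM U V (conn_left U v m)" if V: "open V" "V \<subseteq> U"
    unfolding connection_res[OF D U v V] bilinear_res[OF p1 U V Dv m] by (rule sheaf_hom_res[OF a U V c1[OF Dv m]])
  show "conn_right V (res E U V v) (res M U V m) = res TEM U V (conn_right U v m)" if V: "open V" "V \<subseteq> U"
    unfolding connection_res[OF D' U m V] bilinear_res[OF p2 U V v Dm] by (rule sheaf_hom_res[OF e U V c2[OF v Dm]])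
  assume f: "f \<in> carrier (cinf X U)"
  note df = differential_closed[OF U f]
  note dv = bilinear_closed[OF q1 U df v] and dm = bilinear_closed[OF q2 U df m]
  note fDv = TE.smult_closed[OF f Dv] and fDm = TM.smult_closed[OF f Dm]
  show "conn_left U v (f \<odot>\<^bsub>sec M U\<^esub> m) = f \<odot>\<^bsub>sec TEM U\<^esub> conn_left U v m"
    unfolding bilinear_smult_right[OF p1 U f Dv m] by (rule sheaf_hom_smult[OF a U f c1[OF Dv m]])
  show "conn_right U (f \<odot>\<^bsub>sec E U\<^esub> v) m = f \<odot>\<^bsub>sec TEM U\<^esub> conn_right U v m"
    unfolding bilinear_smult_left[OF p2 U f v Dm] by (rule sheaf_hom_smult[OF e U f c2[OF v Dm]])
  show "conn_left U (f \<odot>\<^bsub>sec E U\<^esub> v) m =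
      pure X T EM U (differential X U f) (pure X E M U v m) \<oplus>\<^bsub>sec TEM U\<^esub> f \<odot>\<^bsub>sec TEM U\<^esub> conn_left U v m"
    unfolding connection_leibniz[OF D U v f] additive_on_add[OF bilinear_left[OF p1 U m] dv fDv]
      sheaf_hom_add[OF a U c1[OF dv m] c1[OF fDv m]]
    unfolding bilinear_smult_left[OF p1 U f Dv m]
      sheaf_hom_smult[OF a U f c1[OF Dv m]] assoc_pure[OF presheaf_cotangent E M U df v m] ..
  show "conn_right U v (f \<odot>\<^bsub>sec M U\<^esub> m) =
      pure X T EM U (differential X U f) (pure X E M U v m) \<oplus>\<^bsub>sec TEM U\<^esub> f \<odot>\<^bsub>sec TEM U\<^esub> conn_right U v m"
    unfolding connection_leibniz[OF D' U m f] additive_on_add[OF bilinear_right[OF p2 U v] dm fDm]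
      sheaf_hom_add[OF e U c2[OF v dm] c2[OF v fDm]]
    unfolding bilinear_smult_right[OF p2 U f v Dm]
      sheaf_hom_smult[OF e U f c2[OF v Dm]] exchange_pure[OF presheaf_cotangent E M U df v m] ..
qed

text \<open>Moving \<open>f\<close> from \<open>v\<close> to \<open>m\<close> moves the term df
  \<otimes> (v \<otimes> m) from one summand to the other, so it is the sum that is
  balanced.\<close>

lemma tensor_connection_balanced:
  "balanced_below X U0 E M TEM (\<lambda>U v m. conn_left U v m \<oplus>\<^bsub>sec TEM U\<^esub> conn_right U v m)"
proof (rule balanced_belowI)
  note r = tensor_connection_summands
  fix U :: "'x set" assume U: "open U"
  interpret H: module "cinf X U" "sec TEM U" by (rule presheaf_module[OF TE_sheaves(4) U])
  show "additive_on (sec E U) (sec TEM U) (\<lambda>v. conn_left U v m \<oplus>\<^bsub>sec TEM U\<^esub> conn_right U v m)" if m: "m \<in> carrier (sec M U)" for m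
    by (rule additive_onI) (simp_all add: r(1-4)[OF U _ m] H.a_ac)
  show "additive_on (sec M U) (sec TEM U) (\<lambda>m. conn_left U v m \<oplus>\<^bsub>sec TEM U\<^esub> conn_right U v m)" if v: "v \<in> carrier (sec E U)" for v
    by (rule additive_onI) (simp_all add: r(1,2,5,6)[OF U v] H.a_ac)
  fix f v m assume f: "f \<in> carrier (cinf X U)" and v: "v \<in> carrier (sec E U)" and m: "m \<in> carrier (sec M U)"
  have "pure X T EM U (differential X U f) (pure X E M U v m) \<in> carrier (sec TEM U)"
    by (intro pure_closed U E M presheaf_cotangent presheaf_tensor differential_closed f v m)
  then show "conn_left U (f \<odot>\<^bsub>sec E U\<^esub> v) m \<oplus>\<^bsub>sec TEM U\<^esub> conn_right U (f \<odot>\<^bsub>sec E U\<^esub> v) m =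
      conn_left U v (f \<odot>\<^bsub>sec M U\<^esub> m) \<oplus>\<^bsub>sec TEM U\<^esub> conn_right U v (f \<odot>\<^bsub>sec M U\<^esub> m)"
    using r(1,2)[OF U v m] f by (simp add: r(7-10)[OF U v m f] H.a_ac)
next
  note r = tensor_connection_summands
  fix U V v m assume U: "open U" "open V" "V \<subseteq> U" and v: "v \<in> carrier (sec E U)" and m: "m \<in> carrier (sec M U)"
  show "conn_left V (res E U V v) (res M U V m) \<oplus>\<^bsub>sec TEM V\<^esub> conn_right V (res E U V v) (res M U V m) =
      res TEM U V (conn_left U v m \<oplus>\<^bsub>sec TEM U\<^esub> conn_right U v m)"
    using res_add[OF TE_sheaves(4) U r(1,2)[OF U(1) v m]] by (simp add: r(11,12)[OF U(1) v m U(2,3)])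
qed

lemma tensor_connection_sheaf_map: "sheaf_map_below U0 EM TEM (tensor_connection X E M D D')"
  unfolding tensor_connection_def Let_def
  by (rule sheaf_map_tensor_lift[OF E M sheaf_tensor[OF presheaf_cotangent TE_sheaves(3)] tensor_connection_balanced])

lemma tensor_connection_pure:
  assumes "open U" "v \<in> carrier (sec E U)" "m \<in> carrier (sec M U)"
  shows "tensor_connection X E M D D' U (pure X E M U v m) = conn_left U v m \<oplus>\<^bsub>sec TEM U\<^esub> conn_right U v m"
  unfolding tensor_connection_def Let_def
  by (rule tensor_lift_pure[OF E M sheaf_tensor[OF presheaf_cotangent TE_sheaves(3)] tensor_connection_balanced assms(1) order_refl assms(2,3)])

text \<open>Additivity and naturality belong to every lift. The Leibniz rule for an arbitrary
  section is, for fixed \<open>f\<close>, an equality of additive maps, tested on pure tensors with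
  \<open>f\<close> put into the first factor.\<close>

lemma connection_tensor_connection: "connection X EM (tensor_connection X E M D D')"
proof -
  let ?D = "tensor_connection X E M D D'"
  note sm = tensor_connection_sheaf_map
  have add: "additive_on (sec EM U) (sec TEM U) (?D U)" if "open U" for U
    by (rule sheaf_map_additive[OF sm that order_refl])
  have leibniz: "?D U (f \<odot>\<^bsub>sec EM U\<^esub> \<xi>) = pure X T EM U (differential X U f) \<xi> \<oplus>\<^bsub>sec TEM U\<^esub> f \<odot>\<^bsub>sec TEM U\<^esub> ?D U \<xi>"
    if U: "open U" and f: "f \<in> carrier (cinf X U)" and \<xi>: "\<xi> \<in> carrier (sec EM U)" for U f \<xi>
  proof -
    note H = sheaf_tensor[OF presheaf_cotangent TE_sheaves(3)]
    note m = sheaf_map_below_smult[OF TE_sheaves(3) H sm U f]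
    note m' = sheaf_map_below_add[OF H sheaf_map_pure_differential[OF TE_sheaves(3) U f] m(1)]
    have "?D U (fres U f \<odot>\<^bsub>sec EM U\<^esub> \<xi>) =
        pure X T EM U (differential X U (fres U f)) \<xi> \<oplus>\<^bsub>sec TEM U\<^esub> fres U f \<odot>\<^bsub>sec TEM U\<^esub> ?D U \<xi>"
    proof (rule tensor_hom_eqI[OF E M H m(2) m' U order_refl \<xi>])
      fix V v w assume V: "open V" "V \<subseteq> U" and v: "v \<in> carrier (sec E V)" and w: "w \<in> carrier (sec M V)"
      note fV = fres_closed[OF U V f]
      interpret Em: module "cinf X V" "sec E V" by (rule presheaf_module[OF E V(1)])
      interpret H: module "cinf X V" "sec TEM V" by (rule presheaf_module[OF TE_sheaves(4) V(1)])
      note r = tensor_connection_summands[OF V(1) v w]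
      have d: "pure X T EM V (differential X V (fres V f)) (pure X E M V v w) \<in> carrier (sec TEM V)"
        by (intro pure_closed V E M presheaf_cotangent presheaf_tensor differential_closed fV v w)
      have "?D V (fres V f \<odot>\<^bsub>sec EM V\<^esub> pure X E M V v w) = ?D V (pure X E M V (fres V f \<odot>\<^bsub>sec E V\<^esub> v) w)"
        by (simp add: pure_smult_left[OF E M V(1) fV v w])
      also have "\<dots> = conn_left V (fres V f \<odot>\<^bsub>sec E V\<^esub> v) w \<oplus>\<^bsub>sec TEM V\<^esub> conn_right V (fres V f \<odot>\<^bsub>sec E V\<^esub> v) w"
        by (rule tensor_connection_pure[OF V(1) Em.smult_closed[OF fV v] w])
      also have "\<dots> = pure X T EM V (differential X V (fres V f)) (pure X E M V v w) \<oplus>\<^bsub>sec TEM V\<^esub>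
          fres V f \<odot>\<^bsub>sec TEM V\<^esub> ?D V (pure X E M V v w)"
        unfolding tensor_connection_pure[OF V(1) v w] r(7)[OF fV] r(9)[OF fV] H.smult_r_distr[OF fV r(1,2)]
        by (rule H.a_assoc[OF d H.smult_closed[OF fV r(1)] H.smult_closed[OF fV r(2)]])
      finally show "?D V (fres V f \<odot>\<^bsub>sec EM V\<^esub> pure X E M V v w) = pure X T EM V (differential X V (fres V f)) (pure X E M V v w)
        \<oplus>\<^bsub>sec TEM V\<^esub> fres V f \<odot>\<^bsub>sec TEM V\<^esub> ?D V (pure X E M V v w)" .
    qed
    then show ?thesis by (simp add: fres_cinf_id[OF f])
  qed
  show ?thesis
    unfolding connection_def
    by (intro conjI allI impI ballI; (elim conjE)?)
      (simp_all add: additive_on_closed[OF add] additive_on_add[OF add] leibniz sheaf_map_res[OF sm _ order_refl])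
qed

end

text \<open>The Leibniz term comes from \<open>D\<close> alone, so a linear map can be added without
  disturbing it.\<close>

lemma connection_add_hom:
  assumes E: "presheaf_mod X E" and D: "connection X E D" and \<alpha>: "sheaf_hom X E (tensor X T E) \<alpha>"
  shows "connection X E (\<lambda>U s. \<alpha> U s \<oplus>\<^bsub>sec (tensor X T E) U\<^esub> D U s)"
proof -
  note TE = presheaf_tensor[OF presheaf_cotangent E]
  have 1: "\<alpha> U (f \<odot>\<^bsub>sec E U\<^esub> s) \<oplus>\<^bsub>sec (tensor X T E) U\<^esub> D U (f \<odot>\<^bsub>sec E U\<^esub> s) =
      pure X T E U (differential X U f) s \<oplus>\<^bsub>sec (tensor X T E) U\<^esub> f \<odot>\<^bsub>sec (tensor X T E) U\<^esub> (\<alpha> U s \<oplus>\<^bsub>sec (tensor X T E) U\<^esub> D U s)"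
    if U: "open U" and f: "f \<in> carrier (cinf X U)" and s: "s \<in> carrier (sec E U)" for U f s
  proof -
    interpret H: module "cinf X U" "sec (tensor X T E) U" by (rule presheaf_module[OF TE U])
    show ?thesis
      using f s sheaf_hom_closed[OF \<alpha> U s] connection_closed[OF D U s] pure_closed[OF presheaf_cotangent E U differential_closed[OF U f] s]
      by (simp add: sheaf_hom_smult[OF \<alpha> U f s] connection_leibniz[OF D U s f] H.smult_r_distr H.a_ac)
  qed
  note m = sheaf_map_below_add[OF sheaf_tensor[OF presheaf_cotangent E] sheaf_hom_map_below[OF \<alpha>] connection_sheaf_map[OF D]]
  note add = sheaf_map_additive[OF m _ order_refl]
  show ?thesis
    unfolding connection_def
    by (intro conjI allI impI ballI; (elim conjE)?)
      (simp_all add: additive_on_closed[OF add] additive_on_add[OF add] 1 sheaf_map_res[OF m _ order_refl])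
qed

text \<open>Both terms have the same Leibniz contribution df \<otimes> \<open>\<phi>\<close>(s),
  which cancels. With \<open>\<phi>\<close> the identity this says that two connections differ by a
  morphism; with \<open>\<phi>\<close> a structure map and \<open>D\<close> the tensor product
  connection it gives linearity of the obstruction.\<close>

lemma connection_defect_hom:
  assumes E: "presheaf_mod X E" and F: "presheaf_mod X F" and D: "connection X E D" and D': "connection X F D'"
    and \<phi>: "sheaf_hom X E F \<phi>"
  shows "sheaf_hom X E (tensor X T F)
    (\<lambda>U s. tensor_map X T E T F id_hom \<phi> U (D U s) \<ominus>\<^bsub>sec (tensor X T F) U\<^esub> D' U (\<phi> U s))"
proof (rule sheaf_homI)
  note TE = presheaf_tensor[OF presheaf_cotangent E] and TF = presheaf_tensor[OF presheaf_cotangent F]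
  note k = tensor_map_hom[OF presheaf_cotangent E presheaf_cotangent F sheaf_hom_id \<phi>]
  let ?k = "tensor_map X T E T F id_hom \<phi>"
  fix U :: "'x set" assume U: "open U"
  interpret H: module "cinf X U" "sec (tensor X T F) U" by (rule presheaf_module[OF TF U])
  interpret G: module "cinf X U" "sec (tensor X T E) U" by (rule presheaf_module[OF TE U])
  note c = sheaf_hom_closed[OF k U connection_closed[OF D U]] connection_closed[OF D' U sheaf_hom_closed[OF \<phi> U]]
  show "additive_on (sec E U) (sec (tensor X T F) U) (\<lambda>s. ?k U (D U s) \<ominus>\<^bsub>sec (tensor X T F) U\<^esub> D' U (\<phi> U s))"
    by (rule additive_onI)
      (simp_all add: c connection_add[OF D U] sheaf_hom_add[OF k U] connection_closed[OF D U] sheaf_hom_add[OF \<phi> U]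
        connection_add[OF D' U] sheaf_hom_closed[OF \<phi> U] a_minus_def H.minus_add H.a_ac)
  fix f s assume f: "f \<in> carrier (cinf X U)" and s: "s \<in> carrier (sec E U)"
  note df = differential_closed[OF U f]
  note \<phi>s = sheaf_hom_closed[OF \<phi> U s]
  have "?k U (D U (f \<odot>\<^bsub>sec E U\<^esub> s)) = pure X T F U (differential X U f) (\<phi> U s) \<oplus>\<^bsub>sec (tensor X T F) U\<^esub> f \<odot>\<^bsub>sec (tensor X T F) U\<^esub> ?k U (D U s)"
    using connection_closed[OF D U s] f pure_closed[OF presheaf_cotangent E U df s]
    by (simp add: connection_leibniz[OF D U s f] sheaf_hom_add[OF k U] sheaf_hom_smult[OF k U]
        tensor_map_pure[OF presheaf_cotangent E presheaf_cotangent F sheaf_hom_id \<phi> U df s])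
  moreover have "D' U (\<phi> U (f \<odot>\<^bsub>sec E U\<^esub> s)) = pure X T F U (differential X U f) (\<phi> U s) \<oplus>\<^bsub>sec (tensor X T F) U\<^esub> f \<odot>\<^bsub>sec (tensor X T F) U\<^esub> D' U (\<phi> U s)"
    by (simp add: sheaf_hom_smult[OF \<phi> U f s] connection_leibniz[OF D' U \<phi>s f])
  \<comment> \<open>Here \<open>p\<close> stands for the common Leibniz term.\<close>
  moreover have "(p \<oplus>\<^bsub>sec (tensor X T F) U\<^esub> f \<odot>\<^bsub>sec (tensor X T F) U\<^esub> x) \<ominus>\<^bsub>sec (tensor X T F) U\<^esub>
      (p \<oplus>\<^bsub>sec (tensor X T F) U\<^esub> f \<odot>\<^bsub>sec (tensor X T F) U\<^esub> y) = f \<odot>\<^bsub>sec (tensor X T F) U\<^esub> (x \<ominus>\<^bsub>sec (tensor X T F) U\<^esub> y)"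
    if "p \<in> carrier (sec (tensor X T F) U)" "x \<in> carrier (sec (tensor X T F) U)" "y \<in> carrier (sec (tensor X T F) U)" for p x y
  proof -
    have "p \<oplus>\<^bsub>sec (tensor X T F) U\<^esub> (q \<oplus>\<^bsub>sec (tensor X T F) U\<^esub> (\<ominus>\<^bsub>sec (tensor X T F) U\<^esub> p \<oplus>\<^bsub>sec (tensor X T F) U\<^esub> r)) =
        q \<oplus>\<^bsub>sec (tensor X T F) U\<^esub> r" if "q \<in> carrier (sec (tensor X T F) U)" "r \<in> carrier (sec (tensor X T F) U)" for q r
      using that \<open>p \<in> _\<close> H.r_neg2[of p "q \<oplus>\<^bsub>sec (tensor X T F) U\<^esub> r"] by (simp add: H.M.a_lcomm)
    then show ?thesis
      using that f by (simp add: a_minus_def H.minus_add H.smult_r_distr H.smult_r_minus H.M.a_assoc)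
  qed
  ultimately show "?k U (D U (f \<odot>\<^bsub>sec E U\<^esub> s)) \<ominus>\<^bsub>sec (tensor X T F) U\<^esub> D' U (\<phi> U (f \<odot>\<^bsub>sec E U\<^esub> s)) =
      f \<odot>\<^bsub>sec (tensor X T F) U\<^esub> (?k U (D U s) \<ominus>\<^bsub>sec (tensor X T F) U\<^esub> D' U (\<phi> U s))"
    using c[OF s] pure_closed[OF presheaf_cotangent F U df \<phi>s] by simp
next
  note TE = presheaf_tensor[OF presheaf_cotangent E] and TF = presheaf_tensor[OF presheaf_cotangent F]
  note k = tensor_map_hom[OF presheaf_cotangent E presheaf_cotangent F sheaf_hom_id \<phi>]
  let ?k = "tensor_map X T E T F id_hom \<phi>"
  fix U V s assume U: "open U" "open V" "V \<subseteq> U" and s: "s \<in> carrier (sec E U)"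
  note c = sheaf_hom_closed[OF k U(1) connection_closed[OF D U(1) s]] connection_closed[OF D' U(1) sheaf_hom_closed[OF \<phi> U(1) s]]
  show "?k V (D V (res E U V s)) \<ominus>\<^bsub>sec (tensor X T F) V\<^esub> D' V (\<phi> V (res E U V s)) =
      res (tensor X T F) U V (?k U (D U s) \<ominus>\<^bsub>sec (tensor X T F) U\<^esub> D' U (\<phi> U s))"
    unfolding additive_on_diff[OF presheaf_abelian_group[OF TF U(1)] presheaf_abelian_group[OF TF U(2)] res_additive[OF TF U] c]
      connection_res[OF D U(1) s U(2,3)] sheaf_hom_res[OF k U connection_closed[OF D U(1) s]]
      sheaf_hom_res[OF \<phi> U s] connection_res[OF D' U(1) sheaf_hom_closed[OF \<phi> U(1) s] U(2,3)] ..
qed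

text \<open>Only the summand with the connection on \<open>E\<close> changes, and it changes by
  \<open>\<alpha>\<close> \<otimes> id followed by \<open>assoc\<close>. The sum is described by an
  equation on sections, so that \<open>D1\<close> may be a given connection and need not be
  literally the sum.\<close>

lemma tensor_connection_add_hom:
  assumes E: "presheaf_mod X E" and M: "presheaf_mod X M" and D: "connection X E D" and D': "connection X M D'"
    and \<alpha>: "sheaf_hom X E (tensor X T E) \<alpha>" and U: "open U" and \<xi>: "\<xi> \<in> carrier (sec (tensor X E M) U)"
    and D1: "connection X E D1"
    and eq: "\<And>V s. open V \<Longrightarrow> s \<in> carrier (sec E V) \<Longrightarrow> D1 V s = \<alpha> V s \<oplus>\<^bsub>sec (tensor X T E) V\<^esub> D V s"
  shows "tensor_connection X E M D1 D' U \<xi> =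
    assoc X T E M U (tensor_map X E M (tensor X T E) M \<alpha> id_hom U \<xi>)
      \<oplus>\<^bsub>sec (tensor X T (tensor X E M)) U\<^esub> tensor_connection X E M D D' U \<xi>"
proof -
  note TE = presheaf_tensor[OF presheaf_cotangent E] and EM = presheaf_tensor[OF E M]
  note H = sheaf_tensor[OF presheaf_cotangent EM]
  note tm = tensor_map_hom[OF E M TE M \<alpha> sheaf_hom_id] and a = assoc_hom[OF presheaf_cotangent E M]
  show ?thesis
  proof (rule tensor_hom_eqI[OF E M H tensor_connection_sheaf_map[OF E M D1 D', of U]
        sheaf_map_below_add[OF H sheaf_hom_map_below[OF sheaf_hom_comp[OF tm a]] tensor_connection_sheaf_map[OF E M D D']] U order_refl \<xi>])
    fix V v m assume V: "open V" and v: "v \<in> carrier (sec E V)" and m: "m \<in> carrier (sec M V)"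
    note c = sheaf_hom_closed[OF \<alpha> V v] connection_closed[OF D V v]
    interpret G: module "cinf X V" "sec (tensor X T (tensor X E M)) V" by (rule presheaf_module[OF sheaf_presheaf[OF H] V])
    have "assoc X T E M V (pure X (tensor X T E) M V (\<alpha> V v \<oplus>\<^bsub>sec (tensor X T E) V\<^esub> D V v) m) =
        assoc X T E M V (pure X (tensor X T E) M V (\<alpha> V v) m) \<oplus>\<^bsub>sec (tensor X T (tensor X E M)) V\<^esub>
        assoc X T E M V (pure X (tensor X T E) M V (D V v) m)"
      unfolding pure_add_left[OF TE M V c m]
      by (rule sheaf_hom_add[OF a V pure_closed[OF TE M V c(1) m] pure_closed[OF TE M V c(2) m]])
    then show "tensor_connection X E M D1 D' V (pure X E M V v m) =
      assoc X T E M V (tensor_map X E M (tensor X T E) M \<alpha> id_hom V (pure X E M V v m))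
        \<oplus>\<^bsub>sec (tensor X T (tensor X E M)) V\<^esub> tensor_connection X E M D D' V (pure X E M V v m)"
      using tensor_connection_summands(1,2)[OF E M D D' V v m] sheaf_hom_closed[OF a V pure_closed[OF TE M V c(1) m]]
      by (simp add: tensor_connection_pure[OF E M D1 D' V v m] tensor_connection_pure[OF E M D D' V v m]
          tensor_map_pure[OF E M TE M \<alpha> sheaf_hom_id V v m] eq[OF V v] G.M.a_assoc)
  qed
qed

end

section \<open>Extensions of twisted quiver sheaves\<close>

text \<open>A morphism is a family of total functions whose values off the sections are arbitrary,
  so families obtained by different formulas are interchanged through their values on
  sections.\<close>

lemma sheaf_hom_cong:
  assumes "sheaf_hom X F G h" "presheaf_mod X F"
    and "\<And>U s. open U \<Longrightarrow> s \<in> carrier (sec F U) \<Longrightarrow> h U s = h' U s"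
  shows "sheaf_hom X F G h'"
proof (rule sheaf_homI)
  fix U :: "'a set" assume U: "open U"
  interpret F: module "cinf X U" "sec F U" by (rule presheaf_module[OF assms(2) U])
  note e = assms(3)[OF U, symmetric]
  show "additive_on (sec F U) (sec G U) (h' U)"
    by (rule additive_onI) (simp_all add: e sheaf_hom_closed[OF assms(1) U] sheaf_hom_add[OF assms(1) U])
  show "h' U (f \<odot>\<^bsub>sec F U\<^esub> s) = f \<odot>\<^bsub>sec G U\<^esub> h' U s" if "f \<in> carrier (cinf X U)" "s \<in> carrier (sec F U)" for f s
    using that by (simp add: e sheaf_hom_smult[OF assms(1) U])
next
  fix U V s assume U: "open U" "open V" "V \<subseteq> U" and s: "s \<in> carrier (sec F U)"
  show "h' V (res F U V s) = res G U V (h' U s)"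
    unfolding assms(3)[OF U(1) s, symmetric] assms(3)[OF U(2) res_closed[OF assms(2) U s], symmetric]
    by (rule sheaf_hom_res[OF assms(1) U s])
qed

lemma sheaf_hom_plus:
  assumes "presheaf_mod X F" "presheaf_mod X G" "sheaf_hom X F G h" "sheaf_hom X F G k"
  shows "sheaf_hom X F G (\<lambda>U s. h U s \<oplus>\<^bsub>sec G U\<^esub> k U s)"
proof (rule sheaf_homI)
  fix U :: "'a set" assume U: "open U"
  interpret G: module "cinf X U" "sec G U" by (rule presheaf_module[OF assms(2) U])
  note c = sheaf_hom_closed[OF assms(3) U] sheaf_hom_closed[OF assms(4) U]
  show "additive_on (sec F U) (sec G U) (\<lambda>s. h U s \<oplus>\<^bsub>sec G U\<^esub> k U s)"
    by (rule additive_onI) (simp_all add: c sheaf_hom_add[OF assms(3) U] sheaf_hom_add[OF assms(4) U] G.M.a_ac)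
  show "h U (f \<odot>\<^bsub>sec F U\<^esub> s) \<oplus>\<^bsub>sec G U\<^esub> k U (f \<odot>\<^bsub>sec F U\<^esub> s) = f \<odot>\<^bsub>sec G U\<^esub> (h U s \<oplus>\<^bsub>sec G U\<^esub> k U s)"
    if "f \<in> carrier (cinf X U)" "s \<in> carrier (sec F U)" for f s
    using that by (simp add: c sheaf_hom_smult[OF assms(3) U] sheaf_hom_smult[OF assms(4) U] G.smult_r_distr)
next
  fix U V s assume U: "open U" "open V" "V \<subseteq> U" and s: "s \<in> carrier (sec F U)"
  show "h V (res F U V s) \<oplus>\<^bsub>sec G V\<^esub> k V (res F U V s) = res G U V (h U s \<oplus>\<^bsub>sec G U\<^esub> k U s)"
    using res_add[OF assms(2) U sheaf_hom_closed[OF assms(3) U(1) s] sheaf_hom_closed[OF assms(4) U(1) s]]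
    by (simp add: sheaf_hom_res[OF assms(3) U s] sheaf_hom_res[OF assms(4) U s])
qed

lemma sheaf_hom_uminus:
  assumes "presheaf_mod X F" "presheaf_mod X G" "sheaf_hom X F G h"
  shows "sheaf_hom X F G (\<lambda>U s. \<ominus>\<^bsub>sec G U\<^esub> h U s)"
proof (rule sheaf_homI)
  fix U :: "'a set" assume U: "open U"
  interpret G: module "cinf X U" "sec G U" by (rule presheaf_module[OF assms(2) U])
  note c = sheaf_hom_closed[OF assms(3) U]
  show "additive_on (sec F U) (sec G U) (\<lambda>s. \<ominus>\<^bsub>sec G U\<^esub> h U s)"
    by (rule additive_onI) (simp_all add: c sheaf_hom_add[OF assms(3) U] G.minus_add)
  show "\<ominus>\<^bsub>sec G U\<^esub> h U (f \<odot>\<^bsub>sec F U\<^esub> s) = f \<odot>\<^bsub>sec G U\<^esub> (\<ominus>\<^bsub>sec G U\<^esub> h U s)"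
    if "f \<in> carrier (cinf X U)" "s \<in> carrier (sec F U)" for f s
    using that by (simp add: c sheaf_hom_smult[OF assms(3) U] G.smult_r_minus)
next
  fix U V s assume U: "open U" "open V" "V \<subseteq> U" and s: "s \<in> carrier (sec F U)"
  show "\<ominus>\<^bsub>sec G V\<^esub> h V (res F U V s) = res G U V (\<ominus>\<^bsub>sec G U\<^esub> h U s)"
    using additive_on_minus[OF presheaf_abelian_group[OF assms(2) U(1)] presheaf_abelian_group[OF assms(2) U(2)]
        res_additive[OF assms(2) U] sheaf_hom_closed[OF assms(3) U(1) s]]
    by (simp add: sheaf_hom_res[OF assms(3) U s])
qed

lemma sheaf_hom_zero:
  assumes "presheaf_mod X F" "presheaf_mod X G"
  shows "sheaf_hom X F G (\<lambda>U s. \<zero>\<^bsub>sec G U\<^esub>)"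
proof (rule sheaf_homI)
  fix U :: "'a set" assume U: "open U"
  interpret G: module "cinf X U" "sec G U" by (rule presheaf_module[OF assms(2) U])
  show "additive_on (sec F U) (sec G U) (\<lambda>s. \<zero>\<^bsub>sec G U\<^esub>)" by (rule additive_onI) simp_all
  show "\<zero>\<^bsub>sec G U\<^esub> = f \<odot>\<^bsub>sec G U\<^esub> \<zero>\<^bsub>sec G U\<^esub>" if "f \<in> carrier (cinf X U)" for f using that by simp
next
  fix U V :: "'a set" assume U: "open U" "open V" "V \<subseteq> U"
  show "\<zero>\<^bsub>sec G V\<^esub> = res G U V \<zero>\<^bsub>sec G U\<^esub>"
    by (rule additive_on_zero[OF presheaf_abelian_group[OF assms(2) U(1)] presheaf_abelian_group[OF assms(2) U(2)] res_additive[OF assms(2) U], symmetric])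
qed

subsection \<open>Direct sums\<close>

lemma dirsum_simps:
  "carrier (sec (dirsum F G) U) = carrier (sec F U) \<times> carrier (sec G U)"
  "\<zero>\<^bsub>sec (dirsum F G) U\<^esub> = (\<zero>\<^bsub>sec F U\<^esub>, \<zero>\<^bsub>sec G U\<^esub>)"
  "(s, t) \<oplus>\<^bsub>sec (dirsum F G) U\<^esub> (s', t') = (s \<oplus>\<^bsub>sec F U\<^esub> s', t \<oplus>\<^bsub>sec G U\<^esub> t')"
  "f \<odot>\<^bsub>sec (dirsum F G) U\<^esub> (s, t) = (f \<odot>\<^bsub>sec F U\<^esub> s, f \<odot>\<^bsub>sec G U\<^esub> t)"
  "res (dirsum F G) U V (s, t) = (res F U V s, res G U V t)"
  by (simp_all add: dirsum_def)

lemma presheaf_dirsum: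
  assumes F: "presheaf_mod X F" and G: "presheaf_mod X G"
  shows "presheaf_mod X (dirsum F G)"
  unfolding presheaf_mod_def
proof (intro conjI allI impI ballI; (elim conjE)?)
  fix U :: "'a set" assume U: "open U"
  interpret F: module "cinf X U" "sec F U" by (rule presheaf_module[OF F U])
  interpret G: module "cinf X U" "sec G U" by (rule presheaf_module[OF G U])
  show "module (cinf X U) (sec (dirsum F G) U)"
  proof (intro moduleI abelian_groupI F.R.is_cring)
    show "\<exists>y\<in>carrier (sec (dirsum F G) U). y \<oplus>\<^bsub>sec (dirsum F G) U\<^esub> x = \<zero>\<^bsub>sec (dirsum F G) U\<^esub>"
      if "x \<in> carrier (sec (dirsum F G) U)" for x
      using that by (intro bexI[of _ "(\<ominus>\<^bsub>sec F U\<^esub> fst x, \<ominus>\<^bsub>sec G U\<^esub> snd x)"]) (auto simp: dirsum_simps F.M.l_neg G.M.l_neg)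
  qed (auto simp: dirsum_simps F.M.a_ac G.M.a_ac F.smult_l_distr G.smult_l_distr F.smult_r_distr G.smult_r_distr
      F.smult_assoc1 G.smult_assoc1)
qed (auto simp: dirsum_simps res_closed[OF F] res_closed[OF G] res_add[OF F] res_add[OF G] res_smult[OF F] res_smult[OF G]
    res_id[OF F] res_id[OF G] res_res[OF F] res_res[OF G])

text \<open>A family of pairs is compatible exactly when both of its components are, so gluing and
  its uniqueness are inherited componentwise.\<close>

lemma sheaf_dirsum:
  assumes F: "sheaf_mod X F" and G: "sheaf_mod X G"
  shows "sheaf_mod X (dirsum F G)"
  unfolding sheaf_mod_def
proof (intro conjI allI impI presheaf_dirsum sheaf_presheaf[OF F] sheaf_presheaf[OF G]; elim conjE)
  fix \<C> s
  assume C: "\<forall>V\<in>\<C>. open V \<and> s V \<in> carrier (sec (dirsum F G) V)"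
    and g: "\<forall>V\<in>\<C>. \<forall>W\<in>\<C>. res (dirsum F G) V (V \<inter> W) (s V) = res (dirsum F G) W (V \<inter> W) (s W)"
  have r: "res (dirsum F G) U V x = (res F U V (fst x), res G U V (snd x))" for U V x
    by (cases x) (simp add: dirsum_simps)
  have s: "open V" "fst (s V) \<in> carrier (sec F V)" "snd (s V) \<in> carrier (sec G V)" if "V \<in> \<C>" for V
    using C[rule_format, OF that] by (auto simp: dirsum_simps)
  have c: "res F V (V \<inter> W) (fst (s V)) = res F W (V \<inter> W) (fst (s W))"
    "res G V (V \<inter> W) (snd (s V)) = res G W (V \<inter> W) (snd (s W))" if "V \<in> \<C>" "W \<in> \<C>" for V W
    using g[rule_format, OF that] by (simp_all add: r)
  obtain t where t: "t \<in> carrier (sec F (\<Union>\<C>))" "\<And>V. V \<in> \<C> \<Longrightarrow> res F (\<Union>\<C>) V t = fst (s V)"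
    using sheaf_glue[OF F s(1,2) c(1)] by blast
  obtain u where u: "u \<in> carrier (sec G (\<Union>\<C>))" "\<And>V. V \<in> \<C> \<Longrightarrow> res G (\<Union>\<C>) V u = snd (s V)"
    using sheaf_glue[OF G s(1,3) c(2)] by blast
  have o: "open (\<Union>\<C>)" using s(1) by blast
  show "\<exists>!t. t \<in> carrier (sec (dirsum F G) (\<Union>\<C>)) \<and> (\<forall>V\<in>\<C>. res (dirsum F G) (\<Union>\<C>) V t = s V)"
  proof (intro ex1I[of _ "(t, u)"] conjI ballI)
    show "(t, u) \<in> carrier (sec (dirsum F G) (\<Union>\<C>))" using t u by (simp add: dirsum_simps)
    show "res (dirsum F G) (\<Union>\<C>) V (t, u) = s V" if "V \<in> \<C>" for V using t u that by (simp add: r)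
    fix x assume x: "x \<in> carrier (sec (dirsum F G) (\<Union>\<C>)) \<and> (\<forall>V\<in>\<C>. res (dirsum F G) (\<Union>\<C>) V x = s V)"
    then have x1: "fst x \<in> carrier (sec F (\<Union>\<C>))" "snd x \<in> carrier (sec G (\<Union>\<C>))" by (auto simp: dirsum_simps)
    have x2: "res F (\<Union>\<C>) V (fst x) = fst (s V)" "res G (\<Union>\<C>) V (snd x) = snd (s V)" if "V \<in> \<C>" for V
      using x[THEN conjunct2, rule_format, OF that, symmetric] by (simp_all add: r)
    have "fst x = t"
    proof (rule sheaf_eqI[OF F o x1(1) t(1)])
      fix y assume "y \<in> \<Union>\<C>"
      then obtain V where "V \<in> \<C>" "y \<in> V" by blast
      then show "\<exists>V. open V \<and> y \<in> V \<and> V \<subseteq> \<Union>\<C> \<and> res F (\<Union>\<C>) V (fst x) = res F (\<Union>\<C>) V t"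
        using x2(1) t(2) s(1) by (intro exI[of _ V]) auto
    qed
    moreover have "snd x = u"
    proof (rule sheaf_eqI[OF G o x1(2) u(1)])
      fix y assume "y \<in> \<Union>\<C>"
      then obtain V where "V \<in> \<C>" "y \<in> V" by blast
      then show "\<exists>V. open V \<and> y \<in> V \<and> V \<subseteq> \<Union>\<C> \<and> res G (\<Union>\<C>) V (snd x) = res G (\<Union>\<C>) V u"
        using x2(2) u(2) s(1) by (intro exI[of _ V]) auto
    qed
    ultimately show "x = (t, u)" by (simp add: prod_eq_iff)
  qed
qed

lemma
  assumes F: "presheaf_mod X F" and G: "presheaf_mod X G"
  shows sheaf_hom_fst: "sheaf_hom X (dirsum F G) F (\<lambda>_. fst)"
    and sheaf_hom_snd: "sheaf_hom X (dirsum F G) G (\<lambda>_. snd)"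
  by (auto intro!: sheaf_homI additive_onI simp: dirsum_simps)

lemma sheaf_hom_Pair:
  assumes "sheaf_hom X H F h" "sheaf_hom X H G k"
  shows "sheaf_hom X H (dirsum F G) (\<lambda>U s. (h U s, k U s))"
  by (rule sheaf_homI)
    (auto intro!: additive_onI simp: dirsum_simps sheaf_hom_closed[OF assms(1)] sheaf_hom_closed[OF assms(2)]
      sheaf_hom_add[OF assms(1)] sheaf_hom_add[OF assms(2)] sheaf_hom_smult[OF assms(1)] sheaf_hom_smult[OF assms(2)]
      sheaf_hom_res[OF assms(1)] sheaf_hom_res[OF assms(2)])

context smooth_functions
begin

text \<open>The sum \<open>w\<close> is given by its values on sections; it will be the first
  component of a shear.\<close>

lemma tensor_map_add_left:
  assumes F: "presheaf_mod X F" and G: "presheaf_mod X G" and F': "presheaf_mod X F'"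
    and u: "sheaf_hom X F F' u" and u': "sheaf_hom X F F' u'" and w: "sheaf_hom X F F' w"
    and eq: "\<And>V s. open V \<Longrightarrow> s \<in> carrier (sec F V) \<Longrightarrow> w V s = u V s \<oplus>\<^bsub>sec F' V\<^esub> u' V s"
    and U: "open U" and \<xi>: "\<xi> \<in> carrier (sec (tensor X F G) U)"
  shows "tensor_map X F G F' G w id_hom U \<xi> =
    tensor_map X F G F' G u id_hom U \<xi> \<oplus>\<^bsub>sec (tensor X F' G) U\<^esub> tensor_map X F G F' G u' id_hom U \<xi>"
proof (rule tensor_sheaf_hom_eqI[OF F G sheaf_tensor[OF F' G] tensor_map_hom[OF F G F' G w sheaf_hom_id]
      sheaf_hom_plus[OF presheaf_tensor[OF F G] presheaf_tensor[OF F' G] tensor_map_hom[OF F G F' G u sheaf_hom_id]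
        tensor_map_hom[OF F G F' G u' sheaf_hom_id]] U \<xi>])
  fix V s t assume V: "open V" and st: "s \<in> carrier (sec F V)" "t \<in> carrier (sec G V)"
  show "tensor_map X F G F' G w id_hom V (pure X F G V s t) = tensor_map X F G F' G u id_hom V (pure X F G V s t)
      \<oplus>\<^bsub>sec (tensor X F' G) V\<^esub> tensor_map X F G F' G u' id_hom V (pure X F G V s t)"
    by (simp add: tensor_map_pure[OF F G F' G u sheaf_hom_id V st] tensor_map_pure[OF F G F' G u' sheaf_hom_id V st]
        tensor_map_pure[OF F G F' G w sheaf_hom_id V st] eq[OF V st(1)]
        pure_add_left[OF F' G V sheaf_hom_closed[OF u V st(1)] sheaf_hom_closed[OF u' V st(1)] st(2)])
qed

lemma tensor_map_zero:
  assumes F: "presheaf_mod X F" and G: "presheaf_mod X G" and F': "presheaf_mod X F'"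
    and U: "open U" and \<xi>: "\<xi> \<in> carrier (sec (tensor X F G) U)"
  shows "tensor_map X F G F' G (\<lambda>U s. \<zero>\<^bsub>sec F' U\<^esub>) id_hom U \<xi> = \<zero>\<^bsub>sec (tensor X F' G) U\<^esub>"
proof (rule tensor_sheaf_hom_eqI[OF F G sheaf_tensor[OF F' G] tensor_map_hom[OF F G F' G sheaf_hom_zero[OF F F'] sheaf_hom_id]
      sheaf_hom_zero[OF presheaf_tensor[OF F G] presheaf_tensor[OF F' G]] U \<xi>])
  fix V s t assume V: "open V" and st: "s \<in> carrier (sec F V)" "t \<in> carrier (sec G V)"
  show "tensor_map X F G F' G (\<lambda>U s. \<zero>\<^bsub>sec F' U\<^esub>) id_hom V (pure X F G V s t) = \<zero>\<^bsub>sec (tensor X F' G) V\<^esub>"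
    unfolding tensor_map_pure[OF F G F' G sheaf_hom_zero[OF F F'] sheaf_hom_id V st]
    by (rule additive_on_zero[OF presheaf_abelian_group[OF F' V] presheaf_abelian_group[OF presheaf_tensor[OF F' G] V]
          bilinear_left[OF bilinear_pure[OF F' G] V st(2)]])
qed

subsection \<open>Equivalence of extensions\<close>

context
  fixes Q :: "('v, 'a) pre_digraph" and M :: "'a \<Rightarrow> ('x, 'm) osheaf"
  assumes Q: "wf_digraph Q" and M: "\<And>a. a \<in> arcs Q \<Longrightarrow> presheaf_mod X (M a)"
begin

lemma
  assumes "twisted_sheaf X Q M R"
  shows vertex_sheaf: "i \<in> verts Q \<Longrightarrow> sheaf_mod X (vsh R i)"
    and tail_sheaf: "a \<in> arcs Q \<Longrightarrow> sheaf_mod X (vsh R (tail Q a))"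
    and head_sheaf: "a \<in> arcs Q \<Longrightarrow> sheaf_mod X (vsh R (head Q a))"
    and arc_hom: "a \<in> arcs Q \<Longrightarrow> sheaf_hom X (tensor X (vsh R (tail Q a)) (M a)) (vsh R (head Q a)) (amap R a)"
  using assms wf_digraph.tail_in_verts[OF Q] wf_digraph.head_in_verts[OF Q] by (auto simp: twisted_sheaf_def)

lemma
  assumes "twisted_hom X Q M R R' h"
  shows vertex_hom: "i \<in> verts Q \<Longrightarrow> sheaf_hom X (vsh R i) (vsh R' i) (h i)"
    and tail_hom: "a \<in> arcs Q \<Longrightarrow> sheaf_hom X (vsh R (tail Q a)) (vsh R' (tail Q a)) (h (tail Q a))"
    and twisted_hom_arc: "a \<in> arcs Q \<Longrightarrow> open U \<Longrightarrow> \<xi> \<in> carrier (sec (tensor X (vsh R (tail Q a)) (M a)) U) \<Longrightarrow>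
      h (head Q a) U (amap R a U \<xi>) =
      amap R' a U (tensor_map X (vsh R (tail Q a)) (M a) (vsh R' (tail Q a)) (M a) (h (tail Q a)) id_hom U \<xi>)"
  using assms wf_digraph.tail_in_verts[OF Q] wf_digraph.head_in_verts[OF Q] by (auto simp: twisted_hom_def)

section \<open>Identity, composition and inverses of morphisms of twisted sheaves\<close>

lemma twisted_hom_id:
  assumes "twisted_sheaf X Q M R"
  shows "twisted_hom X Q M R R (\<lambda>i. id_hom)"
  unfolding twisted_hom_def
  using tensor_map_id[OF sheaf_presheaf[OF tail_sheaf[OF assms]] M]
  by (auto simp: sheaf_hom_id)

lemma twisted_hom_comp:
  assumes R: "twisted_sheaf X Q M R" "twisted_sheaf X Q M R'" "twisted_sheaf X Q M R''"
    and h: "twisted_hom X Q M R R' h" and k: "twisted_hom X Q M R' R'' k"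
  shows "twisted_hom X Q M R R'' (\<lambda>i U s. k i U (h i U s))"
  unfolding twisted_hom_def
proof (intro conjI ballI allI impI)
  show "sheaf_hom X (vsh R i) (vsh R'' i) (\<lambda>U s. k i U (h i U s))" if "i \<in> verts Q" for i
    by (rule sheaf_hom_comp[OF vertex_hom[OF h that] vertex_hom[OF k that]])
  fix a U \<xi> assume a: "a \<in> arcs Q" and U: "open U" and \<xi>: "\<xi> \<in> carrier (sec (tensor X (vsh R (tail Q a)) (M a)) U)"
  note p = sheaf_presheaf[OF tail_sheaf[OF R(1) a]] M[OF a] sheaf_presheaf[OF tail_sheaf[OF R(2) a]] M[OF a]
    sheaf_presheaf[OF tail_sheaf[OF R(3) a]] M[OF a]
  have "tensor_map X (vsh R (tail Q a)) (M a) (vsh R' (tail Q a)) (M a) (h (tail Q a)) id_hom U \<xi>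
      \<in> carrier (sec (tensor X (vsh R' (tail Q a)) (M a)) U)"
    by (rule sheaf_hom_closed[OF tensor_map_hom[OF p(1-4) tail_hom[OF h a] sheaf_hom_id] U \<xi>])
  then show "k (head Q a) U (h (head Q a) U (amap R a U \<xi>)) = amap R'' a U (tensor_map X (vsh R (tail Q a)) (M a)
      (vsh R'' (tail Q a)) (M a) (\<lambda>U s. k (tail Q a) U (h (tail Q a) U s)) id_hom U \<xi>)"
    by (simp add: twisted_hom_arc[OF h a U \<xi>] twisted_hom_arc[OF k a U]
        tensor_map_comp[OF p tail_hom[OF h a] sheaf_hom_id tail_hom[OF k a] sheaf_hom_id U \<xi>])
qed

text \<open>A vertexwise inverse respects the structure maps automatically: the compatibility of
  \<open>h\<close> is used at the preimage (k \<otimes> id)(\<open>\<xi>\<close>), which h \<otimes>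
  id sends back to \<open>\<xi>\<close> by functoriality, and \<open>k\<close> is applied to the
  result.\<close>

lemma twisted_hom_inverse:
  assumes R: "twisted_sheaf X Q M R" "twisted_sheaf X Q M R'" and h: "twisted_hom X Q M R R' h"
    and k: "\<And>i. i \<in> verts Q \<Longrightarrow> sheaf_hom X (vsh R' i) (vsh R i) (k i)"
    and kh: "\<And>i U s. i \<in> verts Q \<Longrightarrow> open U \<Longrightarrow> s \<in> carrier (sec (vsh R i) U) \<Longrightarrow> k i U (h i U s) = s"
    and hk: "\<And>i U s. i \<in> verts Q \<Longrightarrow> open U \<Longrightarrow> s \<in> carrier (sec (vsh R' i) U) \<Longrightarrow> h i U (k i U s) = s"
  shows "twisted_hom X Q M R' R k"
  unfolding twisted_hom_def
proof (intro conjI ballI allI impI k)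
  fix a U \<xi> assume a: "a \<in> arcs Q" and U: "open U" and \<xi>: "\<xi> \<in> carrier (sec (tensor X (vsh R' (tail Q a)) (M a)) U)"
  let ?A = "vsh R (tail Q a)" and ?B = "vsh R' (tail Q a)"
  have v: "tail Q a \<in> verts Q" "head Q a \<in> verts Q"
    using a wf_digraph.tail_in_verts[OF Q] wf_digraph.head_in_verts[OF Q] by auto
  note p = sheaf_presheaf[OF tail_sheaf[OF R(1) a]] and p' = sheaf_presheaf[OF tail_sheaf[OF R(2) a]] and m = M[OF a]
  define \<eta> where "\<eta> = tensor_map X ?B (M a) ?A (M a) (k (tail Q a)) id_hom U \<xi>"
  have \<eta>: "\<eta> \<in> carrier (sec (tensor X ?A (M a)) U)"
    unfolding \<eta>_def by (rule sheaf_hom_closed[OF tensor_map_hom[OF p' m p m k[OF v(1)] sheaf_hom_id] U \<xi>])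
  have "tensor_map X ?A (M a) ?B (M a) (h (tail Q a)) id_hom U \<eta> =
      tensor_map X ?B (M a) ?B (M a) (\<lambda>U s. h (tail Q a) U (k (tail Q a) U s)) id_hom U \<xi>"
    unfolding \<eta>_def
    by (rule tensor_map_comp[OF p' m p m p' m k[OF v(1)] sheaf_hom_id tail_hom[OF h a] sheaf_hom_id U \<xi>])
  also have "\<dots> = tensor_map X ?B (M a) ?B (M a) id_hom id_hom U \<xi>"
    by (rule tensor_map_cong[OF p' m p' m sheaf_hom_comp[OF k[OF v(1)] tail_hom[OF h a]] sheaf_hom_id sheaf_hom_id sheaf_hom_id U \<xi>])
      (simp_all add: hk[OF v(1)])
  also have "\<dots> = \<xi>" by (rule tensor_map_id[OF p' m U \<xi>])
  finally have "h (head Q a) U (amap R a U \<eta>) = amap R' a U \<xi>"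
    by (simp add: twisted_hom_arc[OF h a U \<eta>])
  then have "k (head Q a) U (amap R' a U \<xi>) = k (head Q a) U (h (head Q a) U (amap R a U \<eta>))" by simp
  also have "\<dots> = amap R a U \<eta>"
    by (rule kh[OF v(2) U sheaf_hom_closed[OF arc_hom[OF R(1) a] U \<eta>]])
  finally show "k (head Q a) U (amap R' a U \<xi>) = amap R a U (tensor_map X ?B (M a) ?A (M a) (k (tail Q a)) id_hom U \<xi>)"
    unfolding \<eta>_def .
qed

lemma extensionD:
  assumes "extension X Q M S R (E, \<iota>, \<pi>)"
  shows "twisted_sheaf X Q M E" "twisted_hom X Q M S E \<iota>"
  using assms by (simp_all add: extension_def)

lemma ext_equivI:
  assumes "twisted_hom X Q M E E' h" "twisted_hom X Q M E' E h'"
    and "\<And>i U e. i \<in> verts Q \<Longrightarrow> open U \<Longrightarrow> e \<in> carrier (sec (vsh E i) U) \<Longrightarrow> h' i U (h i U e) = e"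
    and "\<And>i U e. i \<in> verts Q \<Longrightarrow> open U \<Longrightarrow> e \<in> carrier (sec (vsh E i) U) \<Longrightarrow> \<pi>' i U (h i U e) = \<pi> i U e"
    and "\<And>i U e. i \<in> verts Q \<Longrightarrow> open U \<Longrightarrow> e \<in> carrier (sec (vsh E' i) U) \<Longrightarrow> h i U (h' i U e) = e"
    and "\<And>i U s. i \<in> verts Q \<Longrightarrow> open U \<Longrightarrow> s \<in> carrier (sec (vsh S i) U) \<Longrightarrow> h i U (\<iota> i U s) = \<iota>' i U s"
  shows "ext_equiv X Q M S R (E, \<iota>, \<pi>) (E', \<iota>', \<pi>')"
  unfolding ext_equiv_def prod.case using assms by (intro exI[of _ h] exI[of _ h']) simp

lemma ext_equivE:
  assumes "ext_equiv X Q M S R (E, \<iota>, \<pi>) (E', \<iota>', \<pi>')"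
  obtains h h' where "twisted_hom X Q M E E' h" "twisted_hom X Q M E' E h'"
    "\<And>i U e. i \<in> verts Q \<Longrightarrow> open U \<Longrightarrow> e \<in> carrier (sec (vsh E i) U) \<Longrightarrow> h' i U (h i U e) = e"
    "\<And>i U e. i \<in> verts Q \<Longrightarrow> open U \<Longrightarrow> e \<in> carrier (sec (vsh E i) U) \<Longrightarrow> \<pi>' i U (h i U e) = \<pi> i U e"
    "\<And>i U e. i \<in> verts Q \<Longrightarrow> open U \<Longrightarrow> e \<in> carrier (sec (vsh E' i) U) \<Longrightarrow> h i U (h' i U e) = e"
    "\<And>i U s. i \<in> verts Q \<Longrightarrow> open U \<Longrightarrow> s \<in> carrier (sec (vsh S i) U) \<Longrightarrow> h i U (\<iota> i U s) = \<iota>' i U s"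
proof -
  from assms obtain h h' where "twisted_hom X Q M E E' h" "twisted_hom X Q M E' E h'"
    and *: "\<forall>i\<in>verts Q. \<forall>U. open U \<longrightarrow>
          (\<forall>e \<in> carrier (sec (vsh E i) U). h' i U (h i U e) = e \<and> \<pi>' i U (h i U e) = \<pi> i U e) \<and>
          (\<forall>e \<in> carrier (sec (vsh E' i) U). h i U (h' i U e) = e) \<and>
          (\<forall>s \<in> carrier (sec (vsh S i) U). h i U (\<iota> i U s) = \<iota>' i U s)"
    unfolding ext_equiv_def prod.case by (elim exE conjE)
  then show thesis by (intro that[of h h']) simp_all
qed

section \<open>Equivalence of extensions is an equivalence relation\<close>

lemma ext_equiv_refl:
  assumes "extension X Q M S R (E, \<iota>, \<pi>)"
  shows "ext_equiv X Q M S R (E, \<iota>, \<pi>) (E, \<iota>, \<pi>)"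
  by (rule ext_equivI[OF twisted_hom_id twisted_hom_id]) (simp_all add: extensionD[OF assms])

lemma ext_equiv_sym:
  assumes e: "extension X Q M S R (E, \<iota>, \<pi>)" and eq: "ext_equiv X Q M S R (E, \<iota>, \<pi>) (E', \<iota>', \<pi>')"
  shows "ext_equiv X Q M S R (E', \<iota>', \<pi>') (E, \<iota>, \<pi>)"
proof -
  obtain h h' where h: "twisted_hom X Q M E E' h" "twisted_hom X Q M E' E h'"
    "\<And>i U e. i \<in> verts Q \<Longrightarrow> open U \<Longrightarrow> e \<in> carrier (sec (vsh E i) U) \<Longrightarrow> h' i U (h i U e) = e"
    "\<And>i U e. i \<in> verts Q \<Longrightarrow> open U \<Longrightarrow> e \<in> carrier (sec (vsh E i) U) \<Longrightarrow> \<pi>' i U (h i U e) = \<pi> i U e"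
    "\<And>i U e. i \<in> verts Q \<Longrightarrow> open U \<Longrightarrow> e \<in> carrier (sec (vsh E' i) U) \<Longrightarrow> h i U (h' i U e) = e"
    "\<And>i U s. i \<in> verts Q \<Longrightarrow> open U \<Longrightarrow> s \<in> carrier (sec (vsh S i) U) \<Longrightarrow> h i U (\<iota> i U s) = \<iota>' i U s"
    using ext_equivE[OF eq] by blast
  show ?thesis
  proof (rule ext_equivI[OF h(2,1,5) _ h(3)])
    fix i and U :: "'x set" assume i: "i \<in> verts Q" and U: "open U"
    show "\<pi> i U (h' i U e) = \<pi>' i U e" if e: "e \<in> carrier (sec (vsh E' i) U)" for e
      using h(4)[OF i U sheaf_hom_closed[OF vertex_hom[OF h(2) i] U e]] h(5)[OF i U e] by simp
    show "h' i U (\<iota>' i U s) = \<iota> i U s" if s: "s \<in> carrier (sec (vsh S i) U)" for s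
      using h(3)[OF i U sheaf_hom_closed[OF vertex_hom[OF extensionD(2)[OF e] i] U s]] h(6)[OF i U s] by simp
  qed
qed

lemma ext_equiv_trans:
  assumes e: "extension X Q M S R (E, \<iota>, \<pi>)" and e': "extension X Q M S R (E', \<iota>', \<pi>')" and e'': "extension X Q M S R (E'', \<iota>'', \<pi>'')"
    and eq: "ext_equiv X Q M S R (E, \<iota>, \<pi>) (E', \<iota>', \<pi>')" and eq': "ext_equiv X Q M S R (E', \<iota>', \<pi>') (E'', \<iota>'', \<pi>'')"
  shows "ext_equiv X Q M S R (E, \<iota>, \<pi>) (E'', \<iota>'', \<pi>'')"
proof -
  obtain h h' where h: "twisted_hom X Q M E E' h" "twisted_hom X Q M E' E h'"
    "\<And>i U e. i \<in> verts Q \<Longrightarrow> open U \<Longrightarrow> e \<in> carrier (sec (vsh E i) U) \<Longrightarrow> h' i U (h i U e) = e"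
    "\<And>i U e. i \<in> verts Q \<Longrightarrow> open U \<Longrightarrow> e \<in> carrier (sec (vsh E i) U) \<Longrightarrow> \<pi>' i U (h i U e) = \<pi> i U e"
    "\<And>i U e. i \<in> verts Q \<Longrightarrow> open U \<Longrightarrow> e \<in> carrier (sec (vsh E' i) U) \<Longrightarrow> h i U (h' i U e) = e"
    "\<And>i U s. i \<in> verts Q \<Longrightarrow> open U \<Longrightarrow> s \<in> carrier (sec (vsh S i) U) \<Longrightarrow> h i U (\<iota> i U s) = \<iota>' i U s"
    using ext_equivE[OF eq] by blast
  obtain k k' where k: "twisted_hom X Q M E' E'' k" "twisted_hom X Q M E'' E' k'"
    "\<And>i U e. i \<in> verts Q \<Longrightarrow> open U \<Longrightarrow> e \<in> carrier (sec (vsh E' i) U) \<Longrightarrow> k' i U (k i U e) = e"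
    "\<And>i U e. i \<in> verts Q \<Longrightarrow> open U \<Longrightarrow> e \<in> carrier (sec (vsh E' i) U) \<Longrightarrow> \<pi>'' i U (k i U e) = \<pi>' i U e"
    "\<And>i U e. i \<in> verts Q \<Longrightarrow> open U \<Longrightarrow> e \<in> carrier (sec (vsh E'' i) U) \<Longrightarrow> k i U (k' i U e) = e"
    "\<And>i U s. i \<in> verts Q \<Longrightarrow> open U \<Longrightarrow> s \<in> carrier (sec (vsh S i) U) \<Longrightarrow> k i U (\<iota>' i U s) = \<iota>'' i U s"
    using ext_equivE[OF eq'] by blast
  note t = extensionD(1)[OF e] extensionD(1)[OF e'] extensionD(1)[OF e'']
  show ?thesis
    by (rule ext_equivI[OF twisted_hom_comp[OF t h(1) k(1)] twisted_hom_comp[OF t(3,2,1) k(2) h(2)]])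
      (simp_all add: h(3-6) k(3-6) sheaf_hom_closed[OF vertex_hom[OF h(1)]] sheaf_hom_closed[OF vertex_hom[OF k(2)]])
qed

text \<open>\<open>ext_rel\<close> relates extensions only. Reflexivity puts \<open>e'\<close> into
  its own class, and symmetry with transitivity makes the classes of equivalent extensions
  equal.\<close>

lemma ext_class_eq_iff:
  fixes e e' :: "('v, 'a, 'x, 'm, 's, 'r, 's \<times> 'r) qext"
  assumes e: "extension X Q M S R e" and e': "extension X Q M S R e'"
  shows "ext_rel X Q M S R `` {e} = ext_rel X Q M S R `` {e'} \<longleftrightarrow> ext_equiv X Q M S R e e'"
proof
  assume "ext_rel X Q M S R `` {e} = ext_rel X Q M S R `` {e'}"
  moreover have "e' \<in> ext_rel X Q M S R `` {e'}"
    using e' by (cases e') (simp add: ext_rel_def ext_equiv_refl)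
  ultimately have "e' \<in> ext_rel X Q M S R `` {e}" by simp
  then show "ext_equiv X Q M S R e e'" by (simp add: ext_rel_def)
next
  assume eq: "ext_equiv X Q M S R e e'"
  have "ext_equiv X Q M S R e f \<longleftrightarrow> ext_equiv X Q M S R e' f" if "extension X Q M S R f" for f
    using e e' that eq by (cases e, cases e', cases f) (metis ext_equiv_trans ext_equiv_sym)
  then show "ext_rel X Q M S R `` {e} = ext_rel X Q M S R `` {e'}"
    using e e' by (auto simp: ext_rel_def)
qed

end

end

subsection \<open>Extensions on direct sums\<close>

context smooth_functions
begin

context
  fixes Q :: "('v, 'a) pre_digraph" and M :: "'a \<Rightarrow> ('x, 'm) osheaf"
    and S :: "('v, 'a, 'x, 'm, 's) qsheaf" and R :: "('v, 'a, 'x, 'm, 'r) qsheaf"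
  assumes Q: "wf_digraph Q" and M: "\<And>a. a \<in> arcs Q \<Longrightarrow> presheaf_mod X (M a)"
    and S: "twisted_sheaf X Q M S" and R: "twisted_sheaf X Q M R"
begin

abbreviation "Ss a \<equiv> vsh S (tail Q a)"
abbreviation "Rs a \<equiv> vsh R (tail Q a)"
abbreviation "Ds a \<equiv> dirsum (Ss a) (Rs a)"
abbreviation "tfst a \<equiv> tensor_map X (Ds a) (M a) (Ss a) (M a) (\<lambda>_. fst) id_hom"
abbreviation "tsnd a \<equiv> tensor_map X (Ds a) (M a) (Rs a) (M a) (\<lambda>_. snd) id_hom"
abbreviation "inclS i \<equiv> (\<lambda>U s. (s, \<zero>\<^bsub>sec (vsh R i) U\<^esub>))"
abbreviation "inclR i \<equiv> (\<lambda>U r. (\<zero>\<^bsub>sec (vsh S i) U\<^esub>, r))"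

context
  fixes i assumes i: "i \<in> verts Q"
begin

lemmas vS = sheaf_presheaf[OF vertex_sheaf[OF Q M S i]] and vR = sheaf_presheaf[OF vertex_sheaf[OF Q M R i]]

lemma sheaf_hom_inclS: "sheaf_hom X (vsh S i) (dirsum (vsh S i) (vsh R i)) (inclS i)"
  by (rule sheaf_hom_Pair[OF sheaf_hom_id sheaf_hom_zero[OF vS vR]])

lemma sheaf_hom_inclR: "sheaf_hom X (vsh R i) (dirsum (vsh S i) (vsh R i)) (inclR i)"
  by (rule sheaf_hom_Pair[OF sheaf_hom_zero[OF vR vS] sheaf_hom_id])

end

context
  fixes a assumes a: "a \<in> arcs Q"
begin

lemmas aS = sheaf_presheaf[OF tail_sheaf[OF Q M S a]] and aR = sheaf_presheaf[OF tail_sheaf[OF Q M R a]]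
lemmas aM = M[OF a]
lemmas aD = presheaf_dirsum[OF aS aR]
lemmas tail_v = wf_digraph.tail_in_verts[OF Q a] and head_v = wf_digraph.head_in_verts[OF Q a]
lemmas tfst_hom = tensor_map_hom[OF aD aM aS aM sheaf_hom_fst[OF aS aR] sheaf_hom_id]
  and tsnd_hom = tensor_map_hom[OF aD aM aR aM sheaf_hom_snd[OF aS aR] sheaf_hom_id]

context
  fixes U \<sigma> assumes U: "open U" and \<sigma>: "\<sigma> \<in> carrier (sec (tensor X (Ss a) (M a)) U)"
begin

text \<open>This and the next three lemmas describe (S \<oplus> R) \<otimes> M through inclusions
  and projections tensored with the identity; each follows from functoriality of the tensor
  product.\<close>

lemma tfst_inclS: "tfst a U (tensor_map X (Ss a) (M a) (Ds a) (M a) (inclS (tail Q a)) id_hom U \<sigma>) = \<sigma>"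
  using tensor_map_comp[OF aS aM aD aM aS aM sheaf_hom_inclS[OF tail_v] sheaf_hom_id sheaf_hom_fst[OF aS aR] sheaf_hom_id U \<sigma>]
  by (simp add: tensor_map_id[OF aS aM U \<sigma>])

lemma tsnd_inclS:
  "tsnd a U (tensor_map X (Ss a) (M a) (Ds a) (M a) (inclS (tail Q a)) id_hom U \<sigma>) = \<zero>\<^bsub>sec (tensor X (Rs a) (M a)) U\<^esub>"
  using tensor_map_comp[OF aS aM aD aM aR aM sheaf_hom_inclS[OF tail_v] sheaf_hom_id sheaf_hom_snd[OF aS aR] sheaf_hom_id U \<sigma>]
  by (simp add: tensor_map_zero[OF aS aM aR U \<sigma>])

end

context
  fixes U \<rho> assumes U: "open U" and \<rho>: "\<rho> \<in> carrier (sec (tensor X (Rs a) (M a)) U)"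
begin

lemma tsnd_inclR: "tsnd a U (tensor_map X (Rs a) (M a) (Ds a) (M a) (inclR (tail Q a)) id_hom U \<rho>) = \<rho>"
  using tensor_map_comp[OF aR aM aD aM aR aM sheaf_hom_inclR[OF tail_v] sheaf_hom_id sheaf_hom_snd[OF aS aR] sheaf_hom_id U \<rho>]
  by (simp add: tensor_map_id[OF aR aM U \<rho>])

lemma tfst_inclR:
  "tfst a U (tensor_map X (Rs a) (M a) (Ds a) (M a) (inclR (tail Q a)) id_hom U \<rho>) = \<zero>\<^bsub>sec (tensor X (Ss a) (M a)) U\<^esub>"
  using tensor_map_comp[OF aR aM aD aM aS aM sheaf_hom_inclR[OF tail_v] sheaf_hom_id sheaf_hom_fst[OF aS aR] sheaf_hom_id U \<rho>]
  by (simp add: tensor_map_zero[OF aR aM aS U \<rho>])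

end

end

text \<open>\<open>\<gamma>\<close> is the component of the structure map with values in
  \<open>S\<close>; leaving it open covers the split and the twisted sum at once. The last condition
  on \<open>\<gamma>\<close> makes the inclusion a morphism, and the shape of the second component
  does so for the projection.\<close>

lemma sum_extension:
  assumes vE: "\<And>i. vsh E i = dirsum (vsh S i) (vsh R i)"
    and amE: "\<And>a U \<xi>. amap E a U \<xi> = (\<gamma> a U \<xi>, amap R a U (tsnd a U \<xi>))"
    and \<gamma>: "\<And>a. a \<in> arcs Q \<Longrightarrow> sheaf_hom X (tensor X (Ds a) (M a)) (vsh S (head Q a)) (\<gamma> a)"
    and \<gamma>S: "\<And>a U \<sigma>. a \<in> arcs Q \<Longrightarrow> open U \<Longrightarrow> \<sigma> \<in> carrier (sec (tensor X (Ss a) (M a)) U) \<Longrightarrow>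
      \<gamma> a U (tensor_map X (Ss a) (M a) (Ds a) (M a) (inclS (tail Q a)) id_hom U \<sigma>) = amap S a U \<sigma>"
  shows "extension X Q M S R (E, sum_incl R, sum_proj)"
proof -
  have incl: "sum_incl R i = inclS i" for i by (simp add: fun_eq_iff sum_incl_def)
  have proj: "sum_proj i = (\<lambda>_. snd)" for i by (simp add: fun_eq_iff sum_proj_def)
  have amE': "amap E a = (\<lambda>U \<xi>. (\<gamma> a U \<xi>, amap R a U (tsnd a U \<xi>)))" for a
    by (simp add: fun_eq_iff amE)
  have A: "twisted_sheaf X Q M E"
    unfolding twisted_sheaf_def vE amE'
    by (intro conjI ballI sheaf_dirsum vertex_sheaf[OF Q M S] vertex_sheaf[OF Q M R] sheaf_hom_Pair \<gamma>
        sheaf_hom_comp[OF tsnd_hom arc_hom[OF Q M R]])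
  have B: "twisted_hom X Q M S E (sum_incl R)"
    unfolding twisted_hom_def vE incl
  proof (intro conjI ballI allI impI sheaf_hom_inclS)
    fix a U \<sigma> assume a: "a \<in> arcs Q" and U: "open U" and \<sigma>: "\<sigma> \<in> carrier (sec (tensor X (Ss a) (M a)) U)"
    have "amap R a U \<zero>\<^bsub>sec (tensor X (Rs a) (M a)) U\<^esub> = \<zero>\<^bsub>sec (vsh R (head Q a)) U\<^esub>"
      by (rule additive_on_zero[OF presheaf_abelian_group[OF presheaf_tensor[OF aR[OF a] aM[OF a]] U]
            presheaf_abelian_group[OF sheaf_presheaf[OF head_sheaf[OF Q M R a]] U] sheaf_hom_additive[OF arc_hom[OF Q M R a] U]])
    then show "(amap S a U \<sigma>, \<zero>\<^bsub>sec (vsh R (head Q a)) U\<^esub>) =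
        amap E a U (tensor_map X (Ss a) (M a) (Ds a) (M a) (inclS (tail Q a)) id_hom U \<sigma>)"
      by (simp add: amE \<gamma>S[OF a U \<sigma>] tsnd_inclS[OF a U \<sigma>])
  qed
  have C: "twisted_hom X Q M E R sum_proj"
    unfolding twisted_hom_def vE proj
    by (intro conjI ballI allI impI sheaf_hom_snd sheaf_presheaf[OF vertex_sheaf[OF Q M S]] sheaf_presheaf[OF vertex_sheaf[OF Q M R]])
      (simp_all add: amE)
  have D: "inj_on (sum_incl R i U) (carrier (sec (vsh S i) U)) \<and>
        sum_incl R i U ` carrier (sec (vsh S i) U) =
          {e \<in> carrier (sec (vsh E i) U). sum_proj i U e = \<zero>\<^bsub>sec (vsh R i) U\<^esub>} \<and>
        (\<forall>r \<in> carrier (sec (vsh R i) U). \<forall>x\<in>U. \<exists>V. open V \<and> x \<in> V \<and> V \<subseteq> U \<and>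
           res (vsh R i) U V r \<in> sum_proj i V ` carrier (sec (vsh E i) V))"
    if i: "i \<in> verts Q" and U: "open U" for i U
  proof (intro conjI ballI)
    note pR = sheaf_presheaf[OF vertex_sheaf[OF Q M R i]] and pS = sheaf_presheaf[OF vertex_sheaf[OF Q M S i]]
    interpret R: abelian_group "sec (vsh R i) U" by (rule presheaf_abelian_group[OF pR U])
    interpret S: abelian_group "sec (vsh S i) U" by (rule presheaf_abelian_group[OF pS U])
    show "inj_on (sum_incl R i U) (carrier (sec (vsh S i) U))" by (simp add: inj_on_def sum_incl_def)
    show "sum_incl R i U ` carrier (sec (vsh S i) U) = {e \<in> carrier (sec (vsh E i) U). sum_proj i U e = \<zero>\<^bsub>sec (vsh R i) U\<^esub>}"
      by (auto simp: sum_incl_def sum_proj_def vE dirsum_simps image_iff)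
    fix r x assume r: "r \<in> carrier (sec (vsh R i) U)" and x: "x \<in> U"
    \<comment> \<open>The projection is surjective already on sections over \<open>U\<close>, so the
      open set demanded by local surjectivity can be \<open>U\<close> itself.\<close>
    have "r \<in> sum_proj i U ` carrier (sec (vsh E i) U)"
      using r by (intro image_eqI[of _ _ "(\<zero>\<^bsub>sec (vsh S i) U\<^esub>, r)"]) (simp_all add: sum_proj_def vE dirsum_simps)
    then show "\<exists>V. open V \<and> x \<in> V \<and> V \<subseteq> U \<and> res (vsh R i) U V r \<in> sum_proj i V ` carrier (sec (vsh E i) V)"
      using U x res_id[OF pR U r] by (intro exI[of _ U]) simp
  qed
  show ?thesis
    unfolding extension_def prod.case by (intro conjI[OF A] conjI[OF B] conjI[OF C] ballI allI impI D)
qed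

lemma sum_qsheaf_simps:
  "vsh (sum_qsheaf X Q M S R) i = dirsum (vsh S i) (vsh R i)"
  "amap (sum_qsheaf X Q M S R) a U \<xi> = (amap S a U (tfst a U \<xi>), amap R a U (tsnd a U \<xi>))"
  by (simp_all add: sum_qsheaf_def Let_def)

lemma twisted_sum_qsheaf_simps:
  "vsh (twisted_sum_qsheaf X Q M S R \<beta>) i = dirsum (vsh S i) (vsh R i)"
  "amap (twisted_sum_qsheaf X Q M S R \<beta>) a U \<xi> =
    (amap S a U (tfst a U \<xi>) \<oplus>\<^bsub>sec (vsh S (head Q a)) U\<^esub> \<beta> a U (tsnd a U \<xi>), amap R a U (tsnd a U \<xi>))"
  by (simp_all add: twisted_sum_qsheaf_def Let_def)

lemma extension_sum_qsheaf: "extension X Q M S R (sum_qsheaf X Q M S R, sum_incl R, sum_proj)"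
  by (rule sum_extension[where \<gamma> = "\<lambda>a U \<xi>. amap S a U (tfst a U \<xi>)"])
    (simp_all add: sum_qsheaf_simps sheaf_hom_comp[OF tfst_hom arc_hom[OF Q M S]] tfst_inclS)

context
  fixes \<beta> :: "'a \<Rightarrow> 'x set \<Rightarrow> ('x, 'r, 'm) tens \<Rightarrow> 's"
  assumes \<beta>: "\<And>a. a \<in> arcs Q \<Longrightarrow> sheaf_hom X (tensor X (vsh R (tail Q a)) (M a)) (vsh S (head Q a)) (\<beta> a)"
begin

lemma extension_twisted_sum_qsheaf:
  "extension X Q M S R (twisted_sum_qsheaf X Q M S R \<beta>, sum_incl R, sum_proj)"
proof (rule sum_extension[where \<gamma> = "\<lambda>a U \<xi>. amap S a U (tfst a U \<xi>) \<oplus>\<^bsub>sec (vsh S (head Q a)) U\<^esub> \<beta> a U (tsnd a U \<xi>)"])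
  fix a assume a: "a \<in> arcs Q"
  show "sheaf_hom X (tensor X (Ds a) (M a)) (vsh S (head Q a))
      (\<lambda>U \<xi>. amap S a U (tfst a U \<xi>) \<oplus>\<^bsub>sec (vsh S (head Q a)) U\<^esub> \<beta> a U (tsnd a U \<xi>))"
    by (rule sheaf_hom_plus[OF presheaf_tensor[OF aD[OF a] aM[OF a]] sheaf_presheaf[OF head_sheaf[OF Q M S a]]
          sheaf_hom_comp[OF tfst_hom[OF a] arc_hom[OF Q M S a]] sheaf_hom_comp[OF tsnd_hom[OF a] \<beta>[OF a]]])
  fix U \<sigma> assume U: "open U" and \<sigma>: "\<sigma> \<in> carrier (sec (tensor X (Ss a) (M a)) U)"
  interpret H: abelian_group "sec (vsh S (head Q a)) U"
    by (rule presheaf_abelian_group[OF sheaf_presheaf[OF head_sheaf[OF Q M S a]] U])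
  \<comment> \<open>A tensor coming from \<open>S\<close> has zero component in \<open>R\<close>, so
    the twist by \<open>\<beta>\<close> disappears on the image of the inclusion.\<close>
  have "\<beta> a U \<zero>\<^bsub>sec (tensor X (Rs a) (M a)) U\<^esub> = \<zero>\<^bsub>sec (vsh S (head Q a)) U\<^esub>"
    by (rule additive_on_zero[OF presheaf_abelian_group[OF presheaf_tensor[OF aR[OF a] aM[OF a]] U]
          H.abelian_group_axioms sheaf_hom_additive[OF \<beta>[OF a] U]])
  then show "amap S a U (tfst a U (tensor_map X (Ss a) (M a) (Ds a) (M a) (inclS (tail Q a)) id_hom U \<sigma>))
      \<oplus>\<^bsub>sec (vsh S (head Q a)) U\<^esub> \<beta> a U (tsnd a U (tensor_map X (Ss a) (M a) (Ds a) (M a) (inclS (tail Q a)) id_hom U \<sigma>)) =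
      amap S a U \<sigma>"
    by (simp add: tfst_inclS[OF a U \<sigma>] tsnd_inclS[OF a U \<sigma>] sheaf_hom_closed[OF arc_hom[OF Q M S a] U \<sigma>])
qed (simp_all add: twisted_sum_qsheaf_simps)

text \<open>The image of \<open>\<beta>\<close> is zero iff \<open>\<beta>\<close> comes from the preceding term of the long exact sequence: an
  equivalence with the split extension is a shear \<open>(s, r) \<mapsto> (s + \<alpha> r, r)\<close>.\<close>

lemma ext_equiv_sum_iff:
  "ext_equiv X Q M S R (twisted_sum_qsheaf X Q M S R \<beta>, sum_incl R, sum_proj) (sum_qsheaf X Q M S R, sum_incl R, sum_proj) \<longleftrightarrow>
    (\<exists>\<alpha>. (\<forall>i\<in>verts Q. sheaf_hom X (vsh R i) (vsh S i) (\<alpha> i)) \<and>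
      (\<forall>a\<in>arcs Q. \<forall>U \<rho>. open U \<longrightarrow> \<rho> \<in> carrier (sec (tensor X (Rs a) (M a)) U) \<longrightarrow>
        \<beta> a U \<rho> \<oplus>\<^bsub>sec (vsh S (head Q a)) U\<^esub> \<alpha> (head Q a) U (amap R a U \<rho>) =
        amap S a U (tensor_map X (Rs a) (M a) (Ss a) (M a) (\<alpha> (tail Q a)) id_hom U \<rho>)))"
  (is "?E \<longleftrightarrow> ?A")
proof
  let ?B = "twisted_sum_qsheaf X Q M S R \<beta>" and ?Z = "sum_qsheaf X Q M S R"
  note tB = extensionD(1)[OF Q M extension_twisted_sum_qsheaf] and tZ = extensionD(1)[OF Q M extension_sum_qsheaf]
  assume eq: ?E
  obtain h h' where h: "twisted_hom X Q M ?B ?Z h" "twisted_hom X Q M ?Z ?B h'"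
    and "\<And>i U e. i \<in> verts Q \<Longrightarrow> open U \<Longrightarrow> e \<in> carrier (sec (vsh ?B i) U) \<Longrightarrow> h' i U (h i U e) = e"
    and proj: "\<And>i U e. i \<in> verts Q \<Longrightarrow> open U \<Longrightarrow> e \<in> carrier (sec (vsh ?B i) U) \<Longrightarrow> sum_proj i U (h i U e) = sum_proj i U e"
    and "\<And>i U e. i \<in> verts Q \<Longrightarrow> open U \<Longrightarrow> e \<in> carrier (sec (vsh ?Z i) U) \<Longrightarrow> h i U (h' i U e) = e"
    and incl: "\<And>i U s. i \<in> verts Q \<Longrightarrow> open U \<Longrightarrow> s \<in> carrier (sec (vsh S i) U) \<Longrightarrow> h i U (sum_incl R i U s) = sum_incl R i U s"
    using ext_equivE[OF Q M eq] by blast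
  note h = h(1)
  \<comment> \<open>The component of the equivalence from \<open>R\<close> to \<open>S\<close>, the
    only one that is not prescribed.\<close>
  define \<alpha> where "\<alpha> i U r = fst (h i U (inclR i U r))" for i U r
  have hom_h: "sheaf_hom X (dirsum (vsh S i) (vsh R i)) (dirsum (vsh S i) (vsh R i)) (h i)" if "i \<in> verts Q" for i
    using vertex_hom[OF Q M h that] by (simp add: twisted_sum_qsheaf_simps sum_qsheaf_simps)
  have \<alpha>: "sheaf_hom X (vsh R i) (vsh S i) (\<alpha> i)" if i: "i \<in> verts Q" for i
    unfolding \<alpha>_def
    by (rule sheaf_hom_comp[OF sheaf_hom_comp[OF sheaf_hom_inclR[OF i] hom_h[OF i]] sheaf_hom_fst[OF vS[OF i] vR[OF i]]])
  \<comment> \<open>The pair is split as (s, 0) + (0, r): \<open>h\<close> fixes the first summand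
    by compatibility with the inclusions and preserves the entry r of the second one by
    compatibility with the projections.\<close>
  have h_eq: "h i U (s, r) = (s \<oplus>\<^bsub>sec (vsh S i) U\<^esub> \<alpha> i U r, r)"
    if i: "i \<in> verts Q" and U: "open U" and s: "s \<in> carrier (sec (vsh S i) U)" and r: "r \<in> carrier (sec (vsh R i) U)" for i U s r
  proof -
    interpret S: abelian_group "sec (vsh S i) U" by (rule presheaf_abelian_group[OF vS[OF i] U])
    interpret R: abelian_group "sec (vsh R i) U" by (rule presheaf_abelian_group[OF vR[OF i] U])
    have "(s, r) = (s, \<zero>\<^bsub>sec (vsh R i) U\<^esub>) \<oplus>\<^bsub>sec (dirsum (vsh S i) (vsh R i)) U\<^esub> (\<zero>\<^bsub>sec (vsh S i) U\<^esub>, r)"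
      using s r by (simp add: dirsum_simps)
    then have "h i U (s, r) = h i U (s, \<zero>\<^bsub>sec (vsh R i) U\<^esub>) \<oplus>\<^bsub>sec (dirsum (vsh S i) (vsh R i)) U\<^esub> h i U (\<zero>\<^bsub>sec (vsh S i) U\<^esub>, r)"
      using sheaf_hom_add[OF hom_h[OF i] U, of "(s, \<zero>\<^bsub>sec (vsh R i) U\<^esub>)" "(\<zero>\<^bsub>sec (vsh S i) U\<^esub>, r)"] s r
      by (simp add: dirsum_simps)
    moreover have "h i U (s, \<zero>\<^bsub>sec (vsh R i) U\<^esub>) = (s, \<zero>\<^bsub>sec (vsh R i) U\<^esub>)"
      using incl[OF i U s] by (simp add: sum_incl_def)
    moreover have "h i U (\<zero>\<^bsub>sec (vsh S i) U\<^esub>, r) = (\<alpha> i U r, r)"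
      using proj[OF i U, of "(\<zero>\<^bsub>sec (vsh S i) U\<^esub>, r)"] r
      by (simp add: sum_proj_def twisted_sum_qsheaf_simps dirsum_simps \<alpha>_def prod_eq_iff)
    ultimately show ?thesis using r by (simp add: dirsum_simps)
  qed
  have "\<beta> a U \<rho> \<oplus>\<^bsub>sec (vsh S (head Q a)) U\<^esub> \<alpha> (head Q a) U (amap R a U \<rho>) =
        amap S a U (tensor_map X (Rs a) (M a) (Ss a) (M a) (\<alpha> (tail Q a)) id_hom U \<rho>)"
    if a: "a \<in> arcs Q" and U: "open U" and \<rho>: "\<rho> \<in> carrier (sec (tensor X (Rs a) (M a)) U)" for a U \<rho>
  proof -
    note v = tail_v[OF a] head_v[OF a]
    note pS = aS[OF a] and pR = aR[OF a] and pM = aM[OF a] and pD = aD[OF a]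
    interpret S: abelian_group "sec (vsh S (head Q a)) U" by (rule presheaf_abelian_group[OF vS[OF v(2)] U])
    \<comment> \<open>\<open>\<rho>\<close> is inserted through \<open>inclR\<close>, so that its
      \<open>S\<close> component vanishes and the compatibility of \<open>h\<close>, read in the
      first component, becomes the wanted equation.\<close>
    define \<xi> where "\<xi> = tensor_map X (Rs a) (M a) (Ds a) (M a) (inclR (tail Q a)) id_hom U \<rho>"
    have \<xi>: "\<xi> \<in> carrier (sec (tensor X (Ds a) (M a)) U)"
      unfolding \<xi>_def by (rule sheaf_hom_closed[OF tensor_map_hom[OF pR pM pD pM sheaf_hom_inclR[OF v(1)] sheaf_hom_id] U \<rho>])
    have x1: "tfst a U \<xi> = \<zero>\<^bsub>sec (tensor X (Ss a) (M a)) U\<^esub>" and x2: "tsnd a U \<xi> = \<rho>"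
      unfolding \<xi>_def by (rule tfst_inclR[OF a U \<rho>], rule tsnd_inclR[OF a U \<rho>])
    have z: "amap S a U \<zero>\<^bsub>sec (tensor X (Ss a) (M a)) U\<^esub> = \<zero>\<^bsub>sec (vsh S (head Q a)) U\<^esub>"
      by (rule additive_on_zero[OF presheaf_abelian_group[OF presheaf_tensor[OF pS pM] U]
            S.abelian_group_axioms sheaf_hom_additive[OF arc_hom[OF Q M S a] U]])
    have \<beta>\<rho>: "\<beta> a U \<rho> \<in> carrier (sec (vsh S (head Q a)) U)" by (rule sheaf_hom_closed[OF \<beta>[OF a] U \<rho>])
    have \<phi>\<rho>: "amap R a U \<rho> \<in> carrier (sec (vsh R (head Q a)) U)" by (rule sheaf_hom_closed[OF arc_hom[OF Q M R a] U \<rho>])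
    have "h (head Q a) U (amap ?B a U \<xi>) = amap ?Z a U (tensor_map X (Ds a) (M a) (Ds a) (M a) (h (tail Q a)) id_hom U \<xi>)"
      using twisted_hom_arc[OF Q M h a U] \<xi> by (simp add: twisted_sum_qsheaf_simps sum_qsheaf_simps)
    moreover have "fst (h (head Q a) U (amap ?B a U \<xi>)) =
        \<beta> a U \<rho> \<oplus>\<^bsub>sec (vsh S (head Q a)) U\<^esub> \<alpha> (head Q a) U (amap R a U \<rho>)"
      using \<beta>\<rho> \<phi>\<rho> by (simp add: twisted_sum_qsheaf_simps x1 x2 z h_eq[OF v(2) U])
    \<comment> \<open>By functoriality the inclusion of \<open>R\<close>, then \<open>h\<close>,
      then \<open>fst\<close>, all tensored with the identity, compose to \<open>\<alpha>\<close>
      \<otimes> id.\<close>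
    moreover have "tfst a U (tensor_map X (Ds a) (M a) (Ds a) (M a) (h (tail Q a)) id_hom U \<xi>) =
        tensor_map X (Rs a) (M a) (Ss a) (M a) (\<alpha> (tail Q a)) id_hom U \<rho>"
      using tensor_map_comp[OF pR pM pD pM pD pM sheaf_hom_inclR[OF v(1)] sheaf_hom_id hom_h[OF v(1)] sheaf_hom_id U \<rho>]
        tensor_map_comp[OF pR pM pD pM pS pM sheaf_hom_comp[OF sheaf_hom_inclR[OF v(1)] hom_h[OF v(1)]] sheaf_hom_id
          sheaf_hom_fst[OF pS pR] sheaf_hom_id U \<rho>]
      by (simp add: \<xi>_def \<alpha>_def[abs_def])
    ultimately show ?thesis by (simp add: sum_qsheaf_simps)
  qed
  then show ?A using \<alpha> by (intro exI[of _ \<alpha>]) simp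
next
  let ?B = "twisted_sum_qsheaf X Q M S R \<beta>" and ?Z = "sum_qsheaf X Q M S R"
  note tB = extensionD(1)[OF Q M extension_twisted_sum_qsheaf] and tZ = extensionD(1)[OF Q M extension_sum_qsheaf]
  assume ?A
  then obtain \<alpha> where \<alpha>: "\<forall>i\<in>verts Q. sheaf_hom X (vsh R i) (vsh S i) (\<alpha> i)"
    and eq: "\<forall>a\<in>arcs Q. \<forall>U \<rho>. open U \<longrightarrow> \<rho> \<in> carrier (sec (tensor X (Rs a) (M a)) U) \<longrightarrow>
        \<beta> a U \<rho> \<oplus>\<^bsub>sec (vsh S (head Q a)) U\<^esub> \<alpha> (head Q a) U (amap R a U \<rho>) =
        amap S a U (tensor_map X (Rs a) (M a) (Ss a) (M a) (\<alpha> (tail Q a)) id_hom U \<rho>)"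
    by (elim exE conjE)
  note \<alpha> = \<alpha>[rule_format] and eq = eq[rule_format]
  have shear: "sheaf_hom X (dirsum (vsh S i) (vsh R i)) (dirsum (vsh S i) (vsh R i))
      (\<lambda>U e. (fst e \<oplus>\<^bsub>sec (vsh S i) U\<^esub> \<kappa> U (snd e), snd e))"
    if i: "i \<in> verts Q" and \<kappa>: "sheaf_hom X (vsh R i) (vsh S i) \<kappa>" for i \<kappa>
    by (intro sheaf_hom_Pair sheaf_hom_plus[OF presheaf_dirsum[OF vS[OF i] vR[OF i]] vS[OF i]]
        sheaf_hom_fst sheaf_hom_snd vS[OF i] vR[OF i] sheaf_hom_comp[OF sheaf_hom_snd[OF vS[OF i] vR[OF i]] \<kappa>])
  define h where "h i U e = (fst e \<oplus>\<^bsub>sec (vsh S i) U\<^esub> \<alpha> i U (snd e), snd e)" for i U and e :: "'s \<times> 'r"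
  \<comment> \<open>The inverse shear, with \<open>\<alpha>\<close> negated.\<close>
  define k where "k i U e = (fst e \<oplus>\<^bsub>sec (vsh S i) U\<^esub> (\<ominus>\<^bsub>sec (vsh S i) U\<^esub> \<alpha> i U (snd e)), snd e)" for i U and e :: "'s \<times> 'r"
  have hom_h: "sheaf_hom X (dirsum (vsh S i) (vsh R i)) (dirsum (vsh S i) (vsh R i)) (h i)" if i: "i \<in> verts Q" for i
    unfolding h_def by (rule shear[OF i \<alpha>[OF i]])
  have hom_k: "sheaf_hom X (dirsum (vsh S i) (vsh R i)) (dirsum (vsh S i) (vsh R i)) (k i)" if i: "i \<in> verts Q" for i
    unfolding k_def by (rule shear[OF i sheaf_hom_uminus[OF vR[OF i] vS[OF i] \<alpha>[OF i]]])
  have th: "twisted_hom X Q M ?B ?Z h"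
    unfolding twisted_hom_def twisted_sum_qsheaf_simps(1) sum_qsheaf_simps(1)
  proof (intro conjI ballI allI impI hom_h)
    fix a U \<xi> assume a: "a \<in> arcs Q" and U: "open U" and \<xi>: "\<xi> \<in> carrier (sec (tensor X (Ds a) (M a)) U)"
    note v = tail_v[OF a] head_v[OF a]
    note pS = aS[OF a] and pR = aR[OF a] and pM = aM[OF a] and pD = aD[OF a]
    note f = sheaf_hom_fst[OF pS pR] and s = sheaf_hom_snd[OF pS pR]
    interpret S: abelian_group "sec (vsh S (head Q a)) U" by (rule presheaf_abelian_group[OF vS[OF v(2)] U])
    let ?\<sigma> = "tfst a U \<xi>" and ?\<rho> = "tsnd a U \<xi>" and ?\<eta> = "tensor_map X (Ds a) (M a) (Ds a) (M a) (h (tail Q a)) id_hom U \<xi>"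
    have \<sigma>: "?\<sigma> \<in> carrier (sec (tensor X (Ss a) (M a)) U)" by (rule sheaf_hom_closed[OF tfst_hom[OF a] U \<xi>])
    have \<rho>: "?\<rho> \<in> carrier (sec (tensor X (Rs a) (M a)) U)" by (rule sheaf_hom_closed[OF tsnd_hom[OF a] U \<xi>])
    let ?\<alpha>\<rho> = "tensor_map X (Rs a) (M a) (Ss a) (M a) (\<alpha> (tail Q a)) id_hom U ?\<rho>"
    have \<alpha>\<rho>: "?\<alpha>\<rho> \<in> carrier (sec (tensor X (Ss a) (M a)) U)"
      by (rule sheaf_hom_closed[OF tensor_map_hom[OF pR pM pS pM \<alpha>[OF v(1)] sheaf_hom_id] U \<rho>])
    have "tsnd a U ?\<eta> = ?\<rho>"
      using tensor_map_comp[OF pD pM pD pM pR pM hom_h[OF v(1)] sheaf_hom_id s sheaf_hom_id U \<xi>] by (simp add: h_def)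
    moreover have "tfst a U ?\<eta> = ?\<sigma> \<oplus>\<^bsub>sec (tensor X (Ss a) (M a)) U\<^esub> ?\<alpha>\<rho>"
    proof -
      \<comment> \<open>The first component of the shear is a sum of two morphisms, so its tensor
        product with the identity splits as well.\<close>
      have "tensor_map X (Ds a) (M a) (Ss a) (M a) (\<lambda>U e. fst (h (tail Q a) U e)) id_hom U \<xi> =
          ?\<sigma> \<oplus>\<^bsub>sec (tensor X (Ss a) (M a)) U\<^esub> tensor_map X (Ds a) (M a) (Ss a) (M a) (\<lambda>U e. \<alpha> (tail Q a) U (snd e)) id_hom U \<xi>"
      proof (rule tensor_map_add_left[OF pD pM pS f sheaf_hom_comp[OF s \<alpha>[OF v(1)]] sheaf_hom_comp[OF hom_h[OF v(1)] f] _ U \<xi>])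
        show "fst (h (tail Q a) V e) = fst e \<oplus>\<^bsub>sec (Ss a) V\<^esub> \<alpha> (tail Q a) V (snd e)" for V e
          unfolding h_def by simp
      qed
      then show ?thesis
        using tensor_map_comp[OF pD pM pD pM pS pM hom_h[OF v(1)] sheaf_hom_id f sheaf_hom_id U \<xi>]
          tensor_map_comp[OF pD pM pR pM pS pM s sheaf_hom_id \<alpha>[OF v(1)] sheaf_hom_id U \<xi>] by simp
    qed
    ultimately show "h (head Q a) U (amap ?B a U \<xi>) = amap ?Z a U ?\<eta>"
      using sheaf_hom_closed[OF arc_hom[OF Q M S a] U \<sigma>] sheaf_hom_closed[OF \<beta>[OF a] U \<rho>]
        sheaf_hom_closed[OF \<alpha>[OF v(2)] U sheaf_hom_closed[OF arc_hom[OF Q M R a] U \<rho>]]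
      by (simp add: h_def twisted_sum_qsheaf_simps sum_qsheaf_simps sheaf_hom_add[OF arc_hom[OF Q M S a] U \<sigma> \<alpha>\<rho>]
          eq[OF a U \<rho>, symmetric] S.a_assoc)
  qed
  have kh: "k i U (h i U e) = e" "h i U (k i U e) = e"
    if i: "i \<in> verts Q" and U: "open U" and e: "e \<in> carrier (sec (dirsum (vsh S i) (vsh R i)) U)" for i U e
  proof -
    interpret S: abelian_group "sec (vsh S i) U" by (rule presheaf_abelian_group[OF vS[OF i] U])
    have "fst e \<in> carrier (sec (vsh S i) U)" "\<alpha> i U (snd e) \<in> carrier (sec (vsh S i) U)"
      using e sheaf_hom_closed[OF \<alpha>[OF i] U] by (auto simp: dirsum_simps)
    then show "k i U (h i U e) = e" "h i U (k i U e) = e"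
      by (simp_all add: h_def k_def S.a_assoc S.r_neg S.l_neg)
  qed
  \<comment> \<open>Compatibility of the inverse shear with the structure maps is inherited from
    that of \<open>h\<close>.\<close>
  have tk: "twisted_hom X Q M ?Z ?B k"
    by (rule twisted_hom_inverse[OF Q M tB tZ th])
      (simp_all add: twisted_sum_qsheaf_simps(1) sum_qsheaf_simps(1) hom_k kh)
  show ?E
  proof (rule ext_equivI[OF Q M th tk])
    fix i and U :: "'x set" and s assume i: "i \<in> verts Q" and U: "open U" and s: "s \<in> carrier (sec (vsh S i) U)"
    interpret S: abelian_group "sec (vsh S i) U" by (rule presheaf_abelian_group[OF vS[OF i] U])
    have "\<alpha> i U \<zero>\<^bsub>sec (vsh R i) U\<^esub> = \<zero>\<^bsub>sec (vsh S i) U\<^esub>"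
      by (rule additive_on_zero[OF presheaf_abelian_group[OF vR[OF i] U] S.abelian_group_axioms sheaf_hom_additive[OF \<alpha>[OF i] U]])
    then show "h i U (sum_incl R i U s) = sum_incl R i U s"
      using s by (simp add: h_def sum_incl_def)
  qed (simp_all add: twisted_sum_qsheaf_simps(1) sum_qsheaf_simps(1) kh, simp add: sum_proj_def h_def)
qed

lemma Ext1_image_in_Ext1: "Ext1_image X Q M R S \<beta> \<in> Ext1 X Q M R S"
  unfolding Ext1_image_def Ext1_def
  by (rule quotientI) (simp add: extension_twisted_sum_qsheaf)

lemma Ext1_image_eq_zero_iff:
  "Ext1_image X Q M R S \<beta> = Ext1_zero X Q M R S \<longleftrightarrow>
    (\<exists>\<alpha>. (\<forall>i\<in>verts Q. sheaf_hom X (vsh R i) (vsh S i) (\<alpha> i)) \<and>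
      (\<forall>a\<in>arcs Q. \<forall>U \<rho>. open U \<longrightarrow> \<rho> \<in> carrier (sec (tensor X (Rs a) (M a)) U) \<longrightarrow>
        \<beta> a U \<rho> \<oplus>\<^bsub>sec (vsh S (head Q a)) U\<^esub> \<alpha> (head Q a) U (amap R a U \<rho>) =
        amap S a U (tensor_map X (Rs a) (M a) (Ss a) (M a) (\<alpha> (tail Q a)) id_hom U \<rho>)))"
  unfolding Ext1_image_def Ext1_zero_def
  by (subst ext_class_eq_iff[OF Q M extension_twisted_sum_qsheaf extension_sum_qsheaf]) (simp_all add: ext_equiv_sum_iff)

end

end

end

subsection \<open>The obstruction to a relative connection\<close>

context manifold
begin

context
  fixes Q :: "('v, 'a) pre_digraph" and M :: "'a \<Rightarrow> ('x, 'm) osheaf"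
    and nabla1 :: "'a \<Rightarrow> 'x set \<Rightarrow> 'm \<Rightarrow> ('x, 'm) cot_tens"
    and R :: "('v, 'a, 'x, 'm, 'f) qsheaf"
    and nabla0 :: "'v \<Rightarrow> 'x set \<Rightarrow> 'f \<Rightarrow> ('x, 'f) cot_tens"
  assumes Q: "wf_digraph Q" and M: "\<And>a. a \<in> arcs Q \<Longrightarrow> presheaf_mod X (M a)"
    and nabla1: "\<And>a. a \<in> arcs Q \<Longrightarrow> connection X (M a) (nabla1 a)"
    and R: "twisted_sheaf X Q M R"
    and nabla0: "\<And>i. i \<in> verts Q \<Longrightarrow> connection X (vsh R i) (nabla0 i)"
begin

abbreviation "CT \<equiv> cot_twist X Q M R"
abbreviation "ob \<equiv> obstruction X Q M R nabla0 nabla1"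

lemma cot_twist_simps:
  "vsh CT i = tensor X T (vsh R i)"
  "amap CT a U \<xi> = cot_amap X Q M R a U (assoc X T (vsh R (tail Q a)) (M a) U \<xi>)"
  by (simp_all add: cot_twist_def)

context
  fixes a assumes a: "a \<in> arcs Q"
begin

lemmas t_v = wf_digraph.tail_in_verts[OF Q a] and h_v = wf_digraph.head_in_verts[OF Q a]
lemmas t_R = sheaf_presheaf[OF vertex_sheaf[OF Q M R t_v]] and h_R = sheaf_presheaf[OF vertex_sheaf[OF Q M R h_v]]
lemmas a_M = M[OF a]
lemmas a_RM = presheaf_tensor[OF t_R a_M]
lemmas a_phi = arc_hom[OF Q M R a]

lemma cot_amap_hom:
  "sheaf_hom X (tensor X T (tensor X (vsh R (tail Q a)) (M a))) (tensor X T (vsh R (head Q a))) (cot_amap X Q M R a)"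
  unfolding cot_amap_def by (rule tensor_map_hom[OF presheaf_cotangent a_RM presheaf_cotangent h_R sheaf_hom_id a_phi])

text \<open>The obstruction is the defect of the structure map between the tensor product connection
  at the tail and the connection at the head, so its linearity is an instance of
  \<open>connection_defect_hom\<close>.\<close>

lemma obstruction_hom:
  "sheaf_hom X (tensor X (vsh R (tail Q a)) (M a)) (tensor X T (vsh R (head Q a))) (ob a)"
proof -
  have "ob a = (\<lambda>U \<xi>. tensor_map X T (tensor X (vsh R (tail Q a)) (M a)) T (vsh R (head Q a)) id_hom (amap R a) U
       (tensor_connection X (vsh R (tail Q a)) (M a) (nabla0 (tail Q a)) (nabla1 a) U \<xi>)
     \<ominus>\<^bsub>sec (tensor X T (vsh R (head Q a))) U\<^esub> nabla0 (head Q a) U (amap R a U \<xi>))"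
    by (intro ext) (simp add: obstruction_def cot_amap_def)
  then show ?thesis
    using connection_defect_hom[OF a_RM h_R connection_tensor_connection[OF t_R a_M nabla0[OF t_v] nabla1[OF a]] nabla0[OF h_v] a_phi]
    by simp
qed

text \<open>Once \<open>nabla0\<close> is written as the sum of \<open>\<alpha>\<close> and
  \<open>D\<close>, the terms containing \<open>\<alpha>\<close> match on both sides of the shear
  equation and what remains is the compatibility of \<open>D\<close>. The equivalence is stated for
  a single section, so that both directions of the existence statement can use it.\<close>

lemma obstruction_shear_iff:
  assumes D: "\<And>i. i \<in> verts Q \<Longrightarrow> connection X (vsh R i) (D i)"
    and \<alpha>: "\<And>i. i \<in> verts Q \<Longrightarrow> sheaf_hom X (vsh R i) (tensor X T (vsh R i)) (\<alpha> i)"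
    and eq: "\<And>i U s. i \<in> verts Q \<Longrightarrow> open U \<Longrightarrow> s \<in> carrier (sec (vsh R i) U) \<Longrightarrow>
      nabla0 i U s = \<alpha> i U s \<oplus>\<^bsub>sec (tensor X T (vsh R i)) U\<^esub> D i U s"
    and U: "open U" and \<xi>: "\<xi> \<in> carrier (sec (tensor X (vsh R (tail Q a)) (M a)) U)"
  shows "ob a U \<xi> \<oplus>\<^bsub>sec (vsh CT (head Q a)) U\<^esub> \<alpha> (head Q a) U (amap R a U \<xi>) =
      amap CT a U (tensor_map X (vsh R (tail Q a)) (M a) (vsh CT (tail Q a)) (M a) (\<alpha> (tail Q a)) id_hom U \<xi>) \<longleftrightarrow>
    D (head Q a) U (amap R a U \<xi>) =
      cot_amap X Q M R a U (tensor_connection X (vsh R (tail Q a)) (M a) (D (tail Q a)) (nabla1 a) U \<xi>)"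
proof -
  let ?E = "vsh R (tail Q a)" and ?H = "tensor X T (vsh R (head Q a))" and ?c = "cot_amap X Q M R a U"
  let ?tc = "\<lambda>D. tensor_connection X ?E (M a) D (nabla1 a) U \<xi>"
  interpret H: abelian_group "sec ?H U"
    by (rule presheaf_abelian_group[OF presheaf_tensor[OF presheaf_cotangent h_R] U])
  note TE = presheaf_tensor[OF presheaf_cotangent t_R]
  \<comment> \<open>The shift of the tensor product connection at the tail; \<open>cot_amap\<close>
    of it is the right-hand side of the shear equation.\<close>
  define A where "A = assoc X T ?E (M a) U (tensor_map X ?E (M a) (tensor X T ?E) (M a) (\<alpha> (tail Q a)) id_hom U \<xi>)"
  have A: "A \<in> carrier (sec (tensor X T (tensor X ?E (M a))) U)"
    unfolding A_def
    by (intro sheaf_hom_closed[OF assoc_hom[OF presheaf_cotangent t_R a_M] U]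
        sheaf_hom_closed[OF tensor_map_hom[OF t_R a_M TE a_M \<alpha>[OF t_v] sheaf_hom_id] U] \<xi>)
  have tc: "?tc (D (tail Q a)) \<in> carrier (sec (tensor X T (tensor X ?E (M a))) U)"
    by (rule connection_closed[OF connection_tensor_connection[OF t_R a_M D[OF t_v] nabla1[OF a]] U \<xi>])
  have "?tc (nabla0 (tail Q a)) = A \<oplus>\<^bsub>sec (tensor X T (tensor X ?E (M a))) U\<^esub> ?tc (D (tail Q a))"
    unfolding A_def
    by (rule tensor_connection_add_hom[OF t_R a_M D[OF t_v] nabla1[OF a] \<alpha>[OF t_v] U \<xi> nabla0[OF t_v] eq[OF t_v]])
  then have c: "?c (?tc (nabla0 (tail Q a))) = ?c A \<oplus>\<^bsub>sec ?H U\<^esub> ?c (?tc (D (tail Q a)))"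
    using sheaf_hom_add[OF cot_amap_hom U A tc] by simp
  note \<phi>\<xi> = sheaf_hom_closed[OF a_phi U \<xi>]
  have cA: "?c A \<in> carrier (sec ?H U)" by (rule sheaf_hom_closed[OF cot_amap_hom U A])
  have cD: "?c (?tc (D (tail Q a))) \<in> carrier (sec ?H U)" by (rule sheaf_hom_closed[OF cot_amap_hom U tc])
  have \<alpha>\<phi>: "\<alpha> (head Q a) U (amap R a U \<xi>) \<in> carrier (sec ?H U)" by (rule sheaf_hom_closed[OF \<alpha>[OF h_v] U \<phi>\<xi>])
  have D\<phi>: "D (head Q a) U (amap R a U \<xi>) \<in> carrier (sec ?H U)" by (rule connection_closed[OF D[OF h_v] U \<phi>\<xi>])
  \<comment> \<open>In the application \<open>x\<close> and \<open>y\<close> are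
    \<open>cot_amap\<close> of the shift and of the tensor product connection built from
    \<open>D\<close>, while \<open>p\<close> and \<open>q\<close> are \<open>\<alpha>\<close> and
    \<open>D\<close> applied after the structure map.\<close>
  have group: "(x \<oplus>\<^bsub>sec ?H U\<^esub> y \<ominus>\<^bsub>sec ?H U\<^esub> (p \<oplus>\<^bsub>sec ?H U\<^esub> q)) \<oplus>\<^bsub>sec ?H U\<^esub> p = x \<longleftrightarrow> q = y"
    if [simp]: "x \<in> carrier (sec ?H U)" "y \<in> carrier (sec ?H U)" "p \<in> carrier (sec ?H U)" "q \<in> carrier (sec ?H U)" for x y p q
  proof -
    have "(x \<oplus>\<^bsub>sec ?H U\<^esub> y \<ominus>\<^bsub>sec ?H U\<^esub> (p \<oplus>\<^bsub>sec ?H U\<^esub> q)) \<oplus>\<^bsub>sec ?H U\<^esub> p =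
        x \<oplus>\<^bsub>sec ?H U\<^esub> (y \<oplus>\<^bsub>sec ?H U\<^esub> (\<ominus>\<^bsub>sec ?H U\<^esub> q \<oplus>\<^bsub>sec ?H U\<^esub> (\<ominus>\<^bsub>sec ?H U\<^esub> p \<oplus>\<^bsub>sec ?H U\<^esub> p)))"
      by (simp add: a_minus_def H.minus_add H.a_ac)
    also have "\<dots> = x \<oplus>\<^bsub>sec ?H U\<^esub> (y \<ominus>\<^bsub>sec ?H U\<^esub> q)" by (simp add: a_minus_def H.l_neg)
    finally have "(x \<oplus>\<^bsub>sec ?H U\<^esub> y \<ominus>\<^bsub>sec ?H U\<^esub> (p \<oplus>\<^bsub>sec ?H U\<^esub> q)) \<oplus>\<^bsub>sec ?H U\<^esub> p = x \<longleftrightarrow> y \<ominus>\<^bsub>sec ?H U\<^esub> q = \<zero>\<^bsub>sec ?H U\<^esub>"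
      by simp
    also have "\<dots> \<longleftrightarrow> q = y"
      using H.minus_equality[of y "\<ominus>\<^bsub>sec ?H U\<^esub> q"] by (auto simp: a_minus_def H.r_neg)
    finally show ?thesis .
  qed
  show ?thesis
    unfolding cot_twist_simps obstruction_def
    using group[OF cA cD \<alpha>\<phi> D\<phi>] by (simp only: c A_def[symmetric] eq[OF h_v U \<phi>\<xi>])
qed

end

lemma twisted_sheaf_cot_twist: "twisted_sheaf X Q M CT"
proof -
  have am: "amap CT a = (\<lambda>U \<xi>. cot_amap X Q M R a U (assoc X T (vsh R (tail Q a)) (M a) U \<xi>))" for a
    by (simp add: fun_eq_iff cot_twist_simps)
  show ?thesis
    unfolding twisted_sheaf_def cot_twist_simps am
    by (intro conjI ballI sheaf_tensor presheaf_cotangent sheaf_presheaf[OF vertex_sheaf[OF Q M R]]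
        sheaf_hom_comp[OF assoc_hom[OF presheaf_cotangent t_R a_M] cot_amap_hom])
qed

text \<open>The right-hand side has the form found in \<open>Ext1_image_eq_zero_iff\<close> with
  \<open>S\<close> the twist by the cotangent bundle, so that the two equivalences can be
  chained.\<close>

lemma relative_connection_iff:
  "(\<exists>nabla. relative_connection X Q M R nabla nabla1) \<longleftrightarrow>
    (\<exists>\<alpha>. (\<forall>i\<in>verts Q. sheaf_hom X (vsh R i) (vsh CT i) (\<alpha> i)) \<and>
      (\<forall>a\<in>arcs Q. \<forall>U \<rho>. open U \<longrightarrow> \<rho> \<in> carrier (sec (tensor X (vsh R (tail Q a)) (M a)) U) \<longrightarrow>
        ob a U \<rho> \<oplus>\<^bsub>sec (vsh CT (head Q a)) U\<^esub> \<alpha> (head Q a) U (amap R a U \<rho>) =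
        amap CT a U (tensor_map X (vsh R (tail Q a)) (M a) (vsh CT (tail Q a)) (M a) (\<alpha> (tail Q a)) id_hom U \<rho>)))"
proof
  assume "\<exists>nabla. relative_connection X Q M R nabla nabla1"
  then obtain D where D: "relative_connection X Q M R D nabla1" ..
  then have cD: "connection X (vsh R i) (D i)" if "i \<in> verts Q" for i
    using that by (simp add: relative_connection_def)
  define \<alpha> where "\<alpha> i U s = nabla0 i U s \<ominus>\<^bsub>sec (tensor X T (vsh R i)) U\<^esub> D i U s" for i U s
  have vR: "presheaf_mod X (vsh R i)" if "i \<in> verts Q" for i
    by (rule sheaf_presheaf[OF vertex_sheaf[OF Q M R that]])
  have \<alpha>: "sheaf_hom X (vsh R i) (tensor X T (vsh R i)) (\<alpha> i)" if i: "i \<in> verts Q" for i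
    \<comment> \<open>The defect for the identity morphism contains id \<otimes> id applied to
      \<open>nabla0\<close>, which is known to be \<open>nabla0\<close> on sections; hence the
      passage through \<open>sheaf_hom_cong\<close>.\<close>
    by (rule sheaf_hom_cong[OF connection_defect_hom[OF vR[OF i] vR[OF i] nabla0[OF i] cD[OF i] sheaf_hom_id] vR[OF i]])
      (simp add: \<alpha>_def tensor_map_id[OF presheaf_cotangent vR[OF i]] connection_closed[OF nabla0[OF i]])
  have eq: "nabla0 i U s = \<alpha> i U s \<oplus>\<^bsub>sec (tensor X T (vsh R i)) U\<^esub> D i U s"
    if i: "i \<in> verts Q" and U: "open U" and s: "s \<in> carrier (sec (vsh R i) U)" for i U s
  proof -
    interpret H: abelian_group "sec (tensor X T (vsh R i)) U"
      by (rule presheaf_abelian_group[OF presheaf_tensor[OF presheaf_cotangent vR[OF i]] U])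
    show ?thesis
      using connection_closed[OF nabla0[OF i] U s] connection_closed[OF cD[OF i] U s]
      by (simp add: \<alpha>_def a_minus_def H.a_assoc H.l_neg)
  qed
  have "ob a U \<rho> \<oplus>\<^bsub>sec (vsh CT (head Q a)) U\<^esub> \<alpha> (head Q a) U (amap R a U \<rho>) =
        amap CT a U (tensor_map X (vsh R (tail Q a)) (M a) (vsh CT (tail Q a)) (M a) (\<alpha> (tail Q a)) id_hom U \<rho>)"
    if "a \<in> arcs Q" "open U" "\<rho> \<in> carrier (sec (tensor X (vsh R (tail Q a)) (M a)) U)" for a U \<rho>
    using obstruction_shear_iff[OF that(1) cD \<alpha> eq that(2,3)] D that by (simp add: relative_connection_def)
  then show "\<exists>\<alpha>. (\<forall>i\<in>verts Q. sheaf_hom X (vsh R i) (vsh CT i) (\<alpha> i)) \<and>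
      (\<forall>a\<in>arcs Q. \<forall>U \<rho>. open U \<longrightarrow> \<rho> \<in> carrier (sec (tensor X (vsh R (tail Q a)) (M a)) U) \<longrightarrow>
        ob a U \<rho> \<oplus>\<^bsub>sec (vsh CT (head Q a)) U\<^esub> \<alpha> (head Q a) U (amap R a U \<rho>) =
        amap CT a U (tensor_map X (vsh R (tail Q a)) (M a) (vsh CT (tail Q a)) (M a) (\<alpha> (tail Q a)) id_hom U \<rho>))"
    using \<alpha> by (intro exI[of _ \<alpha>]) (simp add: cot_twist_simps(1))
next
  assume "\<exists>\<alpha>. (\<forall>i\<in>verts Q. sheaf_hom X (vsh R i) (vsh CT i) (\<alpha> i)) \<and>
      (\<forall>a\<in>arcs Q. \<forall>U \<rho>. open U \<longrightarrow> \<rho> \<in> carrier (sec (tensor X (vsh R (tail Q a)) (M a)) U) \<longrightarrow>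
        ob a U \<rho> \<oplus>\<^bsub>sec (vsh CT (head Q a)) U\<^esub> \<alpha> (head Q a) U (amap R a U \<rho>) =
        amap CT a U (tensor_map X (vsh R (tail Q a)) (M a) (vsh CT (tail Q a)) (M a) (\<alpha> (tail Q a)) id_hom U \<rho>))"
  then obtain \<alpha> where \<alpha>': "\<forall>i\<in>verts Q. sheaf_hom X (vsh R i) (vsh CT i) (\<alpha> i)"
    and arc: "\<forall>a\<in>arcs Q. \<forall>U \<rho>. open U \<longrightarrow> \<rho> \<in> carrier (sec (tensor X (vsh R (tail Q a)) (M a)) U) \<longrightarrow>
        ob a U \<rho> \<oplus>\<^bsub>sec (vsh CT (head Q a)) U\<^esub> \<alpha> (head Q a) U (amap R a U \<rho>) =
        amap CT a U (tensor_map X (vsh R (tail Q a)) (M a) (vsh CT (tail Q a)) (M a) (\<alpha> (tail Q a)) id_hom U \<rho>)"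
    by (elim exE conjE)
  note arc = arc[rule_format]
  have \<alpha>: "sheaf_hom X (vsh R i) (tensor X T (vsh R i)) (\<alpha> i)" if "i \<in> verts Q" for i
    using \<alpha>' that by (simp add: cot_twist_simps(1))
  have vR: "presheaf_mod X (vsh R i)" if "i \<in> verts Q" for i
    by (rule sheaf_presheaf[OF vertex_sheaf[OF Q M R that]])
  \<comment> \<open>The order of the summands is that of \<open>connection_add_hom\<close>, the
    negated morphism before the connection.\<close>
  define D where "D i U s = (\<ominus>\<^bsub>sec (tensor X T (vsh R i)) U\<^esub> \<alpha> i U s) \<oplus>\<^bsub>sec (tensor X T (vsh R i)) U\<^esub> nabla0 i U s" for i U s
  have cD: "connection X (vsh R i) (D i)" if i: "i \<in> verts Q" for i
    unfolding D_def
    by (rule connection_add_hom[OF vR[OF i] nabla0[OF i] sheaf_hom_uminus[OF vR[OF i] presheaf_tensor[OF presheaf_cotangent vR[OF i]] \<alpha>[OF i]]])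
  have eq: "nabla0 i U s = \<alpha> i U s \<oplus>\<^bsub>sec (tensor X T (vsh R i)) U\<^esub> D i U s"
    if i: "i \<in> verts Q" and U: "open U" and s: "s \<in> carrier (sec (vsh R i) U)" for i U s
  proof -
    interpret H: abelian_group "sec (tensor X T (vsh R i)) U"
      by (rule presheaf_abelian_group[OF presheaf_tensor[OF presheaf_cotangent vR[OF i]] U])
    show ?thesis
      using connection_closed[OF nabla0[OF i] U s] sheaf_hom_closed[OF \<alpha>[OF i] U s]
      by (simp add: D_def H.r_neg2)
  qed
  have "relative_connection X Q M R D nabla1"
    unfolding relative_connection_def
  proof (intro conjI ballI allI impI cD nabla1)
    fix a U \<xi> assume a: "a \<in> arcs Q" and U: "open U" and \<xi>: "\<xi> \<in> carrier (sec (tensor X (vsh R (tail Q a)) (M a)) U)"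
    show "D (head Q a) U (amap R a U \<xi>) =
           cot_amap X Q M R a U (tensor_connection X (vsh R (tail Q a)) (M a) (D (tail Q a)) (nabla1 a) U \<xi>)"
      using arc[OF a U \<xi>] obstruction_shear_iff[OF a cD \<alpha> eq U \<xi>] by simp
  qed
  then show "\<exists>nabla. relative_connection X Q M R nabla nabla1" by (rule exI[of _ D])
qed

end

end

text \<open>Besides the equivalence it is recorded that \<open>\<beta>\<close> consists of morphisms
  and that its image is an element of Ext^1: \<open>ext_rel\<close> relates extensions only, so a
  twisted sum that failed to be an extension would have the empty set as its image, which is no
  class.\<close>

theorem proposition3p7:
  fixes X :: "'x::{t2_space, second_countable_topology} smooth_structure"
    and Q :: "('v, 'a) pre_digraph"
    and M :: "'a \<Rightarrow> ('x, 'm) osheaf"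
    and nabla1 :: "'a \<Rightarrow> 'x set \<Rightarrow> 'm \<Rightarrow> ('x, 'm) cot_tens"
    and R :: "('v, 'a, 'x, 'm, 'f) qsheaf"
    and nabla0 :: "'v \<Rightarrow> 'x set \<Rightarrow> 'f \<Rightarrow> ('x, 'f) cot_tens"
  assumes "smooth_manifold X"
    and "connected (UNIV :: 'x set)"
    and "fin_digraph Q"
    and "\<And>a. a \<in> arcs Q \<Longrightarrow> vector_bundle X (M a)"
    and "\<And>a. a \<in> arcs Q \<Longrightarrow> connection X (M a) (nabla1 a)"
    and "twisted_bundle X Q M R"
    and "\<And>i. i \<in> verts Q \<Longrightarrow> connection X (vsh R i) (nabla0 i)"
  defines "\<beta> \<equiv> obstruction X Q M R nabla0 nabla1"
  shows "(\<forall>a \<in> arcs Q. sheaf_hom X (tensor X (vsh R (tail Q a)) (M a))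
                         (tensor X (cotangent X) (vsh R (head Q a))) (\<beta> a)) \<and>
         Ext1_image X Q M R (cot_twist X Q M R) \<beta> \<in> Ext1 X Q M R (cot_twist X Q M R) \<and>
         ((\<exists>nabla. relative_connection X Q M R nabla nabla1) \<longleftrightarrow>
           Ext1_image X Q M R (cot_twist X Q M R) \<beta> = Ext1_zero X Q M R (cot_twist X Q M R))"
proof -
  interpret manifold X by unfold_locales (rule assms(1))
  interpret Q: fin_digraph Q by (rule assms(3))
  note Q = Q.wf_digraph_axioms
  have M: "presheaf_mod X (M a)" if "a \<in> arcs Q" for a
    using assms(4)[OF that] by (simp add: vector_bundle_def sheaf_mod_def)
  have R: "twisted_sheaf X Q M R" using assms(6) by (simp add: twisted_bundle_def)
  note S = twisted_sheaf_cot_twist[OF Q M assms(5) R assms(7)]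
  have \<beta>: "sheaf_hom X (tensor X (vsh R (tail Q a)) (M a)) (tensor X (cotangent X) (vsh R (head Q a))) (\<beta> a)"
    if "a \<in> arcs Q" for a
    unfolding \<beta>_def by (rule obstruction_hom[OF Q M assms(5) R assms(7) that])
  \<comment> \<open>The same morphism with its target read as a vertex sheaf of
    \<open>cot_twist\<close>, the form in which the extension lemmas ask for it.\<close>
  then have \<beta>': "sheaf_hom X (tensor X (vsh R (tail Q a)) (M a)) (vsh (cot_twist X Q M R) (head Q a)) (\<beta> a)"
    if "a \<in> arcs Q" for a
    using that by (simp add: cot_twist_def)
  show ?thesis
    using \<beta> Ext1_image_in_Ext1[OF Q M S R \<beta>'] Ext1_image_eq_zero_iff[OF Q M S R \<beta>']
      relative_connection_iff[OF Q M assms(5) R assms(7)]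
    unfolding \<beta>_def by simp
qed



end
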